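(* Let $G$ be a finite group, let $p=2$, and let $P$ be a self-dual principal indecomposable $RG$-module with principal indecomposable character $\Phi$ and corresponding irreducible Brauer character $\varphi$. Then the following are equivalent: (i) $P$ has quadratic type. (ii) $\varphi(g)\notin 2R$ for some strongly real $2$-regular $g\in G$. (iii) $\frac{\Phi(g)}{|C_G(g)|}\in 2R$ for all weakly real $2$-regular $g\in G$.
   Context: Let $\mathbb{A}$ be the ring of algebraic integers in $\mathbb{C}$, $\mathfrak{M}$ a maximal ideal of $\mathbb{A}$ containing $2$, $R$ the localisation of $\mathbb{A}$ at $\mathfrak{M}$, with unique maximal ideal $J=R\mathfrak{M}$, $F=\operatorname{Frac}(R)$ (the field of algebraic numbers) and $k=R/J$ (an algebraic closure of $\mathrm{GF}(2)$). Reduction modulo $J$ restricts to an isomorphism from the group of complex roots of unity of odd order onto $k^\times$; for a $kG$-module $M$ and $g\in G$ of odd order, the Brauer character value $\varphi_M(g)\in\mathbb{A}$ is the sum of the lifts, through this isomorphism, of the eigenvalues of $g$ on $M$. A principal indecomposable $RG$-module $P$ is an indecomposable direct summand of the regular module $RG$. It is self-dual if $P\cong\operatorname{Hom}_R(P,R)$ as $RG$-modules. Its principal indecomposable character $\Phi$ is the ordinary character of $P\otimes_R F$. The module $P$ has a unique maximal submodule, and the quotient by it is a simple $kG$-module; the Brauer character $\varphi$ of this simple module is the irreducible Brauer character corresponding to $P$. $P$ has quadratic type if it affords a non-degenerate $G$-invariant $R$-valued quadratic form. Here a quadratic form $Q:P\to R$ is non-degenerate if its polarization $(x,y)\mapsto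 Q(x+y)-Q(x)-Q(y)$ is a non-degenerate bilinear form, that is, induces an isomorphism $P\to\operatorname{Hom}_R(P,R)$. An element $g\in G$ is $2$-regular if its order is odd. It is real if it is conjugate in $G$ to $g^{-1}$; strongly real if $g=g^{-1}$ or $g$ is inverted under conjugation by an involution (element of order $2$) of $G$; weakly real if it is real but not strongly real. $C_G(g)$ is the centralizer of $g$ in $G$.
   Formalization: The group G is assumed to have even order; for odd order the only self-dual principal indecomposable module is the trivial one, where (ii) (via g = 1) and (iii) hold but (i) fails, so the stated equivalence is false there. *)

theory Defs
  imports
    "HOL-Algebra.QuotRing"
    "HOL-Algebra.Multiplicative_Group"
    "HOL-Algebra.Free_Abelian_Groups"
    "HOL-Computational_Algebra.Polynomial"
    "Jordan_Normal_Form.Missing_VectorSpace"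
begin

text \<open>Throughout, \<open>MM\<close> stands for a maximal ideal of the ring of algebraic integers that
  contains \<open>2\<close>. Then \<open>loc_ring\<close>, \<open>loc_ideal\<close>, \<open>frac_field\<close> and \<open>res_field\<close> are \<open>R\<close>,
  \<open>J = R MM\<close>, \<open>F = Frac(R)\<close> and \<open>k = R/J\<close>.\<close>

definition complex_subring :: "complex set \<Rightarrow> complex ring" where
  "complex_subring S = \<lparr>carrier = S, monoid.mult = (*), one = 1, ring.zero = 0, add = (+)\<rparr>"

definition alg_ints :: "complex ring" where
  "alg_ints = complex_subring {z. algebraic_int z}"

definition loc_ring :: "complex set \<Rightarrow> complex ring" where
  "loc_ring MM = complex_subring
     {a / s | a s. a \<in> carrier alg_ints \<and> s \<in> carrier alg_ints - MM}"

definition loc_ideal :: "complex set \<Rightarrow> complex set" where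
  "loc_ideal MM = Idl\<^bsub>loc_ring MM\<^esub> MM"

definition frac_field :: "complex set \<Rightarrow> complex ring" where
  "frac_field MM = complex_subring
     {a / b | a b. a \<in> carrier (loc_ring MM) \<and> b \<in> carrier (loc_ring MM) - {0}}"

definition res_field :: "complex set \<Rightarrow> complex set ring" where
  "res_field MM = loc_ring MM Quot loc_ideal MM"

definition twice_loc_ring :: "complex set \<Rightarrow> complex set" where
  "twice_loc_ring MM = {2 * r | r. r \<in> carrier (loc_ring MM)}"

text \<open>A module over the group ring \<open>RG\<close> is given by an \<open>R\<close>-module \<open>M\<close> and an
  \<open>R\<close>-linear action \<open>\<rho>\<close> of \<open>G\<close> on it. An \<open>R\<close>-submodule stable under \<open>\<rho>\<close> is then an
  \<open>RG\<close>-submodule; as a module in its own right it is \<open>M\<lparr>carrier := N\<rparr>\<close> with the same \<open>\<rho>\<close>.\<close>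

locale group_ring_module = group G + module R M
  for R :: "('r, 'rs) ring_scheme" and G :: "('g, 'gs) monoid_scheme"
    and M :: "('r, 'm, 'ms) module_scheme" and \<rho> :: "'g \<Rightarrow> 'm \<Rightarrow> 'm" +
  assumes act_hom: "g \<in> carrier G \<Longrightarrow> \<rho> g \<in> module_hom R M M"
    and act_one: "m \<in> carrier M \<Longrightarrow> \<rho> \<one>\<^bsub>G\<^esub> m = m"
    and act_mult: "g \<in> carrier G \<Longrightarrow> h \<in> carrier G \<Longrightarrow> m \<in> carrier M \<Longrightarrow>
      \<rho> (g \<otimes>\<^bsub>G\<^esub> h) m = \<rho> g (\<rho> h m)"

definition gr_submodule ::
  "('r, 'rs) ring_scheme \<Rightarrow> ('g, 'gs) monoid_scheme \<Rightarrow> ('r, 'm, 'ms) module_scheme \<Rightarrow>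
   ('g \<Rightarrow> 'm \<Rightarrow> 'm) \<Rightarrow> 'm set \<Rightarrow> bool" where
  "gr_submodule R G M \<rho> N \<longleftrightarrow>
     submodule R N M \<and> (\<forall>g\<in>carrier G. \<forall>n\<in>N. \<rho> g n \<in> N)"

definition gr_iso ::
  "('r, 'rs) ring_scheme \<Rightarrow> ('g, 'gs) monoid_scheme \<Rightarrow>
   ('r, 'm, 'ms) module_scheme \<Rightarrow> ('g \<Rightarrow> 'm \<Rightarrow> 'm) \<Rightarrow>
   ('r, 'n, 'ns) module_scheme \<Rightarrow> ('g \<Rightarrow> 'n \<Rightarrow> 'n) \<Rightarrow> bool" where
  "gr_iso R G M \<rho> N \<sigma> \<longleftrightarrow>
     (\<exists>f \<in> module_hom R M N. bij_betw f (carrier M) (carrier N) \<and>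
        (\<forall>g\<in>carrier G. \<forall>m\<in>carrier M. f (\<rho> g m) = \<sigma> g (f m)))"

definition gr_direct_decomp ::
  "('r, 'rs) ring_scheme \<Rightarrow> ('g, 'gs) monoid_scheme \<Rightarrow> ('r, 'm, 'ms) module_scheme \<Rightarrow>
   ('g \<Rightarrow> 'm \<Rightarrow> 'm) \<Rightarrow> 'm set \<Rightarrow> 'm set \<Rightarrow> bool" where
  "gr_direct_decomp R G M \<rho> A B \<longleftrightarrow>
     gr_submodule R G M \<rho> A \<and> gr_submodule R G M \<rho> B \<and>
     A \<inter> B = {\<zero>\<^bsub>M\<^esub>} \<and> A <+>\<^bsub>M\<^esub> B = carrier M"

definition gr_indecomposable ::
  "('r, 'rs) ring_scheme \<Rightarrow> ('g, 'gs) monoid_scheme \<Rightarrow> ('r, 'm, 'ms) module_scheme \<Rightarrow>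
   ('g \<Rightarrow> 'm \<Rightarrow> 'm) \<Rightarrow> bool" where
  "gr_indecomposable R G M \<rho> \<longleftrightarrow> carrier M \<noteq> {\<zero>\<^bsub>M\<^esub>} \<and>
     (\<forall>A B. gr_direct_decomp R G M \<rho> A B \<longrightarrow> A = {\<zero>\<^bsub>M\<^esub>} \<or> B = {\<zero>\<^bsub>M\<^esub>})"

definition gr_maximal_submodule ::
  "('r, 'rs) ring_scheme \<Rightarrow> ('g, 'gs) monoid_scheme \<Rightarrow> ('r, 'm, 'ms) module_scheme \<Rightarrow>
   ('g \<Rightarrow> 'm \<Rightarrow> 'm) \<Rightarrow> 'm set \<Rightarrow> bool" where
  "gr_maximal_submodule R G M \<rho> N \<longleftrightarrow>
     gr_submodule R G M \<rho> N \<and> N \<noteq> carrier M \<and>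
     (\<forall>L. gr_submodule R G M \<rho> L \<and> N \<subseteq> L \<longrightarrow> L = N \<or> L = carrier M)"

text \<open>The regular module \<open>RG\<close>: the formal sum \<open>\<Sum>x. f x \<cdot> x\<close> is encoded as the function \<open>f\<close>
  on \<open>G\<close>, so that left multiplication by \<open>g\<close> becomes \<open>(g f)(x) = f (g\<inverse> x)\<close>.\<close>

definition regular_module ::
  "('r, 'rs) ring_scheme \<Rightarrow> ('g, 'gs) monoid_scheme \<Rightarrow> ('r, 'g \<Rightarrow> 'r) module" where
  "regular_module R G = ring.func_space R (carrier G)"

definition regular_act ::
  "('g, 'gs) monoid_scheme \<Rightarrow> 'g \<Rightarrow> ('g \<Rightarrow> 'r) \<Rightarrow> 'g \<Rightarrow> 'r" where
  "regular_act G g f = (\<lambda>x\<in>carrier G. f (inv\<^bsub>G\<^esub> g \<otimes>\<^bsub>G\<^esub> x))"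

definition principal_indecomposable ::
  "('r, 'rs) ring_scheme \<Rightarrow> ('g, 'gs) monoid_scheme \<Rightarrow> ('r, 'm, 'ms) module_scheme \<Rightarrow>
   ('g \<Rightarrow> 'm \<Rightarrow> 'm) \<Rightarrow> bool" where
  "principal_indecomposable R G P \<rho> \<longleftrightarrow>
     group_ring_module R G P \<rho> \<and> gr_indecomposable R G P \<rho> \<and>
     (\<exists>A B. gr_direct_decomp R G (regular_module R G) (regular_act G) A B \<and>
        gr_iso R G P \<rho> ((regular_module R G)\<lparr>carrier := A\<rparr>) (regular_act G))"

definition self_module :: "('r, 'rs) ring_scheme \<Rightarrow> ('r, 'r) module" where
  "self_module R = \<lparr>carrier = carrier R, monoid.mult = monoid.mult R, one = one R,
     ring.zero = ring.zero R, add = add R, module.smult = monoid.mult R\<rparr>"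

text \<open>\<open>mult\<close> and \<open>one\<close> are meaningless fields of a module record; here and below they get dummy
  values.\<close>

definition dual_module ::
  "('r, 'rs) ring_scheme \<Rightarrow> ('r, 'm, 'ms) module_scheme \<Rightarrow> ('r, 'm \<Rightarrow> 'r) module" where
  "dual_module R M =
     \<lparr>carrier = module_hom R M (self_module R) \<inter> extensional (carrier M),
      monoid.mult = (\<lambda>f h. \<lambda>m\<in>carrier M. \<zero>\<^bsub>R\<^esub>),
      one = (\<lambda>m\<in>carrier M. \<zero>\<^bsub>R\<^esub>),
      ring.zero = (\<lambda>m\<in>carrier M. \<zero>\<^bsub>R\<^esub>),
      add = (\<lambda>f h. \<lambda>m\<in>carrier M. f m \<oplus>\<^bsub>R\<^esub> h m),
      module.smult = (\<lambda>r f. \<lambda>m\<in>carrier M. r \<otimes>\<^bsub>R\<^esub> f m)\<rparr>"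

definition dual_act ::
  "('g, 'gs) monoid_scheme \<Rightarrow> ('r, 'm, 'ms) module_scheme \<Rightarrow> ('g \<Rightarrow> 'm \<Rightarrow> 'm) \<Rightarrow>
   'g \<Rightarrow> ('m \<Rightarrow> 'r) \<Rightarrow> 'm \<Rightarrow> 'r" where
  "dual_act G M \<rho> g f = (\<lambda>m\<in>carrier M. f (\<rho> (inv\<^bsub>G\<^esub> g) m))"

definition self_dual ::
  "('r, 'rs) ring_scheme \<Rightarrow> ('g, 'gs) monoid_scheme \<Rightarrow> ('r, 'm, 'ms) module_scheme \<Rightarrow>
   ('g \<Rightarrow> 'm \<Rightarrow> 'm) \<Rightarrow> bool" where
  "self_dual R G M \<rho> \<longleftrightarrow> gr_iso R G M \<rho> (dual_module R M) (dual_act G M \<rho>)"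

definition polarization ::
  "('r, 'rs) ring_scheme \<Rightarrow> ('r, 'm, 'ms) module_scheme \<Rightarrow> ('m \<Rightarrow> 'r) \<Rightarrow> 'm \<Rightarrow> 'm \<Rightarrow> 'r" where
  "polarization R M Q x y = Q (x \<oplus>\<^bsub>M\<^esub> y) \<ominus>\<^bsub>R\<^esub> Q x \<ominus>\<^bsub>R\<^esub> Q y"

definition quadratic_form ::
  "('r, 'rs) ring_scheme \<Rightarrow> ('r, 'm, 'ms) module_scheme \<Rightarrow> ('m \<Rightarrow> 'r) \<Rightarrow> bool" where
  "quadratic_form R M Q \<longleftrightarrow>
     Q \<in> carrier M \<rightarrow> carrier R \<and>
     (\<forall>r\<in>carrier R. \<forall>x\<in>carrier M. Q (r \<odot>\<^bsub>M\<^esub> x) = r \<otimes>\<^bsub>R\<^esub> r \<otimes>\<^bsub>R\<^esub> Q x) \<and>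
     (\<forall>x\<in>carrier M. polarization R M Q x \<in> module_hom R M (self_module R)) \<and>
     (\<forall>y\<in>carrier M. (\<lambda>x. polarization R M Q x y) \<in> module_hom R M (self_module R))"

definition nondegenerate_form ::
  "('r, 'rs) ring_scheme \<Rightarrow> ('r, 'm, 'ms) module_scheme \<Rightarrow> ('m \<Rightarrow> 'r) \<Rightarrow> bool" where
  "nondegenerate_form R M Q \<longleftrightarrow>
     bij_betw (\<lambda>x. restrict (polarization R M Q x) (carrier M))
       (carrier M) (carrier (dual_module R M))"

definition quadratic_type ::
  "('r, 'rs) ring_scheme \<Rightarrow> ('g, 'gs) monoid_scheme \<Rightarrow> ('r, 'm, 'ms) module_scheme \<Rightarrow>
   ('g \<Rightarrow> 'm \<Rightarrow> 'm) \<Rightarrow> bool" where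
  "quadratic_type R G M \<rho> \<longleftrightarrow>
     (\<exists>Q. quadratic_form R M Q \<and> nondegenerate_form R M Q \<and>
        (\<forall>g\<in>carrier G. \<forall>x\<in>carrier M. Q (\<rho> g x) = Q x))"

text \<open>The trace of the matrix of \<open>T\<close> in some finite basis \<open>B\<close>; \<open>a b\<close> is the column of
  coordinates of \<open>T b\<close>. The value does not depend on the basis chosen.\<close>

definition lin_trace ::
  "('k, 'ks) ring_scheme \<Rightarrow> ('k, 'v, 'vs) module_scheme \<Rightarrow> ('v \<Rightarrow> 'v) \<Rightarrow> 'k" where
  "lin_trace K V T = (SOME t. \<exists>B a.
     finite B \<and> vectorspace.basis K V B \<and>
     (\<forall>b\<in>B. a b \<in> B \<rightarrow> carrier K \<and> T b = module.lincomb V (a b) B) \<and>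
     t = (\<Oplus>\<^bsub>K\<^esub>b\<in>B. a b b))"

definition eigenvalues ::
  "('k, 'ks) ring_scheme \<Rightarrow> ('k, 'v, 'vs) module_scheme \<Rightarrow> ('v \<Rightarrow> 'v) \<Rightarrow> 'k set" where
  "eigenvalues K V T =
     {c \<in> carrier K. \<exists>v\<in>carrier V. v \<noteq> \<zero>\<^bsub>V\<^esub> \<and> T v = c \<odot>\<^bsub>V\<^esub> v}"

text \<open>The algebraic multiplicity of an eigenvalue, as the dimension of the generalized
  eigenspace.\<close>

definition eigen_mult ::
  "('k, 'ks) ring_scheme \<Rightarrow> ('k, 'v, 'vs) module_scheme \<Rightarrow> ('v \<Rightarrow> 'v) \<Rightarrow> 'k \<Rightarrow> nat" where
  "eigen_mult K V T c = vectorspace.dim K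
     (V\<lparr>carrier := {v \<in> carrier V. \<exists>n. ((\<lambda>w. T w \<ominus>\<^bsub>V\<^esub> c \<odot>\<^bsub>V\<^esub> w) ^^ n) v = \<zero>\<^bsub>V\<^esub>}\<rparr>)"

text \<open>Extension of scalars \<open>M \<otimes>\<^sub>R K\<close> for a subring \<open>R\<close> of \<open>K\<close>: the free abelian group on
  \<open>M \<times> K\<close> modulo the usual relations. \<open>K\<close> acts through the second factor.\<close>

definition tensor_free ::
  "('k, 'ks) ring_scheme \<Rightarrow> ('k, 'm, 'ms) module_scheme \<Rightarrow> ('m \<times> 'k \<Rightarrow>\<^sub>0 int) monoid" where
  "tensor_free K M = free_Abelian_group (carrier M \<times> carrier K)"

definition tensor_rel ::
  "('k, 'rs) ring_scheme \<Rightarrow> ('k, 'ks) ring_scheme \<Rightarrow> ('k, 'm, 'ms) module_scheme \<Rightarrow>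
   ('m \<times> 'k \<Rightarrow>\<^sub>0 int) set" where
  "tensor_rel R K M = generate (tensor_free K M)
     ({frag_of (m \<oplus>\<^bsub>M\<^esub> m', a) - frag_of (m, a) - frag_of (m', a) | m m' a.
         m \<in> carrier M \<and> m' \<in> carrier M \<and> a \<in> carrier K} \<union>
      {frag_of (m, a \<oplus>\<^bsub>K\<^esub> a') - frag_of (m, a) - frag_of (m, a') | m a a'.
         m \<in> carrier M \<and> a \<in> carrier K \<and> a' \<in> carrier K} \<union>
      {frag_of (r \<odot>\<^bsub>M\<^esub> m, a) - frag_of (m, r \<otimes>\<^bsub>K\<^esub> a) | r m a.
         r \<in> carrier R \<and> m \<in> carrier M \<and> a \<in> carrier K})"

definition tensor_map ::
  "('k, 'rs) ring_scheme \<Rightarrow> ('k, 'ks) ring_scheme \<Rightarrow> ('k, 'm, 'ms) module_scheme \<Rightarrow>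
   ('m \<times> 'k \<Rightarrow> 'm \<times> 'k) \<Rightarrow> ('m \<times> 'k \<Rightarrow>\<^sub>0 int) set \<Rightarrow> ('m \<times> 'k \<Rightarrow>\<^sub>0 int) set" where
  "tensor_map R K M h X =
     (\<Union>x\<in>X. tensor_rel R K M #>\<^bsub>tensor_free K M\<^esub> frag_extend (\<lambda>p. frag_of (h p)) x)"

definition extend_scalars ::
  "('k, 'rs) ring_scheme \<Rightarrow> ('k, 'ks) ring_scheme \<Rightarrow> ('k, 'm, 'ms) module_scheme \<Rightarrow>
   ('k, ('m \<times> 'k \<Rightarrow>\<^sub>0 int) set) module" where
  "extend_scalars R K M =
     (let T = tensor_free K M Mod tensor_rel R K M in
      \<lparr>carrier = carrier T, monoid.mult = (\<lambda>X Y. \<one>\<^bsub>T\<^esub>), one = \<one>\<^bsub>T\<^esub>,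
       ring.zero = \<one>\<^bsub>T\<^esub>, add = monoid.mult T,
       module.smult = (\<lambda>c. tensor_map R K M (\<lambda>(m, a). (m, c \<otimes>\<^bsub>K\<^esub> a)))\<rparr>)"

definition extend_act ::
  "('k, 'rs) ring_scheme \<Rightarrow> ('k, 'ks) ring_scheme \<Rightarrow> ('k, 'm, 'ms) module_scheme \<Rightarrow>
   ('g \<Rightarrow> 'm \<Rightarrow> 'm) \<Rightarrow> 'g \<Rightarrow> ('m \<times> 'k \<Rightarrow>\<^sub>0 int) set \<Rightarrow> ('m \<times> 'k \<Rightarrow>\<^sub>0 int) set" where
  "extend_act R K M \<rho> g = tensor_map R K M (\<lambda>(m, a). (\<rho> g m, a))"

definition ordinary_character ::
  "complex set \<Rightarrow> (complex, 'm, 'ms) module_scheme \<Rightarrow> ('g \<Rightarrow> 'm \<Rightarrow> 'm) \<Rightarrow> 'g \<Rightarrow> complex" where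
  "ordinary_character MM P \<rho> g =
     lin_trace (frac_field MM)
       (extend_scalars (loc_ring MM) (frac_field MM) P)
       (extend_act (loc_ring MM) (frac_field MM) P \<rho> g)"

definition root_lift :: "complex set \<Rightarrow> complex set \<Rightarrow> complex" where
  "root_lift MM c = (THE z. (\<exists>n. odd n \<and> z ^ n = 1) \<and> loc_ideal MM +>\<^bsub>loc_ring MM\<^esub> z = c)"

definition brauer_character ::
  "complex set \<Rightarrow> (complex set, 'v, 'vs) module_scheme \<Rightarrow> ('g \<Rightarrow> 'v \<Rightarrow> 'v) \<Rightarrow> 'g \<Rightarrow> complex" where
  "brauer_character MM V \<sigma> g =
     (\<Sum>c\<in>eigenvalues (res_field MM) V (\<sigma> g).
        of_nat (eigen_mult (res_field MM) V (\<sigma> g) c) * root_lift MM c)"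

text \<open>The quotient \<open>P/N\<close> as a vector space over the residue field, for a submodule \<open>N\<close>
  containing \<open>JP\<close> (as every maximal submodule of a principal indecomposable module does). The
  union defining \<open>smult\<close> then consists of a single coset, independent of representatives.\<close>

definition residue_quotient ::
  "(complex, 'm, 'ms) module_scheme \<Rightarrow> 'm set \<Rightarrow> (complex set, 'm set) module" where
  "residue_quotient P N =
     \<lparr>carrier = a_rcosets\<^bsub>P\<^esub> N, monoid.mult = (\<lambda>X Y. N), one = N, ring.zero = N,
      add = set_add P,
      module.smult = (\<lambda>c X. \<Union>r\<in>c. \<Union>x\<in>X. N +>\<^bsub>P\<^esub> (r \<odot>\<^bsub>P\<^esub> x))\<rparr>"

definition quotient_act :: "('g \<Rightarrow> 'm \<Rightarrow> 'm) \<Rightarrow> 'g \<Rightarrow> 'm set \<Rightarrow> 'm set" where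
  "quotient_act \<rho> g X = \<rho> g ` X"

definition unique_maximal_submodule ::
  "('r, 'rs) ring_scheme \<Rightarrow> ('g, 'gs) monoid_scheme \<Rightarrow> ('r, 'm, 'ms) module_scheme \<Rightarrow>
   ('g \<Rightarrow> 'm \<Rightarrow> 'm) \<Rightarrow> 'm set" where
  "unique_maximal_submodule R G P \<rho> = (THE N. gr_maximal_submodule R G P \<rho> N)"

definition head_brauer_character ::
  "complex set \<Rightarrow> ('g, 'gs) monoid_scheme \<Rightarrow> (complex, 'm, 'ms) module_scheme \<Rightarrow>
   ('g \<Rightarrow> 'm \<Rightarrow> 'm) \<Rightarrow> 'g \<Rightarrow> complex" where
  "head_brauer_character MM G P \<rho> =
     brauer_character MM
       (residue_quotient P (unique_maximal_submodule (loc_ring MM) G P \<rho>))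
       (quotient_act \<rho>)"

definition two_regular :: "('g, 'gs) monoid_scheme \<Rightarrow> 'g \<Rightarrow> bool" where
  "two_regular G g \<longleftrightarrow> odd (group.ord G g)"

definition real_element :: "('g, 'gs) monoid_scheme \<Rightarrow> 'g \<Rightarrow> bool" where
  "real_element G g \<longleftrightarrow> (\<exists>x\<in>carrier G. x \<otimes>\<^bsub>G\<^esub> g \<otimes>\<^bsub>G\<^esub> inv\<^bsub>G\<^esub> x = inv\<^bsub>G\<^esub> g)"

text \<open>By the first clause the identity is strongly real even if \<open>G\<close> has odd order. The only
  self-dual principal indecomposable module is then the trivial module \<open>R\<close>, whose quadratic forms
  \<open>a x\<^sup>2\<close> have the degenerate polarizations \<open>2 a x y\<close>, although its Brauer character takes the
  value \<open>1\<close> at the identity. Quadratic type can therefore only be characterized by strongly real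
  elements when \<open>G\<close> has even order.\<close>

definition strongly_real :: "('g, 'gs) monoid_scheme \<Rightarrow> 'g \<Rightarrow> bool" where
  "strongly_real G g \<longleftrightarrow> g = inv\<^bsub>G\<^esub> g \<or>
     (\<exists>t\<in>carrier G. group.ord G t = 2 \<and> t \<otimes>\<^bsub>G\<^esub> g \<otimes>\<^bsub>G\<^esub> inv\<^bsub>G\<^esub> t = inv\<^bsub>G\<^esub> g)"

definition weakly_real :: "('g, 'gs) monoid_scheme \<Rightarrow> 'g \<Rightarrow> bool" where
  "weakly_real G g \<longleftrightarrow> real_element G g \<and> \<not> strongly_real G g"

definition centralizer :: "('g, 'gs) monoid_scheme \<Rightarrow> 'g \<Rightarrow> 'g set" where
  "centralizer G g = {x \<in> carrier G. x \<otimes>\<^bsub>G\<^esub> g = g \<otimes>\<^bsub>G\<^esub> x}"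

end

theory Submission
  imports Defs "Jordan_Normal_Form.Char_Poly" "HOL-Library.Function_Algebras"
    "HOL-Number_Theory.Residues"
begin

text \<open>Write \<open>P \<cong> RG e\<close> with a primitive idempotent \<open>e\<close>. Then \<open>e RG e\<close> is local, its
  residue field is that of \<open>R\<close> (eigenvalues over \<open>R\<close> are integral, hence lie in \<open>R\<close>), and \<open>RG e\<close>
  has a unique maximal submodule. Let \<open>x \<mapsto> x\<^sup>*\<close> be the anti-automorphism inverting group
  elements. Invariant perfect pairings on \<open>RG e\<close> are given by \<open>(x, y) \<mapsto> \<langle>x, y c\<rangle>\<close> with
  \<open>c \<in> e RG e\<^sup>*\<close> and \<open>d \<in> e\<^sup>* RG e\<close> such that \<open>c d = e\<close> and \<open>d c = e\<^sup>*\<close>.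

  The number \<open>\<Phi>(g) / |C(g)|\<close> is the sum of the coefficients of \<open>e\<close> over the class of \<open>g\<inverse>\<close>.
  If \<open>P\<close> has a quadratic form then \<open>c\<close> and \<open>d\<close> can be taken symmetric, and in
  \<open>\<Sum> c\<^sub>u d\<^sub>v\<close> over the pairs with \<open>u v\<close> in the class, \<open>(u, v) \<mapsto> (u\<inverse>, v\<inverse>)\<close> pairs off all terms
  unless the class is a product of two involutions, that is, strongly real. Thus (i) implies (iii).

  Let \<open>\<tau>\<close> be the trace on the head; \<open>\<phi>(g) \<equiv> \<tau>(g)\<close> modulo \<open>J\<close> for 2-regular \<open>g\<close>, and Frobenius
  shows that \<open>\<phi>(g) \<in> 2R\<close> if and only if \<open>\<phi>(g) \<in> J\<close>. As \<open>e\<close> acts on the head with trace \<open>1\<close>, the sum of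
  \<open>e\<^sub>x \<tau>(x)\<close> over \<open>G\<close> is a unit. Modulo \<open>J\<close>, classes that are not 2-regular do not contribute, and
  the contributions of mutually inverse classes cancel. So some real 2-regular class
  contributes; given (iii) it is strongly real. Thus (iii) implies (ii).

  Finally the head carries a symmetric invariant form \<open>\<beta>\<close>. If \<open>g = t t'\<close> for involutions and both
  \<open>\<beta>(t x, y)\<close> and \<open>\<beta>(t' x, y)\<close> were alternating, then the trace \<open>\<tau>(g)\<close> of the product would vanish.
  Hence \<open>\<beta>(t z, z) \<noteq> 0\<close> for one of the two and some \<open>z\<close>, which makes a unit
  \<open>w t w\<^sup>*\<close> from which the quadratic form \<open>Q(x) = \<onehalf> \<langle>x w, x w t\<rangle>\<close> arises; the halving is harmless
  because \<open>t\<close> has no fixed points on \<open>G\<close>. Thus (ii) implies (i).\<close>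

section \<open>Integral closure\<close>

text \<open>\<open>R\<close> is not complete, so idempotents cannot be produced as limits. In place
  of Hensel's lemma, every element of \<open>e RG e\<close> is annihilated by a product of linear
  factors over \<open>R\<close>: a complex annihilating polynomial splits, and integrality puts its
  roots into \<open>R\<close>. Sorting the roots by membership in \<open>J\<close> gives comaximal
  factors and from them an idempotent to which primitivity applies.

  Functionals and forms on the head are kept as \<open>R\<close>-valued functions on
  \<open>RG e\<close>, correct modulo \<open>J\<close>, and traces are sums over frames, so that no
  basis of the head has to be chosen. The residue field enters only where the Brauer character is
  computed; a frame fitted to the eigenspaces of \<open>g\<close> links the two.

  Classes of even order drop out for this reason: modulo \<open>J\<close> the class sum of a square
  is the square of the sum over the square roots of the class. As \<open>e\<close> is its own
  square, roots can be extracted repeatedly, and for a class of even order this ends in the empty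
  set.

  Even order of \<open>G\<close> enters through \<open>g = 1\<close>, which must be written as
  \<open>t t\<close> with an involution \<open>t\<close>.\<close>

lemma int_matrix_eigenvalue_algebraic_int:
  fixes w :: "'i \<Rightarrow> complex" and m :: "'i \<Rightarrow> 'i \<Rightarrow> int"
  assumes fin: "finite I"
    and ev: "\<And>i. i \<in> I \<Longrightarrow> (\<Sum>j\<in>I. of_int (m i j) * w j) = l * w i"
    and i0: "i0 \<in> I" "w i0 \<noteq> 0"
  shows "algebraic_int l"
proof -
  define n where "n = card I"
  obtain h where h: "bij_betw h {0..<n} I"
    using ex_bij_betw_nat_finite[OF fin] n_def by blast
  define A where "A = mat n n (\<lambda>(i, j). m (h i) (h j))"
  define B :: "complex mat" where "B = map_mat of_int A"
  define v where "v = vec n (\<lambda>i. w (h i))"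
  have hI: "h i \<in> I" if "i < n" for i
    using h that by (auto simp: bij_betw_def)
  have B: "B \<in> carrier_mat n n" by (simp add: B_def A_def)
  have "eigenvector B v l"
    unfolding eigenvector_def
  proof (intro conjI)
    show "v \<in> carrier_vec (dim_row B)" using B by (auto simp: v_def)
    obtain i where i: "i < n" "h i = i0"
      using h i0(1) by (auto simp: bij_betw_def)
    then have "v $ i \<noteq> 0" using i0 by (simp add: v_def)
    then show "v \<noteq> 0\<^sub>v (dim_row B)" using i B by auto
    show "B *\<^sub>v v = l \<cdot>\<^sub>v v"
    proof (rule eq_vecI)
      fix i assume "i < dim_vec (l \<cdot>\<^sub>v v)"
      then have i: "i < n" by (simp add: v_def)
      have "(B *\<^sub>v v) $ i = (\<Sum>j\<in>{0..<n}. of_int (m (h i) (h j)) * w (h j))"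
        using i by (simp add: B_def A_def v_def scalar_prod_def)
      also have "\<dots> = (\<Sum>j\<in>I. of_int (m (h i) j) * w j)"
        using sum.reindex_bij_betw[OF h, of "\<lambda>j. of_int (m (h i) j) * w j"] by simp
      also have "\<dots> = l * w (h i)" using ev hI[OF i] by simp
      finally show "(B *\<^sub>v v) $ i = (l \<cdot>\<^sub>v v) $ i" using i by (simp add: v_def)
    qed (use B in \<open>auto simp: v_def\<close>)
  qed
  then have "poly (char_poly B) l = 0"
    using eigenvalue_root_char_poly[OF B] by (auto simp: eigenvalue_def)
  moreover have A: "A \<in> carrier_mat n n" by (simp add: A_def)
  then have "char_poly B = map_poly of_int (char_poly A)"
    unfolding B_def by (rule of_int_hom.char_poly_hom)
  moreover have "lead_coeff (char_poly A) = 1"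
    using degree_monic_char_poly[OF A] by auto
  ultimately show ?thesis
    unfolding algebraic_int_altdef_ipoly by (intro exI[of _ "char_poly A"]) simp
qed

text \<open>The entries \<open>a i j\<close> act on the finitely generated group spanned by the products of their
  bounded powers with the coordinates \<open>v i\<close>, and so does the eigenvalue \<open>l\<close>.\<close>

lemma algebraic_int_matrix_eigenvalue:
  fixes v :: "'i \<Rightarrow> complex" and a :: "'i \<Rightarrow> 'i \<Rightarrow> complex"
  assumes fin: "finite I"
    and a: "\<And>i j. i \<in> I \<Longrightarrow> j \<in> I \<Longrightarrow> algebraic_int (a i j)"
    and ev: "\<And>i. i \<in> I \<Longrightarrow> (\<Sum>j\<in>I. a i j * v j) = l * v i"
    and i0: "i0 \<in> I" "v i0 \<noteq> 0"
  shows "algebraic_int l"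
proof -
  define K where "K = I \<times> I"
  define \<alpha> where "\<alpha> = (\<lambda>(i, j). a i j)"
  have finK: "finite K" using fin by (simp add: K_def)
  have "\<exists>q. poly (map_poly of_int q) (\<alpha> p) = 0 \<and> lead_coeff q = 1" if "p \<in> K" for p
    using a that unfolding algebraic_int_altdef_ipoly by (auto simp: K_def \<alpha>_def)
  then obtain q where q: "\<And>p. p \<in> K \<Longrightarrow> poly (map_poly of_int (q p)) (\<alpha> p) = 0"
    "\<And>p. p \<in> K \<Longrightarrow> lead_coeff (q p) = (1 :: int)"
    by metis
  define d where "d p = degree (q p)" for p
  have d0: "d p > 0" if "p \<in> K" for p
  proof (rule ccontr)
    assume "\<not> d p > 0"
    then have "q p = [:1:]" using q(2)[OF that] by (metis d_def degree_0_id gr0I)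
    then show False using q(1)[OF that] by simp
  qed
  \<comment> \<open>Exponents stay below the degrees: higher powers of \<open>\<alpha> p\<close> are
    rewritten by the monic equation \<open>q p\<close>.\<close>
  define E where "E = (\<Pi>\<^sub>E p\<in>K. {..<d p})"
  define mono where "mono e = (\<Prod>p\<in>K. \<alpha> p ^ e p)" for e :: "'i \<times> 'i \<Rightarrow> nat"
  define W where "W = (\<lambda>(e, i). mono e * v i) ` (E \<times> I)"
  have finE: "finite E" using finK by (auto simp: E_def intro: finite_PiE)
  have finW: "finite W" using finE fin by (auto simp: W_def)
  define Z where "Z = {\<Sum>w\<in>W. of_int (c w) * w | c. True}"
  have ZI: "(\<Sum>w\<in>W. of_int (c w) * w) \<in> Z" for c unfolding Z_def by blast
  have Zadd: "x + y \<in> Z" if xy: "x \<in> Z" "y \<in> Z" for x y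
  proof -
    obtain c c' where "x = (\<Sum>w\<in>W. of_int (c w) * w)" "y = (\<Sum>w\<in>W. of_int (c' w) * w)"
      using xy unfolding Z_def by blast
    then have "x + y = (\<Sum>w\<in>W. of_int (c w + c' w) * w)"
      by (simp add: sum.distrib algebra_simps)
    then show ?thesis using ZI by metis
  qed
  have Zsc: "of_int k * x \<in> Z" if "x \<in> Z" for k x
  proof -
    obtain c where "x = (\<Sum>w\<in>W. of_int (c w) * w)"
      using \<open>x \<in> Z\<close> unfolding Z_def by blast
    then have "of_int k * x = (\<Sum>w\<in>W. of_int (k * c w) * w)"
      by (simp add: sum_distrib_left algebra_simps)
    then show ?thesis using ZI by metis
  qed
  have Z0: "0 \<in> Z" using ZI[of "\<lambda>_. 0"] by simp
  have Zsum: "(\<Sum>s\<in>S. f s) \<in> Z" if "\<And>s. s \<in> S \<Longrightarrow> f s \<in> Z" for f :: "'x \<Rightarrow> complex" and S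
    using that by (induction S rule: infinite_finite_induct) (auto intro: Zadd Z0)
  have WZ: "w \<in> Z" if "w \<in> W" for w
  proof -
    have "(\<Sum>x\<in>W. of_int (if x = w then 1 else 0) * x) = w"
    proof -
      have "(\<Sum>x\<in>W. of_int (if x = w then 1 else 0) * x) = (\<Sum>x\<in>W. if w = x then x else 0)"
        by (intro sum.cong) auto
      then show ?thesis using finW that by simp
    qed
    then show ?thesis using ZI by metis
  qed
  have mono_upd: "mono (e(p := k)) = \<alpha> p ^ k * mono (e(p := 0))" if "p \<in> K" for e p k
  proof -
    have "(\<Prod>p'\<in>K - {p}. \<alpha> p' ^ (e(p := k)) p') = (\<Prod>p'\<in>K - {p}. \<alpha> p' ^ (e(p := 0)) p')"
      by (intro prod.cong) auto
    then show ?thesis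
      unfolding mono_def prod.remove[OF finK that] by simp
  qed
  have step: "\<alpha> p * w \<in> Z" if p: "p \<in> K" and w: "w \<in> W" for p w
  proof -
    obtain e i where e: "e \<in> E" "i \<in> I" "w = mono e * v i" using w by (auto simp: W_def)
    \<comment> \<open>\<open>y\<close> is \<open>w\<close> without its power of
      \<open>\<alpha> p\<close>, so multiplication by \<open>\<alpha> p\<close> only moves that
      exponent.\<close>
    define y where "y = mono (e(p := 0)) * v i"
    have wy: "w = \<alpha> p ^ e p * y"
      using mono_upd[OF p, of e "e p"] by (simp add: e y_def)
    have mem: "\<alpha> p ^ k * y \<in> W" if "k < d p" for k
    proof -
      have "e(p := k) \<in> E" using e(1) that p unfolding E_def PiE_def extensional_def Pi_def by auto
      moreover have "\<alpha> p ^ k * y = mono (e(p := k)) * v i"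
        using mono_upd[OF p, of e k] by (simp add: y_def)
      ultimately show ?thesis using e(2) by (auto simp: W_def)
    qed
    show ?thesis
    proof (cases "Suc (e p) < d p")
      case True
      then show ?thesis using mem[OF True] WZ wy by (simp add: mult.assoc)
    next
      case False
      \<comment> \<open>The exponent is at the top of its range, so the product is
        \<open>\<alpha> p ^ d p * y\<close>, and the monic equation expresses it through lower
        powers.\<close>
      have "e p < d p" using e(1) p by (auto simp: E_def PiE_def)
      then have dp: "Suc (e p) = d p" using False by simp
      have "0 = (\<Sum>k\<le>d p. of_int (coeff (q p) k) * \<alpha> p ^ k)"
        using q(1)[OF p] by (simp add: poly_altdef d_def degree_map_poly coeff_map_poly)
      also have "{..d p} = insert (d p) {..<d p}" by auto
      finally have "\<alpha> p ^ d p = - (\<Sum>k<d p. of_int (coeff (q p) k) * \<alpha> p ^ k)"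
        using q(2)[OF p] by (simp add: d_def add_eq_0_iff2)
      then have "\<alpha> p * w = - (\<Sum>k<d p. of_int (coeff (q p) k) * \<alpha> p ^ k) * y"
        using wy dp by (metis mult.assoc power_Suc)
      also have "\<dots> = (\<Sum>k<d p. of_int (- coeff (q p) k) * (\<alpha> p ^ k * y))"
        by (simp add: sum_distrib_right sum_negf mult.assoc)
      also have "\<dots> \<in> Z" by (intro Zsum Zsc WZ mem) auto
      finally show ?thesis .
    qed
  qed
  have lW: "l * w \<in> Z" if w: "w \<in> W" for w
  proof -
    obtain e i where e: "e \<in> E" "i \<in> I" "w = mono e * v i" using w by (auto simp: W_def)
    have "l * w = mono e * (l * v i)" by (simp add: e)
    also have "\<dots> = mono e * (\<Sum>j\<in>I. a i j * v j)" using ev e by simp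
    also have "\<dots> = (\<Sum>j\<in>I. \<alpha> (i, j) * (mono e * v j))"
      by (simp add: sum_distrib_left \<alpha>_def algebra_simps)
    also have "\<dots> \<in> Z" using e by (intro Zsum step) (auto simp: K_def W_def)
    finally show ?thesis .
  qed
  then have "\<forall>w\<in>W. \<exists>c. l * w = (\<Sum>x\<in>W. of_int (c x) * x)" unfolding Z_def by blast
  then obtain m where m: "\<And>w. w \<in> W \<Longrightarrow> l * w = (\<Sum>x\<in>W. of_int (m w x) * x)"
    by metis
  \<comment> \<open>All degrees being positive, the zero exponent is admissible and
    \<open>v i0\<close> itself belongs to \<open>W\<close>. It is the nonzero coordinate of the
    integer eigenvector \<open>id\<close> indexed by \<open>W\<close>.\<close>
  define e0 :: "'i \<times> 'i \<Rightarrow> nat" where "e0 = (\<lambda>p\<in>K. 0)"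
  have "e0 \<in> E" using d0 by (auto simp: e0_def E_def)
  moreover have "mono e0 = 1" by (simp add: mono_def e0_def)
  ultimately have "v i0 \<in> W" using i0(1) unfolding W_def by force
  then show ?thesis
    using int_matrix_eigenvalue_algebraic_int[OF finW, where m = m and w = id] m i0(2) by auto
qed

section \<open>The local ring\<close>

text \<open>\<open>eigenvalue_R\<close> carries integral closedness in the form in which it is used,
  for matrices over \<open>R\<close>. Its indices are natural numbers because a locale assumption
  cannot quantify over index types.\<close>

locale local_subring =
  fixes R J :: "complex set"
  assumes one_R [simp, intro]: "1 \<in> R"
    and diff_R [intro]: "x \<in> R \<Longrightarrow> y \<in> R \<Longrightarrow> x - y \<in> R"
    and mult_R [intro]: "x \<in> R \<Longrightarrow> y \<in> R \<Longrightarrow> x * y \<in> R"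
    and J_R [intro]: "x \<in> J \<Longrightarrow> x \<in> R"
    and diff_J [intro]: "x \<in> J \<Longrightarrow> y \<in> J \<Longrightarrow> x - y \<in> J"
    and mult_J [intro]: "r \<in> R \<Longrightarrow> x \<in> J \<Longrightarrow> r * x \<in> J"
    and two_J [simp, intro]: "2 \<in> J"
    and one_J [simp]: "1 \<notin> J"
    and unit_R: "x \<in> R \<Longrightarrow> x \<notin> J \<Longrightarrow> inverse x \<in> R"
    and eigenvalue_R: "\<And>I a v l i0. finite I \<Longrightarrow> (\<And>i j. i \<in> I \<Longrightarrow> j \<in> I \<Longrightarrow> a i j \<in> R) \<Longrightarrow>
       (\<And>i. i \<in> I \<Longrightarrow> (\<Sum>j\<in>I. a i j * v j) = l * v i) \<Longrightarrow> (i0::nat) \<in> I \<Longrightarrow> v i0 \<noteq> 0 \<Longrightarrow> l \<in> R"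
    and root_of_unity_R: "n > 0 \<Longrightarrow> z ^ n = 1 \<Longrightarrow> z \<in> R"
begin

lemma zero_R [simp, intro]: "0 \<in> R" using diff_R[of 1 1] by simp
lemma zero_J [simp, intro]: "0 \<in> J" using diff_J[of 2 2] by simp
lemma minus_R [intro]: "x \<in> R \<Longrightarrow> - x \<in> R" using diff_R[of 0 x] by simp
lemma minus_J [intro]: "x \<in> J \<Longrightarrow> - x \<in> J" using diff_J[of 0 x] by simp
lemma add_R [intro]: "x \<in> R \<Longrightarrow> y \<in> R \<Longrightarrow> x + y \<in> R" using diff_R[of x "- y"] minus_R by simp
lemma add_J [intro]: "x \<in> J \<Longrightarrow> y \<in> J \<Longrightarrow> x + y \<in> J" using diff_J[of x "- y"] minus_J by simp
lemma mult_J_right [intro]: "x \<in> J \<Longrightarrow> r \<in> R \<Longrightarrow> x * r \<in> J"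
  using mult_J[of r x] by (simp add: mult.commute)
lemma two_R [simp, intro]: "2 \<in> R" by blast

lemma sum_R [intro]: "(\<And>i. i \<in> I \<Longrightarrow> f i \<in> R) \<Longrightarrow> sum f I \<in> R"
  by (induction I rule: infinite_finite_induct) auto

lemma sum_J [intro]: "(\<And>i. i \<in> I \<Longrightarrow> f i \<in> J) \<Longrightarrow> sum f I \<in> J"
  by (induction I rule: infinite_finite_induct) auto

lemma power_R [intro]: "x \<in> R \<Longrightarrow> x ^ n \<in> R"
  by (induction n) auto

lemma of_nat_R [simp, intro]: "of_nat n \<in> R"
  by (induction n) auto

lemma of_nat_J_iff: "of_nat n \<in> J \<longleftrightarrow> even n"
proof -
  have ev: "of_nat n \<in> J" if "even n" for n
    using mult_J_right[OF two_J of_nat_R] that by (auto elim!: evenE)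
  have "of_nat n \<notin> J" if "odd n"
  proof
    assume "of_nat n \<in> J"
    moreover have "of_nat (n - 1) \<in> J" using that by (intro ev) auto
    moreover have "of_nat n - of_nat (n - 1) = (1::complex)"
      using that by (cases n) auto
    ultimately show False using diff_J one_J by metis
  qed
  then show ?thesis using ev by blast
qed

lemma J_prime: "x \<in> R \<Longrightarrow> y \<in> R \<Longrightarrow> x * y \<in> J \<Longrightarrow> x \<in> J \<or> y \<in> J"
proof (rule ccontr)
  assume xy: "x \<in> R" "y \<in> R" "x * y \<in> J" and n: "\<not> (x \<in> J \<or> y \<in> J)"
  then have "inverse y * (inverse x * (x * y)) \<in> J" by (auto intro: unit_R)
  moreover have "x \<noteq> 0" "y \<noteq> 0" using n by auto
  ultimately show False by (simp add: field_simps)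
qed

definition cong_J :: "complex \<Rightarrow> complex \<Rightarrow> bool" (infix "\<doteq>" 50) where "x \<doteq> y \<longleftrightarrow> x - y \<in> J"

definition twoR :: "complex set" where "twoR = {2 * r | r. r \<in> R}"

lemma twoRI: "r \<in> R \<Longrightarrow> x = 2 * r \<Longrightarrow> x \<in> twoR" unfolding twoR_def by blast

lemma twoRE: "x \<in> twoR \<Longrightarrow> (\<And>r. r \<in> R \<Longrightarrow> x = 2 * r \<Longrightarrow> P) \<Longrightarrow> P" unfolding twoR_def by blast

lemma twoR_J: "x \<in> twoR \<Longrightarrow> x \<in> J"
  by (erule twoRE) auto

lemma twoR_add [intro]: assumes "x \<in> twoR" "y \<in> twoR" shows "x + y \<in> twoR"
proof -
  obtain r s where "r \<in> R" "s \<in> R" "x = 2 * r" "y = 2 * s" using assms unfolding twoR_def by blast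
  then show ?thesis by (intro twoRI[of "r + s"]) (auto simp: algebra_simps)
qed

lemma twoR_mult [intro]: assumes "x \<in> twoR" "r \<in> R" shows "r * x \<in> twoR"
proof -
  obtain s where "s \<in> R" "x = 2 * s" using assms unfolding twoR_def by blast
  then show ?thesis using assms by (intro twoRI[of "r * s"]) auto
qed

lemma twoR_0 [simp, intro]: "0 \<in> twoR" by (rule twoRI[of 0]) auto

lemma twoR_double [intro]: "r \<in> R \<Longrightarrow> r + r \<in> twoR" by (rule twoRI[of r]) auto

lemma twoR_sum [intro]: "(\<And>i. i \<in> I \<Longrightarrow> f i \<in> twoR) \<Longrightarrow> sum f I \<in> twoR"
  by (induction I rule: infinite_finite_induct) auto

end

section \<open>Localisation of the algebraic integers\<close>

lemma complex_subring_simps [simp]: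
  "carrier (complex_subring S) = S"
  "\<zero>\<^bsub>complex_subring S\<^esub> = 0"
  "\<one>\<^bsub>complex_subring S\<^esub> = 1"
  "x \<oplus>\<^bsub>complex_subring S\<^esub> y = x + y"
  "x \<otimes>\<^bsub>complex_subring S\<^esub> y = x * y"
  by (simp_all add: complex_subring_def)

lemma complex_subring_cring:
  assumes "1 \<in> S" and d: "\<And>x y. x \<in> S \<Longrightarrow> y \<in> S \<Longrightarrow> x - y \<in> S"
    and "\<And>x y. x \<in> S \<Longrightarrow> y \<in> S \<Longrightarrow> x * y \<in> S"
  shows "cring (complex_subring S)"
proof (rule cringI)
  have z: "0 \<in> S" using d[OF assms(1) assms(1)] by simp
  have m: "- x \<in> S" if "x \<in> S" for x using d[OF z that] by simp
  have a: "x + y \<in> S" if "x \<in> S" "y \<in> S" for x y using d[OF that(1) m[OF that(2)]] by simp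
  show "abelian_group (complex_subring S)"
    by (rule abelian_groupI) (auto simp: z a algebra_simps intro!: bexI[of _ "- _"] m)
  show "comm_monoid (complex_subring S)"
    by (rule comm_monoidI) (auto simp: assms algebra_simps)
qed (auto simp: algebra_simps)

lemma complex_subring_minus:
  assumes "cring (complex_subring S)" "x \<in> S"
  shows "\<ominus>\<^bsub>complex_subring S\<^esub> x = - x"
proof -
  interpret cring "complex_subring S" by fact
  have "\<ominus>\<^bsub>complex_subring S\<^esub> x + x = 0" using l_neg[of x] assms(2) by simp
  then show ?thesis by (simp add: eq_neg_iff_add_eq_0)
qed

lemma complex_subring_diff:
  assumes "cring (complex_subring S)" "y \<in> S"
  shows "x \<ominus>\<^bsub>complex_subring S\<^esub> y = x - y"
  using complex_subring_minus[OF assms] by (simp add: a_minus_def)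

lemma complex_subring_finsum:
  assumes "cring (complex_subring S)" "f \<in> A \<rightarrow> S"
  shows "(\<Oplus>\<^bsub>complex_subring S\<^esub>i\<in>A. f i) = sum f A"
proof -
  interpret cring "complex_subring S" by fact
  show ?thesis using assms(2)
    by (induction A rule: infinite_finite_induct) auto
qed

locale two_adic_maximal_ideal =
  fixes MM :: "complex set"
  assumes max: "maximalideal MM alg_ints" and two: "2 \<in> MM"
begin

abbreviation A where "A \<equiv> {z :: complex. algebraic_int z}"

lemma alg_cring: "cring alg_ints" and alg_add: "x \<in> A \<Longrightarrow> y \<in> A \<Longrightarrow> x + y \<in> A"
  and alg_mult: "x \<in> A \<Longrightarrow> y \<in> A \<Longrightarrow> x * y \<in> A"
proof -
  interpret maximalideal MM alg_ints by (rule max)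
  show a: "x + y \<in> A" if "x \<in> A" "y \<in> A" for x y
    using add.m_closed[of x y] that by (simp add: alg_ints_def)
  show m: "x * y \<in> A" if "x \<in> A" "y \<in> A" for x y
    using m_closed[of x y] that by (simp add: alg_ints_def)
  show "cring alg_ints"
    unfolding alg_ints_def
  proof (rule complex_subring_cring)
    show "x - y \<in> A" if "x \<in> A" "y \<in> A" for x y
      using a[of x "- y"] that by simp
  qed (use m in auto)
qed

lemma alg_diff: "x \<in> A \<Longrightarrow> y \<in> A \<Longrightarrow> x - y \<in> A"
  using alg_add[of x "- y"] by simp

lemma MM_facts:
  shows MM_A: "x \<in> MM \<Longrightarrow> x \<in> A"
    and MM_add: "x \<in> MM \<Longrightarrow> y \<in> MM \<Longrightarrow> x + y \<in> MM"
    and MM_mult: "a \<in> A \<Longrightarrow> x \<in> MM \<Longrightarrow> a * x \<in> MM"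
    and MM_one: "1 \<notin> MM"
    and MM_prime: "a \<in> A \<Longrightarrow> b \<in> A \<Longrightarrow> a * b \<in> MM \<Longrightarrow> a \<in> MM \<or> b \<in> MM"
proof -
  interpret maximalideal MM alg_ints by (rule max)
  interpret P: primeideal MM alg_ints
    by (rule cring.maximalideal_prime[OF alg_cring max])
  show "x \<in> MM \<Longrightarrow> x \<in> A" using a_subset by (auto simp: alg_ints_def)
  show "x \<in> MM \<Longrightarrow> y \<in> MM \<Longrightarrow> x + y \<in> MM" using additive_subgroup.a_closed[OF ideal.axioms(1)[OF is_ideal], of x y] by (simp add: alg_ints_def)
  show "a \<in> A \<Longrightarrow> x \<in> MM \<Longrightarrow> a * x \<in> MM" using I_l_closed[of x a] by (simp add: alg_ints_def)
  show "1 \<notin> MM" using one_imp_carrier I_notcarr by (auto simp: alg_ints_def)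
  show "a \<in> A \<Longrightarrow> b \<in> A \<Longrightarrow> a * b \<in> MM \<Longrightarrow> a \<in> MM \<or> b \<in> MM"
    using P.I_prime[of a b] by (simp add: alg_ints_def)
qed

lemma MM_diff: "x \<in> MM \<Longrightarrow> y \<in> MM \<Longrightarrow> x - y \<in> MM"
  using MM_add[of x "- y"] MM_mult[of "-1" y] by simp

lemma MM_zero: "0 \<in> MM" using MM_diff[OF two two] by simp

definition R where "R = {a / s | a s. a \<in> A \<and> s \<in> A - MM}"

definition J where "J = {a / s | a s. a \<in> MM \<and> s \<in> A - MM}"

lemma loc_ring_eq: "loc_ring MM = complex_subring R"
  by (simp add: loc_ring_def R_def alg_ints_def)

lemma RI: "a \<in> A \<Longrightarrow> s \<in> A \<Longrightarrow> s \<notin> MM \<Longrightarrow> x = a / s \<Longrightarrow> x \<in> R"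
  unfolding R_def by blast

lemma RE: assumes "x \<in> R" obtains a s where "a \<in> A" "s \<in> A" "s \<notin> MM" "s \<noteq> 0" "x = a / s"
  using assms MM_zero unfolding R_def by blast

lemma JI: "a \<in> MM \<Longrightarrow> s \<in> A \<Longrightarrow> s \<notin> MM \<Longrightarrow> x = a / s \<Longrightarrow> x \<in> J"
  unfolding J_def by blast

lemma JE: assumes "x \<in> J" obtains a s where "a \<in> MM" "s \<in> A" "s \<notin> MM" "s \<noteq> 0" "x = a / s"
  using assms MM_zero unfolding J_def by blast

lemma A_R: "x \<in> A \<Longrightarrow> x \<in> R" by (rule RI[of x 1]) (auto simp: MM_one)

text \<open>Multiplying the matrix by the product \<open>t\<close> of all denominators makes its
  entries algebraic integers and its eigenvalue \<open>t * l\<close>. Since \<open>MM\<close> is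
  prime, \<open>t\<close> stays outside \<open>MM\<close> and may be divided out in
  \<open>R\<close>.\<close>

lemma eigenvalue_closed:
  assumes fin: "finite I" and a: "\<And>i j. i \<in> I \<Longrightarrow> j \<in> I \<Longrightarrow> a i j \<in> R"
    and ev: "\<And>i. i \<in> I \<Longrightarrow> (\<Sum>j\<in>I. a i j * v j) = l * v i"
    and i0: "(i0::nat) \<in> I" "v i0 \<noteq> 0"
  shows "l \<in> R"
proof -
  have "\<forall>p\<in>I \<times> I. \<exists>b s. b \<in> A \<and> s \<in> A \<and> s \<notin> MM \<and> s \<noteq> 0 \<and> a (fst p) (snd p) = b / s"
  proof
    fix p assume "p \<in> I \<times> I"
    then have "a (fst p) (snd p) \<in> R" using a by auto
    then show "\<exists>b s. b \<in> A \<and> s \<in> A \<and> s \<notin> MM \<and> s \<noteq> 0 \<and> a (fst p) (snd p) = b / s"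
      by (rule RE) blast
  qed
  then obtain b s where bs: "\<And>p. p \<in> I \<times> I \<Longrightarrow> b p \<in> A \<and> s p \<in> A \<and> s p \<notin> MM \<and> s p \<noteq> 0 \<and> a (fst p) (snd p) = b p / s p"
    by metis
  have fin2: "finite (I \<times> I)" using fin by simp
  have pr: "prod s X \<in> A \<and> prod s X \<notin> MM" if "X \<subseteq> I \<times> I" for X
    using finite_subset[OF that fin2] that
  proof (induction X rule: finite_induct)
    case (insert p X)
    then show ?case using alg_mult[of "s p" "prod s X"] MM_prime[of "s p" "prod s X"] bs[of p] by auto
  qed (auto simp: MM_one)
  define t where "t = prod s (I \<times> I)"
  have t: "t \<in> A" "t \<notin> MM" "t \<noteq> 0" using pr[of "I \<times> I"] MM_zero by (auto simp: t_def)
  have "algebraic_int (t * l)"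
  proof (rule algebraic_int_matrix_eigenvalue[OF fin, where a = "\<lambda>i j. t * a i j" and v = v, OF _ _ i0])
    fix i j assume ij: "i \<in> I" "j \<in> I"
    then have p: "(i, j) \<in> I \<times> I" by simp
    have "t = s (i, j) * prod s (I \<times> I - {(i, j)})"
      unfolding t_def by (rule prod.remove[OF fin2 p])
    then have "t * a i j = b (i, j) * prod s (I \<times> I - {(i, j)})"
      using bs[OF p] by simp
    then show "algebraic_int (t * a i j)"
      using alg_mult[of "b (i,j)"] bs[OF p] pr[of "I \<times> I - {(i, j)}"] by auto
  next
    fix i assume "i \<in> I"
    then show "(\<Sum>j\<in>I. t * a i j * v j) = t * l * v i"
      using ev[of i] by (simp add: mult.assoc sum_distrib_left[symmetric])
  qed
  then show ?thesis using t by (intro RI[of "t * l" t]) auto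
qed

lemma diff_RA: assumes "x \<in> R" "y \<in> R" shows "x - y \<in> R"
proof -
  obtain a s b t where *: "a \<in> A" "s \<in> A" "s \<notin> MM" "s \<noteq> 0" "x = a / s" "b \<in> A" "t \<in> A" "t \<notin> MM" "t \<noteq> 0" "y = b / t"
    using assms by (elim RE) blast
  show ?thesis
    by (rule RI[of "a * t - b * s" "s * t"])
      (use * MM_prime alg_mult alg_diff in \<open>auto simp: field_simps\<close>)
qed

lemma mult_RA: assumes "x \<in> R" "y \<in> R" shows "x * y \<in> R"
proof -
  obtain a s b t where *: "a \<in> A" "s \<in> A" "s \<notin> MM" "s \<noteq> 0" "x = a / s" "b \<in> A" "t \<in> A" "t \<notin> MM" "t \<noteq> 0" "y = b / t"
    using assms by (elim RE) blast
  show ?thesis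
    by (rule RI[of "a * b" "s * t"]) (use * MM_prime alg_mult in auto)
qed

sublocale local_subring R J
proof
  show "1 \<in> R" by (rule A_R) auto
  fix x y
  show "x \<in> R \<Longrightarrow> y \<in> R \<Longrightarrow> x - y \<in> R" by (rule diff_RA)
  show "x \<in> R \<Longrightarrow> y \<in> R \<Longrightarrow> x * y \<in> R" by (rule mult_RA)
  show "x \<in> R" if "x \<in> J"
    using that
  proof (rule JE)
    fix a s assume "a \<in> MM" "s \<in> A" "s \<notin> MM" "s \<noteq> 0" "x = a / s"
    then show "x \<in> R" by (intro RI[OF MM_A])
  qed
  show "x - y \<in> J" if xy: "x \<in> J" "y \<in> J"
  proof -
    obtain a s b t where *: "a \<in> MM" "s \<in> A" "s \<notin> MM" "s \<noteq> 0" "x = a / s" "b \<in> MM" "t \<in> A" "t \<notin> MM" "t \<noteq> 0" "y = b / t"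
      using xy by (elim JE) blast
    have "t * a - s * b \<in> MM" using * by (intro MM_diff MM_mult) auto
    moreover have "x - y = (t * a - s * b) / (s * t)" using * by (simp add: field_simps)
    ultimately show ?thesis using * MM_prime alg_mult by (intro JI[of "t * a - s * b" "s * t"]) auto
  qed
  show "x * y \<in> J" if xy: "x \<in> R" "y \<in> J"
  proof -
    obtain a s where a: "a \<in> A" "s \<in> A" "s \<notin> MM" "x = a / s" using xy(1) by (rule RE)
    obtain b t where b: "b \<in> MM" "t \<in> A" "t \<notin> MM" "y = b / t" using xy(2) by (rule JE)
    have "s * t \<notin> MM" using a b MM_prime by blast
    then show ?thesis
      using a b by (intro JI[of "a * b" "s * t"] MM_mult alg_mult) auto
  qed
  show "2 \<in> J" by (rule JI[of 2 1]) (auto simp: two MM_one)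
  show "1 \<notin> J"
  proof
    assume "1 \<in> J"
    then show False by (elim JE) (auto simp: field_simps)
  qed
  show "inverse x \<in> R" if x: "x \<in> R" "x \<notin> J"
  proof -
    obtain a s where *: "a \<in> A" "s \<in> A" "s \<notin> MM" "s \<noteq> 0" "x = a / s" using x(1) by (rule RE)
    then have "a \<notin> MM" using x JI by blast
    moreover have "inverse x = s / a" using * by simp
    ultimately show ?thesis by (intro RI[of s a]) (use *(1,2) in simp_all)
  qed
  show "z \<in> R" if "n > 0" "z ^ n = 1" for n z
  proof (rule A_R)
    have "algebraic_int z"
    proof (rule algebraic_int_root[of 1 "monom 1 n"])
      show "\<forall>i. coeff (monom 1 n) i \<in> (\<int> :: complex set)" by (auto simp: coeff_monom)
    qed (use that in \<open>auto simp: poly_monom degree_monom_eq\<close>)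
    then show "z \<in> A" by simp
  qed
  show "l \<in> R" if "finite I" "\<And>i j. i \<in> I \<Longrightarrow> j \<in> I \<Longrightarrow> a i j \<in> R"
    "\<And>i. i \<in> I \<Longrightarrow> (\<Sum>j\<in>I. a i j * v j) = l * v i" "(i0::nat) \<in> I" "v i0 \<noteq> 0"
    for I a v l i0
    by (rule eigenvalue_closed[OF that])
qed

lemma loc_cring: "cring (loc_ring MM)"
  unfolding loc_ring_eq by (rule complex_subring_cring) auto

lemma J_ideal: "ideal J (loc_ring MM)"
proof -
  interpret cring "loc_ring MM" by (rule loc_cring)
  show ?thesis
  proof (rule idealI)
    show "ring (loc_ring MM)" by unfold_locales
    show "subgroup J (add_monoid (loc_ring MM))"
    proof (rule add.subgroupI)
      show "\<ominus>\<^bsub>loc_ring MM\<^esub> x \<in> J" if "x \<in> J" for x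
        using complex_subring_minus[of R x] loc_cring J_R[OF that] minus_J[OF that] by (simp add: loc_ring_eq)
    qed (auto simp: loc_ring_eq)
  qed (auto simp: loc_ring_eq)
qed

lemma loc_ideal_eq: "loc_ideal MM = J"
proof -
  interpret cring "loc_ring MM" by (rule loc_cring)
  have "MM \<subseteq> J"
    by (auto intro: JI[of _ 1] simp: MM_one)
  moreover have "J \<subseteq> I" if I: "ideal I (loc_ring MM)" "MM \<subseteq> I" for I
  proof
    fix x assume "x \<in> J"
    then obtain a s where *: "a \<in> MM" "s \<in> A" "s \<notin> MM" "x = a / s" by (elim JE) blast
    interpret I: ideal I "loc_ring MM" by fact
    have "1 / s \<in> R" by (rule RI[of 1 s]) (use * in auto)
    then show "x \<in> I" using I.I_l_closed[of a "1 / s"] I(2) * by (auto simp: loc_ring_eq)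
  qed
  ultimately show ?thesis
    unfolding loc_ideal_def genideal_def using J_ideal by blast
qed

lemma twice_loc_ring_eq: "twice_loc_ring MM = twoR"
  unfolding twice_loc_ring_def twoR_def loc_ring_eq by simp

end

section \<open>The group algebra\<close>

locale group_algebra = group G + local_subring R J
  for G :: "('g, 'gs) monoid_scheme" (structure) and R J +
  assumes fin_G [simp, intro]: "finite (carrier G)"
begin

text \<open>Elements of the group algebra are functions on the whole type that vanish off the
  carrier, so that equality and the pointwise operations are those of functions. Coefficients are
  complex because the eigenvectors in the integrality argument need not have coefficients in
  \<open>R\<close>.\<close>

definition conv :: "('g \<Rightarrow> complex) \<Rightarrow> ('g \<Rightarrow> complex) \<Rightarrow> 'g \<Rightarrow> complex" (infixl "\<star>" 70) where
  "x \<star> y = (\<lambda>g. if g \<in> carrier G then \<Sum>h\<in>carrier G. x h * y (inv h \<otimes> g) else 0)"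

definition sc :: "complex \<Rightarrow> ('g \<Rightarrow> complex) \<Rightarrow> 'g \<Rightarrow> complex" (infixr "*\<^sub>c" 75) where
  "c *\<^sub>c x = (\<lambda>g. c * x g)"

definition star :: "('g \<Rightarrow> complex) \<Rightarrow> 'g \<Rightarrow> complex" where
  "star x = (\<lambda>g. if g \<in> carrier G then x (inv g) else 0)"

text \<open>The bilinear form with the group elements as orthonormal basis, equivalently the
  coefficient of \<open>\<one>\<close> in \<open>star x \<star> y\<close>. Multiplication by
  \<open>z\<close> on either side has multiplication by \<open>star z\<close> on that side as its
  adjoint.\<close>

definition ip :: "('g \<Rightarrow> complex) \<Rightarrow> ('g \<Rightarrow> complex) \<Rightarrow> complex" where
  "ip x y = (\<Sum>g\<in>carrier G. x g * y g)"

definition dl :: "'g \<Rightarrow> 'g \<Rightarrow> complex" where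
  "dl a = (\<lambda>g. if g = a then 1 else 0)"

definition CG :: "('g \<Rightarrow> complex) set" where
  "CG = {x. \<forall>g. g \<notin> carrier G \<longrightarrow> x g = 0}"

definition RG :: "('g \<Rightarrow> complex) set" where
  "RG = {x \<in> CG. \<forall>g\<in>carrier G. x g \<in> R}"

lemma sum_left_mult: "a \<in> carrier G \<Longrightarrow> (\<Sum>h\<in>carrier G. f (a \<otimes> h)) = (\<Sum>h\<in>carrier G. f h :: complex)"
  by (rule sum.reindex_bij_witness[of _ "\<lambda>h. inv a \<otimes> h" "\<lambda>h. a \<otimes> h"])
    (auto simp: m_assoc[symmetric])

lemma sum_inv: "(\<Sum>h\<in>carrier G. f (inv h)) = (\<Sum>h\<in>carrier G. f h :: complex)"
  by (rule sum.reindex_bij_witness[of _ "\<lambda>h. inv h" "\<lambda>h. inv h"]) auto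

lemma CG_I: "(\<And>g. g \<notin> carrier G \<Longrightarrow> x g = 0) \<Longrightarrow> x \<in> CG" by (simp add: CG_def)

lemma CG_ext: "x \<in> CG \<Longrightarrow> y \<in> CG \<Longrightarrow> (\<And>g. g \<in> carrier G \<Longrightarrow> x g = y g) \<Longrightarrow> x = y"
proof (rule ext)
  fix g
  assume "x \<in> CG" "y \<in> CG" "\<And>g. g \<in> carrier G \<Longrightarrow> x g = y g"
  then show "x g = y g" by (cases "g \<in> carrier G") (auto simp: CG_def)
qed

lemma conv_CG [simp, intro]: "x \<star> y \<in> CG" by (simp add: CG_def conv_def)
lemma star_CG [simp, intro]: "star x \<in> CG" by (simp add: CG_def star_def)
lemma dl_CG [simp, intro]: "a \<in> carrier G \<Longrightarrow> dl a \<in> CG" by (auto simp: CG_def dl_def)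
lemma RG_CG [intro]: "x \<in> RG \<Longrightarrow> x \<in> CG" by (simp add: RG_def)
lemma RG_R [intro]: "x \<in> RG \<Longrightarrow> x g \<in> R" by (cases "g \<in> carrier G") (auto simp: RG_def CG_def)

lemma RG_I: "x \<in> CG \<Longrightarrow> (\<And>g. g \<in> carrier G \<Longrightarrow> x g \<in> R) \<Longrightarrow> x \<in> RG" by (simp add: RG_def)

lemma CG_add [intro]: "x \<in> CG \<Longrightarrow> y \<in> CG \<Longrightarrow> x + y \<in> CG" by (simp add: CG_def)
lemma CG_diff [intro]: "x \<in> CG \<Longrightarrow> y \<in> CG \<Longrightarrow> x - y \<in> CG" by (simp add: CG_def)
lemma CG_sc [intro]: "x \<in> CG \<Longrightarrow> c *\<^sub>c x \<in> CG" by (simp add: CG_def sc_def)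
lemma CG_0 [simp, intro]: "0 \<in> CG" by (simp add: CG_def)

lemma RG_add [intro]: "x \<in> RG \<Longrightarrow> y \<in> RG \<Longrightarrow> x + y \<in> RG" by (auto simp: RG_def)
lemma RG_diff [intro]: "x \<in> RG \<Longrightarrow> y \<in> RG \<Longrightarrow> x - y \<in> RG" by (auto simp: RG_def)
lemma RG_sc [intro]: "c \<in> R \<Longrightarrow> x \<in> RG \<Longrightarrow> c *\<^sub>c x \<in> RG" by (auto simp: RG_def) (auto simp: sc_def)
lemma RG_0 [simp, intro]: "0 \<in> RG" by (auto simp: RG_def)
lemma RG_dl [simp, intro]: "a \<in> carrier G \<Longrightarrow> dl a \<in> RG" by (auto simp: RG_def) (auto simp: dl_def)
lemma RG_sum [intro]: "(\<And>i. i \<in> I \<Longrightarrow> f i \<in> RG) \<Longrightarrow> sum f I \<in> RG"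
  by (induction I rule: infinite_finite_induct) auto

lemma RG_conv [intro]: "x \<in> RG \<Longrightarrow> y \<in> RG \<Longrightarrow> x \<star> y \<in> RG"
  by (rule RG_I, simp) (auto simp: conv_def)

lemma RG_star [intro]: "x \<in> RG \<Longrightarrow> star x \<in> RG"
  by (rule RG_I, simp) (auto simp: star_def)

lemma conv_assoc: "(x \<star> y) \<star> z = x \<star> (y \<star> z)"
proof (rule CG_ext)
  fix g assume g: "g \<in> carrier G"
  have "((x \<star> y) \<star> z) g = (\<Sum>h\<in>carrier G. \<Sum>k\<in>carrier G. x k * y (inv k \<otimes> h) * z (inv h \<otimes> g))"
    using g by (simp add: conv_def sum_distrib_right)
  also have "\<dots> = (\<Sum>k\<in>carrier G. \<Sum>h\<in>carrier G. x k * y (inv k \<otimes> h) * z (inv h \<otimes> g))"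
    by (rule sum.swap)
  also have "\<dots> = (\<Sum>k\<in>carrier G. \<Sum>h\<in>carrier G. x k * (y h * z (inv h \<otimes> (inv k \<otimes> g))))"
  proof (rule sum.cong[OF refl])
    fix k assume k: "k \<in> carrier G"
    have "(\<Sum>h\<in>carrier G. x k * y (inv k \<otimes> h) * z (inv h \<otimes> g))
      = (\<Sum>h\<in>carrier G. x k * y (inv k \<otimes> (k \<otimes> h)) * z (inv (k \<otimes> h) \<otimes> g))"
      using sum_left_mult[OF k, of "\<lambda>h. x k * y (inv k \<otimes> h) * z (inv h \<otimes> g)"] by simp
    also have "\<dots> = (\<Sum>h\<in>carrier G. x k * (y h * z (inv h \<otimes> (inv k \<otimes> g))))"
    proof (rule sum.cong[OF refl])
      fix h assume h: "h \<in> carrier G"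
      have "inv k \<otimes> (k \<otimes> h) = h" using h k by (simp add: m_assoc[symmetric])
      moreover have "inv (k \<otimes> h) \<otimes> g = inv h \<otimes> (inv k \<otimes> g)"
        using h k g by (simp add: inv_mult_group m_assoc)
      ultimately show "x k * y (inv k \<otimes> (k \<otimes> h)) * z (inv (k \<otimes> h) \<otimes> g)
        = x k * (y h * z (inv h \<otimes> (inv k \<otimes> g)))" by simp
    qed
    finally show "(\<Sum>h\<in>carrier G. x k * y (inv k \<otimes> h) * z (inv h \<otimes> g))
      = (\<Sum>h\<in>carrier G. x k * (y h * z (inv h \<otimes> (inv k \<otimes> g))))" .
  qed
  also have "\<dots> = (x \<star> (y \<star> z)) g"
    using g by (simp add: conv_def sum_distrib_left)
  finally show "((x \<star> y) \<star> z) g = (x \<star> (y \<star> z)) g" .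
qed auto

lemma conv_add_left: "(x + y) \<star> z = x \<star> z + y \<star> z"
  by (rule ext) (simp add: conv_def distrib_right sum.distrib)
lemma conv_add_right: "z \<star> (x + y) = z \<star> x + z \<star> y"
  by (rule ext) (simp add: conv_def distrib_left sum.distrib)
lemma conv_diff_left: "(x - y) \<star> z = x \<star> z - y \<star> z"
  by (rule ext) (simp add: conv_def left_diff_distrib sum_subtractf)
lemma conv_diff_right: "z \<star> (x - y) = z \<star> x - z \<star> y"
  by (rule ext) (simp add: conv_def right_diff_distrib sum_subtractf)
lemma conv_0_left [simp]: "0 \<star> z = 0" by (rule ext) (simp add: conv_def)
lemma conv_0_right [simp]: "z \<star> 0 = 0" by (rule ext) (simp add: conv_def)
lemma conv_sc_left [simp]: "(c *\<^sub>c x) \<star> z = c *\<^sub>c (x \<star> z)"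
  by (rule ext) (simp add: conv_def sc_def sum_distrib_left mult.assoc)
lemma conv_sc_right [simp]: "z \<star> (c *\<^sub>c x) = c *\<^sub>c (z \<star> x)"
  by (rule ext) (simp add: conv_def sc_def sum_distrib_left mult.left_commute)
lemma conv_sum_right: "z \<star> sum f I = (\<Sum>i\<in>I. z \<star> f i)"
  by (induction I rule: infinite_finite_induct) (simp_all only: sum.infinite sum.empty sum.insert not_False_eq_True conv_0_right conv_add_right)
lemma conv_sum_left: "sum f I \<star> z = (\<Sum>i\<in>I. f i \<star> z)"
  by (induction I rule: infinite_finite_induct) (simp_all only: sum.infinite sum.empty sum.insert not_False_eq_True conv_0_left conv_add_left)

lemmas conv_distribs = conv_add_left conv_add_right conv_diff_left conv_diff_right

lemma sc_add_right: "c *\<^sub>c (x + y) = c *\<^sub>c x + c *\<^sub>c y" by (rule ext) (simp add: sc_def algebra_simps)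
lemma sc_diff_right: "c *\<^sub>c (x - y) = c *\<^sub>c x - c *\<^sub>c y" by (rule ext) (simp add: sc_def algebra_simps)
lemma sc_add_left: "(c + d) *\<^sub>c x = c *\<^sub>c x + d *\<^sub>c x" by (rule ext) (simp add: sc_def algebra_simps)
lemma sc_diff_left: "(c - d) *\<^sub>c x = c *\<^sub>c x - d *\<^sub>c x" by (rule ext) (simp add: sc_def algebra_simps)
lemma sc_sc [simp]: "c *\<^sub>c (d *\<^sub>c x) = (c * d) *\<^sub>c x" by (rule ext) (simp add: sc_def)
lemma sc_1 [simp]: "1 *\<^sub>c x = x" by (rule ext) (simp add: sc_def)
lemma sc_0_left [simp]: "0 *\<^sub>c x = 0" by (rule ext) (simp add: sc_def)
lemma sc_0_right [simp]: "c *\<^sub>c 0 = 0" by (rule ext) (simp add: sc_def)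
lemma sc_sum: "c *\<^sub>c sum f I = (\<Sum>i\<in>I. c *\<^sub>c f i)"
  by (induction I rule: infinite_finite_induct) (simp_all only: sum.infinite sum.empty sum.insert not_False_eq_True sc_0_right sc_add_right)
lemma sc_uminus_left: "(- c) *\<^sub>c x = - (c *\<^sub>c x)" by (rule ext) (simp add: sc_def)

lemma sum_apply: "(sum f I) g = (\<Sum>i\<in>I. f i g)" for f :: "'i \<Rightarrow> 'g \<Rightarrow> complex"
  by (induction I rule: infinite_finite_induct) auto

lemma conv_dl_left: "a \<in> carrier G \<Longrightarrow> dl a \<star> x = (\<lambda>g. if g \<in> carrier G then x (inv a \<otimes> g) else 0)"
  by (rule ext) (simp add: conv_def dl_def if_distrib[of "\<lambda>c. c * _"] cong: if_cong)

lemma conv_dl_right: "a \<in> carrier G \<Longrightarrow> x \<star> dl a = (\<lambda>g. if g \<in> carrier G then x (g \<otimes> inv a) else 0)"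
proof (rule ext)
  fix g assume a: "a \<in> carrier G"
  show "(x \<star> dl a) g = (if g \<in> carrier G then x (g \<otimes> inv a) else 0)"
  proof (cases "g \<in> carrier G")
    case True
    have "x h * (if inv h \<otimes> g = a then 1 else 0) = (if h = g \<otimes> inv a then x h else 0)"
      if h: "h \<in> carrier G" for h
    proof -
      have "a = inv h \<otimes> g \<longleftrightarrow> g = h \<otimes> a" using inv_solve_left[OF a h True] .
      also have "\<dots> \<longleftrightarrow> h \<otimes> a = g" by auto
      also have "\<dots> \<longleftrightarrow> h = g \<otimes> inv a" using inv_solve_right[OF h True a] by auto
      finally show ?thesis by auto
    qed
    then have "(x \<star> dl a) g = (\<Sum>h\<in>carrier G. if h = g \<otimes> inv a then x h else 0)"
      using True unfolding conv_def dl_def by simp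
    then show ?thesis using True a by simp
  qed (simp add: conv_def)
qed

lemma dl_conv_dl: "a \<in> carrier G \<Longrightarrow> b \<in> carrier G \<Longrightarrow> dl a \<star> dl b = dl (a \<otimes> b)"
  proof (rule CG_ext)
  fix g assume "a \<in> carrier G" "b \<in> carrier G" "g \<in> carrier G"
  then show "(dl a \<star> dl b) g = dl (a \<otimes> b) g"
    using inv_solve_left[of b a g] by (auto simp: conv_dl_left) (auto simp: dl_def)
qed auto

lemma conv_one_left [simp]: "x \<in> CG \<Longrightarrow> dl \<one> \<star> x = x"
  by (rule CG_ext, simp, simp) (auto simp: conv_dl_left)
lemma conv_one_right [simp]: "x \<in> CG \<Longrightarrow> x \<star> dl \<one> = x"
  by (rule CG_ext, simp, simp) (auto simp: conv_dl_right)

lemma CG_expand: "x \<in> CG \<Longrightarrow> x = (\<Sum>g\<in>carrier G. x g *\<^sub>c dl g)"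
  by (rule ext) (auto simp: sum_apply sc_def dl_def CG_def if_distrib[of "\<lambda>c. _ * c"] cong: if_cong)

lemma star_star [simp]: "x \<in> CG \<Longrightarrow> star (star x) = x"
  by (rule CG_ext, simp, simp) (auto simp: star_def)
lemma star_add: "star (x + y) = star x + star y" by (rule ext) (simp add: star_def)
lemma star_diff: "star (x - y) = star x - star y" by (rule ext) (simp add: star_def)
lemma star_0 [simp]: "star 0 = 0" by (rule ext) (simp add: star_def)
lemma star_sc: "star (c *\<^sub>c x) = c *\<^sub>c star x" by (rule ext) (simp add: star_def sc_def)
lemma star_dl: "a \<in> carrier G \<Longrightarrow> star (dl a) = dl (inv a)"
  by (rule ext) (auto simp: star_def dl_def)

lemma star_conv: "star (x \<star> y) = star y \<star> star x"
proof (rule CG_ext)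
  fix g assume g: "g \<in> carrier G"
  have "star (x \<star> y) g = (\<Sum>h\<in>carrier G. x h * y (inv h \<otimes> inv g))"
    using g by (simp add: star_def conv_def)
  also have "\<dots> = (\<Sum>h\<in>carrier G. x (inv g \<otimes> h) * y (inv (inv g \<otimes> h) \<otimes> inv g))"
    using sum_left_mult[of "inv g" "\<lambda>h. x h * y (inv h \<otimes> inv g)"] g by simp
  also have "\<dots> = (\<Sum>h\<in>carrier G. star y h * star x (inv h \<otimes> g))"
    using g by (intro sum.cong) (auto simp: star_def inv_mult_group m_assoc)
  finally show "star (x \<star> y) g = (star y \<star> star x) g"
    using g by (simp add: conv_def)
qed auto

lemma ip_commute: "ip x y = ip y x" by (simp add: ip_def mult.commute)
lemma ip_add_left: "ip (x + y) z = ip x z + ip y z" by (simp add: ip_def distrib_right sum.distrib)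
lemma ip_add_right: "ip z (x + y) = ip z x + ip z y" by (simp add: ip_def distrib_left sum.distrib)
lemma ip_sc_left: "ip (c *\<^sub>c x) z = c * ip x z" by (simp add: ip_def sc_def sum_distrib_left mult.assoc)
lemma ip_sc_right: "ip z (c *\<^sub>c x) = c * ip z x" by (simp add: ip_def sc_def sum_distrib_left mult.left_commute)
lemma ip_0_left [simp]: "ip 0 z = 0" by (simp add: ip_def)
lemma ip_0_right [simp]: "ip z 0 = 0" by (simp add: ip_def)
lemma ip_R [intro]: "x \<in> RG \<Longrightarrow> y \<in> RG \<Longrightarrow> ip x y \<in> R" by (auto simp: ip_def)
lemma ip_dl: "a \<in> carrier G \<Longrightarrow> ip (dl a) x = x a"
  by (simp add: ip_def dl_def if_distrib[of "\<lambda>c. c * _"] cong: if_cong)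
lemma ip_star: "ip (star x) (star y) = ip x y"
  using sum_inv[of "\<lambda>g. x g * y g"] by (simp add: ip_def star_def)

lemma ip_conv_right: "ip (z \<star> x) y = ip x (star z \<star> y)"
proof -
  have "ip (z \<star> x) y = (\<Sum>g\<in>carrier G. \<Sum>h\<in>carrier G. z h * x (inv h \<otimes> g) * y g)"
    by (simp add: ip_def conv_def sum_distrib_right)
  also have "\<dots> = (\<Sum>h\<in>carrier G. \<Sum>g\<in>carrier G. z h * x (inv h \<otimes> g) * y g)" by (rule sum.swap)
  also have "\<dots> = (\<Sum>h\<in>carrier G. \<Sum>g\<in>carrier G. z h * x g * y (h \<otimes> g))"
  proof (rule sum.cong[OF refl])
    fix h assume h: "h \<in> carrier G"
    have "(\<Sum>g\<in>carrier G. z h * x (inv h \<otimes> g) * y g)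
        = (\<Sum>g\<in>carrier G. z h * x (inv h \<otimes> (h \<otimes> g)) * y (h \<otimes> g))"
      using sum_left_mult[OF h, of "\<lambda>g. z h * x (inv h \<otimes> g) * y g"] by simp
    also have "\<dots> = (\<Sum>g\<in>carrier G. z h * x g * y (h \<otimes> g))"
      using h by (intro sum.cong) (auto simp: m_assoc[symmetric])
    finally show "(\<Sum>g\<in>carrier G. z h * x (inv h \<otimes> g) * y g) = (\<Sum>g\<in>carrier G. z h * x g * y (h \<otimes> g))" .
  qed
  also have "\<dots> = (\<Sum>h\<in>carrier G. \<Sum>g\<in>carrier G. z (inv h) * x g * y (inv h \<otimes> g))"
    using sum_inv[of "\<lambda>h. \<Sum>g\<in>carrier G. z h * x g * y (h \<otimes> g)"] by simp
  also have "\<dots> = (\<Sum>g\<in>carrier G. \<Sum>h\<in>carrier G. z (inv h) * x g * y (inv h \<otimes> g))" by (rule sum.swap)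
  also have "\<dots> = ip x (star z \<star> y)"
    by (simp add: ip_def conv_def star_def sum_distrib_left ac_simps)
  finally show ?thesis .
qed

lemma ip_conv_left: "z \<in> CG \<Longrightarrow> ip (x \<star> z) y = ip x (y \<star> star z)"
  using ip_conv_right[of "star z" "star x" "star y"]
  by (metis ip_star star_CG star_conv star_star)

lemma ip_eqI: "x \<in> CG \<Longrightarrow> y \<in> CG \<Longrightarrow> (\<And>z. z \<in> RG \<Longrightarrow> ip z x = ip z y) \<Longrightarrow> x = y"
  by (rule CG_ext) (auto simp: ip_dl[symmetric])

end

declare plus_fun_apply [simp del] zero_fun_apply [simp del] minus_apply [simp del] uminus_apply [simp del]

lemmas fun_apply = plus_fun_apply zero_fun_apply minus_apply uminus_apply

section \<open>Primitive idempotents have local corners\<close>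

context local_subring begin

lemma minus_J_iff [simp]: "- x \<in> J \<longleftrightarrow> x \<in> J"
  using minus_J[of x] minus_J[of "- x"] by auto

lemma minus_R_iff [simp]: "- x \<in> R \<longleftrightarrow> x \<in> R"
  using minus_R[of x] minus_R[of "- x"] by auto

definition RX :: "complex poly set" where "RX = {p. \<forall>i. coeff p i \<in> R}"

lemma RX_add [intro]: "p \<in> RX \<Longrightarrow> q \<in> RX \<Longrightarrow> p + q \<in> RX" by (auto simp: RX_def)
lemma RX_mult [intro]: "p \<in> RX \<Longrightarrow> q \<in> RX \<Longrightarrow> p * q \<in> RX" by (auto simp: RX_def coeff_mult)
lemma RX_pCons [intro]: "c \<in> R \<Longrightarrow> p \<in> RX \<Longrightarrow> pCons c p \<in> RX"
  by (auto simp: RX_def coeff_pCons split: nat.splits)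
lemma RX_0 [simp, intro]: "0 \<in> RX" by (simp add: RX_def)
lemma RX_1 [simp, intro]: "1 \<in> RX" unfolding one_pCons by (intro RX_pCons) auto
lemma RX_pConsD: "pCons c p \<in> RX \<Longrightarrow> c \<in> R \<and> p \<in> RX"
proof -
  assume "pCons c p \<in> RX"
  then have "coeff (pCons c p) i \<in> R" for i by (auto simp: RX_def)
  from this[of 0] this[of "Suc _"] show ?thesis by (auto simp: RX_def)
qed

definition linear_factors :: "complex list \<Rightarrow> complex poly" where
  "linear_factors ls = (\<Prod>l\<leftarrow>ls. [:- l, 1:])"

lemma linear_factors_RX: "set ls \<subseteq> R \<Longrightarrow> linear_factors ls \<in> RX"
  by (induction ls) (auto simp: linear_factors_def simp del: mult_pCons_left)

text \<open>The remainder on division by \<open>X - r\<close> is the value at \<open>r\<close>, a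
  product of elements outside the prime ideal \<open>J\<close>. The induction keeps the quotient in
  \<open>RX\<close>.\<close>

lemma linear_factors_remainder:
  assumes "set ls \<subseteq> R" "r \<in> R" "\<And>l. l \<in> set ls \<Longrightarrow> r - l \<notin> J"
  shows "\<exists>c q. c \<in> R \<and> c \<notin> J \<and> q \<in> RX \<and> linear_factors ls = [:c:] + [:- r, 1:] * q"
  using assms(1,3)
proof (induction ls)
  case Nil
  then show ?case by (intro exI[of _ 1] exI[of _ 0]) (auto simp: linear_factors_def one_pCons)
next
  case (Cons l ls)
  then obtain c q where cq: "c \<in> R" "c \<notin> J" "q \<in> RX" "linear_factors ls = [:c:] + [:- r, 1:] * q" by auto
  have "linear_factors (l # ls) = [:- l, 1:] * ([:c:] + [:- r, 1:] * q)"
    using cq(4) by (simp add: linear_factors_def del: mult_pCons_left mult_pCons_right)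
  also have "\<dots> = [:(r - l) * c:] + [:- r, 1:] * ([:c:] + [:- l, 1:] * q)"
    by (simp add: algebra_simps)
  finally have "linear_factors (l # ls) = [:(r - l) * c:] + [:- r, 1:] * ([:c:] + [:- l, 1:] * q)" .
  moreover have "(r - l) * c \<in> R" "(r - l) * c \<notin> J"
    using Cons.prems cq assms(2) J_prime[of "r - l" c] by auto
  moreover have "[:c:] + [:- l, 1:] * q \<in> RX"
    using Cons.prems cq by (intro RX_add RX_mult RX_pCons minus_R) auto
  ultimately show ?case by blast
qed

definition comaximal :: "complex poly \<Rightarrow> complex poly \<Rightarrow> bool" where
  "comaximal p q \<longleftrightarrow> (\<exists>u\<in>RX. \<exists>v\<in>RX. u * p + v * q = 1)"

lemma comaximal_1: "comaximal 1 q"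
  unfolding comaximal_def by (rule bexI[of _ 1], rule bexI[of _ 0]) simp_all

lemma comaximal_commute: "comaximal p q \<Longrightarrow> comaximal q p"
  unfolding comaximal_def by (metis add.commute)

lemma comaximal_sym: "comaximal p q \<longleftrightarrow> comaximal q p"
  using comaximal_commute by blast

text \<open>Multiply the two Bezout relations; all terms but one contain \<open>q\<close>.\<close>

lemma comaximal_mult:
  assumes "comaximal p q" "comaximal p' q" "p \<in> RX" "p' \<in> RX" "q \<in> RX"
  shows "comaximal (p * p') q"
proof -
  obtain u v where uv: "u \<in> RX" "v \<in> RX" "u * p + v * q = 1" using assms(1) by (auto simp: comaximal_def)
  obtain u' v' where uv': "u' \<in> RX" "v' \<in> RX" "u' * p' + v' * q = 1" using assms(2) by (auto simp: comaximal_def)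
  have "(u * u') * (p * p') + (u * p * v' + v * u' * p' + v * v' * q) * q
      = (u * p + v * q) * (u' * p' + v' * q)"
    by (simp only: distrib_left distrib_right ac_simps)
  also have "\<dots> = 1" by (simp only: uv uv' mult_1)
  finally show ?thesis
    unfolding comaximal_def using uv uv' assms by (intro bexI) (assumption | rule RX_add RX_mult)+
qed

text \<open>Two linear factors differ by the constant \<open>l - m\<close>, a unit of
  \<open>R\<close>, which yields a Bezout relation; this passes to products in either argument.
  Coprimality over the complex numbers would not do, as the Bezout coefficients must lie in
  \<open>RX\<close>.\<close>

lemma comaximal_linear_factors:
  assumes "set ls \<subseteq> R" "set ms \<subseteq> R" "\<And>l m. l \<in> set ls \<Longrightarrow> m \<in> set ms \<Longrightarrow> l - m \<notin> J"
  shows "comaximal (linear_factors ls) (linear_factors ms)"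
proof -
  have one: "comaximal [:- l, 1:] (linear_factors ms)"
    if l: "l \<in> R" "\<And>m. m \<in> set ms \<Longrightarrow> l - m \<notin> J" for l
    using assms(2) l(2)
  proof (induction ms)
    case Nil
    then show ?case using comaximal_commute[OF comaximal_1] by (simp add: linear_factors_def)
  next
    case (Cons m ms)
    define d where "d = inverse (l - m)"
    have "l - m \<in> R" "l - m \<notin> J" using Cons.prems l(1) by auto
    moreover from this have "l - m \<noteq> 0" using zero_J by metis
    ultimately have d: "d \<in> R" "d * (l - m) = 1" using unit_R by (simp_all add: d_def)
    have "[:- d:] * [:- l, 1:] + [:d:] * [:- m, 1:] = 1"
      using d(2) by (simp add: one_pCons algebra_simps)
    moreover have "[:- d:] \<in> RX" "[:d:] \<in> RX" using d by auto
    ultimately have c1: "comaximal [:- l, 1:] [:- m, 1:]" unfolding comaximal_def by blast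
    have c2: "comaximal [:- l, 1:] (linear_factors ms)" using Cons by auto
    have "comaximal ([:- m, 1:] * linear_factors ms) [:- l, 1:]"
    proof (rule comaximal_mult[OF comaximal_commute[OF c1] comaximal_commute[OF c2]])
      show "[:- m, 1:] \<in> RX" "[:- l, 1:] \<in> RX" using Cons.prems l(1) by (auto intro!: RX_pCons)
      show "linear_factors ms \<in> RX" using Cons.prems by (intro linear_factors_RX) auto
    qed
    then show ?case by (subst comaximal_sym) (simp add: linear_factors_def del: mult_pCons_left)
  qed
  show ?thesis using assms(1,3)
  proof (induction ls)
    case Nil
    then show ?case using comaximal_1 by (simp add: linear_factors_def)
  next
    case (Cons l ls)
    have "comaximal ([:- l, 1:] * linear_factors ls) (linear_factors ms)"
    proof (rule comaximal_mult)
      show "comaximal [:- l, 1:] (linear_factors ms)" using Cons.prems by (intro one) auto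
      show "comaximal (linear_factors ls) (linear_factors ms)" using Cons by auto
      show "[:- l, 1:] \<in> RX" using Cons.prems by (auto intro!: RX_pCons)
      show "linear_factors ls \<in> RX" using Cons.prems by (intro linear_factors_RX) auto
      show "linear_factors ms \<in> RX" using assms(2) by (rule linear_factors_RX)
    qed
    then show ?case by (simp add: linear_factors_def del: mult_pCons_left)
  qed
qed

end

section \<open>Eigenvalues of left multiplications on the group algebra\<close>

context group_algebra begin

text \<open>\<open>CG\<close> is spanned by \<open>card (carrier G)\<close> elements, so any larger
  set is dependent; the coefficients are recorded as a polynomial for later evaluation. Repetitions
  in the sequence are treated apart because linear dependence is a property of sets.\<close>

lemma exists_annihilating_relation:
  fixes f :: "nat \<Rightarrow> 'g \<Rightarrow> complex"
  assumes f: "\<And>i. f i \<in> CG"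
  shows "\<exists>p \<noteq> 0. (\<Sum>i\<le>degree p. coeff p i *\<^sub>c f i) = 0"
proof -
  interpret vs: vector_space sc
    by standard (auto simp: sc_add_right sc_add_left)
  define n where "n = card (carrier G)"
  show ?thesis
  proof (cases "inj_on f {..n}")
    case False
    then obtain i j where ij: "i < j" "f i = f j" "i \<le> n" "j \<le> n"
      unfolding inj_on_def by (metis atMost_iff linorder_neqE_nat)
    define p where "p = (monom 1 j - monom 1 i :: complex poly)"
    have c: "coeff p j = 1" using ij by (simp add: p_def coeff_monom)
    then have deg: "p \<noteq> 0" "j \<le> degree p" by (auto intro: le_degree)
    have "(\<Sum>k\<le>degree p. coeff p k *\<^sub>c f k)
      = (\<Sum>k\<le>degree p. (if k = j then 1 *\<^sub>c f j else 0) - (if k = i then 1 *\<^sub>c f i else 0))"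
      using ij by (intro sum.cong) (auto simp: p_def coeff_monom sc_uminus_left sc_diff_left)
    also have "\<dots> = f j - f i"
      unfolding sum_subtractf using deg ij by simp
    finally show ?thesis using deg ij by (intro exI[of _ p]) simp
  next
    case True
    have "vs.dependent (f ` {..n})"
    proof (rule ccontr)
      assume "\<not> vs.dependent (f ` {..n})"
      moreover have "f ` {..n} \<subseteq> vs.span (dl ` carrier G)"
      proof
        fix x assume "x \<in> f ` {..n}"
        then have "x \<in> CG" using f by auto
        then have "x = (\<Sum>g\<in>carrier G. x g *\<^sub>c dl g)" by (rule CG_expand)
        also have "\<dots> \<in> vs.span (dl ` carrier G)"
          by (intro vs.span_sum vs.span_scale vs.span_base) auto
        finally show "x \<in> vs.span (dl ` carrier G)" .
      qed
      ultimately have "card (f ` {..n}) \<le> card (dl ` carrier G)"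
        using vs.independent_span_bound[of "dl ` carrier G" "f ` {..n}"] fin_G by simp
      also have "\<dots> \<le> n" unfolding n_def by (rule card_image_le) auto
      finally show False using card_image[OF True] by simp
    qed
    then obtain u v where u: "v \<in> f ` {..n}" "u v \<noteq> 0" "(\<Sum>v\<in>f ` {..n}. u v *\<^sub>c v) = 0"
      using vs.dependent_finite[of "f ` {..n}"] by auto
    define p where "p = Abs_poly (\<lambda>i. if i \<le> n then u (f i) else 0)"
    have cp: "coeff p i = (if i \<le> n then u (f i) else 0)" for i
      unfolding p_def by (subst coeff_Abs_poly[of n]) auto
    obtain k where k: "k \<le> n" "v = f k" using u(1) by auto
    have "coeff p k \<noteq> 0" using cp[of k] k u by simp
    then have p0: "p \<noteq> 0" by auto
    have deg: "degree p \<le> n" using cp by (intro degree_le) auto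
    have "(\<Sum>i\<le>degree p. coeff p i *\<^sub>c f i) = (\<Sum>i\<le>n. coeff p i *\<^sub>c f i)"
      using deg by (intro sum.mono_neutral_left) (auto simp: coeff_eq_0)
    also have "\<dots> = (\<Sum>i\<le>n. u (f i) *\<^sub>c f i)" by (intro sum.cong) (auto simp: cp)
    also have "\<dots> = 0" using u(3) by (subst (asm) sum.reindex[OF True]) (simp add: o_def)
    finally show ?thesis using p0 by blast
  qed
qed

text \<open>Left multiplication by \<open>a\<close> has the matrix with entries
  \<open>a (b i \<otimes> inv (b j))\<close>, which lie in \<open>R\<close>. The elements of
  \<open>G\<close> are numbered to fit the index type of \<open>eigenvalue_R\<close>.\<close>

lemma conv_eigenvalue_R:
  assumes a: "a \<in> RG" and w: "w \<in> CG" "w \<noteq> 0" "a \<star> w = l *\<^sub>c w"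
  shows "l \<in> R"
proof -
  define n where "n = card (carrier G)"
  obtain b where b: "bij_betw b {0..<n} (carrier G)"
    using ex_bij_betw_nat_finite[OF fin_G] n_def by blast
  have bG: "b i \<in> carrier G" if "i \<in> {0..<n}" for i
    using b that by (auto simp: bij_betw_def)
  obtain g where "w g \<noteq> 0" using w(2) by (metis ext zero_fun_apply)
  then have "g \<in> carrier G" using w(1) by (auto simp: CG_def)
  then have "g \<in> b ` {0..<n}" using b by (simp add: bij_betw_def)
  then obtain i0 where i0: "i0 \<in> {0..<n}" "b i0 = g" by blast
  show ?thesis
  proof (rule eigenvalue_R[of "{0..<n}" "\<lambda>i j. a (b i \<otimes> inv (b j))" "\<lambda>i. w (b i)" l i0])
    fix i assume i: "i \<in> {0..<n}"
    have "(\<Sum>j\<in>{0..<n}. a (b i \<otimes> inv (b j)) * w (b j)) = (\<Sum>h\<in>carrier G. a (b i \<otimes> inv h) * w h)"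
      by (rule sum.reindex_bij_betw[OF b])
    also have "\<dots> = (\<Sum>h\<in>carrier G. a (b i \<otimes> h) * w (inv h))"
      using sum_inv[of "\<lambda>h. a (b i \<otimes> h) * w (inv h)"] by simp
    also have "\<dots> = (\<Sum>h\<in>carrier G. a (b i \<otimes> (inv (b i) \<otimes> h)) * w (inv (inv (b i) \<otimes> h)))"
      using sum_left_mult[of "inv (b i)" "\<lambda>h. a (b i \<otimes> h) * w (inv h)"] bG[OF i] by simp
    also have "\<dots> = (a \<star> w) (b i)"
      using bG[OF i] unfolding conv_def
      by (auto intro!: sum.cong simp: m_assoc[symmetric] inv_mult_group)
    finally show "(\<Sum>j\<in>{0..<n}. a (b i \<otimes> inv (b j)) * w (b j)) = l * w (b i)"
      by (simp add: w sc_def)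
  qed (use i0 \<open>w g \<noteq> 0\<close> a bG in \<open>auto intro: RG_R\<close>)
qed

end

section \<open>The corner e RG e of a primitive idempotent\<close>

locale primitive_idempotent = group_algebra +
  fixes e
  assumes e_RG [simp, intro]: "e \<in> RG" and e_e [simp]: "e \<star> e = e" and e_nz: "e \<noteq> 0"
    and primitive: "\<And>E. E \<in> RG \<Longrightarrow> E \<star> E = E \<Longrightarrow> e \<star> E = E \<Longrightarrow> E \<star> e = E \<Longrightarrow> E = 0 \<or> E = e"
begin

definition corner :: "('a \<Rightarrow> complex) set" where
  "corner = {a \<in> RG. e \<star> a = a \<and> a \<star> e = a}"

lemma cornerI: "a \<in> RG \<Longrightarrow> e \<star> a = a \<Longrightarrow> a \<star> e = a \<Longrightarrow> a \<in> corner"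
  by (simp add: corner_def)

lemma cornerD: "a \<in> corner \<Longrightarrow> a \<in> RG" "a \<in> corner \<Longrightarrow> e \<star> a = a" "a \<in> corner \<Longrightarrow> a \<star> e = a"
  by (simp_all add: corner_def)

lemma corner_e [simp, intro]: "e \<in> corner" by (simp add: corner_def)
lemma corner_0 [simp, intro]: "0 \<in> corner" by (simp add: corner_def)
lemma corner_add [intro]: "a \<in> corner \<Longrightarrow> b \<in> corner \<Longrightarrow> a + b \<in> corner"
  by (auto simp: corner_def conv_distribs)
lemma corner_diff [intro]: "a \<in> corner \<Longrightarrow> b \<in> corner \<Longrightarrow> a - b \<in> corner"
  by (auto simp: corner_def conv_distribs)
lemma corner_conv [intro]: "a \<in> corner \<Longrightarrow> b \<in> corner \<Longrightarrow> a \<star> b \<in> corner"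
  by (auto simp: corner_def conv_assoc) (simp add: conv_assoc[symmetric])
lemma corner_sc [intro]: "r \<in> R \<Longrightarrow> a \<in> corner \<Longrightarrow> r *\<^sub>c a \<in> corner"
  by (auto simp: corner_def)
lemma corner_sandwich: "a \<in> RG \<Longrightarrow> e \<star> a \<star> e \<in> corner"
  by (rule cornerI) (auto simp: conv_assoc, simp add: conv_assoc[symmetric])

text \<open>Horner evaluation of a polynomial at \<open>a\<close>, with \<open>e\<close> in place of
  the identity.\<close>

definition ev :: "('a \<Rightarrow> complex) \<Rightarrow> complex poly \<Rightarrow> 'a \<Rightarrow> complex" where
  "ev a p = fold_coeffs (\<lambda>c r. c *\<^sub>c e + a \<star> r) p 0"

lemma ev_0 [simp]: "ev a 0 = 0" by (simp add: ev_def)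

lemma ev_pCons: "ev a (pCons c p) = c *\<^sub>c e + a \<star> ev a p"
  unfolding ev_def by (cases "c = 0 \<and> p = 0") auto

lemma ev_add: "ev a (p + q) = ev a p + ev a q"
  by (induction p q rule: poly_induct2) (simp_all add: ev_pCons sc_add_left conv_add_right add_ac)

lemma ev_smult: "ev a (smult c p) = c *\<^sub>c ev a p"
  by (induction p) (simp_all add: ev_pCons sc_add_right)

lemma ev_1 [simp]: "ev a 1 = e" by (simp add: one_pCons ev_pCons)

lemma ev_e: assumes "e \<star> a = a" shows "e \<star> ev a p = ev a p"
  by (induction p) (simp_all add: ev_pCons conv_add_right conv_assoc[symmetric] assms)

lemma ev_mult: assumes "e \<star> a = a" shows "ev a (p * q) = ev a p \<star> ev a q"
  by (induction p) (simp_all add: ev_pCons ev_add ev_smult conv_add_left conv_assoc ev_e assms)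

lemma ev_corner: assumes "a \<in> corner" "p \<in> RX" shows "ev a p \<in> corner"
  using assms(2) by (induction p) (auto simp: ev_pCons dest!: RX_pConsD intro!: corner_add corner_sc corner_conv assms(1))

lemma ev_linear: "a \<in> corner \<Longrightarrow> ev a [:- l, 1:] = a - l *\<^sub>c e"
  by (simp add: ev_pCons sc_uminus_left cornerD)

lemma ev_commute: "e \<star> a = a \<Longrightarrow> ev a p \<star> ev a q = ev a q \<star> ev a p"
  by (metis ev_mult mult.commute)

text \<open>A complex polynomial of least degree annihilating \<open>a\<close> is split. For a root
  \<open>l\<close>, the cofactor \<open>q\<close> of \<open>X - l\<close> has smaller degree, so
  \<open>ev a q\<close> is nonzero; it is an eigenvector of left multiplication by \<open>a\<close>
  for \<open>l\<close>, whence \<open>l\<close> lies in \<open>R\<close>.\<close>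

lemma corner_integral:
  assumes a: "a \<in> corner"
  shows "\<exists>ls. set ls \<subseteq> R \<and> ev a (linear_factors ls) = 0"
proof -
  define pw where "pw = rec_nat e (\<lambda>_ x. a \<star> x)"
  have pw: "pw 0 = e" "pw (Suc n) = a \<star> pw n" for n by (simp_all add: pw_def)
  have ev_sum: "ev a p = (\<Sum>i\<le>degree p. coeff p i *\<^sub>c pw i)" for p
  proof -
    have "ev a p = (\<Sum>i\<le>n. coeff p i *\<^sub>c pw i)" if "degree p \<le> n" for n
      using that
    proof (induction p arbitrary: n)
      case 0
      then show ?case by (induction n) simp_all
    next
      case (pCons c p)
      show ?case
      proof (cases n)
        case 0
        then have "p = 0" using pCons.prems by (auto split: if_splits)
        then show ?thesis using 0 by (simp add: ev_pCons pw)
      next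
        case (Suc m)
        then have "degree p \<le> m" using pCons.prems by (auto split: if_splits)
        then have "ev a p = (\<Sum>i\<le>m. coeff p i *\<^sub>c pw i)" by (rule pCons.IH)
        then show ?thesis
          unfolding Suc ev_pCons sum.atMost_Suc_shift by (simp add: pw conv_sum_right)
      qed
    qed
    then show ?thesis by blast
  qed
  have pwC: "pw n \<in> CG" for n by (cases n) (auto simp: pw)
  define Ann where "Ann = {p. p \<noteq> 0 \<and> ev a p = 0}"
  obtain p0 where "p0 \<in> Ann"
    using exists_annihilating_relation[of pw, OF pwC] by (auto simp: Ann_def ev_sum)
  then obtain p where p: "p \<in> Ann" and least: "\<And>q. q \<in> Ann \<Longrightarrow> degree p \<le> degree q"
    using arg_min_nat_lemma[of "\<lambda>p. p \<in> Ann" p0 degree] by metis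
  obtain ls where ls: "smult (lead_coeff p) (linear_factors ls) = p"
    using fundamental_theorem_algebra_factorized[of p] by (auto simp: linear_factors_def)
  have lc: "lead_coeff p \<noteq> 0" using p by (simp add: Ann_def)
  have "ev a (linear_factors ls) = (inverse (lead_coeff p) * lead_coeff p) *\<^sub>c ev a (linear_factors ls)"
    using lc by simp
  also have "\<dots> = inverse (lead_coeff p) *\<^sub>c ev a p"
    by (metis ls ev_smult sc_sc)
  also have "\<dots> = 0" using p by (simp add: Ann_def)
  finally have zero: "ev a (linear_factors ls) = 0" .
  have "l \<in> R" if l: "l \<in> set ls" for l
  proof -
    have "poly (linear_factors ls) l = 0" using l
      by (induction ls) (auto simp: linear_factors_def)
    then obtain q where q: "linear_factors ls = [:- l, 1:] * q"
      by (metis dvd_def poly_eq_0_iff_dvd)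
    have "linear_factors ls \<noteq> 0" using ls p by (auto simp: Ann_def)
    then have q0: "q \<noteq> 0" using q by auto
    then have "degree (linear_factors ls) = Suc (degree q)"
      unfolding q by (subst degree_mult_eq) auto
    then have "degree p = Suc (degree q)" using ls lc by (metis degree_smult_eq)
    then have "q \<notin> Ann" using least by fastforce
    then have w: "ev a q \<noteq> 0" using q0 by (simp add: Ann_def)
    have "0 = ev a [:- l, 1:] \<star> ev a q"
      using zero q a by (metis ev_mult cornerD(2))
    also have "\<dots> = a \<star> ev a q - l *\<^sub>c ev a q"
      by (simp add: ev_linear a conv_diff_left ev_e cornerD)
    finally have "a \<star> ev a q = l *\<^sub>c ev a q" by simp
    moreover have "ev a q \<in> CG"
      using ev_e[OF cornerD(2)[OF a], of q] conv_CG by metis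
    ultimately show ?thesis using w conv_eigenvalue_R[OF cornerD(1)[OF a]] by blast
  qed
  then show ?thesis using zero by blast
qed

definition cunit :: "('a \<Rightarrow> complex) \<Rightarrow> bool" where
  "cunit a \<longleftrightarrow> a \<in> corner \<and> (\<exists>b\<in>corner. a \<star> b = e \<and> b \<star> a = e)"

lemma cunit_e: "cunit e" by (auto simp: cunit_def intro!: bexI[of _ e])

lemma cunit_conv: "cunit a \<Longrightarrow> cunit b \<Longrightarrow> cunit (a \<star> b)"
proof -
  assume "cunit a" "cunit b"
  then obtain a' b' where *: "a \<in> corner" "b \<in> corner" "a' \<in> corner" "b' \<in> corner"
    "a \<star> a' = e" "a' \<star> a = e" "b \<star> b' = e" "b' \<star> b = e" by (auto simp: cunit_def)
  have "a \<star> b \<star> (b' \<star> a') = a \<star> (b \<star> b') \<star> a'" by (simp add: conv_assoc)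
  also have "\<dots> = e" by (simp add: * cornerD(3))
  finally have 1: "a \<star> b \<star> (b' \<star> a') = e" .
  have "b' \<star> a' \<star> (a \<star> b) = b' \<star> (a' \<star> a) \<star> b" by (simp add: conv_assoc)
  also have "\<dots> = e" by (simp add: * cornerD(3))
  finally have 2: "b' \<star> a' \<star> (a \<star> b) = e" .
  have "a \<star> b \<in> corner" "b' \<star> a' \<in> corner" using *(1-4) by (auto intro: corner_conv)
  then show ?thesis unfolding cunit_def using 1 2 by blast
qed

lemma cunit_sc: assumes "r \<in> R" "r \<notin> J" "cunit a" shows "cunit (r *\<^sub>c a)"
proof -
  obtain b where b: "a \<in> corner" "b \<in> corner" "a \<star> b = e" "b \<star> a = e" using assms by (auto simp: cunit_def)
  have "r \<noteq> 0" using assms by auto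
  then have "(r *\<^sub>c a) \<star> (inverse r *\<^sub>c b) = e" "(inverse r *\<^sub>c b) \<star> (r *\<^sub>c a) = e"
    using b by simp_all
  moreover have "r *\<^sub>c a \<in> corner" "inverse r *\<^sub>c b \<in> corner"
    using b(1,2) assms(1,2) unit_R by (auto intro: corner_sc)
  ultimately show ?thesis unfolding cunit_def by blast
qed

text \<open>\<open>b \<star> a\<close> is an idempotent of the corner, hence \<open>0\<close> or
  \<open>e\<close> by primitivity, and it is not \<open>0\<close> because
  \<open>a \<star> (b \<star> a) \<star> b = e\<close>.\<close>

lemma right_inverse_cunit:
  assumes "a \<in> corner" "b \<in> corner" "a \<star> b = e" shows "cunit a" "cunit b"
proof -
  have "b \<star> a \<star> (b \<star> a) = b \<star> (a \<star> b) \<star> a" by (simp add: conv_assoc)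
  also have "\<dots> = b \<star> a" using assms by (simp add: cornerD)
  finally have "b \<star> a = 0 \<or> b \<star> a = e"
    using primitive[of "b \<star> a"] corner_conv[OF assms(2,1)] by (simp add: cornerD)
  moreover have "b \<star> a \<noteq> 0"
  proof
    assume "b \<star> a = 0"
    then have "a \<star> (b \<star> a) \<star> b = 0" by simp
    moreover have "a \<star> (b \<star> a) \<star> b = (a \<star> b) \<star> (a \<star> b)" by (simp add: conv_assoc)
    ultimately show False using assms e_nz by simp
  qed
  ultimately have "b \<star> a = e" by blast
  then show "cunit a" "cunit b" using assms unfolding cunit_def by blast+
qed

lemma cunit_factor:
  assumes "a \<in> corner" "b \<in> corner" "cunit (a \<star> b)" shows "cunit a" "cunit b"
proof -
  obtain c where c: "c \<in> corner" "a \<star> b \<star> c = e" "c \<star> (a \<star> b) = e" using assms(3) by (auto simp: cunit_def)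
  have "b \<star> c \<in> corner" "c \<star> a \<in> corner" using assms(1,2) c(1) by auto
  then show "cunit a" "cunit b" using right_inverse_cunit(1)[of a "b \<star> c"] right_inverse_cunit(2)[of "c \<star> a" b]
      assms(1,2) c(2,3) by (simp_all add: conv_assoc)
qed

lemma zero_not_cunit: "\<not> cunit 0" using e_nz by (auto simp: cunit_def)

text \<open>Otherwise the product of the \<open>a - l e\<close>, which vanishes, would be a
  unit.\<close>

lemma root_value_cunit:
  assumes a: "a \<in> corner" and ls: "set ls \<subseteq> R" "ev a (linear_factors ls) = 0"
  shows "\<exists>l\<in>set ls. \<not> cunit (a - l *\<^sub>c e)"
proof (rule ccontr)
  assume n: "\<not> ?thesis"
  have "cunit (ev a (linear_factors ms))" if "set ms \<subseteq> set ls" for ms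
    using that
  proof (induction ms)
    case Nil
    then show ?case by (simp add: linear_factors_def cunit_e)
  next
    case (Cons m ms)
    have "ev a (linear_factors (m # ms)) = ev a [:- m, 1:] \<star> ev a (linear_factors ms)"
      using ev_mult[OF cornerD(2)[OF a]] by (simp add: linear_factors_def del: mult_pCons_left)
    then show ?case using Cons n a by (auto simp: ev_linear intro!: cunit_conv)
  qed
  from this[of ls] show False using ls zero_not_cunit by simp
qed

text \<open>Division by \<open>X - r\<close> leaves a constant \<open>c\<close> that is a unit of
  \<open>R\<close>. Evaluated at \<open>a\<close>, this says that \<open>a - r e\<close> times some
  corner element is \<open>- c e\<close>.\<close>

lemma nonroot_cunit:
  assumes a: "a \<in> corner" and ls: "set ls \<subseteq> R" "ev a (linear_factors ls) = 0"
    and r: "r \<in> R" "\<And>l. l \<in> set ls \<Longrightarrow> r - l \<notin> J"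
  shows "cunit (a - r *\<^sub>c e)"
proof -
  obtain c q where cq: "c \<in> R" "c \<notin> J" "q \<in> RX" "linear_factors ls = [:c:] + [:- r, 1:] * q"
    using linear_factors_remainder[OF ls(1) r] by blast
  define b where "b = ev a q"
  have b: "b \<in> corner" unfolding b_def by (intro ev_corner a cq)
  have "0 = c *\<^sub>c e + (a - r *\<^sub>c e) \<star> b"
    using ls(2) unfolding cq(4) ev_add ev_mult[OF cornerD(2)[OF a]] ev_linear[OF a]
    by (simp add: ev_pCons b_def)
  then have *: "(a - r *\<^sub>c e) \<star> b = (- c) *\<^sub>c e" by (simp add: sc_uminus_left eq_neg_iff_add_eq_0 add.commute)
  have c: "c \<noteq> 0" "inverse (- c) \<in> R" using cq unit_R[of "- c"] minus_J[of "- c"] by auto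
  have "(a - r *\<^sub>c e) \<star> (inverse (- c) *\<^sub>c b) = e"
    unfolding conv_sc_right * sc_sc using c by simp
  moreover have "a - r *\<^sub>c e \<in> corner" "inverse (- c) *\<^sub>c b \<in> corner"
    using a b c(2) r(1) by (auto simp del: inverse_minus_eq)
  ultimately show ?thesis using right_inverse_cunit(1) by blast
qed

text \<open>This is Schur's lemma for the head in terms of the corner: its residue field is no
  larger than that of \<open>R\<close>.\<close>

lemma corner_schur:
  assumes "a \<in> corner" shows "\<exists>r\<in>R. \<not> cunit (a - r *\<^sub>c e)"
  using corner_integral[OF assms] root_value_cunit[OF assms] by blast

text \<open>The roots of a polynomial annihilating \<open>a\<close> are separated into those in
  \<open>J\<close> and the others. The two factors are comaximal, and one summand of the Bezout
  relation evaluates to an idempotent of the corner. Primitivity makes it \<open>0\<close> or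
  \<open>e\<close>, so one factor alone annihilates \<open>a\<close>. Its roots are then all
  incongruent to \<open>0\<close>, which makes \<open>a\<close> a unit, or all incongruent to
  \<open>1\<close>, which makes \<open>e - a\<close> a unit.\<close>

lemma corner_local:
  assumes a: "a \<in> corner" shows "cunit a \<or> cunit (e - a)"
proof -
  obtain ls where ls: "set ls \<subseteq> R" "ev a (linear_factors ls) = 0"
    using corner_integral[OF a] by blast
  define l1 where "l1 = filter (\<lambda>l. l \<in> J) ls"
  define l2 where "l2 = filter (\<lambda>l. l \<notin> J) ls"
  have s: "set l1 \<subseteq> R" "set l2 \<subseteq> R" using ls by (auto simp: l1_def l2_def)
  have prod: "linear_factors ls = linear_factors l1 * linear_factors l2"
    unfolding l1_def l2_def linear_factors_def
    by (induction ls) (simp_all add: ac_simps del: mult_pCons_left mult_pCons_right)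
  have "comaximal (linear_factors l1) (linear_factors l2)"
  proof (rule comaximal_linear_factors[OF s])
    fix l m assume lm: "l \<in> set l1" "m \<in> set l2"
    show "l - m \<notin> J"
    proof
      assume "l - m \<in> J"
      moreover have "l \<in> J" "m \<notin> J" using lm by (simp_all add: l1_def l2_def)
      ultimately show False using diff_J[of l "l - m"] by simp
    qed
  qed
  then obtain u v where uv: "u \<in> RX" "v \<in> RX" "u * linear_factors l1 + v * linear_factors l2 = 1"
    unfolding comaximal_def by blast
  note ea = cornerD(2)[OF a]
  note [simp] = ev_mult[OF ea]
  define X where "X = ev a (linear_factors l1)"
  define Y where "Y = ev a (linear_factors l2)"
  define U where "U = ev a u"
  define V where "V = ev a v"
  have XY: "X \<star> Y = 0" using ls(2) prod by (simp add: X_def Y_def)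
  have cm: "U \<star> X = X \<star> U" "V \<star> Y = Y \<star> V" "V \<star> X = X \<star> V" "Y \<star> X = X \<star> Y" "U \<star> Y = Y \<star> U"
    unfolding X_def Y_def U_def V_def by (rule ev_commute[OF ea])+
  have sum: "U \<star> X + V \<star> Y = e"
    using arg_cong[OF uv(3), of "ev a"] by (simp add: ev_add U_def V_def X_def Y_def)
  have cs: "U \<in> corner" "V \<in> corner" "X \<in> corner" "Y \<in> corner"
    unfolding X_def Y_def U_def V_def using uv s linear_factors_RX by (auto intro!: ev_corner a)
  have 0: "U \<star> X \<star> (V \<star> Y) = 0"
  proof -
    have "U \<star> X \<star> (V \<star> Y) = U \<star> (X \<star> Y) \<star> V" by (simp only: cm(2) conv_assoc)
    then show ?thesis by (simp add: XY)
  qed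
  define E where "E = V \<star> Y"
  have Ec: "E \<in> corner" unfolding E_def using cs by auto
  have "E = e - U \<star> X" using sum by (simp add: E_def eq_diff_eq add.commute)
  then have "E \<star> E = (e - U \<star> X) \<star> E" by simp
  also have "\<dots> = E - U \<star> X \<star> (V \<star> Y)" using Ec by (simp only: conv_diff_left cornerD(2) E_def)
  also have "\<dots> = E" by (simp only: 0 diff_zero)
  finally have "E = 0 \<or> E = e"
    using primitive[of E] Ec by (simp add: cornerD)
  then show ?thesis
  proof
    assume "E = 0"
    then have "U \<star> X = e" using sum by (simp add: E_def)
    then have "Y = U \<star> X \<star> Y" using cs by (simp add: cornerD)
    then have "ev a (linear_factors l2) = 0" by (simp add: conv_assoc XY Y_def[symmetric])
    then have "cunit (a - 0 *\<^sub>c e)"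
      by (rule nonroot_cunit[OF a s(2)]) (auto simp: l2_def)
    then show ?thesis by simp
  next
    assume "E = e"
    then have "X = X \<star> (V \<star> Y)" using cs by (simp add: cornerD E_def)
    also have "\<dots> = X \<star> Y \<star> V" by (simp only: cm(2) conv_assoc)
    finally have "ev a (linear_factors l1) = 0" by (simp add: XY X_def[symmetric])
    then have "cunit (a - 1 *\<^sub>c e)"
    proof (rule nonroot_cunit[OF a s(1)])
      fix l assume "l \<in> set l1"
      then show "1 - l \<notin> J" using add_J[of "1 - l" l] by (auto simp: l1_def)
    qed auto
    then have "cunit ((-1) *\<^sub>c (a - 1 *\<^sub>c e))"
      using minus_J[of "-1"] by (intro cunit_sc) auto
    then show ?thesis by (simp add: sc_uminus_left)
  qed
qed

end

section \<open>The head of a principal indecomposable module\<close>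

context local_subring begin

text \<open>A two-element orbit contributes \<open>2 h x\<close> up to an element of
  \<open>I\<close>, so only fixed points need care. \<open>I\<close> is an additively closed set
  above \<open>twoR\<close>, which covers both \<open>twoR\<close> and \<open>J\<close>.\<close>

lemma sum_involution:
  assumes fin: "finite X" and im: "\<And>x. x \<in> X \<Longrightarrow> f x \<in> X" and inv: "\<And>x. x \<in> X \<Longrightarrow> f (f x) = x"
    and I: "twoR \<subseteq> I" "\<And>a b. a \<in> I \<Longrightarrow> b \<in> I \<Longrightarrow> a + b \<in> I"
    and R: "\<And>x. x \<in> X \<Longrightarrow> h x \<in> R"
    and swap: "\<And>x. x \<in> X \<Longrightarrow> h (f x) - h x \<in> I"
    and fixp: "\<And>x. x \<in> X \<Longrightarrow> f x = x \<Longrightarrow> h x \<in> I"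
  shows "sum h X \<in> I"
  using fin im inv R swap fixp
proof (induction X rule: finite_psubset_induct)
  case (psubset X)
  show ?case
  proof (cases "X = {}")
    case True
    then show ?thesis using I(1) by auto
  next
    case False
    then obtain x where x: "x \<in> X" by blast
    define Y where "Y = X - {x, f x}"
    have fx: "f x \<in> X" "f (f x) = x" using psubset.prems x by auto
    have "sum h Y \<in> I"
    proof (rule psubset.IH)
      show "Y \<subset> X" using x by (auto simp: Y_def)
      fix y assume y: "y \<in> Y"
      then have yX: "y \<in> X" by (simp add: Y_def)
      have "f y \<noteq> x" "f y \<noteq> f x" using y psubset.prems(2)[OF yX] fx by (auto simp: Y_def)
      then show "f y \<in> Y" using psubset.prems(1)[OF yX] by (simp add: Y_def)
    qed (use psubset.prems in \<open>auto simp: Y_def\<close>)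
    moreover have "sum h {x, f x} \<in> I"
    proof (cases "f x = x")
      case True
      then show ?thesis using psubset.prems(5)[OF x] by simp
    next
      case False
      then have "sum h {x, f x} = (h x + h x) + (h (f x) - h x)" by simp
      also have "\<dots> \<in> I" using I psubset.prems(3,4)[OF x] twoR_double by blast
      finally show ?thesis .
    qed
    moreover have "sum h X = sum h Y + sum h {x, f x}"
      unfolding Y_def using x fx psubset.hyps by (intro sum.subset_diff) auto
    ultimately show ?thesis using I(2) by auto
  qed
qed

lemma cong_refl [simp]: "x \<doteq> x" by (simp add: cong_J_def)
lemma cong_sym: "x \<doteq> y \<Longrightarrow> y \<doteq> x" unfolding cong_J_def using minus_J[of "x - y"] by simp
lemma cong_trans [trans]: "x \<doteq> y \<Longrightarrow> y \<doteq> z \<Longrightarrow> x \<doteq> z"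
  unfolding cong_J_def using add_J[of "x - y" "y - z"] by simp
lemma cong_add: "x \<doteq> y \<Longrightarrow> x' \<doteq> y' \<Longrightarrow> x + x' \<doteq> y + y'"
  unfolding cong_J_def using add_J[of "x - y" "x' - y'"] by (simp add: algebra_simps)
lemma cong_diff: "x \<doteq> y \<Longrightarrow> x' \<doteq> y' \<Longrightarrow> x - x' \<doteq> y - y'"
  unfolding cong_J_def using diff_J[of "x - y" "x' - y'"] by (simp add: algebra_simps)
lemma cong_mult_left: "r \<in> R \<Longrightarrow> x \<doteq> y \<Longrightarrow> r * x \<doteq> r * y"
  unfolding cong_J_def using mult_J[of r "x - y"] by (simp add: algebra_simps)
lemma cong_mult_right: "r \<in> R \<Longrightarrow> x \<doteq> y \<Longrightarrow> x * r \<doteq> y * r"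
  using cong_mult_left by (simp add: mult.commute)
lemma cong_sum: "(\<And>i. i \<in> I \<Longrightarrow> f i \<doteq> g i) \<Longrightarrow> sum f I \<doteq> sum g I"
  unfolding cong_J_def sum_subtractf[symmetric] by (rule sum_J)
lemma cong_J_iff: "x \<doteq> y \<Longrightarrow> x \<in> J \<longleftrightarrow> y \<in> J"
  unfolding cong_J_def using add_J[of "x - y" y] diff_J[of x "x - y"] by auto
lemma cong_0_iff: "x \<doteq> 0 \<longleftrightarrow> x \<in> J" by (simp add: cong_J_def)
lemma cong_mult: "x \<in> R \<Longrightarrow> y' \<in> R \<Longrightarrow> x \<doteq> x' \<Longrightarrow> y \<doteq> y' \<Longrightarrow> x * y \<doteq> x' * y'"
  by (rule cong_trans[OF cong_mult_left cong_mult_right])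
lemma cong_uminus: "x \<in> R \<Longrightarrow> - x \<doteq> x"
  unfolding cong_J_def using mult_J[of "- x" 2] by (simp add: mult.commute)

end

section \<open>The left ideal RG e and its radical\<close>

context primitive_idempotent begin

text \<open>After multiplication by the inverse \<open>w\<close> of the sum,
  \<open>w \<star> a\<close> and \<open>w \<star> b\<close> add up to \<open>e\<close>, and locality
  applies.\<close>

lemma nonunit_add:
  assumes "a \<in> corner" "b \<in> corner" "\<not> cunit a" "\<not> cunit b" shows "\<not> cunit (a + b)"
proof
  assume "cunit (a + b)"
  then obtain w where w: "w \<in> corner" "w \<star> (a + b) = e" by (auto simp: cunit_def)
  have wc: "w \<star> a \<in> corner" "w \<star> b \<in> corner" using w(1) assms(1,2) by auto
  have "e - w \<star> a = w \<star> b" using w(2) by (simp add: conv_add_right diff_eq_eq add.commute)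
  then have "cunit (w \<star> a) \<or> cunit (w \<star> b)" using corner_local[OF wc(1)] by simp
  then show False using cunit_factor w(1) assms by blast
qed

text \<open>If \<open>r e\<close> had an inverse \<open>w\<close>, take a scalar \<open>s\<close>
  for which \<open>w - s e\<close> is a nonunit. Then \<open>r e\<close> times
  \<open>w - s e\<close> is \<open>(1 - r s) e\<close>, a unit because \<open>1 - r s\<close> lies
  outside \<open>J\<close>; this contradicts the choice of \<open>s\<close>.\<close>

lemma nonunit_J:
  assumes r: "r \<in> J" and a: "a \<in> corner" shows "\<not> cunit (r *\<^sub>c a)"
proof
  assume "cunit (r *\<^sub>c a)"
  then have "cunit ((r *\<^sub>c e) \<star> a)" using a by (simp add: cornerD)
  moreover have re: "r *\<^sub>c e \<in> corner" using r by auto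
  ultimately have "cunit (r *\<^sub>c e)" using cunit_factor a by blast
  then obtain w where w: "w \<in> corner" "(r *\<^sub>c e) \<star> w = e" by (auto simp: cunit_def)
  obtain s where s: "s \<in> R" "\<not> cunit (w - s *\<^sub>c e)" using corner_schur[OF w(1)] by blast
  have "(r *\<^sub>c e) \<star> (w - s *\<^sub>c e) = (1 - r * s) *\<^sub>c e"
    unfolding conv_diff_right w(2) by (simp add: sc_diff_left mult.commute)
  moreover have "cunit ((1 - r * s) *\<^sub>c e)"
  proof (rule cunit_sc[OF _ _ cunit_e])
    show "1 - r * s \<in> R" using r s by auto
    show "1 - r * s \<notin> J"
    proof
      assume "1 - r * s \<in> J"
      then have "1 - r * s + r * s \<in> J" using r s by (intro add_J) auto
      then show False by simp
    qed
  qed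
  moreover have "w - s *\<^sub>c e \<in> corner" using w(1) s(1) by auto
  ultimately show False using cunit_factor(2)[OF re, of "w - s *\<^sub>c e"] s(2) by simp
qed

definition L :: "('a \<Rightarrow> complex) set" where "L = {x \<in> RG. x \<star> e = x}"

text \<open>The radical of \<open>L\<close>: by \<open>L_generator\<close> every element of
  \<open>L\<close> outside \<open>N\<close> generates \<open>L\<close>, so \<open>N\<close> contains
  all proper submodules.\<close>

definition N :: "('a \<Rightarrow> complex) set" where "N = {x \<in> L. \<forall>a\<in>RG. \<not> cunit (e \<star> a \<star> x)}"

lemma LI: "x \<in> RG \<Longrightarrow> x \<star> e = x \<Longrightarrow> x \<in> L" by (simp add: L_def)
lemma L_RG [intro]: "x \<in> L \<Longrightarrow> x \<in> RG" by (simp add: L_def)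
lemma L_e_right: "x \<in> L \<Longrightarrow> x \<star> e = x" by (simp add: L_def)
lemma L_e [simp, intro]: "e \<in> L" by (simp add: L_def)
lemma L_0 [simp, intro]: "0 \<in> L" by (simp add: L_def)
lemma L_add [intro]: "x \<in> L \<Longrightarrow> y \<in> L \<Longrightarrow> x + y \<in> L" by (auto simp: L_def conv_distribs)
lemma L_diff [intro]: "x \<in> L \<Longrightarrow> y \<in> L \<Longrightarrow> x - y \<in> L" by (auto simp: L_def conv_distribs)
lemma L_sc [intro]: "r \<in> R \<Longrightarrow> x \<in> L \<Longrightarrow> r *\<^sub>c x \<in> L" by (auto simp: L_def)
lemma L_conv [intro]: "a \<in> RG \<Longrightarrow> x \<in> L \<Longrightarrow> a \<star> x \<in> L" by (auto simp: L_def conv_assoc)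
lemma L_sum [intro]: "(\<And>i. i \<in> I \<Longrightarrow> f i \<in> L) \<Longrightarrow> sum f I \<in> L"
  by (induction I rule: infinite_finite_induct) auto
lemma L_conv_e: "a \<in> RG \<Longrightarrow> a \<star> e \<in> L" by auto
lemma one_conv_L [simp]: "x \<in> L \<Longrightarrow> dl \<one> \<star> x = x" by (intro conv_one_left RG_CG L_RG)
lemma corner_L: "a \<in> corner \<Longrightarrow> a \<in> L" by (simp add: corner_def L_def)

lemma L_expand: assumes "x \<in> L" shows "x = (\<Sum>g\<in>carrier G. x g *\<^sub>c (dl g \<star> e))"
proof -
  have "x = x \<star> e" using assms by (simp add: L_e_right)
  also have "\<dots> = (\<Sum>g\<in>carrier G. x g *\<^sub>c dl g) \<star> e"
    using CG_expand[of x] assms by (metis L_RG RG_CG)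
  also have "\<dots> = (\<Sum>g\<in>carrier G. x g *\<^sub>c (dl g \<star> e))" by (simp only: conv_sum_left conv_sc_left)
  finally show ?thesis .
qed

lemma e_L_corner: assumes "x \<in> L" shows "e \<star> x \<in> corner"
  by (rule cornerI) (use assms in \<open>auto simp: conv_assoc L_e_right\<close>, simp add: conv_assoc[symmetric])

lemma N_L [intro]: "x \<in> N \<Longrightarrow> x \<in> L" by (simp add: N_def)
lemma N_nonunit: "x \<in> N \<Longrightarrow> a \<in> RG \<Longrightarrow> \<not> cunit (e \<star> a \<star> x)" by (simp add: N_def)

lemma e_a_L_corner: "a \<in> RG \<Longrightarrow> x \<in> L \<Longrightarrow> e \<star> a \<star> x \<in> corner"
  using e_L_corner[of "a \<star> x"] by (auto simp: conv_assoc)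

lemma N_add [intro]: assumes "x \<in> N" "y \<in> N" shows "x + y \<in> N"
  unfolding N_def
proof (intro CollectI conjI ballI)
  fix a assume a: "a \<in> RG"
  show "\<not> cunit (e \<star> a \<star> (x + y))"
    unfolding conv_add_right
    by (rule nonunit_add[OF e_a_L_corner[OF a] e_a_L_corner[OF a]])
      (use N_nonunit[OF assms(1) a] N_nonunit[OF assms(2) a] assms in auto)
qed (use assms in auto)

lemma N_conv [intro]: assumes a: "a \<in> RG" and x: "x \<in> N" shows "a \<star> x \<in> N"
  unfolding N_def
proof (intro CollectI conjI ballI)
  fix b assume "b \<in> RG"
  then have "\<not> cunit (e \<star> (b \<star> a) \<star> x)" using a by (intro N_nonunit x) auto
  then show "\<not> cunit (e \<star> b \<star> (a \<star> x))" by (simp add: conv_assoc)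
qed (use assms in auto)

lemma sc_as_conv: "x \<in> CG \<Longrightarrow> r *\<^sub>c x = (r *\<^sub>c dl \<one>) \<star> x" by simp

lemma N_sc [intro]: assumes "r \<in> R" "x \<in> N" shows "r *\<^sub>c x \<in> N"
proof -
  have "r *\<^sub>c x = (r *\<^sub>c dl \<one>) \<star> x" using assms by (intro sc_as_conv) auto
  moreover have "(r *\<^sub>c dl \<one>) \<star> x \<in> N" using assms by (intro N_conv RG_sc) auto
  ultimately show ?thesis by metis
qed

lemma N_0 [simp, intro]: "0 \<in> N" by (auto simp: N_def zero_not_cunit)
lemma N_diff [intro]: "x \<in> N \<Longrightarrow> y \<in> N \<Longrightarrow> x - y \<in> N"
  using N_add[of x "(- 1) *\<^sub>c y"] N_sc[of "-1" y] by (simp add: sc_uminus_left)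
lemma N_sum [intro]: "(\<And>i. i \<in> I \<Longrightarrow> f i \<in> N) \<Longrightarrow> sum f I \<in> N"
  by (induction I rule: infinite_finite_induct) auto

lemma e_notin_N: "e \<notin> N"
proof
  assume "e \<in> N"
  from N_nonunit[OF this e_RG] show False using cunit_e by simp
qed

lemma J_L_N [intro]: assumes "r \<in> J" "x \<in> L" shows "r *\<^sub>c x \<in> N"
  unfolding N_def using assms nonunit_J[OF _ e_a_L_corner] by auto

lemma nonunit_N: assumes a: "a \<in> corner" "\<not> cunit a" shows "a \<in> N"
  unfolding N_def
proof (intro CollectI conjI ballI)
  fix b assume b: "b \<in> RG"
  have "e \<star> b \<star> a = (e \<star> b \<star> e) \<star> a" using a(1) by (simp add: conv_assoc cornerD(2))
  moreover have "\<not> cunit ((e \<star> b \<star> e) \<star> a)"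
    using cunit_factor(2)[OF corner_sandwich[OF b] a(1)] a(2) by blast
  ultimately show "\<not> cunit (e \<star> b \<star> a)" by metis
qed (use a corner_L in auto)

lemma L_generator: assumes x: "x \<in> L" "x \<notin> N" shows "\<exists>b\<in>RG. b \<star> x = e"
proof -
  obtain a where a: "a \<in> RG" "cunit (e \<star> a \<star> x)" using x by (auto simp: N_def)
  then obtain w where w: "w \<in> corner" "w \<star> (e \<star> a \<star> x) = e" by (auto simp: cunit_def)
  have "w \<star> e \<star> a \<star> x = e" using w(2) by (simp add: conv_assoc)
  moreover have "w \<star> e \<star> a \<in> RG" using w(1) a(1) cornerD(1) by auto
  ultimately show ?thesis by blast
qed

lemma head_schur: assumes "x \<in> L" shows "\<exists>r\<in>R. e \<star> x - r *\<^sub>c e \<in> N"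
proof -
  obtain r where r: "r \<in> R" "\<not> cunit (e \<star> x - r *\<^sub>c e)"
    using corner_schur[OF e_L_corner[OF assms]] by blast
  then show ?thesis using nonunit_N[of "e \<star> x - r *\<^sub>c e"] e_L_corner[OF assms] by auto
qed

text \<open>Since \<open>w = w e\<close>, inverting \<open>1 - w\<close> reduces to inverting
  \<open>e - e w\<close> in the corner: if \<open>v\<close> is the inverse there,
  \<open>1 + w v\<close> is a left inverse of \<open>1 - w\<close>.\<close>

lemma N_left_quasi_regular:
  assumes w: "w \<in> N" shows "\<exists>z\<in>RG. z \<star> (dl \<one> - w) = dl \<one>"
proof -
  have wL: "w \<in> L" using w by (rule N_L)
  have wC: "w \<in> CG" by (intro RG_CG L_RG wL)
  have "\<not> cunit (e \<star> w)" using N_nonunit[OF w e_RG] by simp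
  then have "cunit (e - e \<star> w)" using corner_local[OF e_L_corner[OF wL]] by blast
  then obtain v where v: "v \<in> corner" "v \<star> (e - e \<star> w) = e" by (auto simp: cunit_def)
  have ve: "v \<star> e = v" using v(1) by (rule cornerD)
  have vC: "v \<in> CG" by (intro RG_CG cornerD(1) v(1))
  have vw: "v - v \<star> w = e"
    using v(2) unfolding conv_diff_right conv_assoc[symmetric] ve .
  have "(dl \<one> + w \<star> v) \<star> (dl \<one> - w) = dl \<one> - w + (w \<star> v - w \<star> (v \<star> w))"
    using wC vC by (simp add: conv_distribs conv_assoc)
  also have "w \<star> v - w \<star> (v \<star> w) = w \<star> (v - v \<star> w)" by (simp add: conv_diff_right)
  also have "\<dots> = w" unfolding vw by (rule L_e_right[OF wL])
  finally have "(dl \<one> + w \<star> v) \<star> (dl \<one> - w) = dl \<one>" by simp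
  moreover have "dl \<one> + w \<star> v \<in> RG" using wL cornerD(1)[OF v(1)] by auto
  ultimately show ?thesis by blast
qed

text \<open>Since \<open>N\<close> lies in the Jacobson radical of the group algebra, which is stable under
  \<open>star\<close>, the two sides may be exchanged.\<close>

lemma star_N_conv: assumes y: "y \<in> N" and x: "x \<in> L" shows "star y \<star> x \<in> N"
  unfolding N_def
proof (intro CollectI conjI ballI notI)
  show "star y \<star> x \<in> L" using assms by auto
  fix a assume a: "a \<in> RG" and u: "cunit (e \<star> a \<star> (star y \<star> x))"
  then obtain v where v: "v \<in> corner" "v \<star> (e \<star> a \<star> (star y \<star> x)) = e" by (auto simp: cunit_def)
  define b where "b = v \<star> a"
  have vRG: "v \<in> RG" "v \<star> e = v" "e \<star> v = v" using v(1) by (auto simp: cornerD)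
  have bRG: "b \<in> RG" using vRG a by (auto simp: b_def)
  have b: "b \<star> (star y \<star> x) = e"
    using v(2) unfolding b_def conv_assoc[symmetric] vRG(2) .
  have eb: "e \<star> b = b" unfolding b_def conv_assoc[symmetric] vRG(3) ..
  \<comment> \<open>Chosen so that \<open>star w\<close> is
    \<open>star y \<star> x \<star> b\<close>; it lies in \<open>N\<close> as a left multiple of
    \<open>y\<close>.\<close>
  define w where "w = star (x \<star> b) \<star> y"
  have "w \<in> N" unfolding w_def using x bRG y by auto
  then obtain z where z: "z \<in> RG" "z \<star> (dl \<one> - w) = dl \<one>" using N_left_quasi_regular by blast
  have CG: "x \<in> CG" "b \<in> CG" "y \<in> CG"
    by (intro RG_CG L_RG N_L x y bRG)+
  have sw: "star w = star y \<star> x \<star> b"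
    unfolding w_def star_conv using CG by (simp add: conv_assoc)
  have "(dl \<one> - star w) \<star> star z = dl \<one>"
    using arg_cong[OF z(2), of star] unfolding star_conv star_diff by (simp add: star_dl)
  \<comment> \<open>\<open>b \<star> (dl \<one> - star w) = b - e \<star> b = 0\<close>, while
    \<open>dl \<one> - star w\<close> has a right inverse. So \<open>b = 0\<close>, against
    \<open>b \<star> (star y \<star> x) = e\<close>.\<close>
  then have "b = b \<star> ((dl \<one> - star w) \<star> star z)" using CG by simp
  also have "\<dots> = (b - b \<star> (star y \<star> x) \<star> b) \<star> star z"
    using CG by (simp add: conv_distribs conv_assoc sw)
  also have "\<dots> = 0" by (simp add: b eb)
  finally show False using b e_nz by simp
qed

subsection \<open>Functionals and traces on the head\<close>

text \<open>An \<open>R\<close>-valued lift of a linear functional on \<open>L / N\<close> over the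
  residue field; hence linearity is asked modulo \<open>J\<close>.\<close>

definition head_functional :: "(('a \<Rightarrow> complex) \<Rightarrow> complex) \<Rightarrow> bool" where
  "head_functional \<psi> \<longleftrightarrow> (\<forall>x\<in>L. \<psi> x \<in> R) \<and> (\<forall>x\<in>L. \<forall>y\<in>L. \<psi> (x + y) \<doteq> \<psi> x + \<psi> y) \<and>
     (\<forall>r\<in>R. \<forall>x\<in>L. \<psi> (r *\<^sub>c x) \<doteq> r * \<psi> x) \<and> (\<forall>x\<in>N. \<psi> x \<in> J)"

lemma head_functionalD:
  assumes "head_functional \<psi>"
  shows "x \<in> L \<Longrightarrow> \<psi> x \<in> R" "x \<in> L \<Longrightarrow> y \<in> L \<Longrightarrow> \<psi> (x + y) \<doteq> \<psi> x + \<psi> y"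
    "r \<in> R \<Longrightarrow> x \<in> L \<Longrightarrow> \<psi> (r *\<^sub>c x) \<doteq> r * \<psi> x" "x \<in> N \<Longrightarrow> \<psi> x \<in> J"
  using assms by (auto simp: head_functional_def)

lemma head_functional_sum:
  assumes \<psi>: "head_functional \<psi>" and "finite I" "\<And>i. i \<in> I \<Longrightarrow> c i \<in> R" "\<And>i. i \<in> I \<Longrightarrow> x i \<in> L"
  shows "\<psi> (\<Sum>i\<in>I. c i *\<^sub>c x i) \<doteq> (\<Sum>i\<in>I. c i * \<psi> (x i))"
  using assms(2-4)
proof (induction I rule: finite_induct)
  case empty
  show ?case using head_functionalD(4)[OF \<psi> N_0] by (simp add: cong_0_iff)
next
  case (insert i I)
  have "\<psi> (c i *\<^sub>c x i + (\<Sum>i\<in>I. c i *\<^sub>c x i)) \<doteq> \<psi> (c i *\<^sub>c x i) + \<psi> (\<Sum>i\<in>I. c i *\<^sub>c x i)"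
    using insert.prems by (intro head_functionalD(2)[OF \<psi>]) auto
  also have "\<dots> \<doteq> c i * \<psi> (x i) + (\<Sum>i\<in>I. c i * \<psi> (x i))"
    using insert by (intro cong_add head_functionalD(3)[OF \<psi>]) auto
  finally show ?case using insert by simp
qed

lemma head_functional_cong:
  assumes \<psi>: "head_functional \<psi>" and "x \<in> L" "y \<in> L" "x - y \<in> N"
  shows "\<psi> x \<doteq> \<psi> y"
proof -
  have "\<psi> (y + (x - y)) \<doteq> \<psi> y + \<psi> (x - y)" using assms by (intro head_functionalD(2)[OF \<psi>]) auto
  also have "\<dots> \<doteq> \<psi> y + 0"
    by (intro cong_add cong_refl) (simp add: cong_0_iff head_functionalD(4)[OF \<psi> assms(4)])
  finally show ?thesis by simp
qed

text \<open>Vectors and functionals that reproduce every element of the head. The vectors may be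
  dependent, and the trace on the head is still the sum of the
  \<open>\<psi> i (a \<star> d i)\<close>.\<close>

definition frame :: "'i set \<Rightarrow> ('i \<Rightarrow> 'a \<Rightarrow> complex) \<Rightarrow> ('i \<Rightarrow> ('a \<Rightarrow> complex) \<Rightarrow> complex) \<Rightarrow> bool" where
  "frame I d \<psi> \<longleftrightarrow> finite I \<and> (\<forall>i\<in>I. d i \<in> L \<and> head_functional (\<psi> i)) \<and>
     (\<forall>x\<in>L. x - (\<Sum>i\<in>I. \<psi> i x *\<^sub>c d i) \<in> N)"

lemma frameD: assumes "frame I d \<psi>"
  shows "finite I" "i \<in> I \<Longrightarrow> d i \<in> L" "i \<in> I \<Longrightarrow> head_functional (\<psi> i)"
    "x \<in> L \<Longrightarrow> x - (\<Sum>i\<in>I. \<psi> i x *\<^sub>c d i) \<in> N"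
  using assms by (auto simp: frame_def)

definition tr :: "'i set \<Rightarrow> ('i \<Rightarrow> 'a \<Rightarrow> complex) \<Rightarrow> ('i \<Rightarrow> ('a \<Rightarrow> complex) \<Rightarrow> complex) \<Rightarrow> ('a \<Rightarrow> complex) \<Rightarrow> complex" where
  "tr I d \<psi> a = (\<Sum>i\<in>I. \<psi> i (a \<star> d i))"

lemma frame_functional_expand:
  assumes fr: "frame I d \<psi>" and \<phi>: "head_functional \<phi>" and a: "a \<in> RG" and x: "x \<in> L"
  shows "\<phi> (a \<star> x) \<doteq> (\<Sum>i\<in>I. \<psi> i x * \<phi> (a \<star> d i))"
proof -
  note f = frameD[OF fr]
  have s: "(\<Sum>i\<in>I. \<psi> i x *\<^sub>c d i) \<in> L" using f x head_functionalD(1) by blast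
  have "a \<star> x - a \<star> (\<Sum>i\<in>I. \<psi> i x *\<^sub>c d i) \<in> N"
    unfolding conv_diff_right[symmetric] using f(4)[OF x] a by blast
  then have "\<phi> (a \<star> x) \<doteq> \<phi> (a \<star> (\<Sum>i\<in>I. \<psi> i x *\<^sub>c d i))"
    using s x a by (intro head_functional_cong[OF \<phi>]) auto
  also have "a \<star> (\<Sum>i\<in>I. \<psi> i x *\<^sub>c d i) = (\<Sum>i\<in>I. \<psi> i x *\<^sub>c (a \<star> d i))"
    by (simp only: conv_sum_right conv_sc_right)
  also have "\<phi> \<dots> \<doteq> (\<Sum>i\<in>I. \<psi> i x * \<phi> (a \<star> d i))"
    using f x a head_functionalD(1) by (intro head_functional_sum[OF \<phi>]) auto
  finally show ?thesis .
qed

lemma tr_R: assumes "frame I d \<psi>" "a \<in> RG" shows "tr I d \<psi> a \<in> R"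
  unfolding tr_def
  by (rule sum_R, rule head_functionalD(1)[OF frameD(3)[OF assms(1)]])
    (auto intro: L_conv assms(2) frameD(2)[OF assms(1)])

text \<open>Expand \<open>b \<star> d i\<close> in the second frame and exchange the sums. Stating
  this for two frames at once gives cyclicity of the trace and, with one factor
  \<open>dl \<one>\<close>, independence of the frame.\<close>

lemma tr_conv_swap:
  assumes f: "frame I d \<psi>" and f': "frame K d' \<psi>'" and a: "a \<in> RG" and b: "b \<in> RG"
  shows "tr I d \<psi> (a \<star> b) \<doteq> tr K d' \<psi>' (b \<star> a)"
proof -
  have "tr I d \<psi> (a \<star> b) = (\<Sum>i\<in>I. \<psi> i (a \<star> (b \<star> d i)))" by (simp add: tr_def conv_assoc)
  also have "\<dots> \<doteq> (\<Sum>i\<in>I. \<Sum>k\<in>K. \<psi>' k (b \<star> d i) * \<psi> i (a \<star> d' k))"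
    using frameD(2,3)[OF f] a b by (intro cong_sum frame_functional_expand[OF f']) auto
  also have "\<dots> = (\<Sum>k\<in>K. \<Sum>i\<in>I. \<psi> i (a \<star> d' k) * \<psi>' k (b \<star> d i))"
    by (subst sum.swap) (simp only: mult.commute)
  also have "\<dots> \<doteq> (\<Sum>k\<in>K. \<psi>' k (b \<star> (a \<star> d' k)))"
    using frameD(2,3)[OF f'] a b by (intro cong_sum cong_sym[OF frame_functional_expand[OF f]]) auto
  also have "\<dots> = tr K d' \<psi>' (b \<star> a)" by (simp add: tr_def conv_assoc)
  finally show ?thesis .
qed

lemma tr_independent:
  assumes "frame I d \<psi>" "frame K d' \<psi>'" "a \<in> RG" shows "tr I d \<psi> a \<doteq> tr K d' \<psi>' a"
  using tr_conv_swap[OF assms RG_dl[OF one_closed]] RG_CG[OF assms(3)] by simp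

lemma tr_expand:
  assumes f: "frame I d \<psi>" and a: "a \<in> RG"
  shows "tr I d \<psi> a \<doteq> (\<Sum>g\<in>carrier G. a g * tr I d \<psi> (dl g))"
proof -
  have "\<psi> i (a \<star> d i) \<doteq> (\<Sum>g\<in>carrier G. a g * \<psi> i (dl g \<star> d i))" if i: "i \<in> I" for i
  proof -
    have "a \<star> d i = (\<Sum>g\<in>carrier G. a g *\<^sub>c dl g) \<star> d i" using CG_expand[OF RG_CG[OF a]] by simp
    also have "\<dots> = (\<Sum>g\<in>carrier G. a g *\<^sub>c (dl g \<star> d i))" by (simp only: conv_sum_left conv_sc_left)
    finally show ?thesis
      using head_functional_sum[OF frameD(3)[OF f i] fin_G, of a "\<lambda>g. dl g \<star> d i"] frameD(2)[OF f i] a by auto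
  qed
  then have "tr I d \<psi> a \<doteq> (\<Sum>i\<in>I. \<Sum>g\<in>carrier G. a g * \<psi> i (dl g \<star> d i))"
    unfolding tr_def by (rule cong_sum)
  also have "\<dots> = (\<Sum>g\<in>carrier G. a g * tr I d \<psi> (dl g))"
    unfolding tr_def sum_distrib_left by (rule sum.swap)
  finally show ?thesis .
qed

text \<open>By Schur's lemma \<open>e\<close> projects the head onto a line.\<close>

lemma tr_e: assumes f: "frame I d \<psi>" shows "tr I d \<psi> e \<doteq> 1"
proof -
  have "\<forall>i\<in>I. \<exists>r\<in>R. e \<star> d i - r *\<^sub>c e \<in> N" using head_schur frameD(2)[OF f] by blast
  then obtain r where r: "\<And>i. i \<in> I \<Longrightarrow> r i \<in> R" "\<And>i. i \<in> I \<Longrightarrow> e \<star> d i - r i *\<^sub>c e \<in> N" by metis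
  have \<psi>e: "\<psi> i e \<in> R" if "i \<in> I" for i using head_functionalD(1)[OF frameD(3)[OF f that]] by blast
  define s where "s = (\<Sum>i\<in>I. r i * \<psi> i e)"
  have sR: "s \<in> R" unfolding s_def by (intro sum_R mult_R r \<psi>e)
  have "tr I d \<psi> e \<doteq> (\<Sum>i\<in>I. \<psi> i (r i *\<^sub>c e))"
    unfolding tr_def using r frameD(2)[OF f]
    by (intro cong_sum head_functional_cong[OF frameD(3)[OF f]]) auto
  also have "\<dots> \<doteq> s" unfolding s_def using r
    by (intro cong_sum head_functionalD(3)[OF frameD(3)[OF f]]) auto
  finally have 1: "tr I d \<psi> e \<doteq> s" .
  \<comment> \<open>Multiplying the expansion of \<open>e\<close> in the frame by \<open>e\<close>
    and replacing \<open>e \<star> d i\<close> by \<open>r i e\<close> shows \<open>e\<close> to be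
    congruent to \<open>s e\<close> modulo \<open>N\<close>. So \<open>(1 - s) e\<close> is not a
    unit, that is, \<open>s\<close> is congruent to \<open>1\<close>.\<close>
  have "(1 - s) *\<^sub>c e = (e - e \<star> (\<Sum>i\<in>I. \<psi> i e *\<^sub>c d i)) + (\<Sum>i\<in>I. \<psi> i e *\<^sub>c (e \<star> d i - r i *\<^sub>c e))"
  proof -
    have "(\<Sum>i\<in>I. \<psi> i e *\<^sub>c (e \<star> d i - r i *\<^sub>c e)) = e \<star> (\<Sum>i\<in>I. \<psi> i e *\<^sub>c d i) - (\<Sum>i\<in>I. (r i * \<psi> i e) *\<^sub>c e)"
      by (simp add: sc_diff_right sum_subtractf conv_sum_right mult.commute)
    also have "(\<Sum>i\<in>I. (r i * \<psi> i e) *\<^sub>c e) = s *\<^sub>c e"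
      unfolding s_def by (rule ext) (simp add: sum_apply sc_def sum_distrib_right)
    finally show ?thesis by (simp add: sc_diff_left)
  qed
  also have "\<dots> \<in> N"
  proof (rule N_add)
    have "e \<star> (e - (\<Sum>i\<in>I. \<psi> i e *\<^sub>c d i)) \<in> N" using frameD(4)[OF f L_e] by auto
    then show "e - e \<star> (\<Sum>i\<in>I. \<psi> i e *\<^sub>c d i) \<in> N" by (simp add: conv_diff_right)
    show "(\<Sum>i\<in>I. \<psi> i e *\<^sub>c (e \<star> d i - r i *\<^sub>c e)) \<in> N" by (intro N_sum N_sc r \<psi>e)
  qed
  finally have sN: "(1 - s) *\<^sub>c e \<in> N" .
  have "1 - s \<in> J"
  proof (rule ccontr)
    assume n: "1 - s \<notin> J"
    then have "cunit ((1 - s) *\<^sub>c e)" using sR by (intro cunit_sc cunit_e) auto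
    then show False using N_nonunit[OF sN e_RG] by simp
  qed
  then have "s \<doteq> 1" unfolding cong_J_def using minus_J[of "1 - s"] by simp
  with 1 show ?thesis by (rule cong_trans)
qed

end

section \<open>Invariant forms on the head\<close>

context primitive_idempotent begin

text \<open>Exactly bilinear and invariant on \<open>L\<close>, since the forms come from
  \<open>ip\<close>, but with \<open>N\<close> in the radical modulo \<open>J\<close>: such a form
  induces an invariant bilinear form on the head.\<close>

definition ebil :: "(('a \<Rightarrow> complex) \<Rightarrow> ('a \<Rightarrow> complex) \<Rightarrow> complex) \<Rightarrow> bool" where
  "ebil \<beta> \<longleftrightarrow>
     (\<forall>x\<in>L. \<forall>y\<in>L. \<beta> x y \<in> R) \<and>
     (\<forall>x\<in>L. \<forall>x'\<in>L. \<forall>y\<in>L. \<beta> (x + x') y = \<beta> x y + \<beta> x' y \<and> \<beta> y (x + x') = \<beta> y x + \<beta> y x') \<and>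
     (\<forall>r\<in>R. \<forall>x\<in>L. \<forall>y\<in>L. \<beta> (r *\<^sub>c x) y = r * \<beta> x y \<and> \<beta> x (r *\<^sub>c y) = r * \<beta> x y) \<and>
     (\<forall>a\<in>RG. \<forall>x\<in>L. \<forall>y\<in>L. \<beta> (a \<star> x) y = \<beta> x (star a \<star> y)) \<and>
     (\<forall>x\<in>N. \<forall>y\<in>L. \<beta> x y \<in> J \<and> \<beta> y x \<in> J)"

lemma ebilD:
  assumes "ebil \<beta>"
  shows "x \<in> L \<Longrightarrow> y \<in> L \<Longrightarrow> \<beta> x y \<in> R"
    "x \<in> L \<Longrightarrow> x' \<in> L \<Longrightarrow> y \<in> L \<Longrightarrow> \<beta> (x + x') y = \<beta> x y + \<beta> x' y"
    "x \<in> L \<Longrightarrow> x' \<in> L \<Longrightarrow> y \<in> L \<Longrightarrow> \<beta> y (x + x') = \<beta> y x + \<beta> y x'"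
    "r \<in> R \<Longrightarrow> x \<in> L \<Longrightarrow> y \<in> L \<Longrightarrow> \<beta> (r *\<^sub>c x) y = r * \<beta> x y"
    "r \<in> R \<Longrightarrow> x \<in> L \<Longrightarrow> y \<in> L \<Longrightarrow> \<beta> x (r *\<^sub>c y) = r * \<beta> x y"
    "a \<in> RG \<Longrightarrow> x \<in> L \<Longrightarrow> y \<in> L \<Longrightarrow> \<beta> (a \<star> x) y = \<beta> x (star a \<star> y)"
    "x \<in> N \<Longrightarrow> y \<in> L \<Longrightarrow> \<beta> x y \<in> J"
    "x \<in> N \<Longrightarrow> y \<in> L \<Longrightarrow> \<beta> y x \<in> J"
  using assms unfolding ebil_def by blast+

lemma ebil_functional:
  assumes b: "ebil \<beta>" and y: "y \<in> L" shows "head_functional (\<beta> y)" "head_functional (\<lambda>x. \<beta> x y)"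
  unfolding head_functional_def
  using ebilD(1)[OF b] ebilD(2-5)[OF b] ebilD(7,8)[OF b] y by (simp_all add: L_sc)

text \<open>The radical of an invariant form on a simple module is zero or everything. Concretely,
  \<open>y\<close> generates \<open>L\<close>, so \<open>y0\<close> is a multiple of
  \<open>y\<close>, and the multiplier moves to the other argument by invariance.\<close>

lemma ebil_nondegenerate:
  assumes b: "ebil \<beta>" and x0: "x0 \<in> L" "y0 \<in> L" "\<beta> x0 y0 \<notin> J" and y: "y \<in> L" "y \<notin> N"
  shows "\<exists>x\<in>L. \<beta> x y \<notin> J"
proof -
  obtain a where a: "a \<in> RG" "a \<star> y = e" using L_generator y by blast
  have "y0 = y0 \<star> (a \<star> y)" using a(2) x0(2) L_e_right by simp
  also have "\<dots> = star (star (y0 \<star> a)) \<star> y" by (simp add: conv_assoc)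
  finally have y0: "y0 = star (star (y0 \<star> a)) \<star> y" .
  have sR: "star (y0 \<star> a) \<in> RG" using x0(2) a(1) by auto
  have "\<beta> x0 y0 = \<beta> (star (y0 \<star> a) \<star> x0) y"
    using ebilD(6)[OF b sR x0(1) y(1)] y0 by metis
  moreover have "star (y0 \<star> a) \<star> x0 \<in> L" using x0(1) sR by auto
  ultimately show ?thesis using x0(3) by metis
qed

text \<open>A symmetric form comes from an arbitrary one by symmetrisation, unless the symmetrisation
  vanishes; but then the form is already symmetric since \<open>2 \<in> J\<close>.\<close>

lemma exists_symmetric_head_form:
  assumes c: "c \<in> RG" "d \<in> RG" "e \<star> c = c" "c \<star> star e = c" "star e \<star> d = d" "d \<star> e = d"
    "c \<star> d = e" "d \<star> c = star e"
    and fr: "frame I b \<psi>"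
  obtains \<beta> x0 y0 where "ebil \<beta>" "\<And>x y. x \<in> L \<Longrightarrow> y \<in> L \<Longrightarrow> \<beta> x y \<doteq> \<beta> y x"
    "x0 \<in> L" "y0 \<in> L" "\<beta> x0 y0 \<notin> J"
    "\<And>t z. t \<in> carrier G \<Longrightarrow> t \<otimes> t = \<one> \<Longrightarrow> z \<in> L \<Longrightarrow> star z \<star> dl t \<star> z \<in> N \<Longrightarrow> \<beta> (dl t \<star> z) z \<in> J"
proof -
  have dL: "d \<in> L" using c by (intro LI)
  have dN: "d \<notin> N"
  proof
    assume "d \<in> N"
    then have "c \<star> d \<in> N" using c(1) by auto
    then show False using c(7) e_notin_N by simp
  qed
  \<comment> \<open>Otherwise the frame would expand \<open>d\<close> inside \<open>N\<close>,
    whereas \<open>c \<star> d = e\<close> keeps \<open>d\<close> outside \<open>N\<close>.\<close>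
  have "\<exists>i\<in>I. \<psi> i d \<notin> J"
  proof (rule ccontr)
    assume "\<not> ?thesis"
    then have "(\<Sum>i\<in>I. \<psi> i d *\<^sub>c b i) \<in> N" using frameD(2)[OF fr] by (intro N_sum J_L_N) auto
    then have "d - (\<Sum>i\<in>I. \<psi> i d *\<^sub>c b i) + (\<Sum>i\<in>I. \<psi> i d *\<^sub>c b i) \<in> N"
      using frameD(4)[OF fr dL] by (intro N_add)
    then show False using dN by simp
  qed
  then obtain i where i: "i \<in> I" "\<psi> i d \<notin> J" by blast
  define \<phi> where "\<phi> = \<psi> i"
  have \<phi>: "head_functional \<phi>" unfolding \<phi>_def using frameD(3)[OF fr i(1)] .
  \<comment> \<open>\<open>\<phi>\<close> is linear only modulo \<open>J\<close>. Pairing with its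
    values on the generators gives the exactly linear \<open>ip x u\<close> in the same residue
    class.\<close>
  define u where "u = (\<lambda>g. if g \<in> carrier G then \<phi> (dl g \<star> e) else 0)"
  have u: "u \<in> RG"
    by (rule RG_I) (auto simp: u_def intro!: CG_I head_functionalD(1)[OF \<phi>] L_conv)
  have ipu: "ip x u \<doteq> \<phi> x" if x: "x \<in> L" for x
  proof -
    have "\<phi> x \<doteq> (\<Sum>g\<in>carrier G. x g * \<phi> (dl g \<star> e))"
      using head_functional_sum[OF \<phi> fin_G, of x "\<lambda>g. dl g \<star> e"] x
      by (subst L_expand[OF x]) auto
    also have "\<dots> = ip x u" by (simp add: ip_def u_def)
    finally show ?thesis by (rule cong_sym)
  qed
  define \<beta>0 where "\<beta>0 x y = ip (star y \<star> x) u" for x y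
  have starN: "star y \<star> x \<in> N" if "x \<in> L" "y \<in> L" "x \<in> N \<or> y \<in> N" for x y
    using that star_N_conv by (auto intro: N_conv RG_star)
  have \<beta>0N: "\<beta>0 x y \<in> J" if "x \<in> L" "y \<in> L" "star y \<star> x \<in> N" for x y
  proof -
    have "\<beta>0 x y \<doteq> \<phi> (star y \<star> x)" unfolding \<beta>0_def using that(3) by (intro ipu) auto
    then show ?thesis using head_functionalD(4)[OF \<phi> that(3)] cong_J_iff by blast
  qed
  have b0: "ebil \<beta>0"
    unfolding ebil_def
  proof (intro conjI ballI)
    fix x y assume "x \<in> L" "y \<in> L"
    then show "\<beta>0 x y \<in> R" unfolding \<beta>0_def using u by auto
  next
    fix a x y assume *: "a \<in> RG" "x \<in> L" "y \<in> L"
    then have "star (star a \<star> y) \<star> x = star y \<star> (a \<star> x)"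
      unfolding star_conv using star_star[OF RG_CG[OF *(1)]] by (simp add: conv_assoc)
    then show "\<beta>0 (a \<star> x) y = \<beta>0 x (star a \<star> y)" by (simp add: \<beta>0_def)
  next
    fix x y assume *: "x \<in> N" "y \<in> L"
    show "\<beta>0 x y \<in> J" using * starN[of x y] by (intro \<beta>0N) auto
    show "\<beta>0 y x \<in> J" using * starN[of y x] by (intro \<beta>0N) auto
  qed (simp_all add: \<beta>0_def conv_distribs star_add star_sc ip_add_left ip_sc_left)
  have "\<beta>0 d e \<doteq> \<phi> d" using ipu[OF dL] c(5) by (simp add: \<beta>0_def)
  then have nz: "\<beta>0 d e \<notin> J" using i(2) cong_J_iff by (auto simp: \<phi>_def)
  \<comment> \<open>If \<open>t\<close> is its own inverse, both orders of the arguments give the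
    same value; in a symmetrised form it is doubled and hence lies in \<open>J\<close>.\<close>
  have inv: "\<beta>0 (dl t \<star> z) z = ip (star z \<star> dl t \<star> z) u \<and> \<beta>0 z (dl t \<star> z) = ip (star z \<star> dl t \<star> z) u"
    if t: "t \<in> carrier G" "t \<otimes> t = \<one>" for t z
  proof -
    have "inv t = t" using t inv_equality by blast
    then show ?thesis by (simp add: \<beta>0_def star_conv star_dl t conv_assoc)
  qed
  have invJ: "\<beta>0 (dl t \<star> z) z \<in> J"
    if t: "t \<in> carrier G" "t \<otimes> t = \<one>" "z \<in> L" "star z \<star> dl t \<star> z \<in> N" for t z
    using \<beta>0N[of "dl t \<star> z" z] t by (auto simp: conv_assoc)
  show thesis
  proof (cases "\<forall>x\<in>L. \<forall>y\<in>L. \<beta>0 x y + \<beta>0 y x \<in> J")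
    case True
    have "\<beta>0 x y \<doteq> \<beta>0 y x" if "x \<in> L" "y \<in> L" for x y
    proof -
      have "\<beta>0 x y \<doteq> - \<beta>0 y x" unfolding cong_J_def using True that by simp
      also have "\<dots> \<doteq> \<beta>0 y x" by (rule cong_uminus) (rule ebilD(1)[OF b0 that(2,1)])
      finally show ?thesis .
    qed
    then show thesis using that[OF b0 _ dL L_e nz] invJ by blast
  next
    case False
    then obtain x1 y1 where xy: "x1 \<in> L" "y1 \<in> L" "\<beta>0 x1 y1 + \<beta>0 y1 x1 \<notin> J" by blast
    define \<beta> where "\<beta> x y = \<beta>0 x y + \<beta>0 y x" for x y
    have "ebil \<beta>"
      unfolding ebil_def
    proof (intro conjI ballI)
      fix a x y assume *: "a \<in> RG" "x \<in> L" "y \<in> L"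
      have "\<beta>0 y (a \<star> x) = \<beta>0 (star a \<star> y) x"
        using ebilD(6)[OF b0 RG_star[OF *(1)] *(3,2)] star_star[OF RG_CG[OF *(1)]] by simp
      then show "\<beta> (a \<star> x) y = \<beta> x (star a \<star> y)"
        using ebilD(6)[OF b0 *] by (simp add: \<beta>_def)
    qed (use ebilD(1-5)[OF b0] ebilD(7,8)[OF b0] in \<open>auto simp: \<beta>_def distrib_left\<close>)
    moreover have "\<beta> (dl t \<star> z) z \<in> J"
      if t: "t \<in> carrier G" "t \<otimes> t = \<one>" "z \<in> L" "star z \<star> dl t \<star> z \<in> N" for t z
    proof -
      have "\<beta>0 z (dl t \<star> z) = \<beta>0 (dl t \<star> z) z" using inv[OF t(1,2), of z] by metis
      then have "\<beta> (dl t \<star> z) z = \<beta>0 (dl t \<star> z) z + \<beta>0 (dl t \<star> z) z" by (simp only: \<beta>_def)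
      then show ?thesis using invJ[OF t] by auto
    qed
    moreover have "\<beta> x y \<doteq> \<beta> y x" for x y by (simp add: \<beta>_def add.commute)
    moreover have "\<beta> x1 y1 \<notin> J" using xy(3) by (simp add: \<beta>_def)
    ultimately show thesis using that[of \<beta> x1 y1] xy(1,2) by blast
  qed
qed

text \<open>Gram-Schmidt over the generators \<open>g e\<close> of \<open>L\<close>.\<close>

lemma form_frame:
  assumes b: "ebil \<beta>" and x0: "x0 \<in> L" "y0 \<in> L" "\<beta> x0 y0 \<notin> J"
    and sym: "\<And>x y. x \<in> L \<Longrightarrow> y \<in> L \<Longrightarrow> \<beta> x y \<doteq> \<beta> y x"
  obtains n d y where "frame {..<n::nat} d (\<lambda>i. \<beta> (y i))" "\<And>i. i < n \<Longrightarrow> y i \<in> L"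
proof -
  define good where "good n d y x \<longleftrightarrow> x - (\<Sum>i<n. \<beta> (y i) x *\<^sub>c d i) \<in> N" for n :: nat and d y x
  have fb: "head_functional (\<beta> z)" if "z \<in> L" for z using ebil_functional(1)[OF b that] .
  \<comment> \<open>Besides spanning the generators treated so far, \<open>d\<close> and
    \<open>y\<close> are kept dual to each other modulo \<open>J\<close>; the orthogonality
    computations of the next step rest on this.\<close>
  have "\<exists>n d y. (\<forall>i<n. d i \<in> L \<and> y i \<in> L) \<and>
     (\<forall>i<n. \<forall>j<n. \<beta> (y i) (d j) \<doteq> (if i = j then 1 else 0)) \<and> (\<forall>g\<in>S. good n d y (dl g \<star> e))"
    if "S \<subseteq> carrier G" for S
    using finite_subset[OF that fin_G] that
  proof (induction S rule: finite_induct)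
    case empty
    show ?case by (intro exI[of _ 0]) auto
  next
    case (insert g S)
    then obtain n d y where ndy: "\<forall>i<n. d i \<in> L \<and> y i \<in> L"
      "\<forall>i<n. \<forall>j<n. \<beta> (y i) (d j) \<doteq> (if i = j then 1 else 0)"
      "\<forall>g\<in>S. good n d y (dl g \<star> e)" by auto
    then have dy: "\<And>i. i < n \<Longrightarrow> d i \<in> L" "\<And>i. i < n \<Longrightarrow> y i \<in> L"
      and dual: "\<And>i j. i < n \<Longrightarrow> j < n \<Longrightarrow> \<beta> (y i) (d j) \<doteq> (if i = j then 1 else 0)"
      and S: "\<And>g. g \<in> S \<Longrightarrow> good n d y (dl g \<star> e)" by blast+
    define x where "x = dl g \<star> e"
    have x: "x \<in> L" using insert.prems by (auto simp: x_def)
    have \<beta>R: "\<beta> (y i) w \<in> R" if "i < n" "w \<in> L" for i w using ebilD(1)[OF b dy(2)] that by blast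
    \<comment> \<open>The part of the new generator that the old vectors miss. It is orthogonal
      modulo \<open>J\<close> to all old \<open>y j\<close>, and outside \<open>N\<close> it pairs
      to a unit with some \<open>w\<close>.\<close>
    define x' where "x' = x - (\<Sum>i<n. \<beta> (y i) x *\<^sub>c d i)"
    have sL: "(\<Sum>i<n. \<beta> (y i) x *\<^sub>c d i) \<in> L" by (intro L_sum L_sc \<beta>R[OF _ x] dy(1)) simp_all
    have x': "x' \<in> L" unfolding x'_def using x sL by auto
    show ?case
    proof (cases "x' \<in> N")
      case True
      then have "\<forall>g\<in>insert g S. good n d y (dl g \<star> e)" using S by (auto simp: good_def x'_def x_def)
      then show ?thesis using dy dual by blast
    next
      case False
      then obtain w where w: "w \<in> L" "\<beta> w x' \<notin> J" using ebil_nondegenerate[OF b x0 x'] by blast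
      define r where "r = inverse (\<beta> w x')"
      have wR: "\<beta> w x' \<in> R" using ebilD(1)[OF b w(1) x'] .
      have r: "r \<in> R" unfolding r_def using unit_R[OF wR w(2)] .
      have rw: "r * \<beta> w x' = 1" using w(2) zero_J unfolding r_def by (intro left_inverse) metis
      define v where "v = r *\<^sub>c w"
      have v: "v \<in> L" using r w(1) by (auto simp: v_def)
      have vx: "\<beta> v x' = 1" unfolding v_def using ebilD(4)[OF b r w(1) x'] rw by simp
      have vR: "\<beta> v (d i) \<in> R" if "i < n" for i using ebilD(1)[OF b v dy(1)[OF that]] .
      have orth: "\<beta> (y j) x' \<in> J" if j: "j < n" for j
      proof -
        note f = fb[OF dy(2)[OF j]]
        have "\<beta> (y j) (\<Sum>i<n. \<beta> (y i) x *\<^sub>c d i) \<doteq> (\<Sum>i<n. \<beta> (y i) x * \<beta> (y j) (d i))"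
          using dy(1) \<beta>R[OF _ x] by (intro head_functional_sum[OF f]) auto
        also have "\<dots> \<doteq> (\<Sum>i<n. \<beta> (y i) x * (if j = i then 1 else 0))"
          using dual[OF j] \<beta>R[OF _ x] by (intro cong_sum cong_mult_left) auto
        also have "\<dots> = \<beta> (y j) x" using j by (simp add: if_distrib[of "\<lambda>c. _ * c"] cong: if_cong)
        finally have 1: "\<beta> (y j) (\<Sum>i<n. \<beta> (y i) x *\<^sub>c d i) \<doteq> \<beta> (y j) x" .
        have "\<beta> (y j) x = \<beta> (y j) x' + \<beta> (y j) (\<Sum>i<n. \<beta> (y i) x *\<^sub>c d i)"
          using ebilD(3)[OF b x' sL dy(2)[OF j]] by (simp add: x'_def)
        then have "\<beta> (y j) x' = - (\<beta> (y j) (\<Sum>i<n. \<beta> (y i) x *\<^sub>c d i) - \<beta> (y j) x)" by simp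
        then show ?thesis using 1 unfolding cong_J_def by (simp only: minus_J_iff)
      qed
      \<comment> \<open>Subtracting its values on the old \<open>d i\<close> makes \<open>v'\<close>
        vanish on them modulo \<open>J\<close>. The value \<open>1\<close> at \<open>x'\<close>
        survives modulo \<open>J\<close> because \<open>x'\<close> is orthogonal to the old
        \<open>y i\<close>.\<close>
      define v' where "v' = v - (\<Sum>i<n. \<beta> v (d i) *\<^sub>c y i)"
      have tL: "(\<Sum>i<n. \<beta> v (d i) *\<^sub>c y i) \<in> L" by (intro L_sum L_sc vR dy(2)) simp_all
      have v': "v' \<in> L" unfolding v'_def using v tL by auto
      have v'_eval: "\<beta> v' z \<doteq> \<beta> v z - (\<Sum>i<n. \<beta> v (d i) * \<beta> (y i) z)" if z: "z \<in> L" for z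
      proof -
        have "\<beta> v z = \<beta> v' z + \<beta> (\<Sum>i<n. \<beta> v (d i) *\<^sub>c y i) z"
          using ebilD(2)[OF b v' tL z] by (simp add: v'_def)
        then have "\<beta> v' z = \<beta> v z - \<beta> (\<Sum>i<n. \<beta> v (d i) *\<^sub>c y i) z" by simp
        also have "\<dots> \<doteq> \<beta> v z - (\<Sum>i<n. \<beta> v (d i) * \<beta> (y i) z)"
          using dy(2) vR by (intro cong_diff cong_refl head_functional_sum[OF ebil_functional(2)[OF b z]]) auto
        finally show ?thesis .
      qed
      have v'd: "\<beta> v' (d j) \<in> J" if j: "j < n" for j
      proof -
        have "(\<Sum>i<n. \<beta> v (d i) * \<beta> (y i) (d j)) \<doteq> (\<Sum>i<n. \<beta> v (d i) * (if i = j then 1 else 0))"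
          using dual[OF _ j] vR by (intro cong_sum cong_mult_left) auto
        also have "\<dots> = \<beta> v (d j)" using j by (simp add: if_distrib[of "\<lambda>c. _ * c"] cong: if_cong)
        finally have "\<beta> v (d j) - (\<Sum>i<n. \<beta> v (d i) * \<beta> (y i) (d j)) \<in> J"
          using cong_sym unfolding cong_J_def by blast
        then show ?thesis using v'_eval[OF dy(1)[OF j]] cong_J_iff by blast
      qed
      have v'x': "\<beta> v' x' \<doteq> 1"
      proof -
        have "(\<Sum>i<n. \<beta> v (d i) * \<beta> (y i) x') \<in> J" by (intro sum_J mult_J orth vR) simp_all
        then have "\<beta> v x' - (\<Sum>i<n. \<beta> v (d i) * \<beta> (y i) x') \<doteq> 1"
          unfolding cong_J_def vx by simp
        with v'_eval[OF x'] show ?thesis by (rule cong_trans)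
      qed
      define d1 where "d1 = d(n := x')"
      define y1 where "y1 = y(n := v')"
      have s1: "(\<Sum>i<Suc n. \<beta> (y1 i) z *\<^sub>c d1 i) = (\<Sum>i<n. \<beta> (y i) z *\<^sub>c d i) + \<beta> v' z *\<^sub>c x'" for z
        by (simp add: d1_def y1_def)
      have v'good: "\<beta> v' z \<in> J" if z: "z \<in> L" "good n d y z" for z
      proof -
        have "(\<Sum>i<n. \<beta> (y i) z *\<^sub>c d i) \<in> L" by (intro L_sum L_sc \<beta>R[OF _ z(1)] dy(1)) simp_all
        then have "\<beta> v' z \<doteq> \<beta> v' (\<Sum>i<n. \<beta> (y i) z *\<^sub>c d i)"
          using z by (intro head_functional_cong[OF fb[OF v']]) (auto simp: good_def)
        also have "\<dots> \<doteq> (\<Sum>i<n. \<beta> (y i) z * \<beta> v' (d i))"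
          using dy(1) \<beta>R[OF _ z(1)] by (intro head_functional_sum[OF fb[OF v']]) auto
        finally have 1: "\<beta> v' z \<doteq> (\<Sum>i<n. \<beta> (y i) z * \<beta> v' (d i))" .
        have "(\<Sum>i<n. \<beta> (y i) z * \<beta> v' (d i)) \<in> J" by (intro sum_J mult_J v'd \<beta>R[OF _ z(1)]) simp_all
        then show ?thesis using 1 cong_J_iff by blast
      qed
      have good1: "good (Suc n) d1 y1 z" if z: "z \<in> L" "good n d y z" for z
      proof -
        have "z - (\<Sum>i<n. \<beta> (y i) z *\<^sub>c d i) - \<beta> v' z *\<^sub>c x' \<in> N"
          by (rule N_diff[OF z(2)[unfolded good_def] J_L_N[OF v'good[OF z] x']])
        then show ?thesis unfolding good_def s1 by (simp add: diff_diff_eq)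
      qed
      have goodx: "good (Suc n) d1 y1 x"
      proof -
        have "\<beta> v' x = \<beta> v' x' + \<beta> v' (\<Sum>i<n. \<beta> (y i) x *\<^sub>c d i)"
          using ebilD(3)[OF b x' sL v'] by (simp add: x'_def)
        also have "\<dots> \<doteq> 1 + (\<Sum>i<n. \<beta> (y i) x * \<beta> v' (d i))"
          by (intro cong_add v'x' head_functional_sum[OF fb[OF v']]) (simp_all add: dy(1) \<beta>R[OF _ x])
        also have "\<dots> \<doteq> 1 + 0"
        proof (intro cong_add cong_refl)
          have "(\<Sum>i<n. \<beta> (y i) x * \<beta> v' (d i)) \<in> J" by (intro sum_J mult_J v'd \<beta>R[OF _ x]) simp_all
          then show "(\<Sum>i<n. \<beta> (y i) x * \<beta> v' (d i)) \<doteq> 0" by (simp only: cong_0_iff)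
        qed
        finally have "1 - \<beta> v' x \<in> J" using cong_sym unfolding cong_J_def by simp
        then have "(1 - \<beta> v' x) *\<^sub>c x' \<in> N" using x' by auto
        then show ?thesis unfolding good_def s1 by (simp add: x'_def[symmetric] diff_diff_eq[symmetric] sc_diff_left)
      qed
      have "\<forall>g\<in>insert g S. good (Suc n) d1 y1 (dl g \<star> e)"
      proof
        fix h assume h: "h \<in> insert g S"
        show "good (Suc n) d1 y1 (dl h \<star> e)"
        proof (cases "h = g")
          case True
          then show ?thesis using goodx by (simp add: x_def)
        next
          case False
          then have "h \<in> S" using h by blast
          then show ?thesis using insert.prems by (intro good1 S) auto
        qed
      qed
      moreover have "\<forall>i<Suc n. d1 i \<in> L \<and> y1 i \<in> L" using dy x' v' by (auto simp: d1_def y1_def)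
      moreover have "\<forall>i<Suc n. \<forall>j<Suc n. \<beta> (y1 i) (d1 j) \<doteq> (if i = j then 1 else 0)"
        using dual v'x' v'd orth by (auto simp: d1_def y1_def less_Suc_eq cong_0_iff)
      ultimately show ?thesis by blast
    qed
  qed
  from this[of "carrier G"] obtain n d y where ndy: "\<forall>i<n. d i \<in> L \<and> y i \<in> L"
      "\<forall>g\<in>carrier G. good n d y (dl g \<star> e)" by auto
  then have dy: "\<And>i. i < n \<Longrightarrow> d i \<in> L" "\<And>i. i < n \<Longrightarrow> y i \<in> L"
    and gd: "\<And>g. g \<in> carrier G \<Longrightarrow> good n d y (dl g \<star> e)" by blast+
  have "x - (\<Sum>i<n. \<beta> (y i) x *\<^sub>c d i) \<in> N" if x: "x \<in> L" for x
  proof -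
    have R: "x g \<in> R" for g by (intro RG_R L_RG x)
    have ge: "dl g \<star> e \<in> L" if "g \<in> carrier G" for g using that by auto
    have \<beta>g: "\<beta> (y i) (dl g \<star> e) \<in> R" if "i < n" "g \<in> carrier G" for i g
      using ebilD(1)[OF b dy(2) ge] that by blast
    define c where "c i = (\<Sum>g\<in>carrier G. x g * \<beta> (y i) (dl g \<star> e))" for i
    have c: "\<beta> (y i) x - c i \<in> J" if i: "i < n" for i
    proof -
      have "\<beta> (y i) (\<Sum>g\<in>carrier G. x g *\<^sub>c (dl g \<star> e)) \<doteq> c i"
        unfolding c_def by (intro head_functional_sum[OF fb[OF dy(2)[OF i]]] fin_G R ge)
      then show ?thesis unfolding cong_J_def L_expand[OF x, symmetric] .
    qed
    \<comment> \<open>The defects of the generators combine to the defect of \<open>x\<close>, up to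
      the errors \<open>\<beta> (y i) x - c i\<close>, which lie in \<open>J\<close>.\<close>
    have n1: "(\<Sum>g\<in>carrier G. x g *\<^sub>c (dl g \<star> e - (\<Sum>i<n. \<beta> (y i) (dl g \<star> e) *\<^sub>c d i))) \<in> N"
      by (intro N_sum N_sc R gd[unfolded good_def])
    have n2: "(\<Sum>g\<in>carrier G. x g *\<^sub>c (dl g \<star> e - (\<Sum>i<n. \<beta> (y i) (dl g \<star> e) *\<^sub>c d i)))
        = x - (\<Sum>i<n. c i *\<^sub>c d i)"
    proof -
      have "(\<Sum>g\<in>carrier G. x g *\<^sub>c (dl g \<star> e - (\<Sum>i<n. \<beta> (y i) (dl g \<star> e) *\<^sub>c d i)))
        = (\<Sum>g\<in>carrier G. x g *\<^sub>c (dl g \<star> e)) - (\<Sum>g\<in>carrier G. \<Sum>i<n. (x g * \<beta> (y i) (dl g \<star> e)) *\<^sub>c d i)"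
        by (simp only: sc_diff_right sum_subtractf sc_sum sc_sc)
      also have "(\<Sum>g\<in>carrier G. \<Sum>i<n. (x g * \<beta> (y i) (dl g \<star> e)) *\<^sub>c d i) = (\<Sum>i<n. c i *\<^sub>c d i)"
        unfolding c_def by (subst sum.swap, rule sum.cong[OF refl], rule ext)
          (simp add: sum_apply sc_def sum_distrib_right)
      finally show ?thesis using L_expand[OF x] by simp
    qed
    have n3: "(\<Sum>i<n. (\<beta> (y i) x - c i) *\<^sub>c d i) \<in> N" by (intro N_sum J_L_N c dy(1)) simp_all
    have "x - (\<Sum>i<n. c i *\<^sub>c d i) - (\<Sum>i<n. (\<beta> (y i) x - c i) *\<^sub>c d i) \<in> N"
      using N_diff[OF n1[unfolded n2] n3] .
    then show ?thesis by (simp add: sc_diff_left sum_subtractf)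
  qed
  then have "frame {..<n} d (\<lambda>i. \<beta> (y i))"
    unfolding frame_def using dy fb by auto
  then show thesis using that dy(2) by blast
qed

text \<open>In dual bases for a symmetric form, passing from \<open>a\<close> to
  \<open>star a\<close> transposes the matrix, which preserves the trace.\<close>

lemma tr_symmetric:
  assumes b: "ebil \<beta>" and sym: "\<And>x y. x \<in> L \<Longrightarrow> y \<in> L \<Longrightarrow> \<beta> x y \<doteq> \<beta> y x"
    and x0: "x0 \<in> L" "y0 \<in> L" "\<beta> x0 y0 \<notin> J"
    and fr: "frame I f \<psi>" and a: "a \<in> RG"
  shows "tr I f \<psi> (star a) \<doteq> tr I f \<psi> a"
proof -
  obtain n d y where fd: "frame {..<n::nat} d (\<lambda>i. \<beta> (y i))" and y: "\<And>i. i < n \<Longrightarrow> y i \<in> L"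
    using form_frame[OF b x0 sym] by blast
  have d: "\<And>i. i < n \<Longrightarrow> d i \<in> L" using frameD(2)[OF fd] by auto
  \<comment> \<open>Exchanging the two systems again gives a frame. A defect outside
    \<open>N\<close> would pair to a unit with some \<open>w\<close>, but expanding \<open>w\<close>
    in the first frame and using symmetry puts the pairing into \<open>J\<close>.\<close>
  have fd': "frame {..<n} y (\<lambda>i. \<beta> (d i))"
    unfolding frame_def
  proof (intro conjI ballI)
    fix x assume x: "x \<in> L"
    have \<beta>R: "\<beta> (d i) x \<in> R" if "i < n" for i using ebilD(1)[OF b d[OF that] x] .
    have sL: "(\<Sum>i<n. \<beta> (d i) x *\<^sub>c y i) \<in> L" by (intro L_sum L_sc y \<beta>R) simp_all
    show "x - (\<Sum>i<n. \<beta> (d i) x *\<^sub>c y i) \<in> N"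
    proof (rule ccontr)
      assume n: "x - (\<Sum>i<n. \<beta> (d i) x *\<^sub>c y i) \<notin> N"
      have xs: "x - (\<Sum>i<n. \<beta> (d i) x *\<^sub>c y i) \<in> L" using x sL by auto
      obtain w where w: "w \<in> L" "\<beta> w (x - (\<Sum>i<n. \<beta> (d i) x *\<^sub>c y i)) \<notin> J"
        using ebil_nondegenerate[OF b x0 xs n] by blast
      have "\<beta> w x \<doteq> \<beta> x w" using sym w x by blast
      also have "\<beta> x w \<doteq> \<beta> x (dl \<one> \<star> w)" using w by simp
      also have "\<beta> x (dl \<one> \<star> w) \<doteq> (\<Sum>i\<in>{..<n}. \<beta> (y i) w * \<beta> x (dl \<one> \<star> d i))"
        by (rule frame_functional_expand[OF fd ebil_functional(1)[OF b x] RG_dl[OF one_closed] w(1)])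
      also have "\<dots> \<doteq> (\<Sum>i<n. \<beta> (d i) x * \<beta> w (y i))"
      proof (rule cong_sum)
        fix i assume i: "i \<in> {..<n}"
        have "dl \<one> \<star> d i = d i" using d i by simp
        moreover have "\<beta> (y i) w * \<beta> x (d i) \<doteq> \<beta> w (y i) * \<beta> (d i) x"
          using i y d w x sym ebilD(1)[OF b] by (intro cong_mult) auto
        ultimately show "\<beta> (y i) w * \<beta> x (dl \<one> \<star> d i) \<doteq> \<beta> (d i) x * \<beta> w (y i)" by (simp add: mult.commute)
      qed
      also have "\<dots> \<doteq> \<beta> w (\<Sum>i<n. \<beta> (d i) x *\<^sub>c y i)"
        using y \<beta>R by (intro cong_sym[OF head_functional_sum[OF ebil_functional(1)[OF b w(1)]]]) auto
      finally have "\<beta> w x - \<beta> w (\<Sum>i<n. \<beta> (d i) x *\<^sub>c y i) \<in> J" by (simp add: cong_J_def)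
      moreover have "\<beta> w x = \<beta> w (x - (\<Sum>i<n. \<beta> (d i) x *\<^sub>c y i)) + \<beta> w (\<Sum>i<n. \<beta> (d i) x *\<^sub>c y i)"
        using ebilD(3)[OF b xs sL w(1)] by simp
      ultimately show False using w(2) by simp
    qed
  qed (use y ebil_functional(1)[OF b d] in auto)
  have "tr I f \<psi> (star a) \<doteq> tr {..<n} y (\<lambda>i. \<beta> (d i)) (star a)"
    using a by (intro tr_independent[OF fr fd']) auto
  also have "\<dots> = (\<Sum>i<n. \<beta> (a \<star> d i) (y i))"
    unfolding tr_def using ebilD(6)[OF b a d y] by auto
  also have "\<dots> \<doteq> (\<Sum>i<n. \<beta> (y i) (a \<star> d i))"
    using y d a by (intro cong_sum sym) auto
  also have "\<dots> \<doteq> tr I f \<psi> a"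
    using tr_independent[OF fd fr a] by (simp add: tr_def)
  finally show ?thesis .
qed

text \<open>Two involutions \<open>t\<close>, \<open>t'\<close> for which \<open>\<beta>(tz,z)\<close> and \<open>\<beta>(t'z,z)\<close> vanish give alternating
  matrices, and the trace of a product of two alternating matrices vanishes modulo \<open>2\<close>.\<close>

lemma tr_product_of_involutions:
  assumes b: "ebil \<beta>" and sym: "\<And>x y. x \<in> L \<Longrightarrow> y \<in> L \<Longrightarrow> \<beta> x y \<doteq> \<beta> y x"
    and x0: "x0 \<in> L" "y0 \<in> L" "\<beta> x0 y0 \<notin> J"
    and fr: "frame I f \<psi>"
    and t: "t \<in> carrier G" "t \<otimes> t = \<one>" "t' \<in> carrier G" "t' \<otimes> t' = \<one>"
    and alt: "\<And>z. z \<in> L \<Longrightarrow> \<beta> (dl t \<star> z) z \<in> J" "\<And>z. z \<in> L \<Longrightarrow> \<beta> (dl t' \<star> z) z \<in> J"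
  shows "tr I f \<psi> (dl (t \<otimes> t')) \<in> J"
proof -
  obtain n d y where fd: "frame {..<n::nat} d (\<lambda>i. \<beta> (y i))" and y: "\<And>i. i < n \<Longrightarrow> y i \<in> L"
    using form_frame[OF b x0 sym] by blast
  have d: "\<And>i. i < n \<Longrightarrow> d i \<in> L" using frameD(2)[OF fd] by auto
  have st: "star (dl t) = dl t" "star (dl t') = dl t'"
    using t star_dl inv_equality by metis+
  have tz: "dl t \<star> z \<in> L" "dl t' \<star> z \<in> L" if "z \<in> L" for z using that t by auto
  have swap: "\<beta> (dl t \<star> x) z = \<beta> x (dl t \<star> z)" "\<beta> (dl t' \<star> x) z = \<beta> x (dl t' \<star> z)" if "x \<in> L" "z \<in> L" for x z
    using ebilD(6)[OF b _ that] t st by auto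
  \<comment> \<open>The product of the \<open>(i, j)\<close> entries of the Gram matrices of
    \<open>t\<close> on the \<open>y i\<close> and of \<open>t'\<close> on the \<open>d i\<close>.
    Both are symmetric modulo \<open>J\<close> with diagonal in \<open>J\<close>, so the terms of
    the sum cancel in pairs modulo \<open>J\<close>.\<close>
  define h where "h = (\<lambda>(i, j). \<beta> (y j) (dl t \<star> y i) * \<beta> (d j) (dl t' \<star> d i))"
  have "tr {..<n} d (\<lambda>i. \<beta> (y i)) (dl (t \<otimes> t')) = (\<Sum>i<n. \<beta> (dl t \<star> y i) (dl t' \<star> d i))"
    unfolding tr_def dl_conv_dl[OF t(1,3), symmetric] conv_assoc using swap y tz d by auto
  also have "\<dots> \<doteq> (\<Sum>i<n. \<Sum>j<n. h (i, j))"
  proof (rule cong_sum)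
    fix i assume "i \<in> {..<n}"
    then have i: "i < n" by simp
    have yi: "dl t \<star> y i \<in> L" "dl t' \<star> d i \<in> L" by (intro tz y d i)+
    have "\<beta> (dl \<one> \<star> (dl t \<star> y i)) (dl t' \<star> d i)
        \<doteq> (\<Sum>j\<in>{..<n}. \<beta> (y j) (dl t \<star> y i) * \<beta> (dl \<one> \<star> d j) (dl t' \<star> d i))"
      using frame_functional_expand[OF fd ebil_functional(2)[OF b yi(2)] RG_dl[OF one_closed] yi(1)] .
    also have "dl \<one> \<star> (dl t \<star> y i) = dl t \<star> y i" by (rule one_conv_L[OF yi(1)])
    also have "(\<Sum>j<n. \<beta> (y j) (dl t \<star> y i) * \<beta> (dl \<one> \<star> d j) (dl t' \<star> d i)) = (\<Sum>j<n. h (i, j))"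
      unfolding h_def by (rule sum.cong[OF refl]) (simp add: one_conv_L[OF d])
    finally show "\<beta> (dl t \<star> y i) (dl t' \<star> d i) \<doteq> (\<Sum>j<n. h (i, j))" .
  qed
  also have "(\<Sum>i<n. \<Sum>j<n. h (i, j)) = sum h ({..<n} \<times> {..<n})"
    by (simp add: sum.cartesian_product)
  finally have 1: "tr {..<n} d (\<lambda>i. \<beta> (y i)) (dl (t \<otimes> t')) \<doteq> sum h ({..<n} \<times> {..<n})" .
  have m: "\<beta> (y j) (dl t \<star> y i) \<in> R" "\<beta> (d j) (dl t' \<star> d i) \<in> R" if "i < n" "j < n" for i j
    by (rule ebilD(1)[OF b], rule y[OF that(2)], rule tz(1)[OF y[OF that(1)]])
      (rule ebilD(1)[OF b], rule d[OF that(2)], rule tz(2)[OF d[OF that(1)]])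
  have hs: "h (j, i) \<doteq> h (i, j)" if "i < n" "j < n" for i j
  proof -
    have "\<beta> (y i) (dl t \<star> y j) \<doteq> \<beta> (y j) (dl t \<star> y i)"
      using sym[OF tz(1)[OF y[OF that(1)]] y[OF that(2)]] swap(1)[OF y[OF that(1)] y[OF that(2)]] by simp
    moreover have "\<beta> (d i) (dl t' \<star> d j) \<doteq> \<beta> (d j) (dl t' \<star> d i)"
      using sym[OF tz(2)[OF d[OF that(1)]] d[OF that(2)]] swap(2)[OF d[OF that(1)] d[OF that(2)]] by simp
    ultimately show ?thesis
      unfolding h_def prod.case by (rule cong_mult[OF m(1)[OF that(2,1)] m(2)[OF that]])
  qed
  have hd: "h (i, i) \<in> J" if "i < n" for i
    unfolding h_def prod.case
    using alt(1)[OF y[OF that]] swap(1)[OF y[OF that] y[OF that]] m(2)[OF that that] by (simp add: mult_J_right)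
  have hR: "h (i, j) \<in> R" if "i < n" "j < n" for i j
    unfolding h_def prod.case using m[OF that] by (rule mult_R)
  have "sum h ({..<n} \<times> {..<n}) \<in> J"
  proof (rule sum_involution[where f = prod.swap and h = h and I = J and X = "{..<n} \<times> {..<n}"])
    show "twoR \<subseteq> J" by (auto intro: twoR_J)
  next
    fix p assume "p \<in> {..<n} \<times> {..<n}"
    then show "h p \<in> R" using hR by (cases p) simp
  next
    fix p assume "p \<in> {..<n} \<times> {..<n}"
    then show "h (prod.swap p) - h p \<in> J" using hs[unfolded cong_J_def] by (cases p) simp
  next
    fix p assume p: "p \<in> {..<n} \<times> {..<n}" "prod.swap p = p"
    have "fst p = snd p" using arg_cong[OF p(2), of snd] by (simp only: prod.swap_def snd_conv)
    then have "p = (snd p, snd p)" by (metis prod.collapse)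
    moreover have "h (snd p, snd p) \<in> J" using hd p(1) by (metis SigmaE lessThan_iff snd_conv)
    ultimately show "h p \<in> J" by metis
  next
    fix a b assume "a \<in> J" "b \<in> J" then show "a + b \<in> J" by (rule add_J)
  qed auto
  then have "tr {..<n} d (\<lambda>i. \<beta> (y i)) (dl (t \<otimes> t')) \<in> J" using 1 cong_J_iff by blast
  moreover have "tr I f \<psi> (dl (t \<otimes> t')) \<doteq> tr {..<n} d (\<lambda>i. \<beta> (y i)) (dl (t \<otimes> t'))"
    using t by (intro tr_independent[OF fr fd]) auto
  ultimately show ?thesis using cong_J_iff by blast
qed

end

section \<open>Class sums\<close>

context group_algebra begin

lemma inv_cancel:
  assumes "a \<in> carrier G" "y \<in> carrier G"
  shows "inv a \<otimes> (a \<otimes> y) = y" "a \<otimes> (inv a \<otimes> y) = y"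
  using assms by (simp_all add: m_assoc[symmetric])

definition cls :: "'g \<Rightarrow> 'g set" where "cls g = (\<lambda>h. h \<otimes> g \<otimes> inv h) ` carrier G"

definition conj_closed :: "'g set \<Rightarrow> bool" where
  "conj_closed K \<longleftrightarrow> K \<subseteq> carrier G \<and> (\<forall>h\<in>carrier G. \<forall>k\<in>K. h \<otimes> k \<otimes> inv h \<in> K)"

definition csum :: "'g set \<Rightarrow> ('g \<Rightarrow> complex) \<Rightarrow> complex" where "csum K x = sum x K"

definition factor_pairs :: "'g set \<Rightarrow> ('g \<times> 'g) set" where
  "factor_pairs K = {(u, v). u \<in> carrier G \<and> v \<in> carrier G \<and> u \<otimes> v \<in> K}"

lemma cls_conj_closed: assumes g: "g \<in> carrier G" shows "conj_closed (cls g)"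
  unfolding conj_closed_def
proof (intro conjI ballI)
  show "cls g \<subseteq> carrier G" using g by (auto simp: cls_def)
  fix h k assume h: "h \<in> carrier G" and "k \<in> cls g"
  then obtain a where a: "a \<in> carrier G" "k = a \<otimes> g \<otimes> inv a" by (auto simp: cls_def)
  have "h \<otimes> k \<otimes> inv h = (h \<otimes> a) \<otimes> g \<otimes> inv (h \<otimes> a)"
    using a(1) g h unfolding a(2) by (simp add: inv_mult_group m_assoc)
  then show "h \<otimes> k \<otimes> inv h \<in> cls g" unfolding cls_def using a(1) h by blast
qed

lemma self_cls: "g \<in> carrier G \<Longrightarrow> g \<in> cls g"
  unfolding cls_def by (rule image_eqI[of _ _ \<one>]) auto

lemma cls_sym: assumes g: "g \<in> carrier G" and x: "x \<in> cls g" shows "g \<in> cls x"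
proof -
  obtain a where a: "a \<in> carrier G" "x = a \<otimes> g \<otimes> inv a" using x by (auto simp: cls_def)
  have "inv a \<otimes> x \<otimes> inv (inv a) = g"
    unfolding a(2) using a(1) g by (simp add: m_assoc inv_cancel)
  then have "g = inv a \<otimes> x \<otimes> inv (inv a)" by (rule sym)
  then show ?thesis unfolding cls_def using a(1) by blast
qed

lemma cls_subset: assumes g: "g \<in> carrier G" and x: "x \<in> cls g" shows "cls x \<subseteq> cls g"
  using cls_conj_closed[OF g] x unfolding conj_closed_def cls_def[of x] by blast

lemma cls_eq: assumes g: "g \<in> carrier G" and x: "x \<in> cls g" shows "cls x = cls g"
proof -
  have "x \<in> carrier G" using cls_conj_closed[OF g] x by (auto simp: conj_closed_def)
  then show ?thesis using cls_subset[OF g x] cls_subset[OF _ cls_sym[OF g x]] by (intro equalityI)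
qed

lemma conj_closed_swap:
  assumes K: "conj_closed K" and u: "u \<in> carrier G" "v \<in> carrier G" "u \<otimes> v \<in> K" shows "v \<otimes> u \<in> K"
proof -
  have "v \<otimes> (u \<otimes> v) \<otimes> inv v \<in> K" using K u by (auto simp: conj_closed_def)
  then show ?thesis using u by (simp add: m_assoc)
qed

lemma factor_pairs_finite: "finite (factor_pairs K)"
  by (rule finite_subset[of _ "carrier G \<times> carrier G"]) (auto simp: factor_pairs_def)

lemma csum_conv:
  assumes K: "K \<subseteq> carrier G"
  shows "csum K (x \<star> y) = (\<Sum>(u, v)\<in>factor_pairs K. x u * y v)"
proof -
  have "csum K (x \<star> y) = (\<Sum>k\<in>K. \<Sum>h\<in>carrier G. x h * y (inv h \<otimes> k))"
    unfolding csum_def conv_def using K by (intro sum.cong) auto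
  also have "\<dots> = (\<Sum>(k, h)\<in>K \<times> carrier G. x h * y (inv h \<otimes> k))"
    by (rule sum.cartesian_product)
  also have "\<dots> = (\<Sum>(u, v)\<in>factor_pairs K. x u * y v)"
    by (rule sum.reindex_bij_witness[of _ "\<lambda>(u, v). (u \<otimes> v, u)" "\<lambda>(k, h). (h, inv h \<otimes> k)"])
      (use K in \<open>auto simp: factor_pairs_def m_assoc[symmetric]\<close>)
  finally show ?thesis .
qed

text \<open>\<open>v \<otimes> u\<close> is conjugate to \<open>u \<otimes> v\<close>, so summing
  coefficients over a union of classes is a trace form.\<close>

lemma csum_conv_commute:
  assumes K: "conj_closed K" shows "csum K (x \<star> y) = csum K (y \<star> x)"
proof -
  have KG: "K \<subseteq> carrier G" using K by (simp add: conj_closed_def)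
  show ?thesis unfolding csum_conv[OF KG]
    by (rule sum.reindex_bij_witness[of _ prod.swap prod.swap])
      (auto simp: factor_pairs_def conj_closed_swap[OF K])
qed

lemma csum_star:
  assumes K: "K \<subseteq> carrier G" shows "csum K (star x) = csum ((\<lambda>k. inv k) ` K) x"
proof -
  have "inj_on (\<lambda>k. inv k) K" using K by (intro inj_onI) (metis inv_inv subsetD)
  then have "csum ((\<lambda>k. inv k) ` K) x = (\<Sum>k\<in>K. x (inv k))"
    unfolding csum_def by (simp add: sum.reindex)
  also have "\<dots> = csum K (star x)" unfolding csum_def star_def using K by (intro sum.cong) auto
  finally show ?thesis by simp
qed

text \<open>The pairs \<open>(u, v)\<close> with \<open>uv \<in> K\<close> cancel against \<open>(u\<inverse>, v\<inverse>)\<close>, unless both \<open>u\<close> and \<open>v\<close> are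
  involutions; but then \<open>uv\<close> is strongly real.\<close>

lemma csum_symmetric_conv:
  assumes K: "conj_closed K" "\<And>k. k \<in> K \<Longrightarrow> inv k \<in> K"
    and cd: "c \<in> RG" "d \<in> RG" "star c = c" "star d = d"
    and K2: "\<And>u v. u \<in> carrier G \<Longrightarrow> v \<in> carrier G \<Longrightarrow> u \<otimes> u = \<one> \<Longrightarrow> v \<otimes> v = \<one> \<Longrightarrow> u \<otimes> v \<notin> K"
  shows "csum K (c \<star> d) \<in> twoR"
proof -
  have KG: "K \<subseteq> carrier G" using K by (simp add: conj_closed_def)
  have inv_c: "c (inv u) = c u" "d (inv u) = d u" if "u \<in> carrier G" for u
    using fun_cong[OF cd(3), of u] fun_cong[OF cd(4), of u] that by (simp_all add: star_def)
  show ?thesis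
    unfolding csum_conv[OF KG]
  proof (rule sum_involution[OF factor_pairs_finite, where f = "\<lambda>(u, v). (inv u, inv v)" and I = twoR])
    fix p assume "p \<in> factor_pairs K"
    then obtain u v where p: "p = (u, v)" "u \<in> carrier G" "v \<in> carrier G" "u \<otimes> v \<in> K"
      by (auto simp: factor_pairs_def)
    have "inv u \<otimes> inv v = inv (v \<otimes> u)" using p by (simp add: inv_mult_group)
    then have "inv u \<otimes> inv v \<in> K" using K(2) conj_closed_swap[OF K(1) p(2-4)] by simp
    then show "(case p of (u, v) \<Rightarrow> (inv u, inv v)) \<in> factor_pairs K"
      using p by (simp add: factor_pairs_def)
    show "(case case p of (u, v) \<Rightarrow> (inv u, inv v) of (u, v) \<Rightarrow> (inv u, inv v)) = p" using p by simp
    show "(case p of (u, v) \<Rightarrow> c u * d v) \<in> R" using cd(1,2) p by (auto intro: RG_R)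
    show "(case case p of (u, v) \<Rightarrow> (inv u, inv v) of (u, v) \<Rightarrow> c u * d v) - (case p of (u, v) \<Rightarrow> c u * d v) \<in> twoR"
      using p inv_c by simp
  next
    fix p assume "p \<in> factor_pairs K" and fixp: "(case p of (u, v) \<Rightarrow> (inv u, inv v)) = p"
    then obtain u v where p: "p = (u, v)" "u \<in> carrier G" "v \<in> carrier G" "u \<otimes> v \<in> K"
      by (auto simp: factor_pairs_def)
    have "inv u = u" "inv v = v" using fixp p(1) by simp_all
    then have "u \<otimes> u = \<one>" "v \<otimes> v = \<one>" using p(2,3) by (metis r_inv)+
    then show "(case p of (u, v) \<Rightarrow> c u * d v) \<in> twoR" using K2 p by blast
  qed (auto intro: twoR_add)
qed

lemma sum_square_cong:
  assumes "finite S" "\<And>s. s \<in> S \<Longrightarrow> a s \<in> R" shows "(\<Sum>s\<in>S. a s * a s) \<doteq> sum a S * sum a S"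
  using assms
proof (induction S rule: finite_induct)
  case (insert s S)
  have R: "a s \<in> R" "sum a S \<in> R" using insert.prems by auto
  then have "2 * (a s * sum a S) \<in> J" by auto
  then have *: "(a s * a s + sum a S * sum a S) \<doteq> (a s + sum a S) * (a s + sum a S)"
    unfolding cong_J_def using minus_J[of "2 * (a s * sum a S)"] by (simp add: algebra_simps)
  have "a s * a s + (\<Sum>s\<in>S. a s * a s) \<doteq> a s * a s + sum a S * sum a S"
    using insert by (intro cong_add) auto
  from cong_trans[OF this *] show ?case unfolding sum.insert[OF insert.hyps(1,2)] .
qed simp

definition sqrt_set :: "'g set \<Rightarrow> 'g set" where "sqrt_set K = {u \<in> carrier G. u \<otimes> u \<in> K}"

lemma sqrt_set_conj_closed: assumes K: "conj_closed K" shows "conj_closed (sqrt_set K)"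
  unfolding conj_closed_def
proof (intro conjI ballI)
  fix h u assume h: "h \<in> carrier G" and u: "u \<in> sqrt_set K"
  then have uG: "u \<in> carrier G" "u \<otimes> u \<in> K" by (auto simp: sqrt_set_def)
  have "(h \<otimes> u \<otimes> inv h) \<otimes> (h \<otimes> u \<otimes> inv h) = h \<otimes> (u \<otimes> u) \<otimes> inv h"
    using h uG by (simp add: m_assoc inv_cancel)
  moreover have "h \<otimes> (u \<otimes> u) \<otimes> inv h \<in> K" using K h uG by (simp add: conj_closed_def)
  ultimately have "(h \<otimes> u \<otimes> inv h) \<otimes> (h \<otimes> u \<otimes> inv h) \<in> K" by simp
  then show "h \<otimes> u \<otimes> inv h \<in> sqrt_set K" using h uG by (simp add: sqrt_set_def)
qed (auto simp: sqrt_set_def)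

text \<open>Modulo \<open>J\<close> the terms of \<open>(u, v)\<close> and \<open>(v, u)\<close>
  cancel, both products lying in \<open>K\<close>. What remains are squares of coefficients, and
  squaring is additive modulo \<open>2\<close>.\<close>

lemma csum_square:
  assumes K: "conj_closed K" and x: "x \<in> RG"
  shows "csum K (x \<star> x) \<doteq> csum (sqrt_set K) x * csum (sqrt_set K) x"
proof -
  have KG: "K \<subseteq> carrier G" using K by (simp add: conj_closed_def)
  have xR: "x g \<in> R" for g using x by (rule RG_R)
  define h where "h = (\<lambda>(u, v). if u = v then 0 else x u * x v)"
  define k where "k = (\<lambda>(u, v). if u = v then x u * x v else 0)"
  have "sum h (factor_pairs K) \<in> J"
  proof (rule sum_involution[OF factor_pairs_finite, where f = "prod.swap" and I = J and h = h])
    show "twoR \<subseteq> J" by (auto intro: twoR_J)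
    show "prod.swap p \<in> factor_pairs K" if "p \<in> factor_pairs K" for p
      using that conj_closed_swap[OF K] by (auto simp: factor_pairs_def)
    show "h p \<in> R" for p using xR by (cases p) (auto simp: h_def)
    show "h (prod.swap p) - h p \<in> J" for p by (cases p) (auto simp: h_def mult.commute)
    fix p :: "'g \<times> 'g" assume p: "prod.swap p = p"
    have "fst p = snd p" using arg_cong[OF p, of snd] by (simp only: prod.swap_def snd_conv)
    then show "h p \<in> J" by (simp add: h_def case_prod_unfold)
  qed auto
  moreover have "csum K (x \<star> x) = sum h (factor_pairs K) + sum k (factor_pairs K)"
    unfolding csum_conv[OF KG] sum.distrib[symmetric]
    by (intro sum.cong) (auto simp: h_def k_def)
  ultimately have "csum K (x \<star> x) \<doteq> sum k (factor_pairs K)" by (simp add: cong_J_def)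
  also have "sum k (factor_pairs K) = (\<Sum>u\<in>sqrt_set K. x u * x u)"
  proof -
    have "sum k (factor_pairs K) = sum k ((\<lambda>u. (u, u)) ` sqrt_set K)"
      by (rule sum.mono_neutral_right[OF factor_pairs_finite]) (auto simp: factor_pairs_def sqrt_set_def k_def)
    also have "\<dots> = (\<Sum>u\<in>sqrt_set K. x u * x u)"
      by (subst sum.reindex) (auto simp: inj_on_def k_def)
    finally show ?thesis .
  qed
  also have "\<dots> \<doteq> csum (sqrt_set K) x * csum (sqrt_set K) x"
    unfolding csum_def using xR by (intro sum_square_cong) (auto simp: sqrt_set_def)
  finally show ?thesis .
qed

text \<open>For an idempotent, \<open>csum_square\<close> replaces \<open>K\<close> by its set of
  square roots and squares the value. After \<open>m\<close> such steps the set consists of the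
  \<open>2 ^ m\<close>-th roots of elements of \<open>K\<close>, and there are none.\<close>

lemma csum_idempotent_vanishes:
  assumes x: "x \<in> RG" "x \<star> x = x"
  shows "conj_closed K \<Longrightarrow> (\<And>u. u \<in> carrier G \<Longrightarrow> u [^] (2 ^ m :: nat) \<notin> K) \<Longrightarrow> csum K x \<in> J"
proof (induction m arbitrary: K)
  case 0
  then have "K = {}" by (auto simp: conj_closed_def)
  then show ?case by (simp add: csum_def)
next
  case (Suc m)
  have "csum (sqrt_set K) x \<in> J"
  proof (rule Suc.IH)
    show "conj_closed (sqrt_set K)" by (rule sqrt_set_conj_closed) fact
    fix u assume u: "u \<in> carrier G"
    have "u [^] (2 ^ m :: nat) \<otimes> u [^] (2 ^ m :: nat) = u [^] (2 ^ Suc m :: nat)"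
      using u by (simp add: nat_pow_mult mult_2)
    then show "u [^] (2 ^ m :: nat) \<notin> sqrt_set K" using Suc.prems(2)[OF u] by (simp add: sqrt_set_def)
  qed
  moreover have "csum (sqrt_set K) x \<in> R" unfolding csum_def using x by (auto intro: RG_R)
  ultimately have "csum (sqrt_set K) x * csum (sqrt_set K) x \<in> J" by auto
  then show ?case using csum_square[OF Suc.prems(1) x(1)] cong_J_iff x(2) by metis
qed

text \<open>The group order is a crude bound for the multiplicity of \<open>2\<close> in
  \<open>ord u\<close>, chosen so that one exponent serves all elements.\<close>

lemma odd_ord_power: assumes u: "u \<in> carrier G" shows "odd (ord (u [^] (2 ^ Coset.order G :: nat)))"
proof -
  have o0: "ord u > 0" using u ord_ge_1[OF fin_G u] by simp
  obtain q where q: "ord u = 2 ^ multiplicity 2 (ord u) * q" "\<not> 2 dvd q"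
    using multiplicity_decompose'[of "ord u" "2::nat"] o0 by auto
  have "multiplicity 2 (ord u) \<le> Coset.order G"
  proof -
    have "multiplicity 2 (ord u) < 2 ^ multiplicity 2 (ord u)" by simp
    also have "\<dots> \<le> ord u" using q(1) o0 by (metis dvd_imp_le dvd_triv_left)
    also have "\<dots> \<le> Coset.order G" using ord_dvd_group_order[OF u] order_gt_0_iff_finite fin_G by (simp add: dvd_imp_le)
    finally show ?thesis by simp
  qed
  then have "ord u dvd 2 ^ Coset.order G * q"
    using q(1) by (metis dvd_refl le_imp_power_dvd mult_dvd_mono)
  then have "(u [^] (2 ^ Coset.order G :: nat)) [^] q = \<one>"
    using u by (simp add: nat_pow_pow pow_eq_id)
  then have "ord (u [^] (2 ^ Coset.order G :: nat)) dvd q" using u by (simp add: pow_eq_id)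
  then show ?thesis using q(2) dvd_trans by blast
qed

lemma ord_conj: assumes "g \<in> carrier G" "x \<in> cls g" shows "ord x = ord g"
proof -
  have le: "ord y dvd ord g" if g: "g \<in> carrier G" and y: "y \<in> cls g" for g y
  proof -
    obtain a where a: "a \<in> carrier G" "y = a \<otimes> g \<otimes> inv a" using y by (auto simp: cls_def)
    have "y [^] n = a \<otimes> g [^] n \<otimes> inv a" for n :: nat
    proof (induction n)
      case 0
      then show ?case using a by simp
    next
      case (Suc n)
      have "y [^] Suc n = a \<otimes> g [^] n \<otimes> inv a \<otimes> (a \<otimes> g \<otimes> inv a)" using Suc a(2) by simp
      also have "\<dots> = a \<otimes> (g [^] n \<otimes> g) \<otimes> inv a" using a(1) g by (simp add: m_assoc inv_cancel)
      finally show ?case by simp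
    qed
    from this[of "ord g"] have "y [^] ord g = \<one>" using g a by (simp add: pow_ord_eq_1)
    moreover have "y \<in> carrier G" using a g by simp
    ultimately show ?thesis by (simp add: pow_eq_id)
  qed
  have "x \<in> carrier G" using assms cls_conj_closed by (auto simp: conj_closed_def)
  then show ?thesis using le assms cls_sym by (meson dvd_antisym)
qed

text \<open>All powers \<open>u [^] (2 ^ Coset.order G)\<close> have odd order, so none of them lies
  in the class of \<open>g\<close>.\<close>

lemma csum_idempotent_2_singular:
  assumes x: "x \<in> RG" "x \<star> x = x" and g: "g \<in> carrier G" "even (ord g)"
  shows "csum (cls g) x \<in> J"
proof (rule csum_idempotent_vanishes[OF x cls_conj_closed[OF g(1)]])
  fix u assume u: "u \<in> carrier G"
  show "u [^] (2 ^ Coset.order G :: nat) \<notin> cls g"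
    using odd_ord_power[OF u] ord_conj[OF g(1)] g(2) by metis
qed

end

section \<open>Class sums of e against traces on the head, and symmetric units\<close>

context primitive_idempotent begin

lemma tr_cls: assumes f: "frame I b \<psi>" and g: "g \<in> carrier G" and x: "x \<in> cls g"
  shows "tr I b \<psi> (dl x) \<doteq> tr I b \<psi> (dl g)"
proof -
  obtain a where a: "a \<in> carrier G" "x = a \<otimes> g \<otimes> inv a" using x by (auto simp: cls_def)
  have "dl x = dl a \<star> dl (g \<otimes> inv a)" using a g by (simp add: dl_conv_dl m_assoc)
  then have "tr I b \<psi> (dl x) \<doteq> tr I b \<psi> (dl (g \<otimes> inv a) \<star> dl a)"
    using tr_conv_swap[OF f f RG_dl RG_dl, of a "g \<otimes> inv a"] a g by simp
  also have "dl (g \<otimes> inv a) \<star> dl a = dl g" using a g by (simp add: dl_conv_dl m_assoc)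
  finally show ?thesis .
qed

text \<open>Since \<open>e\<close> is idempotent only the 2-regular classes contribute to \<open>1 = tr e\<close>, and the classes
  that are not real cancel in pairs.\<close>

lemma real_class_contribution:
  assumes c: "c \<in> RG" "d \<in> RG" "c \<star> d = e" "d \<star> c = star e"
    and fr: "frame I b \<psi>" and sym: "\<And>a. a \<in> RG \<Longrightarrow> tr I b \<psi> (star a) \<doteq> tr I b \<psi> a"
  shows "\<exists>g\<in>carrier G. inv g \<in> cls g \<and> odd (ord g) \<and> csum (cls g) e \<notin> J \<and> tr I b \<psi> (dl g) \<notin> J"
proof (rule ccontr)
  assume none: "\<not> ?thesis"
  define \<tau> where "\<tau> g = tr I b \<psi> (dl g)" for g
  have \<tau>R: "\<tau> g \<in> R" if "g \<in> carrier G" for g unfolding \<tau>_def using that by (intro tr_R[OF fr]) auto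
  have eR: "e g \<in> R" for g using e_RG by (rule RG_R)
  define h where "h K = (\<Sum>g\<in>K. e g * \<tau> g)" for K
  have hK: "h (cls g) \<doteq> csum (cls g) e * \<tau> g" if g: "g \<in> carrier G" for g
    unfolding h_def csum_def sum_distrib_right
    using tr_cls[OF fr g] eR by (intro cong_sum cong_mult_left) (auto simp: \<tau>_def)
  have csR: "csum K e \<in> R" for K unfolding csum_def using eR by auto
  have inv_cls: "(\<lambda>k. inv k) ` cls g = cls (inv g)" if g: "g \<in> carrier G" for g
    unfolding cls_def image_image using g
    by (intro image_cong) (auto simp: inv_mult_group m_assoc)
  \<comment> \<open>Self-duality enters here: over the inverse class one sees
    \<open>star e = d \<star> c\<close>, which has the same class sums as
    \<open>c \<star> d = e\<close>.\<close>
  have cs_inv: "csum (cls (inv g)) e = csum (cls g) e" if g: "g \<in> carrier G" for g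
  proof -
    note cc = cls_conj_closed[OF g]
    have "csum (cls (inv g)) e = csum (cls g) (star e)"
      using csum_star[of "cls g" e] cc inv_cls[OF g] by (simp add: conj_closed_def)
    also have "\<dots> = csum (cls g) (d \<star> c)" by (simp only: c(4))
    also have "\<dots> = csum (cls g) (c \<star> d)" by (rule csum_conv_commute[OF cc])
    finally show ?thesis by (simp only: c(3))
  qed
  have \<tau>_inv: "\<tau> (inv g) \<doteq> \<tau> g" if g: "g \<in> carrier G" for g
    using sym[OF RG_dl[OF g]] g by (simp add: star_dl \<tau>_def)
  have "1 \<doteq> (\<Sum>g\<in>carrier G. e g * \<tau> g)"
    using cong_sym[OF tr_e[OF fr]] tr_expand[OF fr e_RG] cong_trans unfolding \<tau>_def by blast
  also have "(\<Sum>g\<in>carrier G. e g * \<tau> g) = sum h (cls ` carrier G)"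
  proof -
    have U: "\<Union> (cls ` carrier G) = carrier G"
      using self_cls cls_conj_closed by (fastforce simp: conj_closed_def)
    have "sum (\<lambda>g. e g * \<tau> g) (\<Union> (cls ` carrier G)) = sum h (cls ` carrier G)"
    proof (subst sum.Union_disjoint)
      show "\<forall>K\<in>cls ` carrier G. finite K" by (auto simp: cls_def)
      show "\<forall>A\<in>cls ` carrier G. \<forall>B\<in>cls ` carrier G. A \<noteq> B \<longrightarrow> A \<inter> B = {}"
      proof (intro ballI impI)
        fix A B assume AB: "A \<in> cls ` carrier G" "B \<in> cls ` carrier G" "A \<noteq> B"
        then obtain g k where gk: "g \<in> carrier G" "k \<in> carrier G" "A = cls g" "B = cls k" by blast
        show "A \<inter> B = {}"
        proof (rule ccontr)
          assume "A \<inter> B \<noteq> {}"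
          then obtain x where "x \<in> cls g" "x \<in> cls k" using gk by blast
          then have "cls g = cls k" using cls_eq gk(1,2) by metis
          then show False using AB gk by simp
        qed
      qed
    qed (simp add: h_def[abs_def])
    then show ?thesis unfolding U .
  qed
  finally have 1: "1 \<doteq> sum h (cls ` carrier G)" .
  \<comment> \<open>Inversion permutes the classes and preserves the contributions modulo
    \<open>J\<close>, so only classes closed under inversion are left to treat.\<close>
  have "sum h (cls ` carrier G) \<in> J"
  proof (rule sum_involution[where f = "\<lambda>K. (\<lambda>k. inv k) ` K" and h = h and I = J])
    show "twoR \<subseteq> J" by (auto intro: twoR_J)
    show "finite (cls ` carrier G)" by simp
    fix K assume "K \<in> cls ` carrier G"
    then obtain g where g: "g \<in> carrier G" "K = cls g" by blast
    show "(\<lambda>k. inv k) ` K \<in> cls ` carrier G" using g inv_cls by simp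
    show "(\<lambda>k. inv k) ` (\<lambda>k. inv k) ` K = K" using g inv_cls by simp
    have KG: "K \<subseteq> carrier G" using cls_conj_closed[OF g(1)] g(2) by (simp add: conj_closed_def)
    show "h K \<in> R" unfolding h_def using KG eR \<tau>R by (intro sum_R mult_R) auto
    have "h (cls (inv g)) \<doteq> csum (cls (inv g)) e * \<tau> (inv g)" using g by (intro hK) simp
    also have "\<dots> \<doteq> csum (cls g) e * \<tau> g"
      unfolding cs_inv[OF g(1)] using \<tau>_inv[OF g(1)] csR by (intro cong_mult_left)
    also have "\<dots> \<doteq> h (cls g)" by (rule cong_sym[OF hK[OF g(1)]])
    finally show "h ((\<lambda>k. inv k) ` K) - h K \<in> J" unfolding g(2) inv_cls[OF g(1)] cong_J_def .
    assume "(\<lambda>k. inv k) ` K = K"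
    then have real: "inv g \<in> cls g" using inv_cls[OF g(1)] self_cls[of "inv g"] g by simp
    have "csum (cls g) e * \<tau> g \<in> J"
    proof (cases "csum (cls g) e \<in> J")
      case True
      then show ?thesis using \<tau>R[OF g(1)] by (rule mult_J_right)
    next
      case False
      then have "odd (ord g)" using csum_idempotent_2_singular[OF e_RG e_e g(1)] by blast
      then have "\<tau> g \<in> J" using none g(1) real False unfolding \<tau>_def by blast
      then show ?thesis by (rule mult_J[OF csR])
    qed
    then show "h K \<in> J" unfolding g(2) using hK[OF g(1)] cong_J_iff by blast
  qed (rule add_J)
  then have "1 \<in> J" using 1 cong_J_iff by blast
  then show False by simp
qed

text \<open>The conclusion speaks of \<open>N\<close> alone: the form \<open>\<beta>\<close>,
  symmetric only modulo \<open>J\<close>, is forgotten, and an exact construction can start from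
  \<open>z\<close>.\<close>

lemma exists_nonalternating_involution:
  assumes c: "c \<in> RG" "d \<in> RG" "e \<star> c = c" "c \<star> star e = c" "star e \<star> d = d" "d \<star> e = d"
    "c \<star> d = e" "d \<star> c = star e"
    and fr: "frame I b \<psi>"
    and t: "t \<in> carrier G" "t \<otimes> t = \<one>" "t' \<in> carrier G" "t' \<otimes> t' = \<one>"
    and tr: "tr I b \<psi> (dl (t \<otimes> t')) \<notin> J"
  shows "\<exists>s\<in>{t, t'}. \<exists>z\<in>L. star z \<star> dl s \<star> z \<notin> N"
proof (rule ccontr)
  assume n: "\<not> ?thesis"
  obtain \<beta> x0 y0 where \<beta>: "ebil \<beta>" "\<And>x y. x \<in> L \<Longrightarrow> y \<in> L \<Longrightarrow> \<beta> x y \<doteq> \<beta> y x"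
    "x0 \<in> L" "y0 \<in> L" "\<beta> x0 y0 \<notin> J"
    "\<And>t z. t \<in> carrier G \<Longrightarrow> t \<otimes> t = \<one> \<Longrightarrow> z \<in> L \<Longrightarrow> star z \<star> dl t \<star> z \<in> N \<Longrightarrow> \<beta> (dl t \<star> z) z \<in> J"
    using exists_symmetric_head_form[OF c fr] by blast
  have "tr I b \<psi> (dl (t \<otimes> t')) \<in> J"
  proof (rule tr_product_of_involutions[OF \<beta>(1-5) fr t])
    fix z assume z: "z \<in> L"
    show "\<beta> (dl t \<star> z) z \<in> J" using n z by (intro \<beta>(6) t) auto
    show "\<beta> (dl t' \<star> z) z \<in> J" using n z by (intro \<beta>(6) t) auto
  qed
  then show False using tr by simp
qed

lemma tr_star:
  assumes c: "c \<in> RG" "d \<in> RG" "e \<star> c = c" "c \<star> star e = c" "star e \<star> d = d" "d \<star> e = d"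
    "c \<star> d = e" "d \<star> c = star e"
    and fr: "frame I b \<psi>" and a: "a \<in> RG"
  shows "tr I b \<psi> (star a) \<doteq> tr I b \<psi> a"
proof -
  obtain \<beta> x0 y0 where \<beta>: "ebil \<beta>" "\<And>x y. x \<in> L \<Longrightarrow> y \<in> L \<Longrightarrow> \<beta> x y \<doteq> \<beta> y x"
    "x0 \<in> L" "y0 \<in> L" "\<beta> x0 y0 \<notin> J"
    "\<And>t z. t \<in> carrier G \<Longrightarrow> t \<otimes> t = \<one> \<Longrightarrow> z \<in> L \<Longrightarrow> star z \<star> dl t \<star> z \<in> N \<Longrightarrow> \<beta> (dl t \<star> z) z \<in> J"
    using exists_symmetric_head_form[OF c fr] by blast
  show ?thesis by (rule tr_symmetric[OF \<beta>(1-5) fr a])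
qed

text \<open>With \<open>w = star (z \<star> c)\<close>, the element
  \<open>m = w \<star> dl t \<star> z\<close> lies in the corner and
  \<open>star d \<star> m = star z \<star> dl t \<star> z\<close>. Were \<open>m\<close> a nonunit,
  this would lie in \<open>N\<close>. Now
  \<open>w \<star> dl t \<star> star w = m \<star> c\<close>, whose inverse is \<open>d\<close>
  times the inverse of \<open>m\<close>.\<close>

lemma symmetric_unit_from_involution:
  assumes c: "c \<in> RG" "d \<in> RG" "e \<star> c = c" "c \<star> star e = c" "star e \<star> d = d" "d \<star> e = d"
    "c \<star> d = e" "d \<star> c = star e"
    and t: "t \<in> carrier G" and z: "z \<in> L" "star z \<star> dl t \<star> z \<notin> N"
  obtains w d' where "w \<in> RG" "d' \<in> RG" "e \<star> w = w" "d' \<star> e = d'"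
    "w \<star> dl t \<star> star w \<star> d' = e" "d' \<star> (w \<star> dl t \<star> star w) = star e"
proof -
  define w where "w = star c \<star> star z"
  have CG: "c \<in> CG" "d \<in> CG" "z \<in> CG" by (intro RG_CG c(1,2) L_RG z(1))+
  have zR: "z \<in> RG" using z(1) by blast
  have sc: "e \<star> star c = star c" "star c \<star> star e = star c" "star d \<star> star c = star e"
    using arg_cong[OF c(4), of star] arg_cong[OF c(3), of star] arg_cong[OF c(7), of star]
    by (simp_all add: star_conv RG_CG)
  have w: "w \<in> RG" unfolding w_def using c(1) zR by auto
  have sw: "star w = z \<star> c" unfolding w_def star_conv using CG by simp
  define m where "m = star c \<star> star z \<star> dl t \<star> z"
  have mc: "m \<star> c = w \<star> dl t \<star> star w" by (simp add: m_def w_def[symmetric] sw conv_assoc)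
  have mRG: "m \<in> RG" unfolding m_def using c(1) zR t by auto
  have em: "e \<star> m = m" unfolding m_def conv_assoc[symmetric] sc(1) ..
  have me: "m \<star> e = m" unfolding m_def conv_assoc L_e_right[OF z(1)] ..
  have m: "m \<in> corner" using mRG em me by (rule cornerI)
  have "cunit m"
  proof (rule ccontr)
    assume "\<not> cunit m"
    then have "m \<in> N" using nonunit_N m by blast
    then have "star d \<star> m \<in> N" using c(2) by auto
    moreover have "star d \<star> m = star e \<star> (star z \<star> dl t \<star> z)"
      unfolding m_def conv_assoc[symmetric] sc(3) ..
    moreover have "star e \<star> star z = star z" using L_e_right[OF z(1)] by (metis star_conv)
    then have "star e \<star> (star z \<star> dl t \<star> z) = star z \<star> dl t \<star> z" by (simp add: conv_assoc[symmetric])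
    ultimately show False using z(2) by simp
  qed
  then obtain m' where m': "m' \<in> corner" "m \<star> m' = e" "m' \<star> m = e" by (auto simp: cunit_def)
  define d' where "d' = d \<star> m'"
  have 1: "m \<star> c \<star> d' = e"
  proof -
    have "m \<star> c \<star> d' = m \<star> (c \<star> d) \<star> m'" by (simp add: d'_def conv_assoc)
    also have "\<dots> = m \<star> m'" by (simp only: c(7) me)
    finally show ?thesis by (simp only: m'(2))
  qed
  have 2: "d' \<star> (m \<star> c) = star e"
  proof -
    have "d' \<star> (m \<star> c) = d \<star> (m' \<star> m) \<star> c" by (simp add: d'_def conv_assoc)
    also have "\<dots> = d \<star> c" by (simp only: m'(3) c(6))
    finally show ?thesis by (simp only: c(8))
  qed
  have "e \<star> w = w" unfolding w_def conv_assoc[symmetric] sc(1) ..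
  moreover have "d' \<in> RG" unfolding d'_def using c(2) cornerD(1)[OF m'(1)] by auto
  moreover have "d' \<star> e = d'" unfolding d'_def conv_assoc cornerD(3)[OF m'(1)] ..
  ultimately show thesis using that[OF w] 1 2 unfolding mc by blast
qed

end

section \<open>Principal indecomposable modules as left ideals\<close>

context two_adic_maximal_ideal begin

lemma loc_ring_ops [simp]:
  "carrier (loc_ring MM) = R" "\<zero>\<^bsub>loc_ring MM\<^esub> = 0" "\<one>\<^bsub>loc_ring MM\<^esub> = 1"
  "x \<oplus>\<^bsub>loc_ring MM\<^esub> y = x + y" "x \<otimes>\<^bsub>loc_ring MM\<^esub> y = x * y"
  by (simp_all add: loc_ring_eq)

lemma loc_ring_minus: "y \<in> R \<Longrightarrow> x \<ominus>\<^bsub>loc_ring MM\<^esub> y = x - y"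
  using complex_subring_diff[of R y x] loc_cring by (simp add: loc_ring_eq)

end

text \<open>\<open>F\<close> is a fixed isomorphism from \<open>P\<close> onto the left ideal
  \<open>L = RG e\<close>, in which the computations are made.\<close>

locale pim_model = two_adic_maximal_ideal MM + primitive_idempotent G R J e
  for MM :: "complex set" and G :: "('g, 'gs) monoid_scheme" (structure) and e +
  fixes P :: "(complex, 'm, 'ms) module_scheme" and \<rho> :: "'g \<Rightarrow> 'm \<Rightarrow> 'm" and F :: "'m \<Rightarrow> 'g \<Rightarrow> complex"
  assumes P_module: "group_ring_module (loc_ring MM) G P \<rho>"
    and F_bij: "bij_betw F (carrier P) L"
    and F_add: "x \<in> carrier P \<Longrightarrow> y \<in> carrier P \<Longrightarrow> F (x \<oplus>\<^bsub>P\<^esub> y) = F x + F y"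
    and F_smult: "r \<in> R \<Longrightarrow> x \<in> carrier P \<Longrightarrow> F (r \<odot>\<^bsub>P\<^esub> x) = r *\<^sub>c F x"
    and F_act: "g \<in> carrier G \<Longrightarrow> x \<in> carrier P \<Longrightarrow> F (\<rho> g x) = dl g \<star> F x"

locale finite_group_pim = two_adic_maximal_ideal MM + group_algebra G R J
  for MM :: "complex set" and G :: "('g, 'gs) monoid_scheme" (structure) +
  fixes P :: "(complex, 'm, 'ms) module_scheme" and \<rho> :: "'g \<Rightarrow> 'm \<Rightarrow> 'm"
  assumes pim: "principal_indecomposable (loc_ring MM) G P \<rho>"
begin

text \<open>Elements of the regular module are \<open>undefined\<close> off the carrier, those of
  \<open>CG\<close> are \<open>0\<close> there.\<close>

definition ext0 :: "('g \<Rightarrow> complex) \<Rightarrow> 'g \<Rightarrow> complex" where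
  "ext0 f = (\<lambda>g. if g \<in> carrier G then f g else 0)"

abbreviation RM where "RM \<equiv> regular_module (loc_ring MM) G"

lemma RM_simps:
  "carrier RM = (carrier G \<rightarrow>\<^sub>E R)"
  "\<zero>\<^bsub>RM\<^esub> = (\<lambda>v\<in>carrier G. 0)"
  "f \<oplus>\<^bsub>RM\<^esub> h = (\<lambda>v\<in>carrier G. f v + h v)"
  "r \<odot>\<^bsub>RM\<^esub> f = (\<lambda>v\<in>carrier G. r * f v)"
  using loc_cring by (simp_all add: regular_module_def ring.func_space_def[OF cring.axioms(1)])

lemma ext0_RG: "f \<in> carrier RM \<Longrightarrow> ext0 f \<in> RG"
  by (auto simp: RM_simps ext0_def RG_def CG_def)

lemma ext0_inj: "f \<in> carrier RM \<Longrightarrow> h \<in> carrier RM \<Longrightarrow> ext0 f = ext0 h \<Longrightarrow> f = h"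
proof -
  assume *: "f \<in> carrier RM" "h \<in> carrier RM" "ext0 f = ext0 h"
  have "f g = h g" if "g \<in> carrier G" for g
    using fun_cong[OF *(3), of g] that by (simp add: ext0_def)
  then show "f = h" using * by (intro PiE_ext[of f "carrier G" "\<lambda>_. R" h]) (simp_all add: RM_simps)
qed

lemma ext0_surj: assumes "x \<in> RG" shows "\<exists>f\<in>carrier RM. ext0 f = x"
proof
  show "restrict x (carrier G) \<in> carrier RM" using assms by (auto simp: RM_simps)
  show "ext0 (restrict x (carrier G)) = x"
    by (rule CG_ext) (use assms in \<open>auto simp: ext0_def CG_def RG_def\<close>)
qed

lemma ext0_add: "ext0 (f \<oplus>\<^bsub>RM\<^esub> h) = ext0 f + ext0 h"
  by (rule ext) (simp add: ext0_def RM_simps fun_apply)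

lemma ext0_zero: "ext0 \<zero>\<^bsub>RM\<^esub> = 0"
  by (rule ext) (simp add: ext0_def RM_simps fun_apply)

lemma ext0_smult: "ext0 (r \<odot>\<^bsub>RM\<^esub> f) = r *\<^sub>c ext0 f"
  by (rule ext) (simp add: ext0_def RM_simps sc_def)

lemma ext0_act: "g \<in> carrier G \<Longrightarrow> ext0 (regular_act G g f) = dl g \<star> ext0 f"
  by (rule ext) (simp add: ext0_def regular_act_def conv_dl_left)

text \<open>\<open>e\<close> is the component in \<open>A\<close> of the identity of
  \<open>RG = A + B\<close>, and \<open>A\<close> is then the left ideal generated by
  \<open>e\<close>. An idempotent \<open>E\<close> under \<open>e\<close> splits \<open>P\<close>
  into the parts on which right multiplication by \<open>E\<close> is the identity and zero, so
  indecomposability of \<open>P\<close> makes \<open>e\<close> primitive.\<close>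

lemma exists_model: "\<exists>e F. pim_model MM G e P \<rho> F"
proof -
  have grm: "group_ring_module (loc_ring MM) G P \<rho>"
    and indec: "gr_indecomposable (loc_ring MM) G P \<rho>"
    using pim by (auto simp: principal_indecomposable_def)
  interpret P: group_ring_module "loc_ring MM" G P \<rho> by (rule grm)
  obtain A B f where decomp: "gr_direct_decomp (loc_ring MM) G RM (regular_act G) A B"
    and f: "f \<in> module_hom (loc_ring MM) P (RM\<lparr>carrier := A\<rparr>)" "bij_betw f (carrier P) A"
      "\<And>g m. g \<in> carrier G \<Longrightarrow> m \<in> carrier P \<Longrightarrow> f (\<rho> g m) = regular_act G g (f m)"
    using pim by (auto simp: principal_indecomposable_def gr_iso_def)
  have A: "submodule (loc_ring MM) A RM" "\<And>g a. g \<in> carrier G \<Longrightarrow> a \<in> A \<Longrightarrow> regular_act G g a \<in> A"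
    and B: "submodule (loc_ring MM) B RM" "\<And>g a. g \<in> carrier G \<Longrightarrow> a \<in> B \<Longrightarrow> regular_act G g a \<in> B"
    and AB: "A \<inter> B = {\<zero>\<^bsub>RM\<^esub>}" "A <+>\<^bsub>RM\<^esub> B = carrier RM"
    using decomp by (auto simp: gr_direct_decomp_def gr_submodule_def)
  interpret A: submodule "loc_ring MM" A RM by (rule A(1))
  interpret B: submodule "loc_ring MM" B RM by (rule B(1))
  have conv_closed: "x \<star> ext0 c \<in> ext0 ` C"
    if C: "submodule (loc_ring MM) C RM" "\<And>g a. g \<in> carrier G \<Longrightarrow> a \<in> C \<Longrightarrow> regular_act G g a \<in> C"
      and c: "c \<in> C" and x: "x \<in> RG" for C c x
  proof -
    interpret C: submodule "loc_ring MM" C RM by (rule C(1))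
    have "(\<Sum>g\<in>S. x g *\<^sub>c (dl g \<star> ext0 c)) \<in> ext0 ` C" if "S \<subseteq> carrier G" for S
      using finite_subset[OF that fin_G] that
    proof (induction S rule: finite_induct)
      case empty
      show ?case using imageI[OF C.zero_closed, of ext0] by (simp add: ext0_zero)
    next
      case (insert g S)
      then obtain c' where c': "c' \<in> C" "(\<Sum>g\<in>S. x g *\<^sub>c (dl g \<star> ext0 c)) = ext0 c'" by auto
      have xg: "x g \<in> R" using x by (rule RG_R)
      have "x g *\<^sub>c (dl g \<star> ext0 c) = ext0 (x g \<odot>\<^bsub>RM\<^esub> regular_act G g c)"
        using insert.prems by (simp add: ext0_smult ext0_act)
      then have "(\<Sum>g\<in>insert g S. x g *\<^sub>c (dl g \<star> ext0 c)) = ext0 ((x g \<odot>\<^bsub>RM\<^esub> regular_act G g c) \<oplus>\<^bsub>RM\<^esub> c')"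
        using insert.hyps c' by (simp add: ext0_add)
      moreover have "(x g \<odot>\<^bsub>RM\<^esub> regular_act G g c) \<oplus>\<^bsub>RM\<^esub> c' \<in> C"
        using C(2) c c'(1) insert.prems xg by (intro C.m_closed C.smult_closed) auto
      ultimately show ?case by simp
    qed
    from this[OF subset_refl] show ?thesis
      using CG_expand[OF RG_CG[OF x]] by (metis (no_types, lifting) conv_sc_left conv_sum_left sum.cong)
  qed
  obtain u where u: "u \<in> carrier RM" "ext0 u = dl \<one>" using ext0_surj[of "dl \<one>"] by auto
  then have "u \<in> A <+>\<^bsub>RM\<^esub> B" using AB(2) by simp
  then obtain a b where ab: "a \<in> A" "b \<in> B" "u = a \<oplus>\<^bsub>RM\<^esub> b"
    unfolding set_add_def set_mult_def by auto
  define e where "e = ext0 a"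
  define e' where "e' = ext0 b"
  have AC: "A \<subseteq> carrier RM" "B \<subseteq> carrier RM" using A.subset B.subset by auto
  have eR: "e \<in> RG" using ab(1) AC by (auto simp: e_def intro: ext0_RG)
  have ee': "e + e' = dl \<one>" using u ab by (simp add: e_def e'_def ext0_add)
  have right_e: "ext0 c \<star> e = ext0 c" if c: "c \<in> A" for c
  proof -
    have cR: "ext0 c \<in> RG" using c AC by (auto intro: ext0_RG)
    obtain b' where b': "b' \<in> B" "ext0 c \<star> e' = ext0 b'"
      using conv_closed[OF B ab(2) cR] by (auto simp: e'_def)
    obtain a' where a': "a' \<in> A" "ext0 c \<star> e = ext0 a'"
      using conv_closed[OF A ab(1) cR] by (auto simp: e_def)
    have "ext0 c = ext0 c \<star> e + ext0 c \<star> e'"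
      unfolding conv_add_right[symmetric] ee' using RG_CG[OF cR] by simp
    then have eq: "ext0 c = ext0 a' + ext0 b'" using a' b' by simp
    \<comment> \<open>\<open>c\<close> minus its component in \<open>A\<close> is its component in
      \<open>B\<close>; it lies in both summands and vanishes.\<close>
    define s where "s = c \<oplus>\<^bsub>RM\<^esub> ((-1) \<odot>\<^bsub>RM\<^esub> a')"
    have sA: "s \<in> A" unfolding s_def using c a' by (intro A.m_closed A.smult_closed) auto
    have "ext0 s = ext0 c + (-1) *\<^sub>c ext0 a'" by (simp only: s_def ext0_add ext0_smult)
    also have "\<dots> = ext0 b'" by (simp add: eq sc_uminus_left)
    finally have "s = b'" by (rule ext0_inj[OF subsetD[OF AC(1) sA] subsetD[OF AC(2) b'(1)]])
    then have "s \<in> A \<inter> B" using sA b' by simp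
    then have "ext0 b' = 0" using AB(1) \<open>s = b'\<close> ext0_zero by auto
    then show ?thesis using eq a' by simp
  qed
  have imA: "x \<in> ext0 ` A \<longleftrightarrow> x \<in> RG \<and> x \<star> e = x" for x
  proof
    assume "x \<in> ext0 ` A" then show "x \<in> RG \<and> x \<star> e = x" using right_e AC ext0_RG by auto
  next
    assume x: "x \<in> RG \<and> x \<star> e = x"
    then have "x \<star> ext0 a \<in> ext0 ` A" using conv_closed[OF A ab(1)] by blast
    then show "x \<in> ext0 ` A" using x by (simp add: e_def)
  qed
  have eidem: "e \<star> e = e" using right_e[OF ab(1)] by (simp add: e_def)
  define F where "F = ext0 \<circ> f"
  have fA: "f m \<in> A" if "m \<in> carrier P" for m using f(2) that by (auto simp: bij_betw_def)
  have Fbij: "bij_betw F (carrier P) (ext0 ` A)"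
    unfolding F_def
  proof (rule bij_betw_trans[OF f(2)])
    show "bij_betw ext0 A (ext0 ` A)"
      by (rule inj_on_imp_bij_betw, rule inj_onI) (use AC ext0_inj in blast)
  qed
  have Fadd: "F (x \<oplus>\<^bsub>P\<^esub> y) = F x + F y" if "x \<in> carrier P" "y \<in> carrier P" for x y
    using module_hom_add[OF f(1) that] by (simp add: F_def ext0_add)
  have Fsm: "F (r \<odot>\<^bsub>P\<^esub> x) = r *\<^sub>c F x" if "r \<in> R" "x \<in> carrier P" for r x
    using module_hom_smult[OF f(1), of r x] that by (simp add: F_def ext0_smult)
  have Fact: "F (\<rho> g x) = dl g \<star> F x" if "g \<in> carrier G" "x \<in> carrier P" for g x
    using f(3)[OF that] that by (simp add: F_def ext0_act)
  have F0: "F \<zero>\<^bsub>P\<^esub> = 0" using Fadd[of "\<zero>\<^bsub>P\<^esub>" "\<zero>\<^bsub>P\<^esub>"] by simp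
  have Finj: "x = y" if "x \<in> carrier P" "y \<in> carrier P" "F x = F y" for x y
    using Fbij that by (auto simp: bij_betw_def inj_on_def)
  have Fsurj: "\<exists>p\<in>carrier P. F p = x" if "x \<in> RG" "x \<star> e = x" for x
  proof -
    have "x \<in> F ` carrier P" using imA[of x] that Fbij by (auto simp: bij_betw_def)
    then show ?thesis by blast
  qed
  have FL: "F p \<in> RG \<and> F p \<star> e = F p" if "p \<in> carrier P" for p
    using imA[of "F p"] Fbij that by (auto simp: bij_betw_def)
  have act: "\<rho> g p \<in> carrier P" if "g \<in> carrier G" "p \<in> carrier P" for g p
    using P.act_hom[OF that(1)] that(2) module_hom_closed by blast
  have enz: "e \<noteq> 0"
  proof
    assume e0: "e = 0"
    have "p = \<zero>\<^bsub>P\<^esub>" if p: "p \<in> carrier P" for p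
      using FL[OF p] e0 F0 by (intro Finj) (auto simp: p)
    then have "carrier P = {\<zero>\<^bsub>P\<^esub>}" by blast
    then show False using indec by (simp add: gr_indecomposable_def)
  qed
  have prim: "E = 0 \<or> E = e"
    if E: "E \<in> RG" "E \<star> E = E" "e \<star> E = E" "E \<star> e = E" for E
  proof -
    define M1 where "M1 = {p \<in> carrier P. F p \<star> E = F p}"
    define M2 where "M2 = {p \<in> carrier P. F p \<star> E = 0}"
    have sub: "gr_submodule (loc_ring MM) G P \<rho> M1" "gr_submodule (loc_ring MM) G P \<rho> M2"
      unfolding gr_submodule_def M1_def M2_def
      by (auto intro!: submodule.intro P.module_axioms simp: Fadd Fsm Fact act F0 conv_add_left conv_assoc)
    have int: "M1 \<inter> M2 = {\<zero>\<^bsub>P\<^esub>}"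
    proof (intro equalityI subsetI)
      fix p assume "p \<in> M1 \<inter> M2"
      then have "p \<in> carrier P" "F p = F \<zero>\<^bsub>P\<^esub>" by (auto simp: M1_def M2_def F0)
      then show "p \<in> {\<zero>\<^bsub>P\<^esub>}" using Finj by auto
    qed (auto simp: M1_def M2_def F0)
    have "M1 <+>\<^bsub>P\<^esub> M2 = carrier P"
    proof (intro equalityI subsetI)
      fix p assume "p \<in> M1 <+>\<^bsub>P\<^esub> M2"
      then show "p \<in> carrier P" unfolding set_add_def set_mult_def M1_def M2_def by auto
    next
      fix p assume p: "p \<in> carrier P"
      have FR: "F p \<in> RG" using FL[OF p] by simp
      have "\<exists>q\<in>carrier P. F q = F p \<star> E"
        using FR E by (intro Fsurj) (auto simp: conv_assoc)
      then obtain q where q: "q \<in> carrier P" "F q = F p \<star> E" by blast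
      have "\<exists>q'\<in>carrier P. F q' = F p - F p \<star> E"
        using FR E FL[OF p] by (intro Fsurj) (auto simp: conv_assoc conv_diff_left)
      then obtain q' where q': "q' \<in> carrier P" "F q' = F p - F p \<star> E" by blast
      have "q \<in> M1" "q' \<in> M2"
        using q q' E by (simp_all add: M1_def M2_def conv_assoc conv_diff_left)
      moreover have "p = q \<oplus>\<^bsub>P\<^esub> q'" using p q q' by (intro Finj) (simp_all add: Fadd)
      ultimately show "p \<in> M1 <+>\<^bsub>P\<^esub> M2" unfolding set_add_def set_mult_def by auto
    qed
    then have "M1 = {\<zero>\<^bsub>P\<^esub>} \<or> M2 = {\<zero>\<^bsub>P\<^esub>}"
      using indec sub int unfolding gr_indecomposable_def gr_direct_decomp_def by blast
    then show ?thesis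
    proof
      assume M: "M1 = {\<zero>\<^bsub>P\<^esub>}"
      obtain p where p: "p \<in> carrier P" "F p = E" using Fsurj E by blast
      then have "p \<in> M1" using E by (simp add: M1_def)
      then show ?thesis using M p F0 by simp
    next
      assume M: "M2 = {\<zero>\<^bsub>P\<^esub>}"
      have "e - E \<in> RG" "(e - E) \<star> e = e - E" "(e - E) \<star> E = 0"
        using E eR eidem by (auto simp: conv_diff_left)
      then obtain p where p: "p \<in> carrier P" "F p = e - E" "F p \<star> E = 0" using Fsurj by metis
      then have "p \<in> M2" by (simp add: M2_def)
      then show ?thesis using M p F0 by simp
    qed
  qed
  interpret PI: primitive_idempotent G R J e
    by unfold_locales (use eR eidem enz prim in auto)
  have "ext0 ` A = PI.L" using imA by (auto simp: PI.L_def)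
  then have "pim_model MM G e P \<rho> F"
    using Fbij Fadd Fsm Fact by unfold_locales (auto intro: grm)
  then show ?thesis by blast
qed

end

section \<open>Invariant forms and quadratic type\<close>

context primitive_idempotent begin

lemma star_e_idem: "star e \<star> star e = star e" by (metis e_e star_conv)

lemma star_e_RG [simp, intro]: "star e \<in> RG" by (intro RG_star e_RG)

lemma star_star_e [simp]: "star (star e) = e" by (intro star_star RG_CG e_RG)

text \<open>Right multiplication by \<open>star e\<close> is adjoint to right multiplication by
  \<open>e\<close>, so testing on \<open>L\<close> amounts to testing on all of
  \<open>RG\<close>.\<close>

lemma eq_by_ip_L:
  assumes u: "u \<in> RG" "u \<star> star e = u" and v: "v \<in> RG" "v \<star> star e = v"
    and eq: "\<And>y. y \<in> L \<Longrightarrow> ip y u = ip y v"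
  shows "u = v"
proof (rule ip_eqI)
  fix z assume z: "z \<in> RG"
  have "ip z u = ip (z \<star> e) u" "ip z v = ip (z \<star> e) v"
    using ip_conv_left[OF RG_CG[OF e_RG], of z u] ip_conv_left[OF RG_CG[OF e_RG], of z v] u v by simp_all
  then show "ip z u = ip z v" using eq[of "z \<star> e"] z by (simp add: L_conv_e)
qed (use u v in auto)

definition lin_functional :: "(('a \<Rightarrow> complex) \<Rightarrow> complex) \<Rightarrow> bool" where
  "lin_functional \<phi> \<longleftrightarrow> (\<forall>x\<in>L. \<phi> x \<in> R) \<and> (\<forall>x\<in>L. \<forall>y\<in>L. \<phi> (x + y) = \<phi> x + \<phi> y) \<and>
     (\<forall>r\<in>R. \<forall>x\<in>L. \<phi> (r *\<^sub>c x) = r * \<phi> x)"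

lemma lin_functional_sum:
  assumes \<phi>: "lin_functional \<phi>" and "finite I" "\<And>i. i \<in> I \<Longrightarrow> c i \<in> R" "\<And>i. i \<in> I \<Longrightarrow> x i \<in> L"
  shows "\<phi> (\<Sum>i\<in>I. c i *\<^sub>c x i) = (\<Sum>i\<in>I. c i * \<phi> (x i))"
  using assms(2-4)
proof (induction I rule: finite_induct)
  case empty
  have "\<phi> (0 *\<^sub>c 0) = 0 * \<phi> 0" using \<phi> zero_R L_0 unfolding lin_functional_def by blast
  then show ?case by simp
next
  case (insert i I)
  have i: "c i *\<^sub>c x i \<in> L" "(\<Sum>i\<in>I. c i *\<^sub>c x i) \<in> L" "c i \<in> R" "x i \<in> L"
    using insert.prems by (auto intro!: L_sum)
  have "\<phi> (c i *\<^sub>c x i + (\<Sum>i\<in>I. c i *\<^sub>c x i)) = c i * \<phi> (x i) + (\<Sum>i\<in>I. c i * \<phi> (x i))"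
    using \<phi> i insert unfolding lin_functional_def by simp
  then show ?case using insert.hyps by simp
qed

text \<open>The functional is pulled back to \<open>RG\<close> along right multiplication by
  \<open>e\<close> and represented by its values at the group elements. The pull-back is unchanged
  by a further multiplication by \<open>e\<close>, which gives
  \<open>u \<star> star e = u\<close>.\<close>

lemma lin_functional_represented:
  assumes \<phi>: "lin_functional \<phi>"
  obtains u where "u \<in> RG" "u \<star> star e = u" "\<And>y. y \<in> L \<Longrightarrow> \<phi> y = ip y u"
proof -
  define u where "u = (\<lambda>g. if g \<in> carrier G then \<phi> (dl g \<star> e) else 0)"
  have ge: "dl g \<star> e \<in> L" if "g \<in> carrier G" for g using that by (intro L_conv_e RG_dl)
  have u: "u \<in> RG"
    using \<phi> ge by (intro RG_I CG_I) (auto simp: u_def lin_functional_def)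
  have rep: "ip z u = \<phi> (z \<star> e)" if z: "z \<in> RG" for z
  proof -
    have "z \<star> e = (\<Sum>g\<in>carrier G. z g *\<^sub>c dl g) \<star> e" using CG_expand[OF RG_CG[OF z]] by simp
    also have "\<dots> = (\<Sum>g\<in>carrier G. z g *\<^sub>c (dl g \<star> e))" by (simp only: conv_sum_left conv_sc_left)
    finally have "\<phi> (z \<star> e) = (\<Sum>g\<in>carrier G. z g * \<phi> (dl g \<star> e))"
      using lin_functional_sum[OF \<phi> fin_G, of z "\<lambda>g. dl g \<star> e"] ge RG_R[OF z] by simp
    then show ?thesis by (simp add: ip_def u_def)
  qed
  have "u \<star> star e = u"
  proof (rule ip_eqI)
    fix z assume z: "z \<in> RG"
    have "ip z (u \<star> star e) = ip (z \<star> e) u" using ip_conv_left[OF RG_CG[OF e_RG], of z u] by simp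
    also have "\<dots> = ip z u" using rep[of "z \<star> e"] rep[OF z] z by (simp add: RG_conv conv_assoc)
    finally show "ip z (u \<star> star e) = ip z u" .
  qed (use u in auto)
  moreover have "\<phi> y = ip y u" if "y \<in> L" for y using rep[OF L_RG[OF that]] that by (simp add: L_e_right)
  ultimately show thesis using that u by blast
qed

lemma ip_lin_functional: "u \<in> RG \<Longrightarrow> lin_functional (\<lambda>y. ip y u)"
  unfolding lin_functional_def by (auto simp: ip_add_left ip_sc_left)

text \<open>\<open>c\<close> represents the functional \<open>T e\<close>, and by invariance and
  linearity it determines \<open>T\<close>. The argument \<open>x\<close> whose functional is
  represented by \<open>star e\<close> gives a left inverse \<open>d\<close> of \<open>c\<close>.
  The product in the other order is a nonzero idempotent of the corner, hence
  \<open>e\<close>.\<close>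

lemma pairing_units:
  assumes T: "\<And>x. x \<in> L \<Longrightarrow> lin_functional (T x)" "\<And>y. y \<in> L \<Longrightarrow> lin_functional (\<lambda>x. T x y)"
    and inv: "\<And>g x y. g \<in> carrier G \<Longrightarrow> x \<in> L \<Longrightarrow> y \<in> L \<Longrightarrow> T (dl g \<star> x) (dl g \<star> y) = T x y"
    and surj: "\<And>\<phi>. lin_functional \<phi> \<Longrightarrow> \<exists>x\<in>L. \<forall>y\<in>L. T x y = \<phi> y"
  obtains c d where "c \<in> RG" "d \<in> RG" "e \<star> c = c" "c \<star> star e = c" "star e \<star> d = d" "d \<star> e = d"
    "c \<star> d = e" "d \<star> c = star e" "\<And>x y. x \<in> L \<Longrightarrow> y \<in> L \<Longrightarrow> T x y = ip y (x \<star> c)"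
proof -
  obtain c where c: "c \<in> RG" "c \<star> star e = c" "\<And>y. y \<in> L \<Longrightarrow> T e y = ip y c"
    using lin_functional_represented[OF T(1)[OF L_e]] by blast
  have ge: "dl g \<star> e \<in> L" if "g \<in> carrier G" for g using that by (intro L_conv_e RG_dl)
  have Tge: "T (dl g \<star> e) y = ip y (dl g \<star> c)" if g: "g \<in> carrier G" and y: "y \<in> L" for g y
  proof -
    have "dl g \<star> (dl (inv g) \<star> y) = y" using g y by (simp add: conv_assoc[symmetric] dl_conv_dl)
    then have "T (dl g \<star> e) y = T e (dl (inv g) \<star> y)"
      using inv[OF g L_e, of "dl (inv g) \<star> y"] g y by (simp add: L_conv)
    also have "\<dots> = ip (dl (inv g) \<star> y) c" using g y by (intro c(3) L_conv RG_dl) auto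
    also have "\<dots> = ip y (dl g \<star> c)" using g by (simp add: ip_conv_right star_dl)
    finally show ?thesis .
  qed
  have Txy: "T x y = ip y (x \<star> c)" if x: "x \<in> L" and y: "y \<in> L" for x y
  proof -
    have xR: "x g \<in> R" for g by (intro RG_R L_RG x)
    have "T x y = (\<Sum>g\<in>carrier G. x g * T (dl g \<star> e) y)"
      using lin_functional_sum[OF T(2)[OF y] fin_G, of x "\<lambda>g. dl g \<star> e"] ge xR L_expand[OF x] by simp
    also have "\<dots> = (\<Sum>g\<in>carrier G. ip y (x g *\<^sub>c (dl g \<star> c)))" using Tge y by (simp add: ip_sc_right)
    also have "\<dots> = ip y (\<Sum>g\<in>carrier G. x g *\<^sub>c (dl g \<star> c))"
    proof -
      have "ip y (sum f S) = (\<Sum>g\<in>S. ip y (f g))" for f :: "'a \<Rightarrow> 'a \<Rightarrow> complex" and S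
        by (induction S rule: infinite_finite_induct) (simp_all add: ip_add_right)
      then show ?thesis by simp
    qed
    also have "(\<Sum>g\<in>carrier G. x g *\<^sub>c (dl g \<star> c)) = (\<Sum>g\<in>carrier G. x g *\<^sub>c dl g) \<star> c"
      by (simp only: conv_sum_left conv_sc_left)
    also have "\<dots> = x \<star> c" using CG_expand[OF RG_CG[OF L_RG[OF x]]] by simp
    finally show ?thesis .
  qed
  have ec: "e \<star> c = c"
    by (rule eq_by_ip_L) (use c Txy[OF L_e] in \<open>auto simp: conv_assoc\<close>)
  obtain x where x: "x \<in> L" "\<And>y. y \<in> L \<Longrightarrow> T x y = ip y (star e)"
    using surj[OF ip_lin_functional[OF star_e_RG]] by blast
  have xc: "x \<star> c = star e"
    by (rule eq_by_ip_L) (use c x Txy star_e_idem in \<open>auto simp: conv_assoc\<close>)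
  define d where "d = star e \<star> x"
  have d: "d \<in> RG" "star e \<star> d = d" "d \<star> e = d"
    using x(1) L_e_right[OF x(1)] star_e_idem unfolding d_def
    by (blast, simp_all add: conv_assoc, simp add: conv_assoc[symmetric])
  have dc: "d \<star> c = star e" by (simp add: d_def conv_assoc xc star_e_idem)
  have cdcd: "c \<star> d \<star> (c \<star> d) = c \<star> d"
  proof -
    have "c \<star> d \<star> (c \<star> d) = c \<star> (d \<star> c) \<star> d" by (simp only: conv_assoc)
    also have "\<dots> = c \<star> d" by (simp only: dc c(2))
    finally show ?thesis .
  qed
  have "c \<star> d = 0 \<or> c \<star> d = e"
  proof (rule primitive[OF _ cdcd])
    show "c \<star> d \<in> RG" using c(1) d(1) by (rule RG_conv)
    show "e \<star> (c \<star> d) = c \<star> d" by (simp only: conv_assoc[symmetric] ec)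
    show "c \<star> d \<star> e = c \<star> d" by (simp only: conv_assoc d(3))
  qed
  moreover have "c \<star> d \<noteq> 0"
  proof
    assume "c \<star> d = 0"
    then have "d \<star> (c \<star> d) \<star> c = 0" by simp
    moreover have "d \<star> (c \<star> d) \<star> c = (d \<star> c) \<star> (d \<star> c)" by (simp only: conv_assoc)
    ultimately have "star e = 0" by (simp only: dc star_e_idem)
    then have "star (star e) = 0" by simp
    then show False using e_nz by simp
  qed
  ultimately show thesis using that[OF c(1) d(1) ec c(2) d(2,3) _ dc Txy] by blast
qed

text \<open>Symmetry of the form says that \<open>c\<close> and \<open>star c\<close> represent the
  same functional on \<open>L\<close>; the inverse of a symmetric element is symmetric.\<close>

lemma symmetric_units:
  assumes c: "c \<in> RG" "d \<in> RG" "e \<star> c = c" "c \<star> star e = c" "star e \<star> d = d" "d \<star> e = d"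
    "c \<star> d = e" "d \<star> c = star e"
    and sym: "\<And>x y. x \<in> L \<Longrightarrow> y \<in> L \<Longrightarrow> ip y (x \<star> c) = ip x (y \<star> c)"
  shows "star c = c" "star d = d"
proof -
  have cC: "c \<in> CG" "d \<in> CG" using c(1,2) by auto
  have es: "e \<star> star c = star c" "star c \<star> star e = star c"
    using arg_cong[OF c(4), of star] arg_cong[OF c(3), of star] by (simp_all add: star_conv)
  show sc: "star c = c"
  proof (rule eq_by_ip_L)
    fix y assume y: "y \<in> L"
    have "ip y (e \<star> c) = ip e (y \<star> c)" using sym[OF L_e y] .
    also have "\<dots> = ip (e \<star> star c) y"
      using ip_conv_left[OF star_CG, of e c y] cC by (simp add: star_star)
    finally show "ip y (star c) = ip y c" unfolding c(3) es(1) by (simp add: ip_commute)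
  qed (use c es in auto)
  have "star d \<star> e = star d" "star d \<star> c = star e"
    using arg_cong[OF c(5), of star] arg_cong[OF c(7), of star] sc by (simp_all add: star_conv)
  then have "star d = star d \<star> (c \<star> d)" by (simp only: c(7))
  also have "\<dots> = star d \<star> c \<star> d" by (simp only: conv_assoc)
  also have "\<dots> = d" by (simp only: \<open>star d \<star> c = star e\<close> c(5))
  finally show "star d = d" .
qed

end

section \<open>Forms on P expressed in the group algebra\<close>

context pim_model begin

sublocale P: group_ring_module "loc_ring MM" G P \<rho> by (rule P_module)

definition Fi :: "('g \<Rightarrow> complex) \<Rightarrow> 'm" where "Fi = inv_into (carrier P) F"

lemma F_L [intro]: "p \<in> carrier P \<Longrightarrow> F p \<in> L" using F_bij by (auto simp: bij_betw_def)
lemma F_inj: "p \<in> carrier P \<Longrightarrow> q \<in> carrier P \<Longrightarrow> F p = F q \<Longrightarrow> p = q"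
  using F_bij by (auto simp: bij_betw_def inj_on_def)
lemma Fi_P [intro]: "x \<in> L \<Longrightarrow> Fi x \<in> carrier P"
  unfolding Fi_def using F_bij by (metis bij_betw_def inv_into_into)
lemma F_Fi [simp]: "x \<in> L \<Longrightarrow> F (Fi x) = x"
  unfolding Fi_def using F_bij by (metis bij_betw_inv_into_right)
lemma Fi_F [simp]: "p \<in> carrier P \<Longrightarrow> Fi (F p) = p"
  unfolding Fi_def using F_bij by (metis bij_betw_inv_into_left)
lemma act_P [intro]: "g \<in> carrier G \<Longrightarrow> p \<in> carrier P \<Longrightarrow> \<rho> g p \<in> carrier P"
  using P.act_hom module_hom_closed by blast
lemma F_zero: "F \<zero>\<^bsub>P\<^esub> = 0" using F_add[of "\<zero>\<^bsub>P\<^esub>" "\<zero>\<^bsub>P\<^esub>"] by simp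
lemma Fi_add: "x \<in> L \<Longrightarrow> y \<in> L \<Longrightarrow> Fi (x + y) = Fi x \<oplus>\<^bsub>P\<^esub> Fi y"
  by (rule F_inj) (auto simp: F_add Fi_P L_add)
lemma Fi_smult: "r \<in> R \<Longrightarrow> x \<in> L \<Longrightarrow> Fi (r *\<^sub>c x) = r \<odot>\<^bsub>P\<^esub> Fi x"
  by (rule F_inj) (auto simp: F_smult Fi_P L_sc)
lemma Fi_act: "g \<in> carrier G \<Longrightarrow> x \<in> L \<Longrightarrow> Fi (dl g \<star> x) = \<rho> g (Fi x)"
  by (rule F_inj) (auto simp: F_act Fi_P L_conv)

lemma self_module_simps [simp]:
  "carrier (self_module (loc_ring MM)) = R"
  "x \<oplus>\<^bsub>self_module (loc_ring MM)\<^esub> y = x + y"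
  "x \<odot>\<^bsub>self_module (loc_ring MM)\<^esub> y = x * y"
  by (simp_all add: self_module_def)

lemma dual_module_simps:
  "carrier (dual_module (loc_ring MM) P) = module_hom (loc_ring MM) P (self_module (loc_ring MM)) \<inter> extensional (carrier P)"
  "f \<oplus>\<^bsub>dual_module (loc_ring MM) P\<^esub> h = (\<lambda>m\<in>carrier P. f m + h m)"
  "r \<odot>\<^bsub>dual_module (loc_ring MM) P\<^esub> f = (\<lambda>m\<in>carrier P. r * f m)"
  by (simp_all add: dual_module_def)

lemma hom_lin_functional:
  assumes f: "f \<in> module_hom (loc_ring MM) P (self_module (loc_ring MM))"
  shows "lin_functional (\<lambda>x. f (Fi x))"
  unfolding lin_functional_def
  using module_hom_closed[OF f] module_hom_add[OF f] module_hom_smult[OF f]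
  by (auto simp: Fi_add Fi_smult Fi_P)

lemma lin_functional_hom:
  assumes f: "lin_functional f"
  shows "(\<lambda>m\<in>carrier P. f (F m)) \<in> carrier (dual_module (loc_ring MM) P)"
  unfolding dual_module_simps module_hom_def
  using f by (auto simp: lin_functional_def F_add F_smult F_L)

text \<open>The pairing evaluates the image of one argument in the dual at the other argument; it is
  invariant because the dual action is contragredient.\<close>

lemma self_dual_units:
  assumes sd: "self_dual (loc_ring MM) G P \<rho>"
  obtains c d where "c \<in> RG" "d \<in> RG" "e \<star> c = c" "c \<star> star e = c" "star e \<star> d = d" "d \<star> e = d"
    "c \<star> d = e" "d \<star> c = star e"
proof -
  let ?D = "dual_module (loc_ring MM) P"
  obtain h where h: "h \<in> module_hom (loc_ring MM) P ?D" "bij_betw h (carrier P) (carrier ?D)"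
    "\<And>g m. g \<in> carrier G \<Longrightarrow> m \<in> carrier P \<Longrightarrow> h (\<rho> g m) = dual_act G P \<rho> g (h m)"
    using sd unfolding self_dual_def gr_iso_def by blast
  have hD: "h p \<in> carrier ?D" if "p \<in> carrier P" for p using h(2) that by (auto simp: bij_betw_def)
  then have hh: "h p \<in> module_hom (loc_ring MM) P (self_module (loc_ring MM))" if "p \<in> carrier P" for p
    using that by (auto simp: dual_module_simps)
  define T where "T x y = h (Fi x) (Fi y)" for x y
  show thesis
  proof (rule pairing_units[of T])
    show "lin_functional (T x)" if "x \<in> L" for x
      unfolding T_def using that by (intro hom_lin_functional hh Fi_P)
    show "lin_functional (\<lambda>x. T x y)" if y: "y \<in> L" for y
      unfolding lin_functional_def
    proof (intro conjI ballI)
      fix x assume x: "x \<in> L"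
      then show "T x y \<in> R" using module_hom_closed[OF hh[OF Fi_P[OF x]]] y by (auto simp: T_def)
      fix x' assume "x' \<in> L"
      then show "T (x + x') y = T x y + T x' y"
        using x y module_hom_add[OF h(1) Fi_P Fi_P] by (simp add: T_def Fi_add dual_module_simps Fi_P)
    next
      fix r x assume "r \<in> R" "x \<in> L"
      then show "T (r *\<^sub>c x) y = r * T x y"
        using y module_hom_smult[OF h(1), of r "Fi x"] by (simp add: T_def Fi_smult dual_module_simps Fi_P)
    qed
    show "T (dl g \<star> x) (dl g \<star> y) = T x y" if g: "g \<in> carrier G" and x: "x \<in> L" and y: "y \<in> L" for g x y
    proof -
      have "dl (inv g) \<star> (dl g \<star> y) = y" using g y by (simp add: conv_assoc[symmetric] dl_conv_dl)
      then have "\<rho> (inv g) (\<rho> g (Fi y)) = Fi y"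
        using g y by (metis Fi_act L_conv RG_dl inv_closed)
      then show ?thesis
        using g x y by (simp add: T_def Fi_act h(3) Fi_P dual_act_def act_P)
    qed
    show "\<exists>x\<in>L. \<forall>y\<in>L. T x y = \<phi> y" if \<phi>: "lin_functional \<phi>" for \<phi>
    proof -
      have "(\<lambda>m\<in>carrier P. \<phi> (F m)) \<in> h ` carrier P"
        using lin_functional_hom[OF \<phi>] h(2) by (simp add: bij_betw_def)
      then obtain p where p: "p \<in> carrier P" "h p = (\<lambda>m\<in>carrier P. \<phi> (F m))" by auto
      then have "T (F p) y = \<phi> y" if "y \<in> L" for y using that by (simp add: T_def Fi_P)
      then show ?thesis using p by blast
    qed
  qed (use that in blast)
qed

text \<open>The polarization is an invariant perfect pairing, and its symmetry makes both units
  fixed by \<open>star\<close>.\<close>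

lemma quadratic_type_units:
  assumes qt: "quadratic_type (loc_ring MM) G P \<rho>"
  obtains c d where "c \<in> RG" "d \<in> RG" "star c = c" "star d = d" "c \<star> d = e"
proof -
  let ?D = "dual_module (loc_ring MM) P"
  let ?pol = "polarization (loc_ring MM) P"
  obtain Q where Q: "quadratic_form (loc_ring MM) P Q" and nd: "nondegenerate_form (loc_ring MM) P Q"
    and QG: "\<And>g x. g \<in> carrier G \<Longrightarrow> x \<in> carrier P \<Longrightarrow> Q (\<rho> g x) = Q x"
    using qt unfolding quadratic_type_def by blast
  have QR: "Q x \<in> R" if "x \<in> carrier P" for x using Q that by (auto simp: quadratic_form_def)
  have pol: "?pol Q x y = Q (x \<oplus>\<^bsub>P\<^esub> y) - Q x - Q y" if "x \<in> carrier P" "y \<in> carrier P" for x y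
    unfolding polarization_def using QR that by (simp add: loc_ring_minus)
  define T where "T x y = ?pol Q (Fi x) (Fi y)" for x y
  obtain c d where cd: "c \<in> RG" "d \<in> RG" "e \<star> c = c" "c \<star> star e = c" "star e \<star> d = d" "d \<star> e = d"
    "c \<star> d = e" "d \<star> c = star e" "\<And>x y. x \<in> L \<Longrightarrow> y \<in> L \<Longrightarrow> T x y = ip y (x \<star> c)"
  proof (rule pairing_units[of T])
    show "lin_functional (T x)" if "x \<in> L" for x
      unfolding T_def using that Q by (intro hom_lin_functional) (auto simp: quadratic_form_def Fi_P)
    show "lin_functional (\<lambda>x. T x y)" if y: "y \<in> L" for y
      unfolding T_def using hom_lin_functional[of "\<lambda>x. ?pol Q x (Fi y)"] y Q
      by (auto simp: quadratic_form_def Fi_P)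
    show "T (dl g \<star> x) (dl g \<star> y) = T x y" if g: "g \<in> carrier G" and x: "x \<in> L" and y: "y \<in> L" for g x y
    proof -
      have "\<rho> g (Fi x) \<oplus>\<^bsub>P\<^esub> \<rho> g (Fi y) = \<rho> g (Fi x \<oplus>\<^bsub>P\<^esub> Fi y)"
        using module_hom_add[OF P.act_hom[OF g] Fi_P[OF x] Fi_P[OF y]] by simp
      then show ?thesis using g x y by (simp add: T_def Fi_act pol act_P Fi_P QG)
    qed
    show "\<exists>x\<in>L. \<forall>y\<in>L. T x y = \<phi> y" if \<phi>: "lin_functional \<phi>" for \<phi>
    proof -
      have "(\<lambda>m\<in>carrier P. \<phi> (F m)) \<in> (\<lambda>x. restrict (?pol Q x) (carrier P)) ` carrier P"
        using lin_functional_hom[OF \<phi>] nd by (simp add: nondegenerate_form_def bij_betw_def)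
      then obtain p where p: "p \<in> carrier P" "restrict (?pol Q p) (carrier P) = (\<lambda>m\<in>carrier P. \<phi> (F m))" by auto
      have "T (F p) y = \<phi> y" if y: "y \<in> L" for y
        using fun_cong[OF p(2), of "Fi y"] p(1) y by (simp add: T_def Fi_P)
      then show ?thesis using p by blast
    qed
  qed blast
  have "T x y = T y x" if "x \<in> L" "y \<in> L" for x y
    using that by (simp add: T_def pol Fi_P P.a_comm)
  then have "ip y (x \<star> c) = ip x (y \<star> c)" if "x \<in> L" "y \<in> L" for x y using cd(9) that by metis
  from symmetric_units[OF cd(1-8) this] show thesis using that cd(1,2,7) by blast
qed

text \<open>The form is the sum of \<open>y\<^sub>g y\<^sub>g\<^sub>t\<close> over the cosets \<open>{g, gt}\<close>, pulled back along \<open>x \<mapsto> y = xw\<close>;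
  summing over \<open>g \<in> G\<close> counts every coset twice.\<close>

lemma quadratic_type_from_units:
  assumes w: "w \<in> RG" "d' \<in> RG" "e \<star> w = w" "d' \<star> e = d'"
    and t: "t \<in> carrier G" "t \<otimes> t = \<one>" "t \<noteq> \<one>"
    and u: "w \<star> dl t \<star> star w \<star> d' = e" "d' \<star> (w \<star> dl t \<star> star w) = star e"
  shows "quadratic_type (loc_ring MM) G P \<rho>"
proof -
  have it: "inv t = t" using t inv_equality by blast
  define B where "B x y = ip (x \<star> w) (y \<star> w \<star> dl t)" for x y
  have B_sym: "B x y = B y x" for x y
    using ip_conv_left[OF dl_CG[OF t(1)], of "y \<star> w" "x \<star> w"] t(1)
    by (simp add: B_def star_dl it ip_commute)
  have B_lin: "B (x + x') y = B x y + B x' y" "B (r *\<^sub>c x) y = r * B x y" for x x' y r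
    by (simp_all add: B_def conv_add_left ip_add_left ip_sc_left)
  have B_lin2: "B y (x + x') = B y x + B y x'" "B y (r *\<^sub>c x) = r * B y x" for x x' y r
    using B_lin B_sym by metis+
  \<comment> \<open>\<open>B\<close> is the pairing given by \<open>c'\<close>, so its perfectness
    reduces to invertibility of \<open>c'\<close>.\<close>
  define c' where "c' = w \<star> dl t \<star> star w"
  have wC: "w \<in> CG" using w(1) by blast
  have c'R: "c' \<in> RG" unfolding c'_def using w(1) t(1) by auto
  have B_c': "B x y = ip y (x \<star> c')" for x y
  proof -
    have "B x y = ip (y \<star> w) (x \<star> w \<star> dl t)" using B_sym[of x y] by (simp add: B_def)
    also have "\<dots> = ip y (x \<star> w \<star> dl t \<star> star w)" by (rule ip_conv_left[OF wC])
    finally show ?thesis by (simp add: c'_def conv_assoc)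
  qed
  have c'e: "c' \<star> star e = c'"
    using arg_cong[OF w(3), of star] by (simp add: c'_def conv_assoc star_conv)
  have BR: "B x y \<in> R" if "x \<in> RG" "y \<in> RG" for x y
    unfolding B_def using that w(1) t(1) by (intro ip_R RG_conv RG_dl)
  have B2: "B x x \<in> twoR" if x: "x \<in> RG" for x
  proof -
    define y where "y = x \<star> w"
    have y: "y \<in> RG" unfolding y_def using x w(1) by auto
    \<comment> \<open>Right translation by \<open>t\<close> pairs equal terms, and
      \<open>t \<noteq> \<one>\<close> excludes fixed points. Thus the diagonal of \<open>B\<close>
      is divisible by \<open>2\<close>, and \<open>Q\<close> takes values in
      \<open>R\<close>.\<close>
    have "(\<Sum>g\<in>carrier G. y g * y (g \<otimes> t)) \<in> twoR"
    proof (rule sum_involution[where f = "\<lambda>g. g \<otimes> t" and I = twoR and h = "\<lambda>g. y g * y (g \<otimes> t)"])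
      fix g assume g: "g \<in> carrier G"
      show "g \<otimes> t \<in> carrier G" using g t(1) by simp
      show gtt: "g \<otimes> t \<otimes> t = g" using g t by (simp add: m_assoc)
      show "y g * y (g \<otimes> t) \<in> R" using y by (intro mult_R RG_R)
      show "y (g \<otimes> t) * y (g \<otimes> t \<otimes> t) - y g * y (g \<otimes> t) \<in> twoR" by (simp add: gtt)
    next
      fix g assume g: "g \<in> carrier G" "g \<otimes> t = g"
      then show "y g * y (g \<otimes> t) \<in> twoR" using t l_cancel_one by auto
    qed auto
    moreover have "B x x = (\<Sum>g\<in>carrier G. y g * y (g \<otimes> t))"
      using t(1) by (simp add: B_def ip_def y_def conv_dl_right it)
    ultimately show ?thesis by simp
  qed
  define Q where "Q p = B (F p) (F p) / 2" for p
  have F_RG: "F p \<in> RG" if "p \<in> carrier P" for p using that by blast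
  have QR: "Q p \<in> R" if "p \<in> carrier P" for p
    using B2[OF F_RG[OF that]] by (auto simp: Q_def elim!: twoRE)
  have pol: "polarization (loc_ring MM) P Q p q = B (F p) (F q)" if pq: "p \<in> carrier P" "q \<in> carrier P" for p q
  proof -
    have "polarization (loc_ring MM) P Q p q = Q (p \<oplus>\<^bsub>P\<^esub> q) - Q p - Q q"
      unfolding polarization_def using pq QR by (simp add: loc_ring_minus)
    also have "\<dots> = B (F p) (F q)"
      using pq B_sym[of "F q" "F p"] by (simp add: Q_def F_add B_lin B_lin2 field_simps)
    finally show ?thesis .
  qed
  have QG: "Q (\<rho> g p) = Q p" if g: "g \<in> carrier G" and p: "p \<in> carrier P" for g p
  proof -
    have "dl (inv g) \<star> (dl g \<star> (F p \<star> w \<star> dl t)) = F p \<star> w \<star> dl t"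
      using g by (simp add: conv_assoc[symmetric] dl_conv_dl)
        (use p in \<open>simp add: one_conv_L F_L\<close>)
    then have "B (dl g \<star> F p) (dl g \<star> F p) = B (F p) (F p)"
      unfolding B_def conv_assoc[of "dl g"] ip_conv_right star_dl[OF g] by (simp add: conv_assoc)
    then show ?thesis using g p by (simp add: Q_def F_act)
  qed
  have hom: "(\<lambda>q. polarization (loc_ring MM) P Q p q) \<in> module_hom (loc_ring MM) P (self_module (loc_ring MM))"
    if p: "p \<in> carrier P" for p
    unfolding module_hom_def using p BR F_RG by (auto simp: pol F_add F_smult B_lin2)
  have hom2: "(\<lambda>q. polarization (loc_ring MM) P Q q p) \<in> module_hom (loc_ring MM) P (self_module (loc_ring MM))"
    if p: "p \<in> carrier P" for p
    unfolding module_hom_def using p BR F_RG by (auto simp: pol F_add F_smult B_lin)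
  have "quadratic_form (loc_ring MM) P Q"
    unfolding quadratic_form_def
    using QR hom hom2 by (auto simp: Q_def F_smult B_lin B_lin2)
  moreover have "nondegenerate_form (loc_ring MM) P Q"
    unfolding nondegenerate_form_def
  proof (rule bij_betw_imageI)
    show "inj_on (\<lambda>x. restrict (polarization (loc_ring MM) P Q x) (carrier P)) (carrier P)"
    proof (rule inj_onI)
      fix p q assume pq: "p \<in> carrier P" "q \<in> carrier P"
        and eq: "restrict (polarization (loc_ring MM) P Q p) (carrier P) = restrict (polarization (loc_ring MM) P Q q) (carrier P)"
      have "F p \<star> c' = F q \<star> c'"
      proof (rule eq_by_ip_L)
        fix y assume y: "y \<in> L"
        show "ip y (F p \<star> c') = ip y (F q \<star> c')"
          using fun_cong[OF eq, of "Fi y"] y pq by (simp add: Fi_P pol B_c')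
      qed (use pq c'R F_RG in \<open>auto simp: conv_assoc c'e\<close>)
      then have "F p \<star> (c' \<star> d') = F q \<star> (c' \<star> d')" by (simp only: conv_assoc[symmetric])
      then have "F p = F q" using u(1) pq by (simp add: c'_def L_e_right F_L)
      then show "p = q" using F_inj pq by blast
    qed
    show "(\<lambda>x. restrict (polarization (loc_ring MM) P Q x) (carrier P)) ` carrier P = carrier (dual_module (loc_ring MM) P)"
    proof (intro equalityI subsetI)
      fix f assume "f \<in> (\<lambda>x. restrict (polarization (loc_ring MM) P Q x) (carrier P)) ` carrier P"
      then obtain p where "p \<in> carrier P" "f = restrict (polarization (loc_ring MM) P Q p) (carrier P)" by blast
      then show "f \<in> carrier (dual_module (loc_ring MM) P)"
        using hom[of p] unfolding dual_module_simps module_hom_def by auto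
    next
      fix f assume f: "f \<in> carrier (dual_module (loc_ring MM) P)"
      then have "lin_functional (\<lambda>x. f (Fi x))" by (intro hom_lin_functional) (simp add: dual_module_simps)
      then obtain v where v: "v \<in> RG" "v \<star> star e = v" "\<And>y. y \<in> L \<Longrightarrow> f (Fi y) = ip y v"
        using lin_functional_represented by blast
      \<comment> \<open>\<open>d'\<close> inverts \<open>c'\<close>, so
        \<open>x \<star> c' = v\<close>. Surjectivity uses \<open>d'\<close> as a left inverse,
        injectivity above used it as a right inverse.\<close>
      define x where "x = v \<star> d'"
      have x: "x \<in> L" unfolding x_def using v(1) w by (intro LI) (auto simp: conv_assoc)
      have xc: "x \<star> c' = v" using u(2) v(2) by (simp add: x_def conv_assoc c'_def)
      have "f = restrict (polarization (loc_ring MM) P Q (Fi x)) (carrier P)"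
      proof (rule extensionalityI)
        fix q assume q: "q \<in> carrier P"
        have "f q = ip (F q) v" using v(3)[of "F q"] q by (simp add: F_L)
        also have "\<dots> = polarization (loc_ring MM) P Q (Fi x) q"
          using q x by (simp add: pol Fi_P B_c' xc)
        finally show "f q = restrict (polarization (loc_ring MM) P Q (Fi x)) (carrier P) q" using q by simp
      qed (use f in \<open>auto simp: dual_module_simps\<close>)
      then show "f \<in> (\<lambda>x. restrict (polarization (loc_ring MM) P Q x) (carrier P)) ` carrier P"
        using Fi_P[OF x] by blast
    qed
  qed
  ultimately show ?thesis unfolding quadratic_type_def using QG by blast
qed

end

section \<open>Traces in terms of frames\<close>

text \<open>A finite frame is a family of vectors \<open>v i\<close> with linear functionals \<open>f i\<close> such that
  \<open>x = \<Sum> f i x \<cdot> v i\<close> for all \<open>x\<close>. Unlike bases, frames are available without choices, and they compute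
  traces equally well.\<close>

context vectorspace begin

lemma basis_coordinates:
  assumes B: "finite B" "basis B"
  obtains co where "\<And>b x. b \<in> B \<Longrightarrow> x \<in> carrier V \<Longrightarrow> co b x \<in> carrier K"
    "\<And>b x y. b \<in> B \<Longrightarrow> x \<in> carrier V \<Longrightarrow> y \<in> carrier V \<Longrightarrow> co b (x \<oplus>\<^bsub>V\<^esub> y) = co b x \<oplus>\<^bsub>K\<^esub> co b y"
    "\<And>b c x. b \<in> B \<Longrightarrow> c \<in> carrier K \<Longrightarrow> x \<in> carrier V \<Longrightarrow> co b (c \<odot>\<^bsub>V\<^esub> x) = c \<otimes>\<^bsub>K\<^esub> co b x"
    "\<And>x. x \<in> carrier V \<Longrightarrow> lincomb (\<lambda>b. co b x) B = x"
    "\<And>a b. a \<in> B \<rightarrow> carrier K \<Longrightarrow> b \<in> B \<Longrightarrow> co b (lincomb a B) = a b"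
    "\<And>b. b \<in> B \<Longrightarrow> co b b = \<one>\<^bsub>K\<^esub>"
proof -
  have BV: "B \<subseteq> carrier V" using B(2) by (simp add: basis_def)
  have ex1: "\<exists>!a. a \<in> B \<rightarrow>\<^sub>E carrier K \<and> lincomb a B = x" if "x \<in> carrier V" for x
    using basis_criterion[OF B(1) BV] B(2) that by simp
  define co where "co b x = (THE a. a \<in> B \<rightarrow>\<^sub>E carrier K \<and> lincomb a B = x) b" for b x
  have co: "(\<lambda>b\<in>B. co b x) \<in> B \<rightarrow>\<^sub>E carrier K \<and> lincomb (\<lambda>b\<in>B. co b x) B = x" if x: "x \<in> carrier V" for x
  proof -
    have *: "(THE a. a \<in> B \<rightarrow>\<^sub>E carrier K \<and> lincomb a B = x) \<in> B \<rightarrow>\<^sub>E carrier K \<and>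
        lincomb (THE a. a \<in> B \<rightarrow>\<^sub>E carrier K \<and> lincomb a B = x) B = x"
      using theI'[OF ex1[OF x]] .
    then have "(\<lambda>b\<in>B. co b x) = (THE a. a \<in> B \<rightarrow>\<^sub>E carrier K \<and> lincomb a B = x)"
      unfolding co_def by (intro extensionalityI[of _ B]) (auto simp: PiE_def)
    then show ?thesis using * by simp
  qed
  have lc: "lincomb a B = lincomb a' B" if "\<And>b. b \<in> B \<Longrightarrow> a b = a' b" "a' \<in> B \<rightarrow> carrier K" for a a'
    using that BV by (intro lincomb_cong) simp_all
  have uniq: "co b (lincomb a B) = a b" if a: "a \<in> B \<rightarrow> carrier K" and b: "b \<in> B" for a b
  proof -
    have x: "lincomb a B \<in> carrier V" using BV a by (intro lincomb_closed) simp_all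
    have "restrict a B \<in> B \<rightarrow>\<^sub>E carrier K" using a by auto
    moreover have "lincomb (restrict a B) B = lincomb a B" by (rule lc) (use a in auto)
    ultimately have "restrict a B = (\<lambda>b\<in>B. co b (lincomb a B))" using ex1[OF x] co[OF x] by blast
    then show ?thesis using b by (metis restrict_apply')
  qed
  have coS: "co b x \<in> carrier K" if "b \<in> B" "x \<in> carrier V" for b x
    using co[OF that(2)] that(1) by (auto simp: PiE_def Pi_def)
  have colc: "lincomb (\<lambda>b. co b x) B = x" if x: "x \<in> carrier V" for x
    using lc[of "\<lambda>b\<in>B. co b x" "\<lambda>b. co b x"] co[OF x] coS[OF _ x] by auto
  have add: "co b (x \<oplus>\<^bsub>V\<^esub> y) = co b x \<oplus>\<^bsub>K\<^esub> co b y" if b: "b \<in> B" and x: "x \<in> carrier V" and y: "y \<in> carrier V" for b x y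
  proof -
    have cS: "(\<lambda>b. co b x) \<in> B \<rightarrow> carrier K" "(\<lambda>b. co b y) \<in> B \<rightarrow> carrier K" using coS x y by auto
    have "lincomb (\<lambda>b. co b x \<oplus>\<^bsub>K\<^esub> co b y) B = x \<oplus>\<^bsub>V\<^esub> y"
      using lincomb_sum[OF B(1) BV cS] colc[OF x] colc[OF y] by simp
    moreover have "(\<lambda>b. co b x \<oplus>\<^bsub>K\<^esub> co b y) \<in> B \<rightarrow> carrier K" using coS x y by auto
    ultimately show ?thesis using uniq[OF _ b] by metis
  qed
  have smult: "co b (c \<odot>\<^bsub>V\<^esub> x) = c \<otimes>\<^bsub>K\<^esub> co b x" if b: "b \<in> B" and c: "c \<in> carrier K" and x: "x \<in> carrier V" for b c x
  proof -
    have cS: "(\<lambda>b. co b x) \<in> B \<rightarrow> carrier K" using coS x by auto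
    have "lincomb (\<lambda>b. c \<otimes>\<^bsub>K\<^esub> co b x) B = c \<odot>\<^bsub>V\<^esub> x"
      using lincomb_smult[OF BV cS c] colc[OF x] by simp
    moreover have "(\<lambda>b. c \<otimes>\<^bsub>K\<^esub> co b x) \<in> B \<rightarrow> carrier K" using coS c x by auto
    ultimately show ?thesis using uniq[OF _ b] by metis
  qed
  have diag: "co b b = \<one>\<^bsub>K\<^esub>" if b: "b \<in> B" for b
  proof -
    define a where "a b' = (if b = b' then \<one>\<^bsub>K\<^esub> else \<zero>\<^bsub>K\<^esub>)" for b'
    have "lincomb a B = (\<Oplus>\<^bsub>V\<^esub>b'\<in>B. if b = b' then b' else \<zero>\<^bsub>V\<^esub>)"
      unfolding lincomb_def a_def using BV by (intro finsum_cong') auto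
    also have "\<dots> = b" using BV b B(1) finsum_singleton[of b B "\<lambda>b'. b'"] by auto
    finally show ?thesis using uniq[of a, OF _ b] by (simp add: a_def)
  qed
  show thesis by (rule that[of co]) (fact coS add smult colc uniq diag)+
qed

lemma spanning_family_fin_dim:
  assumes I: "finite I" "v \<in> I \<rightarrow> carrier V"
    and span: "\<And>x. x \<in> carrier V \<Longrightarrow> \<exists>c\<in>I \<rightarrow> carrier K. x = (\<Oplus>\<^bsub>V\<^esub>i\<in>I. c i \<odot>\<^bsub>V\<^esub> v i)"
  shows "fin_dim"
proof -
  have "gen_set (v ` I)"
  proof
    show "span (v ` I) \<subseteq> carrier V" using I(2) by (intro span_is_subset2) auto
    show "carrier V \<subseteq> span (v ` I)"
    proof
      fix x assume x: "x \<in> carrier V"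
      then obtain c where c: "c \<in> I \<rightarrow> carrier K" "x = (\<Oplus>\<^bsub>V\<^esub>i\<in>I. c i \<odot>\<^bsub>V\<^esub> v i)" using span by blast
      interpret sp: submodule K "span (v ` I)" V
        using I(2) by (intro span_is_submodule) auto
      have vs: "v i \<in> span (v ` I)" if "i \<in> I" for i
        using in_own_span[of "v ` I"] I(2) that by auto
      have "(\<Oplus>\<^bsub>V\<^esub>i\<in>S. c i \<odot>\<^bsub>V\<^esub> v i) \<in> span (v ` I)" if "S \<subseteq> I" for S
        using finite_subset[OF that I(1)] that
      proof (induction S rule: finite_induct)
        case empty
        then show ?case by simp
      next
        case (insert k S)
        have "c k \<odot>\<^bsub>V\<^esub> v k \<in> carrier V" using insert.prems c(1) I(2) by (intro smult_closed) auto
        moreover have "(\<lambda>i. c i \<odot>\<^bsub>V\<^esub> v i) \<in> S \<rightarrow> carrier V"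
        proof
          fix j assume "j \<in> S" then show "c j \<odot>\<^bsub>V\<^esub> v j \<in> carrier V"
            using insert.prems c(1) I(2) by (intro smult_closed) auto
        qed
        ultimately have "(\<Oplus>\<^bsub>V\<^esub>i\<in>insert k S. c i \<odot>\<^bsub>V\<^esub> v i) = c k \<odot>\<^bsub>V\<^esub> v k \<oplus>\<^bsub>V\<^esub> (\<Oplus>\<^bsub>V\<^esub>i\<in>S. c i \<odot>\<^bsub>V\<^esub> v i)"
          using insert.hyps by (intro finsum_insert)
        also have "\<dots> \<in> span (v ` I)"
          using insert vs c(1) by (intro sp.m_closed sp.smult_closed) auto
        finally show ?case .
      qed
      from this[OF subset_refl] show "x \<in> span (v ` I)" by (simp only: c(2))
    qed
  qed
  then show "fin_dim" unfolding fin_dim_def using I by (intro exI[of _ "v ` I"]) auto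
qed

end

locale complex_vectorspace = vectorspace "complex_subring S" V
  for S :: "complex set" and V :: "(complex, 'v, 'vs) module_scheme" (structure)
begin

lemma S_cring: "cring (complex_subring S)" by unfold_locales

definition functional :: "('v \<Rightarrow> complex) \<Rightarrow> bool" where
  "functional f \<longleftrightarrow> (\<forall>x\<in>carrier V. f x \<in> S) \<and>
     (\<forall>x\<in>carrier V. \<forall>y\<in>carrier V. f (x \<oplus> y) = f x + f y) \<and>
     (\<forall>c\<in>S. \<forall>x\<in>carrier V. f (c \<odot> x) = c * f x)"

lemma functionalD:
  assumes "functional f"
  shows "x \<in> carrier V \<Longrightarrow> f x \<in> S"
    and "x \<in> carrier V \<Longrightarrow> y \<in> carrier V \<Longrightarrow> f (x \<oplus> y) = f x + f y"
    and "c \<in> S \<Longrightarrow> x \<in> carrier V \<Longrightarrow> f (c \<odot> x) = c * f x"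
  using assms unfolding functional_def by blast+

lemma functional_finsum:
  assumes f: "functional f" and "finite I" "c \<in> I \<rightarrow> S" "w \<in> I \<rightarrow> carrier V"
  shows "f (\<Oplus>i\<in>I. c i \<odot> w i) = (\<Sum>i\<in>I. c i * f (w i))"
  using assms(2-4)
proof (induction I rule: finite_induct)
  case empty
  have "f (\<zero> \<oplus> \<zero>) = f \<zero> + f \<zero>" using f M.zero_closed unfolding functional_def by blast
  then show ?case by simp
next
  case (insert i I)
  have c: "c i \<in> S" "w i \<in> carrier V" "c \<in> I \<rightarrow> S" "w \<in> I \<rightarrow> carrier V" using insert.prems by auto
  have ci: "c i \<odot> w i \<in> carrier V" using c by (intro smult_closed) simp_all
  have cI: "(\<lambda>i. c i \<odot> w i) \<in> I \<rightarrow> carrier V"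
  proof
    fix j assume "j \<in> I" then show "c j \<odot> w j \<in> carrier V" using c by (intro smult_closed) auto
  qed
  have "(\<Oplus>i\<in>insert i I. c i \<odot> w i) = c i \<odot> w i \<oplus> (\<Oplus>i\<in>I. c i \<odot> w i)"
    using insert.hyps ci cI by (intro finsum_insert)
  also have "f \<dots> = f (c i \<odot> w i) + f (\<Oplus>i\<in>I. c i \<odot> w i)"
    using f ci finsum_closed[OF cI] unfolding functional_def by blast
  also have "f (c i \<odot> w i) = c i * f (w i)" using f c unfolding functional_def by blast
  finally show ?case using insert.IH c insert.hyps by simp
qed

text \<open>Basis vectors are expanded in the frame and images of frame vectors in the basis; the
  two double sums agree. The value is the same for every basis, so the choice by \<open>SOME\<close>
  in \<open>lin_trace\<close> is harmless, and a basis exists because the frame spans.\<close>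

lemma lin_trace_frame:
  assumes I: "finite I" "v \<in> I \<rightarrow> carrier V" "\<And>i. i \<in> I \<Longrightarrow> functional (f i)"
    and frame: "\<And>x. x \<in> carrier V \<Longrightarrow> x = (\<Oplus>i\<in>I. f i x \<odot> v i)"
    and T: "T \<in> module_hom (complex_subring S) V V"
  shows "lin_trace (complex_subring S) V T = (\<Sum>i\<in>I. f i (T (v i)))"
proof -
  have TV: "T x \<in> carrier V" if "x \<in> carrier V" for x using module_hom_closed[OF T] that by auto
  have functional_T: "functional (\<lambda>x. \<phi> (T x))" if "functional \<phi>" for \<phi>
    using that TV module_hom_add[OF T] module_hom_smult[OF T] unfolding functional_def by simp
  have fS: "f i x \<in> S" if "i \<in> I" "x \<in> carrier V" for i x using I(3) that unfolding functional_def by blast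
  have coords: "\<exists>co. (\<forall>b\<in>B. functional (co b)) \<and>
      (\<forall>x\<in>carrier V. x = (\<Oplus>b\<in>B. co b x \<odot> b)) \<and>
      (\<forall>a x. a \<in> B \<rightarrow> S \<and> x = lincomb a B \<longrightarrow> (\<forall>b\<in>B. co b x = a b))"
    if B: "finite B" "basis B" for B
  proof -
    obtain co where co: "\<And>b x. b \<in> B \<Longrightarrow> x \<in> carrier V \<Longrightarrow> co b x \<in> carrier (complex_subring S)"
      "\<And>b x y. b \<in> B \<Longrightarrow> x \<in> carrier V \<Longrightarrow> y \<in> carrier V \<Longrightarrow>
        co b (x \<oplus> y) = co b x \<oplus>\<^bsub>complex_subring S\<^esub> co b y"
      "\<And>b c x. b \<in> B \<Longrightarrow> c \<in> carrier (complex_subring S) \<Longrightarrow> x \<in> carrier V \<Longrightarrow>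
        co b (c \<odot> x) = c \<otimes>\<^bsub>complex_subring S\<^esub> co b x"
      "\<And>x. x \<in> carrier V \<Longrightarrow> lincomb (\<lambda>b. co b x) B = x"
      "\<And>a b. a \<in> B \<rightarrow> carrier (complex_subring S) \<Longrightarrow> b \<in> B \<Longrightarrow> co b (lincomb a B) = a b"
      by (rule basis_coordinates[OF B]) (rule that)
    have p1: "\<forall>b\<in>B. functional (co b)" unfolding functional_def using co(1-3) by simp
    have p2: "\<forall>x\<in>carrier V. x = (\<Oplus>b\<in>B. co b x \<odot> b)"
      using co(4) unfolding lincomb_def by (intro ballI) (rule sym)
    have p3: "\<forall>a x. a \<in> B \<rightarrow> S \<and> x = lincomb a B \<longrightarrow> (\<forall>b\<in>B. co b x = a b)"
      using co(5) by simp
    show ?thesis by (intro exI[of _ co] conjI) (fact p1 p2 p3)+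
  qed
  have traces: "t = (\<Sum>i\<in>I. f i (T (v i)))"
    if B: "finite B" "basis B" and a: "\<And>b. b \<in> B \<Longrightarrow> a b \<in> B \<rightarrow> S \<and> T b = lincomb (a b) B"
      and t: "t = (\<Sum>b\<in>B. a b b)" for B a t
  proof -
    obtain co where co': "\<forall>b\<in>B. functional (co b)"
      "\<forall>x\<in>carrier V. x = (\<Oplus>b\<in>B. co b x \<odot> b)"
      "\<forall>a x. a \<in> B \<rightarrow> S \<and> x = lincomb a B \<longrightarrow> (\<forall>b\<in>B. co b x = a b)"
      using coords[OF B] by (elim exE conjE)
    note co = bspec[OF co'(1)] bspec[OF co'(2)] mp[OF spec[OF spec[OF co'(3)]], THEN bspec, OF conjI]
    have BV: "B \<subseteq> carrier V" using B(2) by (simp add: basis_def)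
    have coS: "co b x \<in> S" if "b \<in> B" "x \<in> carrier V" for b x using co(1) that unfolding functional_def by blast
    have "t = (\<Sum>b\<in>B. co b (T b))"
      unfolding t using a co(3) by (intro sum.cong) auto
    also have "\<dots> = (\<Sum>b\<in>B. \<Sum>i\<in>I. f i b * co b (T (v i)))"
    proof (rule sum.cong[OF refl])
      fix b assume b: "b \<in> B"
      then have bV: "b \<in> carrier V" using BV by auto
      have "(\<lambda>x. co b (T x)) b = (\<lambda>x. co b (T x)) (\<Oplus>i\<in>I. f i b \<odot> v i)" by (rule arg_cong[of b]) (rule frame[OF bV])
      also have "\<dots> = (\<Sum>i\<in>I. f i b * co b (T (v i)))"
        by (rule functional_finsum[OF functional_T[OF co(1)[OF b]] I(1) _ I(2)]) (use fS bV in auto)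
      finally show "co b (T b) = (\<Sum>i\<in>I. f i b * co b (T (v i)))" .
    qed
    also have "\<dots> = (\<Sum>i\<in>I. \<Sum>b\<in>B. co b (T (v i)) * f i b)"
      by (subst sum.swap) (simp only: mult.commute)
    also have "\<dots> = (\<Sum>i\<in>I. f i (T (v i)))"
    proof (rule sum.cong[OF refl])
      fix i assume i: "i \<in> I"
      then have Tv: "T (v i) \<in> carrier V" using I(2) TV by auto
      have "f i (T (v i)) = f i (\<Oplus>b\<in>B. co b (T (v i)) \<odot> b)" by (rule arg_cong[OF co(2)[OF Tv]])
      also have "\<dots> = (\<Sum>b\<in>B. co b (T (v i)) * f i b)"
        by (rule functional_finsum[OF I(3)[OF i] B(1)]) (use coS Tv BV in auto)
      finally show "(\<Sum>b\<in>B. co b (T (v i)) * f i b) = f i (T (v i))" by simp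
    qed
    finally show ?thesis .
  qed
  have "fin_dim"
  proof (rule spanning_family_fin_dim[OF I(1,2)])
    fix x assume x: "x \<in> carrier V"
    show "\<exists>c\<in>I \<rightarrow> carrier (complex_subring S). x = (\<Oplus>i\<in>I. c i \<odot> v i)"
    proof (rule bexI[of "\<lambda>c. x = (\<Oplus>i\<in>I. c i \<odot> v i)" "\<lambda>i. f i x"])
      show "x = (\<Oplus>i\<in>I. f i x \<odot> v i)" by (rule frame[OF x])
      show "(\<lambda>i. f i x) \<in> I \<rightarrow> carrier (complex_subring S)" using fS x by simp
    qed
  qed
  then obtain B where B: "finite B" "basis B" using finite_basis_exists by blast
  obtain co where co': "\<forall>b\<in>B. functional (co b)" "\<forall>x\<in>carrier V. x = (\<Oplus>b\<in>B. co b x \<odot> b)"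
    using coords[OF B] by (elim exE conjE)
  note co = bspec[OF co'(1)] bspec[OF co'(2)]
  have BV: "B \<subseteq> carrier V" using B(2) by (simp add: basis_def)
  define a where "a b b' = co b' (T b)" for b b'
  have a: "a b \<in> B \<rightarrow> S" "T b = lincomb (a b) B" if b: "b \<in> B" for b
  proof -
    have Tb: "T b \<in> carrier V" using TV BV b by auto
    show "a b \<in> B \<rightarrow> S" using co(1) Tb unfolding functional_def a_def by auto
    show "T b = lincomb (a b) B" unfolding lincomb_def a_def by (rule co(2)[OF Tb])
  qed
  have fsum: "(\<Oplus>\<^bsub>complex_subring S\<^esub>b\<in>B. a b b) = (\<Sum>b\<in>B. a b b)" if "\<And>b. b \<in> B \<Longrightarrow> a b \<in> B \<rightarrow> S" for B :: "'v set" and a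
    using that by (intro complex_subring_finsum[OF S_cring]) auto
  show ?thesis
    unfolding lin_trace_def
  proof (rule someI2)
    show "\<exists>B' a'. finite B' \<and> basis B' \<and>
      (\<forall>b\<in>B'. a' b \<in> B' \<rightarrow> carrier (complex_subring S) \<and> T b = lincomb (a' b) B') \<and>
      (\<Oplus>\<^bsub>complex_subring S\<^esub>b\<in>B. a b b) = (\<Oplus>\<^bsub>complex_subring S\<^esub>b\<in>B'. a' b b)"
      using B a by (intro exI[of _ B] exI[of _ a]) auto
    fix t assume "\<exists>B a. finite B \<and> basis B \<and>
      (\<forall>b\<in>B. a b \<in> B \<rightarrow> carrier (complex_subring S) \<and> T b = lincomb (a b) B) \<and>
      t = (\<Oplus>\<^bsub>complex_subring S\<^esub>b\<in>B. a b b)"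
    then obtain B a where *: "finite B" "basis B" "\<And>b. b \<in> B \<Longrightarrow> a b \<in> B \<rightarrow> S \<and> T b = lincomb (a b) B"
      "t = (\<Oplus>\<^bsub>complex_subring S\<^esub>b\<in>B. a b b)" by auto
    then show "t = (\<Sum>i\<in>I. f i (T (v i)))" using fsum[of B a] by (intro traces[of B a]) auto
  qed
qed

end

section \<open>Extension of scalars\<close>

locale scalar_extension = module "complex_subring R" M
  for R :: "complex set" and M :: "(complex, 'm, 'ms) module_scheme" (structure) +
  fixes K :: "complex set"
  assumes K_field: "field (complex_subring K)" and R_K: "R \<subseteq> K"
begin

lemma K_closed:
  "0 \<in> K" "1 \<in> K" "x \<in> K \<Longrightarrow> y \<in> K \<Longrightarrow> x + y \<in> K" "x \<in> K \<Longrightarrow> y \<in> K \<Longrightarrow> x - y \<in> K"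
  "x \<in> K \<Longrightarrow> y \<in> K \<Longrightarrow> x * y \<in> K"
proof -
  interpret K: field "complex_subring K" by (rule K_field)
  show "0 \<in> K" "1 \<in> K" using K.zero_closed K.one_closed by simp_all
  show "x + y \<in> K" "x * y \<in> K" if "x \<in> K" "y \<in> K"
    using K.add.m_closed[of x y] K.m_closed[of x y] that by simp_all
  show "x - y \<in> K" if "x \<in> K" "y \<in> K"
    using K.minus_closed[of x y] complex_subring_diff[of K y x] K.cring_axioms that by simp
qed

text \<open>The generators in \<open>tensor_rel\<close>, with the operations of the coefficient
  records evaluated to complex arithmetic.\<close>

definition gens :: "('m \<times> complex \<Rightarrow>\<^sub>0 int) set" where
  "gens =
     {frag_of (m \<oplus> m', a) - frag_of (m, a) - frag_of (m', a) | m m' a.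
         m \<in> carrier M \<and> m' \<in> carrier M \<and> a \<in> K} \<union>
      {frag_of (m, a + a') - frag_of (m, a) - frag_of (m, a') | m a a'.
         m \<in> carrier M \<and> a \<in> K \<and> a' \<in> K} \<union>
      {frag_of (r \<odot> m, a) - frag_of (m, r * a) | r m a.
         r \<in> R \<and> m \<in> carrier M \<and> a \<in> K}"

lemma gens_cases:
  assumes "x \<in> gens"
  obtains m m' a where "m \<in> carrier M" "m' \<in> carrier M" "a \<in> K"
      "x = frag_of (m \<oplus> m', a) - frag_of (m, a) - frag_of (m', a)"
    | m a a' where "m \<in> carrier M" "a \<in> K" "a' \<in> K"
      "x = frag_of (m, a + a') - frag_of (m, a) - frag_of (m, a')"
    | r m a where "r \<in> R" "m \<in> carrier M" "a \<in> K" "x = frag_of (r \<odot> m, a) - frag_of (m, r * a)"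
proof -
  from assms consider
      (1) "\<exists>m m' a. x = frag_of (m \<oplus> m', a) - frag_of (m, a) - frag_of (m', a) \<and>
        m \<in> carrier M \<and> m' \<in> carrier M \<and> a \<in> K"
    | (2) "\<exists>m a a'. x = frag_of (m, a + a') - frag_of (m, a) - frag_of (m, a') \<and>
        m \<in> carrier M \<and> a \<in> K \<and> a' \<in> K"
    | (3) "\<exists>r m a. x = frag_of (r \<odot> m, a) - frag_of (m, r * a) \<and> r \<in> R \<and> m \<in> carrier M \<and> a \<in> K"
    unfolding gens_def Un_iff mem_Collect_eq by argo
  then show ?thesis
  proof cases
    case 1 then show ?thesis using that(1) by (elim exE conjE)
  next
    case 2 then show ?thesis using that(2) by (elim exE conjE)
  next
    case 3 then show ?thesis using that(3) by (elim exE conjE)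
  qed
qed

lemma gensI:
  "m \<in> carrier M \<Longrightarrow> m' \<in> carrier M \<Longrightarrow> a \<in> K \<Longrightarrow>
     frag_of (m \<oplus> m', a) - frag_of (m, a) - frag_of (m', a) \<in> gens"
  "m \<in> carrier M \<Longrightarrow> a \<in> K \<Longrightarrow> a' \<in> K \<Longrightarrow> frag_of (m, a + a') - frag_of (m, a) - frag_of (m, a') \<in> gens"
  "r \<in> R \<Longrightarrow> m \<in> carrier M \<Longrightarrow> a \<in> K \<Longrightarrow> frag_of (r \<odot> m, a) - frag_of (m, r * a) \<in> gens"
  unfolding gens_def by blast+

definition free :: "('m \<times> complex \<Rightarrow>\<^sub>0 int) set" where
  "free = {x. Poly_Mapping.keys x \<subseteq> carrier M \<times> K}"

lemma free_closed:
  "0 \<in> free" "x \<in> free \<Longrightarrow> y \<in> free \<Longrightarrow> x + y \<in> free" "x \<in> free \<Longrightarrow> y \<in> free \<Longrightarrow> x - y \<in> free"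
  "m \<in> carrier M \<Longrightarrow> a \<in> K \<Longrightarrow> frag_of (m, a) \<in> free"
proof -
  show "x + y \<in> free" if "x \<in> free" "y \<in> free" using that keys_add[of x y] by (auto simp: free_def)
  show "x - y \<in> free" if "x \<in> free" "y \<in> free" using that keys_diff[of x y] by (auto simp: free_def)
qed (simp_all add: free_def)

lemma free_induct [consumes 1, case_names zero one diff]:
  assumes "x \<in> free" "Q 0" "\<And>m a. m \<in> carrier M \<Longrightarrow> a \<in> K \<Longrightarrow> Q (frag_of (m, a))"
    "\<And>x y. x \<in> free \<Longrightarrow> y \<in> free \<Longrightarrow> Q x \<Longrightarrow> Q y \<Longrightarrow> Q (x - y)"
  shows "Q x"
proof (rule free_Abelian_group_induct[of x "carrier M \<times> K"])
  show "Poly_Mapping.keys x \<subseteq> carrier M \<times> K" using assms(1) by (simp add: free_def)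
  show "Q (x - y)" if "Poly_Mapping.keys x \<subseteq> carrier M \<times> K" "Poly_Mapping.keys y \<subseteq> carrier M \<times> K" "Q x" "Q y" for x y
    using assms(4)[of x y] that by (simp add: free_def)
qed (use assms(2,3) in auto)

abbreviation TF where "TF \<equiv> tensor_free (complex_subring K) M"

lemma TF_simps:
  "carrier TF = free" "x \<otimes>\<^bsub>TF\<^esub> y = x + y" "\<one>\<^bsub>TF\<^esub> = 0"
  by (simp_all add: tensor_free_def free_def free_Abelian_group_def)

lemma gens_free: "gens \<subseteq> free"
proof
  fix x assume "x \<in> gens"
  then show "x \<in> free"
  proof (cases rule: gens_cases)
    case (1 m m' a)
    then show ?thesis by (simp only: 1(4)) (intro free_closed, simp_all)
  next
    case (2 m a a')
    then show ?thesis by (simp only: 2(4)) (intro free_closed K_closed, simp_all)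
  next
    case (3 r m a)
    then show ?thesis using R_K by (simp only: 3(4)) (intro free_closed K_closed, auto)
  qed
qed

abbreviation Rel where "Rel \<equiv> tensor_rel (complex_subring R) (complex_subring K) M"

lemma Rel_generate: "Rel = generate TF gens"
  by (simp add: tensor_rel_def gens_def)

lemma TF_group: "group TF" by (simp add: tensor_free_def)

lemma TF_inv: "x \<in> free \<Longrightarrow> inv\<^bsub>TF\<^esub> x = - x"
  by (simp add: tensor_free_def free_def)

lemma Rel_closed: "0 \<in> Rel" "x \<in> Rel \<Longrightarrow> y \<in> Rel \<Longrightarrow> x - y \<in> Rel" "x \<in> Rel \<Longrightarrow> y \<in> Rel \<Longrightarrow> x + y \<in> Rel"
  "gens \<subseteq> Rel" "Rel \<subseteq> free"
proof -
  interpret S: subgroup Rel TF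
    unfolding Rel_generate using group.generate_is_subgroup[OF TF_group, of gens] gens_free by (simp add: TF_simps)
  show 0: "0 \<in> Rel" using S.one_closed by (simp add: TF_simps)
  show F: "Rel \<subseteq> free" using S.subset by (simp add: TF_simps)
  show add: "x + y \<in> Rel" if "x \<in> Rel" "y \<in> Rel" for x y using S.m_closed[OF that] by (simp add: TF_simps)
  show "x - y \<in> Rel" if "x \<in> Rel" "y \<in> Rel"
    using add[OF that(1) S.m_inv_closed[OF that(2)]] F that by (simp add: TF_inv subsetD)
  show "gens \<subseteq> Rel" unfolding Rel_generate by (blast intro: generate.incl)
qed

lemma Rel_induct [consumes 1, case_names zero gen diff]:
  assumes "x \<in> Rel" "Q 0" "\<And>g. g \<in> gens \<Longrightarrow> Q g" "\<And>x y. Q x \<Longrightarrow> Q y \<Longrightarrow> Q (x - y)"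
  shows "Q x"
  using assms(1) unfolding Rel_generate
proof (induction rule: generate.induct)
  case (inv h)
  then show ?case using assms(4)[OF assms(2) assms(3)[OF inv]] gens_free by (simp add: TF_inv subsetD)
next
  case (eng x y)
  then show ?case using assms(4)[OF eng.IH(1) assms(4)[OF assms(2) eng.IH(2)]] by (simp add: TF_simps)
qed (use assms(2,3) in \<open>simp_all add: TF_simps\<close>)

text \<open>Cosets of the relation subgroup, that is, the elements of the tensor product; not the
  cosine.\<close>

definition cos where "cos x = (\<lambda>r. r + x) ` Rel"

lemma cos_eq: "cos x = cos y \<longleftrightarrow> x - y \<in> Rel"
proof
  assume "cos x = cos y"
  moreover have "x \<in> cos x" unfolding cos_def using Rel_closed(1) by (rule rev_image_eqI) simp
  ultimately have "x \<in> cos y" by simp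
  then show "x - y \<in> Rel" unfolding cos_def by auto
next
  assume xy: "x - y \<in> Rel"
  show "cos x = cos y"
    unfolding cos_def
  proof (intro equalityI subsetI; elim imageE)
    fix z r assume "z = r + x" "r \<in> Rel"
    then show "z \<in> (\<lambda>r. r + y) ` Rel"
      using Rel_closed(3)[OF _ xy, of r] by (intro image_eqI[of _ _ "r + (x - y)"]) simp_all
  next
    fix z r assume "z = r + y" "r \<in> Rel"
    then show "z \<in> (\<lambda>r. r + x) ` Rel"
      using Rel_closed(2)[OF _ xy, of r] by (intro image_eqI[of _ _ "r - (x - y)"]) simp_all
  qed
qed

lemma cos_self: "x \<in> cos x"
  unfolding cos_def using Rel_closed(1) by (rule rev_image_eqI) simp

lemma cos_mem: "y \<in> cos x \<longleftrightarrow> y - x \<in> Rel"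
  unfolding cos_def by (auto intro: rev_image_eqI)

lemma r_coset_eq: "Rel #>\<^bsub>TF\<^esub> x = cos x"
  by (auto simp: r_coset_def cos_def TF_simps)

abbreviation V where "V \<equiv> extend_scalars (complex_subring R) (complex_subring K) M"

lemma V_simps:
  "carrier V = cos ` free" "\<zero>\<^bsub>V\<^esub> = cos 0" "cos x \<oplus>\<^bsub>V\<^esub> cos y = cos (x + y)"
proof -
  show "carrier V = cos ` free"
    by (auto simp: extend_scalars_def Let_def FactGroup_def RCOSETS_def r_coset_eq TF_simps)
  show "\<zero>\<^bsub>V\<^esub> = cos 0" by (simp add: extend_scalars_def Let_def FactGroup_def cos_def)
  have "cos x <#>\<^bsub>TF\<^esub> cos y = cos (x + y)"
  proof (intro equalityI subsetI)
    fix z assume "z \<in> cos x <#>\<^bsub>TF\<^esub> cos y"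
    then obtain u v where uv: "u - x \<in> Rel" "v - y \<in> Rel" "z = u + v"
      by (auto simp: set_mult_def TF_simps cos_mem)
    show "z \<in> cos (x + y)" using Rel_closed(3)[OF uv(1,2)] by (simp add: cos_mem uv(3) algebra_simps)
  next
    fix z assume "z \<in> cos (x + y)"
    then have "z - y \<in> cos x" by (simp add: cos_mem algebra_simps)
    moreover have "z = (z - y) \<otimes>\<^bsub>TF\<^esub> y" by (simp add: TF_simps)
    ultimately show "z \<in> cos x <#>\<^bsub>TF\<^esub> cos y" using cos_self[of y] unfolding set_mult_def by blast
  qed
  then show "cos x \<oplus>\<^bsub>V\<^esub> cos y = cos (x + y)"
    by (simp add: extend_scalars_def Let_def FactGroup_def)
qed

definition ext :: "('m \<times> complex \<Rightarrow> 'm \<times> complex) \<Rightarrow> ('m \<times> complex \<Rightarrow>\<^sub>0 int) \<Rightarrow> ('m \<times> complex \<Rightarrow>\<^sub>0 int)"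
  where "ext h = frag_extend (\<lambda>p. frag_of (h p))"

lemma ext_simps [simp]:
  "ext h 0 = 0" "ext h (frag_of p) = frag_of (h p)" "ext h (x - y) = ext h x - ext h y"
  "ext h (x + y) = ext h x + ext h y"
  by (simp_all add: ext_def frag_extend_diff frag_extend_add)

text \<open>\<open>tensor_map\<close> unites cosets over all representatives. If \<open>h\<close>
  maps relations to relations, these cosets coincide and the union is a single one.\<close>

lemma tensor_map_cos:
  assumes "\<And>g. g \<in> gens \<Longrightarrow> ext h g \<in> Rel"
  shows "tensor_map (complex_subring R) (complex_subring K) M h (cos x) = cos (ext h x)"
proof -
  have rel: "ext h y \<in> Rel" if "y \<in> Rel" for y
    using that by (induction rule: Rel_induct) (use assms Rel_closed in auto)
  have "cos (ext h y) = cos (ext h x)" if "y \<in> cos x" for y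
    using rel[of "y - x"] that by (simp add: cos_mem cos_eq)
  then show ?thesis unfolding tensor_map_def r_coset_eq ext_def[symmetric] using cos_self[of x] by blast
qed

lemma ext_free:
  assumes "\<And>m a. m \<in> carrier M \<Longrightarrow> a \<in> K \<Longrightarrow> frag_of (h (m, a)) \<in> free" "x \<in> free"
  shows "ext h x \<in> free"
  using assms(2) by (induction rule: free_induct) (use assms(1) free_closed in auto)

definition scale :: "complex \<Rightarrow> 'm \<times> complex \<Rightarrow> 'm \<times> complex" where "scale c = (\<lambda>(m, a). (m, c * a))"

lemma scale_free: "c \<in> K \<Longrightarrow> x \<in> free \<Longrightarrow> ext (scale c) x \<in> free"
  by (rule ext_free) (auto simp: scale_def intro!: free_closed K_closed)

lemma V_smult:
  assumes c: "c \<in> K"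
  shows "c \<odot>\<^bsub>V\<^esub> cos x = cos (ext (scale c) x)"
proof -
  have "ext (scale c) g \<in> gens" if "g \<in> gens" for g
    using that
  proof (cases rule: gens_cases)
    case (1 m m' a)
    then show ?thesis using gensI(1)[of m m' "c * a"] c K_closed by (simp add: scale_def)
  next
    case (2 m a a')
    then show ?thesis using gensI(2)[of m "c * a" "c * a'"] c K_closed by (simp add: scale_def distrib_left)
  next
    case (3 r m a)
    then show ?thesis using gensI(3)[of r m "c * a"] c K_closed by (simp add: scale_def mult.left_commute)
  qed
  then have "tensor_map (complex_subring R) (complex_subring K) M (scale c) (cos x) = cos (ext (scale c) x)"
    using Rel_closed(4) by (intro tensor_map_cos) auto
  then show ?thesis by (simp add: extend_scalars_def Let_def scale_def)
qed

lemma ext_scale_add: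
  assumes "a \<in> K" "b \<in> K" "x \<in> free"
  shows "ext (scale (a + b)) x - (ext (scale a) x + ext (scale b) x) \<in> Rel"
  using assms(3)
proof (induction rule: free_induct)
  case (one m c)
  have "frag_of (m, a * c + b * c) - frag_of (m, a * c) - frag_of (m, b * c) \<in> Rel"
    using gensI(2)[of m "a * c" "b * c"] one assms Rel_closed(4) K_closed by blast
  then show ?case by (simp add: scale_def algebra_simps)
next
  case (diff x y)
  then show ?case using Rel_closed(2)[OF diff.IH] by (simp add: algebra_simps)
qed (simp add: Rel_closed(1))

lemma ext_scale_scale: "x \<in> free \<Longrightarrow> ext (scale a) (ext (scale b) x) = ext (scale (a * b)) x"
  by (induction rule: free_induct) (auto simp: scale_def mult.assoc)

lemma ext_scale_one: "x \<in> free \<Longrightarrow> ext (scale 1) x = x"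
  by (induction rule: free_induct) (auto simp: scale_def)

lemma V_vectorspace: "vectorspace (complex_subring K) V"
proof (rule vs_criteria[OF K_field])
  note [simp] = V_simps V_smult free_closed(1,2) scale_free
  show "\<zero>\<^bsub>V\<^esub> \<in> carrier V" by simp
  show "\<forall>v\<in>carrier V. \<exists>w\<in>carrier V. v \<oplus>\<^bsub>V\<^esub> w = \<zero>\<^bsub>V\<^esub>"
  proof
    fix v assume "v \<in> carrier V"
    then obtain x where x: "x \<in> free" "v = cos x" by auto
    have "0 - x \<in> free" using x free_closed by blast
    then show "\<exists>w\<in>carrier V. v \<oplus>\<^bsub>V\<^esub> w = \<zero>\<^bsub>V\<^esub>" using x by (intro bexI[of _ "cos (0 - x)"]) simp_all
  qed
  show "\<forall>a b v. a \<in> carrier (complex_subring K) \<and> b \<in> carrier (complex_subring K) \<and> v \<in> carrier V \<longrightarrow>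
     (a \<oplus>\<^bsub>complex_subring K\<^esub> b) \<odot>\<^bsub>V\<^esub> v = a \<odot>\<^bsub>V\<^esub> v \<oplus>\<^bsub>V\<^esub> b \<odot>\<^bsub>V\<^esub> v"
  proof (intro allI impI, elim conjE)
    fix a b v assume "a \<in> carrier (complex_subring K)" "b \<in> carrier (complex_subring K)" "v \<in> carrier V"
    then obtain x where x: "a \<in> K" "b \<in> K" "x \<in> free" "v = cos x" by auto
    have "cos (ext (scale (a + b)) x) = cos (ext (scale a) x + ext (scale b) x)"
      unfolding cos_eq using ext_scale_add x by simp
    then show "(a \<oplus>\<^bsub>complex_subring K\<^esub> b) \<odot>\<^bsub>V\<^esub> v = a \<odot>\<^bsub>V\<^esub> v \<oplus>\<^bsub>V\<^esub> b \<odot>\<^bsub>V\<^esub> v"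
      using x K_closed(3) by simp
  qed
qed (use K_closed in \<open>auto simp: V_simps V_smult free_closed scale_free ac_simps ext_scale_scale ext_scale_one\<close>)

definition tens where "tens m a = cos (frag_of (m, a))"

lemma tens_V: "m \<in> carrier M \<Longrightarrow> a \<in> K \<Longrightarrow> tens m a \<in> carrier V"
  using free_closed(4) by (auto simp: tens_def V_simps)

lemma smult_tens: "c \<in> K \<Longrightarrow> c \<odot>\<^bsub>V\<^esub> tens m a = tens m (c * a)"
  by (simp add: tens_def V_smult scale_def)

lemma tens_add_left:
  "m \<in> carrier M \<Longrightarrow> m' \<in> carrier M \<Longrightarrow> a \<in> K \<Longrightarrow> tens (m \<oplus> m') a = tens m a \<oplus>\<^bsub>V\<^esub> tens m' a"
  using gensI(1)[of m m' a] Rel_closed(4) by (auto simp: tens_def V_simps cos_eq algebra_simps)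

lemma tens_smult_left:
  "r \<in> R \<Longrightarrow> m \<in> carrier M \<Longrightarrow> a \<in> K \<Longrightarrow> tens (r \<odot> m) a = r \<odot>\<^bsub>V\<^esub> tens m a"
  using gensI(3)[of r m a] Rel_closed(4) R_K by (auto simp: tens_def V_smult subsetD scale_def cos_eq)

text \<open>The pure tensors generate the tensor product as an additive group.\<close>

lemma additive_maps_eq:
  assumes "abelian_group W" "f \<in> carrier V \<rightarrow> carrier W" "h \<in> carrier V \<rightarrow> carrier W"
    and add: "\<And>x y. x \<in> carrier V \<Longrightarrow> y \<in> carrier V \<Longrightarrow> f (x \<oplus>\<^bsub>V\<^esub> y) = f x \<oplus>\<^bsub>W\<^esub> f y"
      "\<And>x y. x \<in> carrier V \<Longrightarrow> y \<in> carrier V \<Longrightarrow> h (x \<oplus>\<^bsub>V\<^esub> y) = h x \<oplus>\<^bsub>W\<^esub> h y"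
    and tens: "\<And>m a. m \<in> carrier M \<Longrightarrow> a \<in> K \<Longrightarrow> f (tens m a) = h (tens m a)"
    and x: "x \<in> carrier V"
  shows "f x = h x"
proof -
  interpret W: abelian_group W by (rule assms(1))
  have cW: "f (cos x) \<in> carrier W" "h (cos x) \<in> carrier W" if "x \<in> free" for x
    using assms(2,3) that by (auto simp: V_simps)
  have fV: "cos x \<in> carrier V" if "x \<in> free" for x using that by (simp add: V_simps)
  have "f (cos x) = h (cos x)" if "x \<in> free" for x
    using that
  proof (induction rule: free_induct)
    case zero
    have "f (cos 0) \<oplus>\<^bsub>W\<^esub> f (cos 0) = f (cos 0)" "h (cos 0) \<oplus>\<^bsub>W\<^esub> h (cos 0) = h (cos 0)"
      using add[of "cos 0" "cos 0"] fV[OF free_closed(1)] by (simp_all add: V_simps)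
    then show ?case using cW[OF free_closed(1)] by simp
  next
    case (diff x y)
    have xy: "x - y \<in> free" using diff.hyps free_closed by blast
    have "f (cos (x - y)) \<oplus>\<^bsub>W\<^esub> f (cos y) = f (cos x)" "h (cos (x - y)) \<oplus>\<^bsub>W\<^esub> h (cos y) = h (cos x)"
      using add(1)[OF fV[OF xy] fV[OF diff.hyps(2)]] add(2)[OF fV[OF xy] fV[OF diff.hyps(2)]] by (simp_all add: V_simps)
    then have "f (cos (x - y)) \<oplus>\<^bsub>W\<^esub> f (cos y) = h (cos (x - y)) \<oplus>\<^bsub>W\<^esub> f (cos y)" using diff.IH by simp
    then show ?case using cW[OF xy] cW[OF diff.hyps(2)] by (simp add: W.add.right_cancel)
  next
    case (one m a)
    then show ?case using tens[OF one, unfolded tens_def] by blast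
  qed
  then show ?thesis using x by (auto simp: V_simps)
qed

definition additive_functional :: "('m \<Rightarrow> complex) \<Rightarrow> bool" where
  "additive_functional \<psi> \<longleftrightarrow> (\<forall>m\<in>carrier M. \<psi> m \<in> R) \<and>
     (\<forall>m\<in>carrier M. \<forall>m'\<in>carrier M. \<psi> (m \<oplus> m') = \<psi> m + \<psi> m') \<and>
     (\<forall>r\<in>R. \<forall>m\<in>carrier M. \<psi> (r \<odot> m) = r * \<psi> m)"

definition ev :: "('m \<Rightarrow> complex) \<Rightarrow> ('m \<times> complex \<Rightarrow>\<^sub>0 int) \<Rightarrow> complex" where
  "ev \<psi> x = (\<Sum>p. of_int (Poly_Mapping.lookup x p) * (snd p * \<psi> (fst p)))"

lemma ev_simps: "ev \<psi> 0 = 0" "ev \<psi> (frag_of (m, a)) = a * \<psi> m" "ev \<psi> (x - y) = ev \<psi> x - ev \<psi> y"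
proof -
  have fin: "finite {p. of_int (Poly_Mapping.lookup x p) * (snd p * \<psi> (fst p)) \<noteq> 0}" for x
    by (rule finite_subset[OF _ finite_lookup[of x]]) auto
  have "ev \<psi> x = ev \<psi> (x - y) + ev \<psi> y" for x y
    unfolding ev_def Sum_any.distrib[OF fin fin, symmetric]
    by (rule Sum_any.cong) (simp add: lookup_minus left_diff_distrib)
  then show "ev \<psi> (x - y) = ev \<psi> x - ev \<psi> y" by (simp add: algebra_simps)
  show "ev \<psi> 0 = 0" by (simp add: ev_def)
  have "ev \<psi> (frag_of (m, a)) = (\<Sum>p. a * \<psi> m when p = (m, a))"
    unfolding ev_def by (rule Sum_any.cong) (auto simp: when_def)
  then show "ev \<psi> (frag_of (m, a)) = a * \<psi> m" by simp
qed

text \<open>For an additive functional \<open>\<psi>\<close> this is the induced functional on the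
  tensor product. The representative chosen is then immaterial because \<open>ev \<psi>\<close>
  kills the relations.\<close>

definition lift_fun :: "('m \<Rightarrow> complex) \<Rightarrow> ('m \<times> complex \<Rightarrow>\<^sub>0 int) set \<Rightarrow> complex" where
  "lift_fun \<psi> X = ev \<psi> (SOME x. x \<in> X)"

lemma lift_fun_cos:
  assumes "additive_functional \<psi>"
  shows "lift_fun \<psi> (cos x) = ev \<psi> x"
proof -
  have "ev \<psi> y = 0" if "y \<in> Rel" for y
    using that
  proof (induction rule: Rel_induct)
    case (gen g)
    then show ?case
    proof (cases rule: gens_cases)
      case (1 m m' a)
      then show ?thesis using assms by (simp only: 1(4)) (simp add: ev_simps additive_functional_def distrib_left)
    next
      case (2 m a a')
      then show ?thesis by (simp only: 2(4)) (simp add: ev_simps distrib_right)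
    next
      case (3 r m a)
      then show ?thesis using assms by (simp only: 3(4)) (simp add: ev_simps additive_functional_def)
    qed
  qed (simp_all add: ev_simps)
  moreover have "(SOME y. y \<in> cos x) - x \<in> Rel" using someI[of "\<lambda>y. y \<in> cos x", OF cos_self] by (simp add: cos_mem)
  ultimately show ?thesis unfolding lift_fun_def by (metis ev_simps(3) eq_iff_diff_eq_0)
qed

lemma lift_fun_tens: "additive_functional \<psi> \<Longrightarrow> lift_fun \<psi> (tens m a) = a * \<psi> m"
  by (simp add: tens_def lift_fun_cos ev_simps)

sublocale V: complex_vectorspace K V
  by (rule complex_vectorspace.intro[OF V_vectorspace])

lemma lift_fun_functional:
  assumes \<psi>: "additive_functional \<psi>"
  shows "V.functional (lift_fun \<psi>)"
proof -
  have K: "ev \<psi> x \<in> K" if "x \<in> free" for x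
    using that by (induction rule: free_induct)
      (use \<psi> R_K K_closed in \<open>auto simp: ev_simps additive_functional_def intro!: K_closed\<close>)
  have add: "ev \<psi> (x + y) = ev \<psi> x + ev \<psi> y" for x y
    using ev_simps(3)[of \<psi> "x + y" y] by simp
  have "ev \<psi> (ext (scale c) x) = c * ev \<psi> x" if "x \<in> free" for c x
    using that by (induction rule: free_induct) (auto simp: ev_simps scale_def algebra_simps)
  then show ?thesis
    unfolding V.functional_def using K by (auto simp: V_simps V_smult lift_fun_cos[OF \<psi>] add)
qed

end

section \<open>The ordinary character\<close>

lemma complex_subring_field:
  assumes "1 \<in> S" "\<And>x y. x \<in> S \<Longrightarrow> y \<in> S \<Longrightarrow> x - y \<in> S" "\<And>x y. x \<in> S \<Longrightarrow> y \<in> S \<Longrightarrow> x * y \<in> S"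
    "\<And>x. x \<in> S \<Longrightarrow> x \<noteq> 0 \<Longrightarrow> inverse x \<in> S"
  shows "field (complex_subring S)"
proof (rule cring.cring_fieldI2)
  show "cring (complex_subring S)" using assms(1-3) by (intro complex_subring_cring)
  fix a assume "a \<in> carrier (complex_subring S)" "a \<noteq> \<zero>\<^bsub>complex_subring S\<^esub>"
  then show "\<exists>b\<in>carrier (complex_subring S). a \<otimes>\<^bsub>complex_subring S\<^esub> b = \<one>\<^bsub>complex_subring S\<^esub>"
    using assms(4)[of a] by (intro bexI[of _ "inverse a"]) simp_all
qed simp

context two_adic_maximal_ideal begin

definition Fr where "Fr = {a / b | a b. a \<in> R \<and> b \<in> R - {0}}"

lemma frac_field_eq: "frac_field MM = complex_subring Fr"
  by (simp add: frac_field_def Fr_def)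

lemma R_Fr: "R \<subseteq> Fr"
proof
  fix x assume "x \<in> R"
  then have "x = x / 1 \<and> x \<in> R \<and> 1 \<in> R - {0}" by simp
  then show "x \<in> Fr" unfolding Fr_def by blast
qed

lemma Fr_I: "a \<in> R \<Longrightarrow> b \<in> R \<Longrightarrow> b \<noteq> 0 \<Longrightarrow> x = a / b \<Longrightarrow> x \<in> Fr"
  unfolding Fr_def by blast

lemma Fr_E: assumes "x \<in> Fr" obtains a b where "a \<in> R" "b \<in> R" "b \<noteq> 0" "x = a / b"
  using assms unfolding Fr_def by blast

lemma frac_field_field: "field (frac_field MM)"
  unfolding frac_field_eq
proof (rule complex_subring_field)
  show "1 \<in> Fr" using R_Fr one_R by blast
  fix x y assume xy: "x \<in> Fr" "y \<in> Fr"
  obtain a b where ab: "a \<in> R" "b \<in> R" "b \<noteq> 0" "x = a / b" using xy(1) by (rule Fr_E)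
  obtain c d where cd: "c \<in> R" "d \<in> R" "d \<noteq> 0" "y = c / d" using xy(2) by (rule Fr_E)
  show "x - y \<in> Fr"
    by (rule Fr_I[of "a * d - c * b" "b * d"])
      (use ab(1-3) cd(1-3) in \<open>simp_all add: ab(4) cd(4) mult_R diff_R diff_frac_eq\<close>)
  show "x * y \<in> Fr"
    by (rule Fr_I[of "a * c" "b * d"]) (use ab cd in \<open>simp_all add: mult_R\<close>)
next
  fix x assume x: "x \<in> Fr" "x \<noteq> 0"
  obtain a b where ab: "a \<in> R" "b \<in> R" "b \<noteq> 0" "x = a / b" using x(1) by (rule Fr_E)
  show "inverse x \<in> Fr" by (rule Fr_I[of b a]) (use ab x(2) in auto)
qed

end

section \<open>Counting conjugates\<close>

context group_algebra begin

lemma centralizer_inv: assumes g: "g \<in> carrier G" shows "centralizer G (inv g) = centralizer G g"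
proof -
  have "x \<otimes> inv g = inv g \<otimes> x" if "x \<in> carrier G" "x \<otimes> g = g \<otimes> x" "g \<in> carrier G" for x g
  proof -
    have "inv g \<otimes> (x \<otimes> g) \<otimes> inv g = inv g \<otimes> (g \<otimes> x) \<otimes> inv g" using that(2) by simp
    then show ?thesis using that(1,3) by (simp add: m_assoc inv_cancel)
  qed
  from this[of _ g] this[of _ "inv g"] show ?thesis using g unfolding centralizer_def by auto
qed

lemma centralizer_pos: assumes g: "g \<in> carrier G" shows "card (centralizer G g) > 0"
proof -
  have "\<one> \<in> centralizer G g" "finite (centralizer G g)" using g fin_G by (auto simp: centralizer_def)
  then show ?thesis by (auto simp: card_gt_0_iff)
qed

text \<open>The fibres of \<open>h \<mapsto> inv h \<otimes> (g \<otimes> h)\<close> are cosets of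
  the centralizer, so each conjugate is hit equally often.\<close>

lemma sum_conjugates:
  assumes g: "g \<in> carrier G"
  shows "(\<Sum>h\<in>carrier G. x (inv h \<otimes> (g \<otimes> h))) = of_nat (card (centralizer G g)) * csum (cls g) x"
proof -
  let ?c = "\<lambda>h. inv h \<otimes> (g \<otimes> h)"
  have im: "?c ` carrier G = cls g"
  proof (intro equalityI subsetI)
    fix u assume "u \<in> ?c ` carrier G"
    then obtain h where h: "h \<in> carrier G" "u = ?c h" by auto
    then show "u \<in> cls g" unfolding cls_def using g by (intro image_eqI[of _ _ "inv h"]) (simp_all add: m_assoc)
  next
    fix u assume "u \<in> cls g"
    then obtain h where h: "h \<in> carrier G" "u = h \<otimes> g \<otimes> inv h" by (auto simp: cls_def)
    then show "u \<in> ?c ` carrier G" using g by (intro image_eqI[of _ _ "inv h"]) (simp_all add: m_assoc)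
  qed
  have fib: "card {h \<in> carrier G. ?c h = u} = card (centralizer G g)" if u: "u \<in> ?c ` carrier G" for u
  proof -
    obtain k where k: "k \<in> carrier G" "u = ?c k" using u by auto
    have "bij_betw (\<lambda>z. z \<otimes> k) (centralizer G g) {h \<in> carrier G. ?c h = u}"
    proof (rule bij_betwI[where g = "\<lambda>h. h \<otimes> inv k"])
      show "(\<lambda>z. z \<otimes> k) \<in> centralizer G g \<rightarrow> {h \<in> carrier G. ?c h = u}"
      proof
        fix z assume "z \<in> centralizer G g"
        then have z: "z \<in> carrier G" "z \<otimes> g = g \<otimes> z" by (auto simp: centralizer_def)
        have "g \<otimes> (z \<otimes> k) = z \<otimes> (g \<otimes> k)" using z g k(1) by (metis m_assoc)
        then have "?c (z \<otimes> k) = u" using z(1) g k by (simp add: inv_mult_group m_assoc inv_cancel)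
        then show "z \<otimes> k \<in> {h \<in> carrier G. ?c h = u}" using z k by simp
      qed
      show "(\<lambda>h. h \<otimes> inv k) \<in> {h \<in> carrier G. ?c h = u} \<rightarrow> centralizer G g"
      proof
        fix h assume "h \<in> {h \<in> carrier G. ?c h = u}"
        then have h: "h \<in> carrier G" "?c h = ?c k" using k by auto
        have "g \<otimes> h = h \<otimes> ?c h" using h(1) g by (simp add: inv_cancel)
        also have "\<dots> = h \<otimes> ?c k" using h(2) by simp
        finally have "g \<otimes> h \<otimes> inv k = h \<otimes> ?c k \<otimes> inv k" by simp
        then show "h \<otimes> inv k \<in> centralizer G g"
          using h(1) g k(1) by (simp add: centralizer_def m_assoc)
      qed
    qed (use k in \<open>auto simp: centralizer_def m_assoc\<close>)
    then show ?thesis by (metis bij_betw_same_card)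
  qed
  have "(\<Sum>h\<in>carrier G. x (?c h)) = (\<Sum>u\<in>?c ` carrier G. \<Sum>h | h \<in> carrier G \<and> ?c h = u. x (?c h))"
    by (rule sum.image_gen[OF fin_G])
  also have "\<dots> = (\<Sum>u\<in>?c ` carrier G. of_nat (card (centralizer G g)) * x u)"
    by (rule sum.cong[OF refl]) (simp add: fib)
  finally show ?thesis by (simp add: csum_def im sum_distrib_left)
qed

end

section \<open>A frame of the extended module and the trace in it\<close>

context pim_model begin

sublocale E: scalar_extension R P Fr
proof (rule scalar_extension.intro)
  show "module (complex_subring R) P" using P.module_axioms by (simp add: loc_ring_eq)
  show "scalar_extension_axioms R Fr"
    using frac_field_field R_Fr unfolding scalar_extension_axioms_def frac_field_eq by blast
qed

text \<open>The expansion of \<open>F p\<close> in the generators \<open>h e\<close> of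
  \<open>L\<close>, carried to the tensor product, where scalars from \<open>R\<close> move to the
  second factor.\<close>

lemma tens_frame:
  assumes p: "p \<in> carrier P" and a: "a \<in> Fr"
  shows "E.tens p a = (\<Oplus>\<^bsub>E.V\<^esub>h\<in>carrier G. (a * F p h) \<odot>\<^bsub>E.V\<^esub> E.tens (Fi (dl h \<star> e)) 1)"
proof -
  have gen: "dl h \<star> e \<in> L" if "h \<in> carrier G" for h using that by auto
  have tV: "E.tens (Fi (dl h \<star> e)) 1 \<in> carrier E.V" if "h \<in> carrier G" for h
    using that by (intro E.tens_V Fi_P gen E.K_closed)
  have "E.tens (Fi (\<Sum>h\<in>S. x h *\<^sub>c (dl h \<star> e))) a = (\<Oplus>\<^bsub>E.V\<^esub>h\<in>S. (a * x h) \<odot>\<^bsub>E.V\<^esub> E.tens (Fi (dl h \<star> e)) 1)"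
    if "S \<subseteq> carrier G" "\<And>h. x h \<in> R" for S x
    using finite_subset[OF that(1) fin_G] that(1)
  proof (induction S rule: finite_induct)
    case empty
    have "E.tens \<zero>\<^bsub>P\<^esub> a \<oplus>\<^bsub>E.V\<^esub> E.tens \<zero>\<^bsub>P\<^esub> a = E.tens \<zero>\<^bsub>P\<^esub> a" using E.tens_add_left[of "\<zero>\<^bsub>P\<^esub>" "\<zero>\<^bsub>P\<^esub>" a] a by simp
    then have "E.tens \<zero>\<^bsub>P\<^esub> a = \<zero>\<^bsub>E.V\<^esub>" using E.tens_V[of "\<zero>\<^bsub>P\<^esub>" a] a by simp
    moreover have "Fi 0 = \<zero>\<^bsub>P\<^esub>" using Fi_F[of "\<zero>\<^bsub>P\<^esub>"] by (simp add: F_zero)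
    ultimately show ?case by simp
  next
    case (insert k S)
    have kG: "k \<in> carrier G" "S \<subseteq> carrier G" using insert.prems by auto
    have kL: "dl k \<star> e \<in> L" "x k *\<^sub>c (dl k \<star> e) \<in> L" "(\<Sum>h\<in>S. x h *\<^sub>c (dl h \<star> e)) \<in> L"
      using kG that(2) gen by (auto intro!: L_sum L_sc)
    have xk: "x k \<in> Fr" "a * x k \<in> Fr" using that(2) R_Fr a E.K_closed(5) by auto
    have c: "(\<lambda>h. (a * x h) \<odot>\<^bsub>E.V\<^esub> E.tens (Fi (dl h \<star> e)) 1) \<in> S \<rightarrow> carrier E.V"
    proof
      fix h assume "h \<in> S"
      moreover have "a * x h \<in> Fr" using that(2) R_Fr a E.K_closed(5) by auto
      ultimately show "(a * x h) \<odot>\<^bsub>E.V\<^esub> E.tens (Fi (dl h \<star> e)) 1 \<in> carrier E.V"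
        using tV kG(2) by (intro E.V.smult_closed) auto
    qed
    have "E.tens (Fi (\<Sum>h\<in>insert k S. x h *\<^sub>c (dl h \<star> e))) a
        = E.tens (x k \<odot>\<^bsub>P\<^esub> Fi (dl k \<star> e)) a \<oplus>\<^bsub>E.V\<^esub> E.tens (Fi (\<Sum>h\<in>S. x h *\<^sub>c (dl h \<star> e))) a"
      using insert.hyps kL a that(2)
      by (simp add: Fi_add Fi_smult E.tens_add_left Fi_P)
    also have "E.tens (x k \<odot>\<^bsub>P\<^esub> Fi (dl k \<star> e)) a = x k \<odot>\<^bsub>E.V\<^esub> E.tens (Fi (dl k \<star> e)) a"
      using that(2) a kL by (intro E.tens_smult_left) auto
    also have "\<dots> = (a * x k) \<odot>\<^bsub>E.V\<^esub> E.tens (Fi (dl k \<star> e)) 1"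
      using xk by (simp add: E.smult_tens mult.commute)
    finally show ?case
      using insert.IH[OF kG(2)] insert.hyps E.V.finsum_insert[OF insert.hyps c] E.V.smult_closed[of "a * x k", OF _ tV[OF kG(1)]] xk
      by simp
  qed
  from this[OF subset_refl, of "F p"] show ?thesis
    using L_expand[OF F_L[OF p], symmetric] p L_RG[OF F_L[OF p]] by (simp add: RG_R)
qed

lemma coordinate_functional: "E.additive_functional (\<lambda>p. F p h)"
  using L_RG[OF F_L] by (auto simp: E.additive_functional_def F_add F_smult fun_apply sc_def RG_R)

text \<open>The generators \<open>h e\<close> together with the coefficients at \<open>h\<close>
  form a frame, since \<open>x = x \<star> e\<close> on \<open>L\<close>. They are dependent in
  general, which is why traces are taken in frames. Both sides are additive, so pure tensors
  suffice.\<close>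

lemma tensor_frame:
  assumes x: "x \<in> carrier E.V"
  shows "x = (\<Oplus>\<^bsub>E.V\<^esub>h\<in>carrier G. E.lift_fun (\<lambda>p. F p h) x \<odot>\<^bsub>E.V\<^esub> E.tens (Fi (dl h \<star> e)) 1)"
proof -
  let ?f = "\<lambda>h. E.lift_fun (\<lambda>p. F p h)" and ?v = "\<lambda>h. E.tens (Fi (dl h \<star> e)) 1"
  have fnl: "E.V.functional (?f h)" for h by (intro E.lift_fun_functional coordinate_functional)
  have v: "?v h \<in> carrier E.V" if "h \<in> carrier G" for h
    using that by (intro E.tens_V Fi_P E.K_closed) auto
  have fK: "?f h x \<in> Fr" if "x \<in> carrier E.V" for h x
    using E.V.functionalD(1)[OF fnl that] .
  have c: "(\<lambda>h. ?f h x \<odot>\<^bsub>E.V\<^esub> ?v h) \<in> carrier G \<rightarrow> carrier E.V" if "x \<in> carrier E.V" for x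
    using v fK[OF that] by (intro Pi_I E.V.smult_closed) simp_all
  show ?thesis
  proof (rule E.additive_maps_eq[where W = E.V and f = "\<lambda>x. x"])
    show "abelian_group E.V" by (rule E.V.abelian_group_axioms)
    show "(\<lambda>x. \<Oplus>\<^bsub>E.V\<^esub>h\<in>carrier G. ?f h x \<odot>\<^bsub>E.V\<^esub> ?v h) \<in> carrier E.V \<rightarrow> carrier E.V"
      by (intro Pi_I) (rule E.V.finsum_closed[OF c])
    show "(\<Oplus>\<^bsub>E.V\<^esub>h\<in>carrier G. ?f h (x \<oplus>\<^bsub>E.V\<^esub> y) \<odot>\<^bsub>E.V\<^esub> ?v h) =
        (\<Oplus>\<^bsub>E.V\<^esub>h\<in>carrier G. ?f h x \<odot>\<^bsub>E.V\<^esub> ?v h) \<oplus>\<^bsub>E.V\<^esub> (\<Oplus>\<^bsub>E.V\<^esub>h\<in>carrier G. ?f h y \<odot>\<^bsub>E.V\<^esub> ?v h)"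
      if xy: "x \<in> carrier E.V" "y \<in> carrier E.V" for x y
    proof -
      have "?f h (x \<oplus>\<^bsub>E.V\<^esub> y) \<odot>\<^bsub>E.V\<^esub> ?v h = ?f h x \<odot>\<^bsub>E.V\<^esub> ?v h \<oplus>\<^bsub>E.V\<^esub> ?f h y \<odot>\<^bsub>E.V\<^esub> ?v h"
        if h: "h \<in> carrier G" for h
      proof -
        have "?f h (x \<oplus>\<^bsub>E.V\<^esub> y) = ?f h x + ?f h y" by (rule E.V.functionalD(2)[OF fnl xy])
        then show ?thesis using E.V.smult_l_distr[of "?f h x" "?f h y" "?v h"] fK xy v[OF h] by simp
      qed
      then have "(\<Oplus>\<^bsub>E.V\<^esub>h\<in>carrier G. ?f h (x \<oplus>\<^bsub>E.V\<^esub> y) \<odot>\<^bsub>E.V\<^esub> ?v h) =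
          (\<Oplus>\<^bsub>E.V\<^esub>h\<in>carrier G. ?f h x \<odot>\<^bsub>E.V\<^esub> ?v h \<oplus>\<^bsub>E.V\<^esub> ?f h y \<odot>\<^bsub>E.V\<^esub> ?v h)"
        using c[OF xy(1)] c[OF xy(2)] by (intro E.V.finsum_cong') auto
      also have "\<dots> = (\<Oplus>\<^bsub>E.V\<^esub>h\<in>carrier G. ?f h x \<odot>\<^bsub>E.V\<^esub> ?v h) \<oplus>\<^bsub>E.V\<^esub> (\<Oplus>\<^bsub>E.V\<^esub>h\<in>carrier G. ?f h y \<odot>\<^bsub>E.V\<^esub> ?v h)"
        by (rule E.V.finsum_addf[OF c[OF xy(1)] c[OF xy(2)]])
      finally show ?thesis .
    qed
    show "E.tens m a = (\<Oplus>\<^bsub>E.V\<^esub>h\<in>carrier G. ?f h (E.tens m a) \<odot>\<^bsub>E.V\<^esub> ?v h)"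
      if ma: "m \<in> carrier P" "a \<in> Fr" for m a
      unfolding E.lift_fun_tens[OF coordinate_functional] by (rule tens_frame[OF ma])
  qed (use x in auto)
qed

lemma extend_act:
  assumes g: "g \<in> carrier G"
  shows "extend_act (loc_ring MM) (frac_field MM) P \<rho> g \<in> module_hom (complex_subring Fr) E.V E.V"
    and "m \<in> carrier P \<Longrightarrow> extend_act (loc_ring MM) (frac_field MM) P \<rho> g (E.tens m a) = E.tens (\<rho> g m) a"
proof -
  let ?h = "\<lambda>(m, a). (\<rho> g m, a)"
  have hom: "\<rho> g \<in> module_hom (loc_ring MM) P P" using P.act_hom g .
  have gens: "E.ext ?h x \<in> E.gens" if "x \<in> E.gens" for x
    using that
  proof (cases rule: E.gens_cases)
    case (1 m m' a)
    then show ?thesis using E.gensI(1)[of "\<rho> g m" "\<rho> g m'" a] module_hom_add[OF hom] g by (simp add: act_P)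
  next
    case (2 m a a')
    then show ?thesis using E.gensI(2)[of "\<rho> g m" a a'] g by (simp add: act_P)
  next
    case (3 r m a)
    then show ?thesis using E.gensI(3)[of r "\<rho> g m" a] module_hom_smult[OF hom, of r m] g by (simp add: act_P)
  qed
  have cos: "extend_act (loc_ring MM) (frac_field MM) P \<rho> g (E.cos x) = E.cos (E.ext ?h x)" for x
    unfolding extend_act_def loc_ring_eq frac_field_eq
    by (rule E.tensor_map_cos) (use gens E.Rel_closed(4) in auto)
  have free: "E.ext ?h x \<in> E.free" if "x \<in> E.free" for x
    using that by (intro E.ext_free) (use g in \<open>auto intro!: E.free_closed act_P\<close>)
  have scale: "E.ext ?h (E.ext (E.scale c) x) = E.ext (E.scale c) (E.ext ?h x)" if "x \<in> E.free" for c x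
    using that by (induction rule: E.free_induct) (auto simp: E.scale_def)
  show "extend_act (loc_ring MM) (frac_field MM) P \<rho> g \<in> module_hom (complex_subring Fr) E.V E.V"
    unfolding module_hom_def
  proof (intro CollectI conjI allI impI Pi_I; (elim conjE)?)
    fix X assume "X \<in> carrier E.V"
    then show "extend_act (loc_ring MM) (frac_field MM) P \<rho> g X \<in> carrier E.V"
      using free cos by (force simp: E.V_simps)
    fix Y assume "Y \<in> carrier E.V"
    then show "extend_act (loc_ring MM) (frac_field MM) P \<rho> g (X \<oplus>\<^bsub>E.V\<^esub> Y) =
        extend_act (loc_ring MM) (frac_field MM) P \<rho> g X \<oplus>\<^bsub>E.V\<^esub> extend_act (loc_ring MM) (frac_field MM) P \<rho> g Y"
      using \<open>X \<in> carrier E.V\<close> by (clarsimp simp: E.V_simps cos)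
  next
    fix c X assume "c \<in> carrier (complex_subring Fr)" "X \<in> carrier E.V"
    then show "extend_act (loc_ring MM) (frac_field MM) P \<rho> g (c \<odot>\<^bsub>E.V\<^esub> X) =
        c \<odot>\<^bsub>E.V\<^esub> extend_act (loc_ring MM) (frac_field MM) P \<rho> g X"
      by (clarsimp simp: E.V_simps cos E.V_smult scale)
  qed
  show "extend_act (loc_ring MM) (frac_field MM) P \<rho> g (E.tens m a) = E.tens (\<rho> g m) a" if "m \<in> carrier P"
    by (simp add: E.tens_def cos)
qed

text \<open>In this frame the trace of \<open>g\<close> is the sum over \<open>h\<close> of the
  coefficient of \<open>g h e\<close> at \<open>h\<close>. That coefficient is the value of
  \<open>e\<close> at the conjugate \<open>inv h \<otimes> (inv g \<otimes> h)\<close>, whence the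
  class of the inverse.\<close>

theorem ordinary_character_eq:
  assumes g: "g \<in> carrier G"
  shows "ordinary_character MM P \<rho> g = of_nat (card (centralizer G g)) * csum (cls (inv g)) e"
proof -
  let ?T = "extend_act (loc_ring MM) (frac_field MM) P \<rho> g"
  let ?f = "\<lambda>h. E.lift_fun (\<lambda>p. F p h)" and ?v = "\<lambda>h. E.tens (Fi (dl h \<star> e)) 1"
  have hL: "dl h \<star> e \<in> L" if "h \<in> carrier G" for h using that by auto
  have "ordinary_character MM P \<rho> g = lin_trace (complex_subring Fr) E.V ?T"
    by (simp add: ordinary_character_def loc_ring_eq frac_field_eq)
  also have "\<dots> = (\<Sum>h\<in>carrier G. ?f h (?T (?v h)))"
  proof (rule E.V.lin_trace_frame[OF fin_G])
    show "?v \<in> carrier G \<rightarrow> carrier E.V" by (intro Pi_I E.tens_V Fi_P hL E.K_closed)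
    show "E.V.functional (?f h)" for h by (intro E.lift_fun_functional coordinate_functional)
    show "?T \<in> module_hom (complex_subring Fr) E.V E.V" by (rule extend_act[OF g])
    show "x = (\<Oplus>\<^bsub>E.V\<^esub>h\<in>carrier G. ?f h x \<odot>\<^bsub>E.V\<^esub> ?v h)" if "x \<in> carrier E.V" for x
      by (rule tensor_frame[OF that])
  qed
  also have "\<dots> = (\<Sum>h\<in>carrier G. e (inv h \<otimes> (inv g \<otimes> h)))"
  proof (rule sum.cong[OF refl])
    fix h assume h: "h \<in> carrier G"
    have "?f h (?T (?v h)) = F (\<rho> g (Fi (dl h \<star> e))) h"
      using extend_act(2)[OF g Fi_P[OF hL[OF h]]] by (simp add: E.lift_fun_tens[OF coordinate_functional])
    also have "F (\<rho> g (Fi (dl h \<star> e))) = dl g \<star> (dl h \<star> e)" using F_act[OF g Fi_P[OF hL[OF h]]] hL[OF h] by simp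
    also have "\<dots> h = e (inv h \<otimes> (inv g \<otimes> h))" using g h by (simp add: conv_dl_left)
    finally show "?f h (?T (?v h)) = e (inv h \<otimes> (inv g \<otimes> h))" .
  qed
  also have "\<dots> = of_nat (card (centralizer G g)) * csum (cls (inv g)) e"
    using sum_conjugates[of "inv g"] g by (simp add: centralizer_inv)
  finally show ?thesis .
qed

end

section \<open>Roots of unity of odd order and the residue field\<close>

context local_subring begin

lemma inverse_root_of_unity_R:
  assumes "(n::nat) > 0" "z ^ n = 1" shows "inverse z \<in> R"
  using assms by (intro root_of_unity_R[of n]) (simp_all add: power_inverse)

text \<open>The quotient \<open>u\<close> of two congruent roots is congruent to \<open>1\<close>.
  If \<open>u\<close> differs from \<open>1\<close>, the geometric sum of its powers vanishes,
  although it is congruent to the odd number \<open>n\<close>, which lies outside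
  \<open>J\<close>.\<close>

lemma odd_roots_of_unity_incongruent:
  assumes n: "odd (n::nat)" and z: "z ^ n = 1" and w: "w ^ n = 1" and zw: "z \<doteq> w"
  shows "z = w"
proof (rule ccontr)
  assume ne: "z \<noteq> w"
  have n0: "n > 0" using n by (cases n) auto
  have w0: "w \<noteq> 0" using w n0 by (auto simp: power_0_left)
  define u where "u = z * inverse w"
  have wR: "inverse w \<in> R" using inverse_root_of_unity_R[OF n0 w] .
  have uR: "u \<in> R" unfolding u_def using root_of_unity_R[OF n0 z] wR by (rule mult_R)
  have u1: "u \<noteq> 1" using ne w0 by (auto simp: u_def field_simps)
  have un: "u ^ n = 1" using z w by (simp add: u_def power_mult_distrib power_inverse)
  have uJ: "u \<doteq> 1"
    using mult_J[OF wR, of "z - w"] zw w0 by (simp add: cong_J_def u_def algebra_simps)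
  have "u ^ i \<doteq> 1" for i
  proof (induction i)
    case 0
    show ?case by (simp add: cong_J_def)
  next
    case (Suc i)
    have "u * (u ^ i - 1) + (u - 1) \<in> J" using mult_J[OF uR, of "u ^ i - 1"] Suc uJ by (intro add_J) (simp_all add: cong_J_def)
    then show ?case by (simp add: cong_J_def algebra_simps)
  qed
  then have "(\<Sum>i<n. u ^ i - 1) \<in> J" by (intro sum_J) (simp add: cong_J_def)
  moreover have "(\<Sum>i<n. u ^ i) = 0" using geometric_sum[OF u1, of n] un by simp
  ultimately have "- of_nat n \<in> J" by (simp add: sum_subtractf)
  then have "of_nat n \<in> J" using minus_J_iff[of "of_nat n"] by simp
  then show False using n of_nat_J_iff[of n] by simp
qed

end

section \<open>The residue field\<close>

context two_adic_maximal_ideal begin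

definition res :: "complex \<Rightarrow> complex set" where "res r = {s \<in> R. s - r \<in> J}"

lemma coset_res: "r \<in> R \<Longrightarrow> J +>\<^bsub>loc_ring MM\<^esub> r = res r"
proof (intro equalityI subsetI)
  fix s assume r: "r \<in> R" and "s \<in> J +>\<^bsub>loc_ring MM\<^esub> r"
  then show "s \<in> res r" using J_R by (auto simp: a_r_coset_def' res_def intro!: add_R)
next
  fix s assume r: "r \<in> R" and "s \<in> res r"
  then show "s \<in> J +>\<^bsub>loc_ring MM\<^esub> r" by (auto simp: a_r_coset_def' res_def intro!: bexI[of _ "s - r"])
qed

lemma res_eq: "r \<in> R \<Longrightarrow> s \<in> R \<Longrightarrow> res r = res s \<longleftrightarrow> r - s \<in> J"
proof
  assume rs: "r \<in> R" "s \<in> R" "res r = res s"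
  have "r \<in> res r" using rs(1) by (simp add: res_def)
  then have "r \<in> res s" by (simp only: rs(3))
  then show "r - s \<in> J" by (simp add: res_def)
next
  assume rs: "r \<in> R" "s \<in> R" "r - s \<in> J"
  have "t - r \<in> J \<longleftrightarrow> t - s \<in> J" for t
    using add_J[OF _ rs(3), of "t - r"] diff_J[OF _ rs(3), of "t - s"] by (auto simp del: diff_J add_J)
  then show "res r = res s" by (simp add: res_def)
qed

abbreviation k where "k \<equiv> res_field MM"

lemma k_simps:
  "carrier k = res ` R" "\<zero>\<^bsub>k\<^esub> = res 0" "\<one>\<^bsub>k\<^esub> = res 1"
  "r \<in> R \<Longrightarrow> s \<in> R \<Longrightarrow> res r \<oplus>\<^bsub>k\<^esub> res s = res (r + s)"
  "r \<in> R \<Longrightarrow> s \<in> R \<Longrightarrow> res r \<otimes>\<^bsub>k\<^esub> res s = res (r * s)"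
proof -
  interpret I: ideal J "loc_ring MM" by (rule J_ideal)
  note hom = I.rcos_ring_hom
  note k = res_field_def[of MM, unfolded loc_ideal_eq]
  show "carrier k = res ` R"
    unfolding k FactRing_def A_RCOSETS_def' by (auto simp: coset_res)
  show "\<zero>\<^bsub>k\<^esub> = res 0" unfolding k FactRing_def using J_R by (auto simp: res_def)
  show "\<one>\<^bsub>k\<^esub> = res 1" unfolding k FactRing_def by (simp add: coset_res)
  show "res r \<oplus>\<^bsub>k\<^esub> res s = res (r + s)" "res r \<otimes>\<^bsub>k\<^esub> res s = res (r * s)" if "r \<in> R" "s \<in> R"
    using ring_hom_add[OF hom, of r s] ring_hom_mult[OF hom, of r s] that
    by (simp_all add: k coset_res add_R mult_R)
qed

lemma k_field: "field k"
proof (rule cring.cring_fieldI2)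
  interpret I: ideal J "loc_ring MM" by (rule J_ideal)
  show "cring k" unfolding res_field_def loc_ideal_eq by (rule I.quotient_is_cring[OF loc_cring])
  show "\<zero>\<^bsub>k\<^esub> \<noteq> \<one>\<^bsub>k\<^esub>" using res_eq[of 1 0] one_J by (auto simp: k_simps)
  fix c assume "c \<in> carrier k" "c \<noteq> \<zero>\<^bsub>k\<^esub>"
  then obtain r where r: "r \<in> R" "c = res r" "r \<notin> J" using res_eq[of _ 0] by (auto simp: k_simps)
  then have ir: "inverse r \<in> R" "r \<noteq> 0" using unit_R zero_J by auto
  then show "\<exists>b\<in>carrier k. c \<otimes>\<^bsub>k\<^esub> b = \<one>\<^bsub>k\<^esub>"
    using r by (intro bexI[of _ "res (inverse r)"]) (simp_all add: k_simps)
qed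

lemma root_lift_res:
  assumes n: "odd n" and z: "z ^ n = 1"
  shows "root_lift MM (res z) = z"
  unfolding root_lift_def loc_ideal_eq
proof (rule the_equality)
  have odd_pos: "n > 0" if "odd n" for n :: nat using that by (cases n) auto
  have zR: "z \<in> R" using root_of_unity_R[OF odd_pos[OF n] z] .
  show "(\<exists>n. odd n \<and> z ^ n = 1) \<and> J +>\<^bsub>loc_ring MM\<^esub> z = res z" using n z zR by (auto simp: coset_res)
  fix w assume "(\<exists>m. odd m \<and> w ^ m = 1) \<and> J +>\<^bsub>loc_ring MM\<^esub> w = res z"
  then obtain m where m: "odd m" "w ^ m = 1" "J +>\<^bsub>loc_ring MM\<^esub> w = res z" by blast
  have wR: "w \<in> R" using root_of_unity_R[OF odd_pos[OF m(1)] m(2)] .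
  have "w - z \<in> J" using m(3) res_eq[OF wR zR] by (simp add: coset_res[OF wR])
  \<comment> \<open>The exponents of the two roots may differ; \<open>n * m\<close> is a common one
    and still odd.\<close>
  moreover have "z ^ (n * m) = 1" using z by (simp add: power_mult)
  moreover have "w ^ (m * n) = 1" using m(2) by (simp only: power_mult power_one)
  then have "w ^ (n * m) = 1" by (simp only: mult.commute)
  ultimately show "w = z" using odd_roots_of_unity_incongruent[of "n * m" w z] n m(1) by (simp add: cong_J_def)
qed

end

section \<open>Divisibility by two of sums of roots of unity of odd order\<close>

context local_subring begin

lemma square_sum_twoR:
  assumes "finite A" "\<And>i. i \<in> A \<Longrightarrow> a i \<in> R"
  shows "(\<Sum>i\<in>A. a i)\<^sup>2 - (\<Sum>i\<in>A. (a i)\<^sup>2) \<in> twoR"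
  using assms
proof (induction A rule: finite_induct)
  case (insert i A)
  have "a i * (\<Sum>i\<in>A. a i) \<in> R" using insert.prems by (intro mult_R sum_R) auto
  then have "2 * (a i * (\<Sum>i\<in>A. a i)) \<in> twoR" by (rule twoRI) simp
  then have "((\<Sum>i\<in>A. a i)\<^sup>2 - (\<Sum>i\<in>A. (a i)\<^sup>2)) + 2 * (a i * (\<Sum>i\<in>A. a i)) \<in> twoR"
    using insert.IH insert.prems by (intro twoR_add) simp_all
  moreover have "(\<Sum>i\<in>insert i A. a i)\<^sup>2 - (\<Sum>i\<in>insert i A. (a i)\<^sup>2) =
      ((\<Sum>i\<in>A. a i)\<^sup>2 - (\<Sum>i\<in>A. (a i)\<^sup>2)) + 2 * (a i * (\<Sum>i\<in>A. a i))"
    using insert.hyps by (simp add: power2_sum)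
  ultimately show ?case by (simp only:)
qed (simp add: twoR_0)

text \<open>Squaring removes the mixed terms modulo \<open>2\<close>, and a multiplicity has the
  same parity as its square.\<close>

lemma weighted_square_sum_twoR:
  fixes m :: "'i \<Rightarrow> nat"
  assumes A: "finite A" "\<And>i. i \<in> A \<Longrightarrow> a i \<in> R"
  shows "(\<Sum>i\<in>A. of_nat (m i) * a i)\<^sup>2 - (\<Sum>i\<in>A. of_nat (m i) * (a i)\<^sup>2) \<in> twoR"
proof -
  have "of_nat (m i) * of_nat (m i) * (a i)\<^sup>2 - of_nat (m i) * (a i)\<^sup>2 \<in> twoR" if "i \<in> A" for i
  proof -
    have "even (m i * (m i - 1))" by (cases "m i") auto
    then obtain q where q: "m i * (m i - 1) = 2 * q" by blast
    have "m i * m i = 2 * q + m i" using q by (cases "m i") auto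
    then have "of_nat (m i) * of_nat (m i) = 2 * of_nat q + (of_nat (m i) :: complex)"
      by (metis of_nat_add of_nat_mult of_nat_numeral)
    then have "of_nat (m i) * of_nat (m i) * (a i)\<^sup>2 - of_nat (m i) * (a i)\<^sup>2 = 2 * (of_nat q * (a i)\<^sup>2)"
      by (simp add: algebra_simps)
    then show ?thesis using A(2)[OF that] by (metis twoRI mult_R of_nat_R power_R)
  qed
  then have 1: "(\<Sum>i\<in>A. of_nat (m i) * of_nat (m i) * (a i)\<^sup>2 - of_nat (m i) * (a i)\<^sup>2) \<in> twoR"
    by (intro twoR_sum) auto
  have 2: "(\<Sum>i\<in>A. of_nat (m i) * a i)\<^sup>2 - (\<Sum>i\<in>A. (of_nat (m i) * a i)\<^sup>2) \<in> twoR"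
    using A by (intro square_sum_twoR) (auto intro: mult_R)
  have 3: "(\<Sum>i\<in>A. (of_nat (m i) * a i)\<^sup>2) = (\<Sum>i\<in>A. of_nat (m i) * of_nat (m i) * (a i)\<^sup>2)"
    by (simp add: power2_eq_square mult_ac)
  show ?thesis using twoR_add[OF 1 2] by (simp add: sum_subtractf 3)
qed

text \<open>The Frobenius map fixes the sum modulo \<open>2 R\<close> after finitely many steps; hence it is a
  multiple of \<open>2\<close> as soon as it is a nonunit.\<close>

lemma sum_of_odd_roots_twoR_iff:
  fixes m :: "complex \<Rightarrow> nat"
  assumes n: "odd (n::nat)" and Z: "finite Z" "\<And>z. z \<in> Z \<Longrightarrow> z ^ n = 1"
  shows "(\<Sum>z\<in>Z. of_nat (m z) * z) \<in> twoR \<longleftrightarrow> (\<Sum>z\<in>Z. of_nat (m z) * z) \<in> J"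
proof
  assume "(\<Sum>z\<in>Z. of_nat (m z) * z) \<in> twoR" then show "(\<Sum>z\<in>Z. of_nat (m z) * z) \<in> J" by (rule twoR_J)
next
  \<comment> \<open>\<open>s j\<close> is the sum after \<open>j\<close> Frobenius steps have been
    applied to each root.\<close>
  define s where "s j = (\<Sum>z\<in>Z. of_nat (m z) * z ^ (2 ^ j))" for j :: nat
  have n0: "n > 0" using n by (cases n) auto
  have ZR: "z \<in> R" if "z \<in> Z" for z using root_of_unity_R[OF n0 Z(2)[OF that]] .
  assume "(\<Sum>z\<in>Z. of_nat (m z) * z) \<in> J"
  then have s0: "s 0 \<in> J" by (simp add: s_def)
  then have s0R: "s 0 \<in> R" by (rule J_R)
  have sR: "s j \<in> R" for j unfolding s_def using ZR by (intro sum_R mult_R of_nat_R power_R) auto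
  have step: "(s j)\<^sup>2 - s (Suc j) \<in> twoR" for j
  proof -
    have sq: "z ^ (2 ^ Suc j) = (z ^ (2 ^ j))\<^sup>2" for z :: complex
      by (simp add: power_mult[symmetric] mult.commute)
    show ?thesis unfolding s_def sq
      using weighted_square_sum_twoR[of Z "\<lambda>z. z ^ (2 ^ j)" m] Z(1) power_R[OF ZR] by blast
  qed
  have frob: "s 0 ^ (2 ^ j) - s j \<in> twoR" for j
  proof (induction j)
    case 0
    show ?case by (simp add: twoR_0)
  next
    case (Suc j)
    have "(s 0 ^ (2 ^ j) + s j) * (s 0 ^ (2 ^ j) - s j) \<in> twoR"
      by (rule twoR_mult[OF Suc add_R[OF power_R[OF s0R] sR]])
    from twoR_add[OF this step[of j]] have "(s 0 ^ (2 ^ j))\<^sup>2 - s (Suc j) \<in> twoR"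
      by (simp add: power2_eq_square square_diff_square_factored[symmetric])
    moreover have "s 0 ^ (2 ^ Suc j) = (s 0 ^ (2 ^ j))\<^sup>2" by (simp add: power_mult[symmetric] mult.commute)
    ultimately show ?case by (simp only:)
  qed
  \<comment> \<open>After \<open>f\<close> steps every root is back at itself. As
    \<open>f > 0\<close>, the exponent \<open>2 ^ f\<close> is at least \<open>2\<close>, so for
    \<open>s 0\<close> in \<open>J\<close> the difference \<open>s 0 ^ (2 ^ f) - s 0\<close> is
    \<open>s 0\<close> times a unit.\<close>
  define f where "f = (if n = 1 then 1 else totient n)"
  have f0: "f > 0" using n0 by (simp add: f_def)
  have "[2 ^ f = 1] (mod n)" using euler_theorem[of 2 n] n by (auto simp: f_def cong_def)
  from cong_to_1_nat[OF this] obtain q where "2 ^ f - 1 = n * q" by (rule dvdE)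
  then have q: "(2::nat) ^ f = 1 + n * q" using one_le_power[of "2::nat" f] by linarith
  have "z ^ (2 ^ f) = z" if "z \<in> Z" for z using Z(2)[OF that] by (simp add: q power_add power_mult)
  then have "s f = s 0" unfolding s_def by (intro sum.cong) auto
  then have fr: "s 0 ^ (2 ^ f) - s 0 \<in> twoR" using frob[of f] by simp
  have ge: "(2::nat) \<le> 2 ^ f" using f0 power_increasing[of 1 f "2::nat"] by simp
  from le_Suc_ex[OF ge] obtain j where "(2::nat) ^ f = 2 + j" by (rule exE)
  then have j: "(2::nat) ^ f = Suc (Suc j)" by simp
  have 1: "s 0 * (s 0 * s 0 ^ j - 1) \<in> twoR" using fr unfolding j by (simp add: right_diff_distrib)
  have u: "s 0 * s 0 ^ j - 1 \<in> R" "s 0 * s 0 ^ j - 1 \<notin> J"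
  proof -
    have J: "s 0 * s 0 ^ j \<in> J" using mult_J[OF power_R[OF s0R] s0] by (simp only: mult.commute)
    show "s 0 * s 0 ^ j - 1 \<in> R" using J_R[OF J] by (intro diff_R one_R)
    show "s 0 * s 0 ^ j - 1 \<notin> J" using diff_J[OF J, of "s 0 * s 0 ^ j - 1"] one_J by auto
  qed
  have "inverse (s 0 * s 0 ^ j - 1) * (s 0 * (s 0 * s 0 ^ j - 1)) \<in> twoR"
    by (rule twoR_mult[OF 1 unit_R[OF u]])
  moreover have "inverse (s 0 * s 0 ^ j - 1) * (s 0 * (s 0 * s 0 ^ j - 1)) = s 0"
  proof -
    have "s 0 * s 0 ^ j - 1 \<noteq> 0" using u(2) zero_J by metis
    then show ?thesis by simp
  qed
  ultimately have "s 0 \<in> twoR" by (simp only:)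
  then show "(\<Sum>z\<in>Z. of_nat (m z) * z) \<in> twoR" by (simp add: s_def)
qed

end

section \<open>The Brauer character of the head\<close>

text \<open>The projections onto the eigenspaces of an element of odd order already exist over \<open>R\<close>,
  since its order is invertible in \<open>R\<close>.\<close>

locale odd_order_element = group_algebra G R J for G :: "('g, 'gs) monoid_scheme" (structure) and R J +
  fixes g :: 'g
  assumes g_G: "g \<in> carrier G" and g_odd: "odd (ord g)"
begin

abbreviation Z where "Z \<equiv> {z :: complex. z ^ ord g = 1}"

lemma n_pos: "ord g > 0" using g_odd by (cases "ord g") auto

lemma Z_finite: "finite Z" using finite_roots_unity[of "ord g"] n_pos by simp

lemma Z_R: "z \<in> Z \<Longrightarrow> z \<in> R" using root_of_unity_R[OF n_pos] by simp

lemma inverse_order_R: "inverse (of_nat (ord g)) \<in> R"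
  using g_odd of_nat_J_iff[of "ord g"] by (intro unit_R of_nat_R) simp

text \<open>For \<open>z\<close> in \<open>Z\<close>, the idempotent of the algebra of the cyclic
  group generated by \<open>g\<close> that belongs to the character sending \<open>g\<close> to
  \<open>z\<close>.\<close>

definition proj :: "complex \<Rightarrow> 'g \<Rightarrow> complex" where
  "proj z = inverse (of_nat (ord g)) *\<^sub>c (\<Sum>i< ord g. inverse z ^ i *\<^sub>c dl (g [^] i))"

lemma proj_RG: assumes "z \<in> Z" shows "proj z \<in> RG"
proof -
  have "inverse z \<in> R" using inverse_root_of_unity_R[OF n_pos] assms by simp
  then show ?thesis
    unfolding proj_def using g_G by (intro RG_sc RG_sum RG_dl power_R inverse_order_R) auto
qed

lemma shifted_sum:
  assumes z: "z \<in> Z"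
  shows "(\<Sum>i< ord g. inverse z ^ i *\<^sub>c dl (g [^] Suc i)) = z *\<^sub>c (\<Sum>i< ord g. inverse z ^ i *\<^sub>c dl (g [^] i))"
proof -
  let ?f = "\<lambda>i. inverse z ^ i *\<^sub>c dl (g [^] i)"
  have z0: "z \<noteq> 0" using z n_pos by (auto simp: power_0_left)
  have "?f (ord g) = ?f 0" using z g_G by (simp add: power_inverse pow_ord_eq_1)
  moreover have "(\<Sum>i<Suc (ord g). ?f i) = ?f 0 + (\<Sum>i< ord g. ?f (Suc i))" by (rule sum.lessThan_Suc_shift)
  moreover have "(\<Sum>i<Suc (ord g). ?f i) = (\<Sum>i< ord g. ?f i) + ?f (ord g)" by (rule sum.lessThan_Suc)
  ultimately have "(\<Sum>i< ord g. ?f (Suc i)) = (\<Sum>i< ord g. ?f i)" by simp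
  then have "z *\<^sub>c (\<Sum>i< ord g. ?f i) = z *\<^sub>c (\<Sum>i< ord g. ?f (Suc i))" by (simp only:)
  also have "\<dots> = (\<Sum>i< ord g. z *\<^sub>c ?f (Suc i))" by (simp only: sc_sum)
  also have "\<dots> = (\<Sum>i< ord g. inverse z ^ i *\<^sub>c dl (g [^] Suc i))"
    using z0 by (intro sum.cong refl) (simp add: mult.assoc[symmetric])
  finally show ?thesis by simp
qed

lemma dl_proj: assumes z: "z \<in> Z" shows "dl g \<star> proj z = z *\<^sub>c proj z"
proof -
  have "dl g \<star> (\<Sum>i< ord g. inverse z ^ i *\<^sub>c dl (g [^] i)) = (\<Sum>i< ord g. inverse z ^ i *\<^sub>c dl (g [^] Suc i))"
    unfolding conv_sum_right using g_G nat_pow_Suc2[OF g_G]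
    by (intro sum.cong refl) (simp add: dl_conv_dl del: nat_pow_Suc)
  then show ?thesis by (simp only: proj_def shifted_sum[OF z] conv_sc_right sc_sc mult.commute[of z])
qed

lemma proj_dl: assumes z: "z \<in> Z" shows "proj z \<star> dl g = z *\<^sub>c proj z"
proof -
  have "(\<Sum>i< ord g. inverse z ^ i *\<^sub>c dl (g [^] i)) \<star> dl g = (\<Sum>i< ord g. inverse z ^ i *\<^sub>c dl (g [^] Suc i))"
    unfolding conv_sum_left using g_G by (intro sum.cong refl) (simp add: dl_conv_dl)
  then show ?thesis by (simp only: proj_def shifted_sum[OF z] conv_sc_left sc_sc mult.commute[of z])
qed

text \<open>Counting roots gives some \<open>w\<close> in \<open>Z\<close> with
  \<open>w ^ i \<noteq> 1\<close>. Multiplication by \<open>w\<close> permutes \<open>Z\<close>, and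
  it multiplies the sum by \<open>inverse w ^ i\<close>.\<close>

lemma sum_inverse_powers:
  assumes i: "0 < i" "i < ord g"
  shows "(\<Sum>z\<in>Z. inverse z ^ i) = 0"
proof -
  have "\<not> Z \<subseteq> {z. z ^ i = 1}"
  proof
    assume "Z \<subseteq> {z. z ^ i = 1}"
    then have "card Z \<le> card {z :: complex. z ^ i = 1}"
      using finite_roots_unity[of i] i(1) by (intro card_mono) simp_all
    then show False using card_roots_unity_eq[of i] card_roots_unity_eq[OF n_pos] i by simp
  qed
  then obtain w :: complex where w: "w ^ ord g = 1" "w ^ i \<noteq> 1" by blast
  have w0: "w \<noteq> 0" using w n_pos by (auto simp: power_0_left)
  have "(\<Sum>z\<in>Z. inverse z ^ i) = (\<Sum>z\<in>Z. inverse (w * z) ^ i)"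
    by (rule sum.reindex_bij_witness[of _ "\<lambda>z. w * z" "\<lambda>z. z / w"])
      (use w(1) w0 in \<open>auto simp: power_mult_distrib power_divide\<close>)
  also have "\<dots> = inverse w ^ i * (\<Sum>z\<in>Z. inverse z ^ i)"
    by (simp add: power_mult_distrib sum_distrib_left)
  finally show ?thesis using w(2) w0 by (auto simp: power_inverse)
qed

lemma sum_proj: "(\<Sum>z\<in>Z. proj z) = dl \<one>"
proof -
  have 0: "(\<Sum>z\<in>Z. inverse z ^ i) *\<^sub>c dl (g [^] i) = (if i = 0 then of_nat (ord g) *\<^sub>c dl \<one> else 0)"
    if "i < ord g" for i
    using that sum_inverse_powers[of i] card_roots_unity_eq[OF n_pos] by auto
  have sc_sum_left: "(\<Sum>z\<in>Z. f z *\<^sub>c x) = (\<Sum>z\<in>Z. f z) *\<^sub>c x" for f :: "complex \<Rightarrow> complex" and x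
    by (rule ext) (simp add: sum_apply sc_def sum_distrib_right)
  have "(\<Sum>z\<in>Z. proj z) = inverse (of_nat (ord g)) *\<^sub>c (\<Sum>i< ord g. (\<Sum>z\<in>Z. inverse z ^ i) *\<^sub>c dl (g [^] i))"
    unfolding proj_def sc_sum[symmetric] sc_sum_left[symmetric] by (subst sum.swap) (rule refl)
  also have "(\<Sum>i< ord g. (\<Sum>z\<in>Z. inverse z ^ i) *\<^sub>c dl (g [^] i)) = of_nat (ord g) *\<^sub>c dl \<one>"
    using 0 n_pos by (simp add: sum.delta)
  finally show ?thesis using n_pos by simp
qed

text \<open>Letting \<open>g\<close> act between the factors shows that products of distinct
  projections vanish, and the projections sum to the identity.\<close>

lemma proj_proj: assumes z: "z \<in> Z" shows "proj z \<star> proj z = proj z"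
proof -
  have "proj w \<star> proj z = 0" if w: "w \<in> Z" "w \<noteq> z" for w
  proof -
    have "w *\<^sub>c (proj w \<star> proj z) = (proj w \<star> dl g) \<star> proj z" by (simp only: proj_dl[OF w(1)] conv_sc_left)
    also have "\<dots> = z *\<^sub>c (proj w \<star> proj z)" unfolding conv_assoc by (simp only: dl_proj[OF z] conv_sc_right)
    finally have "inverse (w - z) *\<^sub>c ((w - z) *\<^sub>c (proj w \<star> proj z)) = 0" by (simp add: sc_diff_left)
    then show ?thesis using w(2) by simp
  qed
  then have "(\<Sum>w\<in>Z. proj w \<star> proj z) = (\<Sum>w\<in>Z. if w = z then proj z \<star> proj z else 0)"
    by (intro sum.cong) auto
  also have "\<dots> = proj z \<star> proj z" using Z_finite z by (simp add: sum.delta)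
  finally show ?thesis
    using conv_sum_left[of proj Z "proj z"] RG_CG[OF proj_RG[OF z]] by (simp add: sum_proj)
qed

end

section \<open>The head as a vector space over the residue field\<close>

context pim_model begin

text \<open>For \<open>x\<close> in \<open>L\<close>, the element of the head represented by
  \<open>x\<close>, as a coset inside \<open>P\<close>; \<open>kl 0\<close> is the maximal
  submodule.\<close>

definition kl :: "('g \<Rightarrow> complex) \<Rightarrow> 'm set" where "kl x = {q \<in> carrier P. F q - x \<in> N}"

lemma kl_self: "x \<in> L \<Longrightarrow> Fi x \<in> kl x" by (simp add: kl_def Fi_P)

lemma kl_eq: assumes "x \<in> L" "y \<in> L" shows "kl x = kl y \<longleftrightarrow> x - y \<in> N"
proof
  assume "kl x = kl y"
  then have "Fi x \<in> kl y" using kl_self[OF assms(1)] by simp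
  then show "x - y \<in> N" using assms by (simp add: kl_def)
next
  assume xy: "x - y \<in> N"
  have "z - x \<in> N \<longleftrightarrow> z - y \<in> N" for z
    using N_add[OF _ xy, of "z - x"] N_diff[OF _ xy, of "z - y"] by (auto simp del: N_add N_diff)
  then show "kl x = kl y" by (simp add: kl_def)
qed

lemma coset_kl: assumes p: "p \<in> carrier P" shows "kl 0 +>\<^bsub>P\<^esub> p = kl (F p)"
proof (intro equalityI subsetI)
  fix q assume "q \<in> kl 0 +>\<^bsub>P\<^esub> p"
  then show "q \<in> kl (F p)" using p by (auto simp: a_r_coset_def' kl_def F_add)
next
  fix q assume "q \<in> kl (F p)"
  then have q: "q \<in> carrier P" "F q - F p \<in> N" by (auto simp: kl_def)
  have d: "F q - F p \<in> L" using q(2) by (rule N_L)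
  have "Fi (F q - F p) \<oplus>\<^bsub>P\<^esub> p = q" using p q(1) d by (intro F_inj) (simp_all add: F_add Fi_P)
  moreover have "Fi (F q - F p) \<in> kl 0" using d q(2) by (simp add: kl_def Fi_P)
  ultimately show "q \<in> kl 0 +>\<^bsub>P\<^esub> p" unfolding a_r_coset_def' by blast
qed

lemma submodule_kl_0: "gr_submodule (loc_ring MM) G P \<rho> (kl 0)"
  unfolding gr_submodule_def kl_def
  by (auto intro!: submodule.intro P.module_axioms simp: F_add F_smult F_act act_P F_zero)

text \<open>An element outside \<open>N\<close> generates: with \<open>b \<star> F x = e\<close>,
  any \<open>F y\<close> equals \<open>(F y \<star> b) \<star> F x\<close>, an
  \<open>R\<close>-combination of translates of \<open>F x\<close>.\<close>

lemma proper_submodule_le: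
  assumes M: "gr_submodule (loc_ring MM) G P \<rho> M" and ne: "M \<noteq> carrier P"
  shows "M \<subseteq> kl 0"
proof (rule ccontr)
  assume "\<not> M \<subseteq> kl 0"
  interpret M: submodule "loc_ring MM" M P using M by (simp add: gr_submodule_def)
  have MP: "M \<subseteq> carrier P" by (rule M.subset)
  obtain x where x: "x \<in> M" "F x \<notin> N" using \<open>\<not> M \<subseteq> kl 0\<close> MP by (auto simp: kl_def)
  have xP: "x \<in> carrier P" using MP x(1) by auto
  obtain b where b: "b \<in> RG" "b \<star> F x = e" using L_generator[OF F_L[OF xP] x(2)] by blast
  have "carrier P \<subseteq> M"
  proof
    fix y assume y: "y \<in> carrier P"
    have hL: "dl h \<star> F x \<in> L" if "h \<in> carrier G" for h using that xP by (intro L_conv F_L) auto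
    have aR: "(F y \<star> b) h \<in> R" for h by (rule RG_R[OF RG_conv[OF L_RG[OF F_L[OF y]] b(1)]])
    have inM: "Fi (\<Sum>h\<in>S. c h *\<^sub>c (dl h \<star> F x)) \<in> M" if "S \<subseteq> carrier G" "\<And>h. c h \<in> R" for S c
      using finite_subset[OF that(1) fin_G] that(1)
    proof (induction S rule: finite_induct)
      case empty
      have "Fi 0 = \<zero>\<^bsub>P\<^esub>" using Fi_F[of "\<zero>\<^bsub>P\<^esub>"] by (simp add: F_zero)
      then show ?case by simp
    next
      case (insert h S)
      have h: "h \<in> carrier G" "S \<subseteq> carrier G" using insert.prems by auto
      have "(\<Sum>h\<in>S. c h *\<^sub>c (dl h \<star> F x)) \<in> L" using h(2) that(2) hL by (intro L_sum L_sc) auto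
      then have "Fi (\<Sum>h\<in>insert h S. c h *\<^sub>c (dl h \<star> F x)) = c h \<odot>\<^bsub>P\<^esub> \<rho> h x \<oplus>\<^bsub>P\<^esub> Fi (\<Sum>h\<in>S. c h *\<^sub>c (dl h \<star> F x))"
        using insert.hyps h(1) hL[OF h(1)] that(2) F_L[OF xP] xP
        by (simp add: Fi_add Fi_smult Fi_act L_sc)
      moreover have "\<rho> h x \<in> M" using M x(1) h(1) by (simp add: gr_submodule_def)
      ultimately show ?case using insert.IH[OF h(2)] that(2) by (simp add: M.m_closed M.smult_closed)
    qed
    have "F y = (F y \<star> b) \<star> F x" using L_e_right[OF F_L[OF y]] b(2) by (simp add: conv_assoc)
    also have "F y \<star> b = (\<Sum>h\<in>carrier G. (F y \<star> b) h *\<^sub>c dl h)" by (rule CG_expand) simp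
    also have "\<dots> \<star> F x = (\<Sum>h\<in>carrier G. (F y \<star> b) h *\<^sub>c (dl h \<star> F x))" by (simp only: conv_sum_left conv_sc_left)
    finally have "Fi (F y) = Fi (\<Sum>h\<in>carrier G. (F y \<star> b) h *\<^sub>c (dl h \<star> F x))" by (rule arg_cong)
    then show "y \<in> M" using inM[OF subset_refl, of "F y \<star> b"] aR y by simp
  qed
  then show False using ne MP by blast
qed

lemma unique_maximal_submodule_eq: "unique_maximal_submodule (loc_ring MM) G P \<rho> = kl 0"
  unfolding unique_maximal_submodule_def
proof (rule the_equality)
  have "F (Fi e) - 0 \<notin> N" unfolding F_Fi[OF L_e] diff_zero by (rule e_notin_N)
  then have "Fi e \<notin> kl 0" unfolding kl_def by blast
  then have ne: "kl 0 \<noteq> carrier P" using Fi_P[OF L_e] by blast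
  show "gr_maximal_submodule (loc_ring MM) G P \<rho> (kl 0)"
    unfolding gr_maximal_submodule_def
  proof (intro conjI allI impI, rule submodule_kl_0, rule ne, elim conjE)
    fix M assume "gr_submodule (loc_ring MM) G P \<rho> M" "kl 0 \<subseteq> M"
    then show "M = kl 0 \<or> M = carrier P" using proper_submodule_le[of M] by blast
  qed
  fix M assume M: "gr_maximal_submodule (loc_ring MM) G P \<rho> M"
  then have "gr_submodule (loc_ring MM) G P \<rho> M" "M \<noteq> carrier P"
    unfolding gr_maximal_submodule_def by simp_all
  then have "M \<subseteq> kl 0" by (rule proper_submodule_le)
  then show "M = kl 0" using M submodule_kl_0 ne unfolding gr_maximal_submodule_def by metis
qed

abbreviation hd where "hd \<equiv> residue_quotient P (kl 0)"

lemma hd_simps: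
  "carrier hd = kl ` L" "\<zero>\<^bsub>hd\<^esub> = kl 0"
  "x \<in> L \<Longrightarrow> y \<in> L \<Longrightarrow> kl x \<oplus>\<^bsub>hd\<^esub> kl y = kl (x + y)"
  "r \<in> R \<Longrightarrow> x \<in> L \<Longrightarrow> res r \<odot>\<^bsub>hd\<^esub> kl x = kl (r *\<^sub>c x)"
proof -
  show "carrier hd = kl ` L"
  proof (intro equalityI subsetI)
    fix X assume "X \<in> carrier hd"
    then obtain p where "p \<in> carrier P" "X = kl 0 +>\<^bsub>P\<^esub> p" by (auto simp: residue_quotient_def A_RCOSETS_def')
    then show "X \<in> kl ` L" by (auto simp: coset_kl)
  next
    fix X assume "X \<in> kl ` L"
    then obtain x where x: "x \<in> L" "X = kl x" by blast
    then have "X = kl 0 +>\<^bsub>P\<^esub> Fi x" by (simp add: coset_kl Fi_P)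
    then show "X \<in> carrier hd" using x(1) by (auto simp: residue_quotient_def A_RCOSETS_def')
  qed
  show "\<zero>\<^bsub>hd\<^esub> = kl 0" by (simp add: residue_quotient_def)
  show "kl x \<oplus>\<^bsub>hd\<^esub> kl y = kl (x + y)" if x: "x \<in> L" and y: "y \<in> L"
  proof -
    have "kl x <+>\<^bsub>P\<^esub> kl y = kl (x + y)"
    proof (intro equalityI subsetI)
      fix q assume "q \<in> kl x <+>\<^bsub>P\<^esub> kl y"
      then obtain a b where ab: "a \<in> kl x" "b \<in> kl y" "q = a \<oplus>\<^bsub>P\<^esub> b" by (auto simp: set_add_def')
      then have "(F a - x) + (F b - y) \<in> N" by (intro N_add) (simp_all add: kl_def)
      then show "q \<in> kl (x + y)" using ab by (simp add: kl_def F_add algebra_simps)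
    next
      fix q assume q: "q \<in> kl (x + y)"
      then have qP: "q \<in> carrier P" "F q - (x + y) \<in> N" by (auto simp: kl_def)
      have d: "F q - x \<in> L" using F_L[OF qP(1)] x by (rule L_diff)
      have "Fi x \<oplus>\<^bsub>P\<^esub> Fi (F q - x) = q" using qP(1) d x by (intro F_inj) (simp_all add: F_add Fi_P)
      moreover have "Fi (F q - x) \<in> kl y" using d qP(2) by (simp add: kl_def Fi_P algebra_simps)
      ultimately show "q \<in> kl x <+>\<^bsub>P\<^esub> kl y" using kl_self[OF x] unfolding set_add_def' by blast
    qed
    then show ?thesis by (simp add: residue_quotient_def)
  qed
  show "res r \<odot>\<^bsub>hd\<^esub> kl x = kl (r *\<^sub>c x)" if r: "r \<in> R" and x: "x \<in> L"
  proof -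
    have "kl 0 +>\<^bsub>P\<^esub> (s \<odot>\<^bsub>P\<^esub> q) = kl (r *\<^sub>c x)" if "s \<in> res r" "q \<in> kl x" for s q
    proof -
      have s: "s \<in> R" "s - r \<in> J" and q: "q \<in> carrier P" "F q - x \<in> N" using that by (auto simp: res_def kl_def)
      have "s *\<^sub>c (F q - x) + (s - r) *\<^sub>c x \<in> N" using s q x by (intro N_add N_sc J_L_N)
      then have "s *\<^sub>c F q - r *\<^sub>c x \<in> N" by (simp add: sc_diff_right sc_diff_left)
      then show ?thesis using s q r x by (simp add: coset_kl F_smult kl_eq L_sc F_L)
    qed
    moreover have "r \<in> res r" using r by (simp add: res_def)
    ultimately have "(\<Union>s\<in>res r. \<Union>q\<in>kl x. kl 0 +>\<^bsub>P\<^esub> (s \<odot>\<^bsub>P\<^esub> q)) = kl (r *\<^sub>c x)" using kl_self[OF x] by blast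
    then show ?thesis by (simp add: residue_quotient_def)
  qed
qed

lemma quotient_act_kl: assumes h: "h \<in> carrier G" and x: "x \<in> L" shows "quotient_act \<rho> h (kl x) = kl (dl h \<star> x)"
  unfolding quotient_act_def
proof (intro equalityI subsetI)
  fix q assume "q \<in> \<rho> h ` kl x"
  then obtain p where p: "p \<in> carrier P" "F p - x \<in> N" "q = \<rho> h p" by (auto simp: kl_def)
  have "dl h \<star> (F p - x) \<in> N" using p(2) h by (intro N_conv) auto
  then show "q \<in> kl (dl h \<star> x)" using p h by (simp add: kl_def act_P F_act conv_diff_right)
next
  fix q assume "q \<in> kl (dl h \<star> x)"
  then have q: "q \<in> carrier P" "F q - dl h \<star> x \<in> N" by (auto simp: kl_def)
  define y where "y = dl (inv h) \<star> F q"
  have yL: "y \<in> L" unfolding y_def using h F_L[OF q(1)] by (intro L_conv) auto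
  have hy: "dl h \<star> y = F q" unfolding y_def conv_assoc[symmetric] using h F_L[OF q(1)] by (simp add: dl_conv_dl)
  have "dl (inv h) \<star> (F q - dl h \<star> x) \<in> N" using q(2) h by (intro N_conv) auto
  moreover have "dl (inv h) \<star> (dl h \<star> x) = x" unfolding conv_assoc[symmetric] using h x by (simp add: dl_conv_dl)
  ultimately have "y - x \<in> N" by (simp add: y_def conv_diff_right)
  then have "Fi y \<in> kl x" using yL by (simp add: kl_def Fi_P)
  moreover have "\<rho> h (Fi y) = q" using Fi_act[OF h yL] q(1) by (simp add: hy)
  ultimately show "q \<in> \<rho> h ` kl x" by blast
qed

text \<open>Closure under \<open>R\<close> and not under \<open>G\<close>, so that eigenspaces of a
  single group element are covered.\<close>

definition R_closed :: "('g \<Rightarrow> complex) set \<Rightarrow> bool" where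
  "R_closed Y \<longleftrightarrow> Y \<subseteq> L \<and> 0 \<in> Y \<and> (\<forall>x\<in>Y. \<forall>y\<in>Y. x + y \<in> Y) \<and> (\<forall>r\<in>R. \<forall>x\<in>Y. r *\<^sub>c x \<in> Y)"

lemma R_closedD:
  assumes "R_closed Y"
  shows "x \<in> Y \<Longrightarrow> x \<in> L" "0 \<in> Y" "x \<in> Y \<Longrightarrow> y \<in> Y \<Longrightarrow> x + y \<in> Y" "r \<in> R \<Longrightarrow> x \<in> Y \<Longrightarrow> r *\<^sub>c x \<in> Y"
  using assms unfolding R_closed_def by blast+

lemma R_closed_L: "R_closed L" by (auto simp: R_closed_def)

abbreviation sub where "sub Y \<equiv> hd\<lparr>carrier := kl ` Y\<rparr>"

lemma sub_vectorspace: assumes Y: "R_closed Y" shows "vectorspace k (sub Y)"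
proof (rule vs_criteria[OF k_field])
  note Y' = R_closedD[OF Y]
  have add: "kl x \<oplus>\<^bsub>hd\<^esub> kl y = kl (x + y)" if "x \<in> Y" "y \<in> Y" for x y using that Y'(1) hd_simps(3) by blast
  have sm: "res r \<odot>\<^bsub>hd\<^esub> kl x = kl (r *\<^sub>c x)" if "r \<in> R" "x \<in> Y" for r x using that Y'(1) hd_simps(4) by blast
  show "\<zero>\<^bsub>sub Y\<^esub> \<in> carrier (sub Y)" using Y'(2) by (simp add: hd_simps)
  show "\<forall>v w. v \<in> carrier (sub Y) \<and> w \<in> carrier (sub Y) \<longrightarrow> v \<oplus>\<^bsub>sub Y\<^esub> w \<in> carrier (sub Y)"
    using add Y'(3) by auto
  show "\<forall>v\<in>carrier (sub Y). \<exists>w\<in>carrier (sub Y). v \<oplus>\<^bsub>sub Y\<^esub> w = \<zero>\<^bsub>sub Y\<^esub>"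
  proof
    fix v assume "v \<in> carrier (sub Y)"
    then obtain x where x: "x \<in> Y" "v = kl x" by auto
    have m: "(- 1) *\<^sub>c x \<in> Y" using x(1) by (intro Y'(4)) auto
    have "x + (- 1) *\<^sub>c x = 0" by (simp add: sc_uminus_left)
    then show "\<exists>w\<in>carrier (sub Y). v \<oplus>\<^bsub>sub Y\<^esub> w = \<zero>\<^bsub>sub Y\<^esub>"
      using add[OF x(1) m] m x(2) by (intro bexI[of _ "kl ((- 1) *\<^sub>c x)"]) (simp_all add: hd_simps(2))
  qed
  show "\<forall>c v. c \<in> carrier k \<and> v \<in> carrier (sub Y) \<longrightarrow> c \<odot>\<^bsub>sub Y\<^esub> v \<in> carrier (sub Y)"
    using sm Y'(4) by (auto simp: k_simps(1))
  show "\<forall>v w. v \<in> carrier (sub Y) \<and> w \<in> carrier (sub Y) \<longrightarrow> v \<oplus>\<^bsub>sub Y\<^esub> w = w \<oplus>\<^bsub>sub Y\<^esub> v"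
    using add by (auto simp: add.commute)
  show "\<forall>u v w. u \<in> carrier (sub Y) \<and> v \<in> carrier (sub Y) \<and> w \<in> carrier (sub Y) \<longrightarrow>
      (u \<oplus>\<^bsub>sub Y\<^esub> v) \<oplus>\<^bsub>sub Y\<^esub> w = u \<oplus>\<^bsub>sub Y\<^esub> (v \<oplus>\<^bsub>sub Y\<^esub> w)"
    using add Y'(3) by (auto simp: add.assoc)
  show "\<forall>v\<in>carrier (sub Y). v \<oplus>\<^bsub>sub Y\<^esub> \<zero>\<^bsub>sub Y\<^esub> = v"
    using add[OF _ Y'(2)] by (auto simp: hd_simps(2))
  show "\<forall>a b v. a \<in> carrier k \<and> b \<in> carrier k \<and> v \<in> carrier (sub Y) \<longrightarrow>
      (a \<otimes>\<^bsub>k\<^esub> b) \<odot>\<^bsub>sub Y\<^esub> v = a \<odot>\<^bsub>sub Y\<^esub> (b \<odot>\<^bsub>sub Y\<^esub> v)"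
    using sm Y'(4) by (auto simp: k_simps mult_R)
  show "\<forall>v\<in>carrier (sub Y). \<one>\<^bsub>k\<^esub> \<odot>\<^bsub>sub Y\<^esub> v = v" using sm[OF one_R] by (auto simp: k_simps)
  show "\<forall>a b v. a \<in> carrier k \<and> b \<in> carrier k \<and> v \<in> carrier (sub Y) \<longrightarrow>
      (a \<oplus>\<^bsub>k\<^esub> b) \<odot>\<^bsub>sub Y\<^esub> v = a \<odot>\<^bsub>sub Y\<^esub> v \<oplus>\<^bsub>sub Y\<^esub> b \<odot>\<^bsub>sub Y\<^esub> v"
    using sm add Y'(4) by (auto simp: k_simps add_R sc_add_left)
  show "\<forall>a v w. a \<in> carrier k \<and> v \<in> carrier (sub Y) \<and> w \<in> carrier (sub Y) \<longrightarrow>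
      a \<odot>\<^bsub>sub Y\<^esub> (v \<oplus>\<^bsub>sub Y\<^esub> w) = a \<odot>\<^bsub>sub Y\<^esub> v \<oplus>\<^bsub>sub Y\<^esub> a \<odot>\<^bsub>sub Y\<^esub> w"
    using sm add Y'(3,4) by (auto simp: k_simps sc_add_right)
qed

lemma sub_finsum:
  assumes Y: "R_closed Y" and I: "finite I" "\<And>i. i \<in> I \<Longrightarrow> r i \<in> R" "\<And>i. i \<in> I \<Longrightarrow> x i \<in> Y"
  shows "(\<Oplus>\<^bsub>sub Y\<^esub>i\<in>I. res (r i) \<odot>\<^bsub>hd\<^esub> kl (x i)) = kl (\<Sum>i\<in>I. r i *\<^sub>c x i)"
    and "(\<Sum>i\<in>I. r i *\<^sub>c x i) \<in> Y"
proof -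
  interpret S: vectorspace k "sub Y" by (rule sub_vectorspace[OF Y])
  note Y' = R_closedD[OF Y]
  have "(\<Oplus>\<^bsub>sub Y\<^esub>i\<in>I. res (r i) \<odot>\<^bsub>hd\<^esub> kl (x i)) = kl (\<Sum>i\<in>I. r i *\<^sub>c x i) \<and> (\<Sum>i\<in>I. r i *\<^sub>c x i) \<in> Y"
    using I
  proof (induction I rule: finite_induct)
    case empty
    then show ?case using Y'(2) S.M.finsum_empty by (simp add: hd_simps(2))
  next
    case (insert i I)
    have t: "res (r j) \<odot>\<^bsub>hd\<^esub> kl (x j) \<in> carrier (sub Y)" if "j \<in> insert i I" for j
      using hd_simps(4)[of "r j" "x j"] insert.prems(1)[OF that] insert.prems(2)[OF that] Y'(1,4) by auto
    have IH: "(\<Oplus>\<^bsub>sub Y\<^esub>i\<in>I. res (r i) \<odot>\<^bsub>hd\<^esub> kl (x i)) = kl (\<Sum>i\<in>I. r i *\<^sub>c x i)" "(\<Sum>i\<in>I. r i *\<^sub>c x i) \<in> Y"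
      using insert.IH insert.prems by auto
    have i: "r i *\<^sub>c x i \<in> Y" using insert.prems Y'(4) by auto
    have "(\<Oplus>\<^bsub>sub Y\<^esub>i\<in>insert i I. res (r i) \<odot>\<^bsub>hd\<^esub> kl (x i)) =
        res (r i) \<odot>\<^bsub>hd\<^esub> kl (x i) \<oplus>\<^bsub>sub Y\<^esub> (\<Oplus>\<^bsub>sub Y\<^esub>i\<in>I. res (r i) \<odot>\<^bsub>hd\<^esub> kl (x i))"
      using insert.hyps t by (intro S.M.finsum_insert) auto
    also have "\<dots> = kl (r i *\<^sub>c x i) \<oplus>\<^bsub>hd\<^esub> kl (\<Sum>i\<in>I. r i *\<^sub>c x i)"
      using IH insert.prems Y'(1) by (simp add: hd_simps(4))
    also have "\<dots> = kl (\<Sum>i\<in>insert i I. r i *\<^sub>c x i)"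
      using insert.hyps Y'(1)[OF i] Y'(1)[OF IH(2)] by (simp add: hd_simps(3))
    finally show ?case using insert.hyps Y'(3)[OF i IH(2)] by simp
  qed
  then show "(\<Oplus>\<^bsub>sub Y\<^esub>i\<in>I. res (r i) \<odot>\<^bsub>hd\<^esub> kl (x i)) = kl (\<Sum>i\<in>I. r i *\<^sub>c x i)" "(\<Sum>i\<in>I. r i *\<^sub>c x i) \<in> Y"
    by simp_all
qed

end

section \<open>Eigenspaces of an element of odd order on the head\<close>

locale pim_model_odd_element = pim_model MM G e P \<rho> F + odd_order_element G R J g
  for MM :: "complex set" and G :: "('g, 'gs) monoid_scheme" (structure) and e
    and P :: "(complex, 'm, 'ms) module_scheme" and \<rho> :: "'g \<Rightarrow> 'm \<Rightarrow> 'm"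
    and F :: "'m \<Rightarrow> 'g \<Rightarrow> complex" and g
begin

abbreviation T where "T \<equiv> quotient_act \<rho> g"

text \<open>For \<open>z\<close> in \<open>Z\<close>, a direct summand of the
  \<open>R\<close>-module \<open>L\<close> that lifts the eigenspace of \<open>g\<close> for the
  residue of \<open>z\<close>.\<close>

definition Y :: "complex \<Rightarrow> ('g \<Rightarrow> complex) set" where "Y z = (\<lambda>x. proj z \<star> x) ` L"

lemma proj_L: "z \<in> Z \<Longrightarrow> x \<in> L \<Longrightarrow> proj z \<star> x \<in> L" by (intro L_conv proj_RG)

lemma Y_iff: assumes z: "z \<in> Z" shows "y \<in> Y z \<longleftrightarrow> y \<in> L \<and> proj z \<star> y = y"
proof
  assume "y \<in> Y z"
  then obtain x where x: "x \<in> L" "y = proj z \<star> x" by (auto simp: Y_def)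
  have "proj z \<star> y = (proj z \<star> proj z) \<star> x" by (simp only: x(2) conv_assoc)
  then show "y \<in> L \<and> proj z \<star> y = y" using proj_proj[OF z] proj_L[OF z x(1)] x(2) by simp
next
  assume "y \<in> L \<and> proj z \<star> y = y" then show "y \<in> Y z" unfolding Y_def by (metis imageI)
qed

lemma Y_closed: assumes z: "z \<in> Z" shows "R_closed (Y z)"
  unfolding R_closed_def
proof (intro conjI ballI subsetI)
  show "0 \<in> Y z" unfolding Y_iff[OF z] by simp
  fix x assume "x \<in> Y z"
  then have x: "x \<in> L" "proj z \<star> x = x" unfolding Y_iff[OF z] by simp_all
  show "x \<in> L" by (rule x(1))
  show "x + y \<in> Y z" if y: "y \<in> Y z" for y
  proof -
    have "y \<in> L" "proj z \<star> y = y" using y unfolding Y_iff[OF z] by simp_all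
    then show ?thesis unfolding Y_iff[OF z] conv_add_right x(2) using L_add[OF x(1)] by simp
  qed
  show "r *\<^sub>c x \<in> Y z" if r: "r \<in> R" for r
    unfolding Y_iff[OF z] conv_sc_right x(2) using L_sc[OF r x(1)] by simp
qed

lemma sum_proj_conv: assumes x: "x \<in> L" shows "(\<Sum>z\<in>Z. proj z \<star> x) = x"
  using conv_sum_left[of proj Z x] one_conv_L[OF x] by (simp only: sum_proj)

definition shift :: "complex \<Rightarrow> ('g \<Rightarrow> complex) \<Rightarrow> 'g \<Rightarrow> complex" where
  "shift r x = dl g \<star> x - r *\<^sub>c x"

lemma shift_L: "r \<in> R \<Longrightarrow> x \<in> L \<Longrightarrow> shift r x \<in> L"
  unfolding shift_def using g_G by (intro L_diff L_conv L_sc RG_dl)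

lemma T_shift:
  assumes r: "r \<in> R" and x: "x \<in> L"
  shows "((\<lambda>w. T w \<ominus>\<^bsub>hd\<^esub> res r \<odot>\<^bsub>hd\<^esub> w) ^^ n) (kl x) = kl ((shift r ^^ n) x)" and "(shift r ^^ n) x \<in> L"
proof -
  have hd: "sub L = hd" by (simp add: hd_simps(1)[symmetric] residue_quotient_def)
  interpret H: vectorspace k hd using sub_vectorspace[OF R_closed_L] unfolding hd .
  have one: "T (kl y) \<ominus>\<^bsub>hd\<^esub> res r \<odot>\<^bsub>hd\<^esub> kl y = kl (shift r y)" if y: "y \<in> L" for y
  proof -
    have gy: "dl g \<star> y \<in> L" "r *\<^sub>c y \<in> L" using y g_G r by (auto intro!: L_conv L_sc)
    have sum: "kl (dl g \<star> y) = kl (shift r y) \<oplus>\<^bsub>hd\<^esub> kl (r *\<^sub>c y)"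
      using gy shift_L[OF r y] by (simp add: hd_simps(3) shift_def)
    have "kl (shift r y) \<in> carrier hd" "kl (r *\<^sub>c y) \<in> carrier hd"
      using gy shift_L[OF r y] by (simp_all add: hd_simps(1))
    then have "kl (dl g \<star> y) \<ominus>\<^bsub>hd\<^esub> kl (r *\<^sub>c y) = kl (shift r y)"
      unfolding sum by (simp add: H.M.minus_eq H.M.a_assoc H.M.a_inv_closed H.M.r_neg H.M.r_zero)
    then show ?thesis using quotient_act_kl[OF g_G y] r y by (simp add: hd_simps(4))
  qed
  have "((\<lambda>w. T w \<ominus>\<^bsub>hd\<^esub> res r \<odot>\<^bsub>hd\<^esub> w) ^^ n) (kl x) = kl ((shift r ^^ n) x) \<and> (shift r ^^ n) x \<in> L"
    by (induction n) (use x one shift_L[OF r] in simp_all)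
  then show "((\<lambda>w. T w \<ominus>\<^bsub>hd\<^esub> res r \<odot>\<^bsub>hd\<^esub> w) ^^ n) (kl x) = kl ((shift r ^^ n) x)" "(shift r ^^ n) x \<in> L"
    by simp_all
qed

lemma proj_shift:
  assumes z: "z \<in> Z"
  shows "proj z \<star> (shift r ^^ n) x = (z - r) ^ n *\<^sub>c (proj z \<star> x)"
proof (induction n)
  case (Suc n)
  have "proj z \<star> shift r y = (z - r) *\<^sub>c (proj z \<star> y)" for y
    unfolding shift_def conv_diff_right conv_assoc[symmetric] proj_dl[OF z] conv_sc_left conv_sc_right sc_diff_left ..
  then show ?case using Suc by (simp add: mult.commute)
qed simp

text \<open>On the image of \<open>proj w\<close> the \<open>n\<close>-th power of the shift is
  multiplication by \<open>(w - r) ^ n\<close>, a unit of \<open>R\<close>.\<close>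

lemma proj_in_N:
  assumes r: "r \<in> R" and x: "x \<in> L" and N: "(shift r ^^ n) x \<in> N" and w: "w \<in> Z" "w - r \<notin> J"
  shows "proj w \<star> x \<in> N"
proof -
  have 1: "(w - r) ^ n *\<^sub>c (proj w \<star> x) \<in> N" using N_conv[OF proj_RG[OF w(1)] N] by (simp only: proj_shift[OF w(1)])
  have u: "inverse (w - r) \<in> R" by (rule unit_R[OF diff_R[OF Z_R[OF w(1)] r] w(2)])
  have "w - r \<noteq> 0" using w(2) zero_J by metis
  then have "inverse (w - r) ^ n * (w - r) ^ n = 1" by (simp add: power_mult_distrib[symmetric])
  then show ?thesis using N_sc[OF power_R[OF u] 1, of n] by simp
qed

lemma Z_incongruent: "z \<in> Z \<Longrightarrow> w \<in> Z \<Longrightarrow> w - z \<in> J \<Longrightarrow> w = z"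
  using odd_roots_of_unity_incongruent[OF g_odd, of w z] by (simp add: cong_J_def)

text \<open>No root of unity in \<open>Z\<close> other than \<open>z\<close> is congruent to
  \<open>r\<close>, so all other components lie in \<open>N\<close> by
  \<open>proj_in_N\<close>.\<close>

lemma diff_proj_in_N:
  assumes r: "r \<in> R" and x: "x \<in> L" and N: "(shift r ^^ n) x \<in> N" and z: "z \<in> Z" "z - r \<in> J"
  shows "x - proj z \<star> x \<in> N"
proof -
  have "proj w \<star> x \<in> N" if w: "w \<in> Z - {z}" for w
  proof (rule proj_in_N[OF r x N])
    show "w \<in> Z" using w by simp
    show "w - r \<notin> J"
    proof
      assume "w - r \<in> J"
      then have "(w - r) - (z - r) \<in> J" using z(2) by (rule diff_J)
      then show False using Z_incongruent[OF z(1), of w] w by simp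
    qed
  qed
  then have "(\<Sum>w\<in>Z - {z}. proj w \<star> x) \<in> N" by (rule N_sum)
  moreover have "x = proj z \<star> x + (\<Sum>w\<in>Z - {z}. proj w \<star> x)"
    using sum.remove[OF Z_finite z(1), of "\<lambda>w. proj w \<star> x"] sum_proj_conv[OF x] by simp
  ultimately show ?thesis by (metis add_diff_cancel_left')
qed

text \<open>A generalized eigenvector agrees modulo \<open>N\<close> with its component at
  \<open>z\<close>. Conversely that component is a genuine eigenvector, killed already by the first
  power.\<close>

lemma generalized_eigenspace:
  assumes z: "z \<in> Z"
  shows "{v \<in> carrier hd. \<exists>n. ((\<lambda>w. T w \<ominus>\<^bsub>hd\<^esub> res z \<odot>\<^bsub>hd\<^esub> w) ^^ n) v = \<zero>\<^bsub>hd\<^esub>} = kl ` Y z"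
proof (intro equalityI subsetI)
  fix v assume "v \<in> {v \<in> carrier hd. \<exists>n. ((\<lambda>w. T w \<ominus>\<^bsub>hd\<^esub> res z \<odot>\<^bsub>hd\<^esub> w) ^^ n) v = \<zero>\<^bsub>hd\<^esub>}"
  then obtain x n where x: "x \<in> L" "v = kl x" "((\<lambda>w. T w \<ominus>\<^bsub>hd\<^esub> res z \<odot>\<^bsub>hd\<^esub> w) ^^ n) v = \<zero>\<^bsub>hd\<^esub>"
    unfolding mem_Collect_eq hd_simps(1) by blast
  then have "kl ((shift z ^^ n) x) = kl 0" using T_shift(1)[OF Z_R[OF z] x(1)] by (simp add: hd_simps(2))
  then have "(shift z ^^ n) x \<in> N" using kl_eq[OF T_shift(2)[OF Z_R[OF z] x(1)] L_0] by simp
  then have "x - proj z \<star> x \<in> N" by (rule diff_proj_in_N[OF Z_R[OF z] x(1) _ z]) simp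
  then have "v = kl (proj z \<star> x)" using kl_eq[OF x(1) proj_L[OF z x(1)]] x(2) by simp
  then show "v \<in> kl ` Y z" using x(1) unfolding Y_def by blast
next
  fix v assume "v \<in> kl ` Y z"
  then obtain y where y: "y \<in> L" "v = kl (proj z \<star> y)" by (auto simp: Y_def)
  have "shift z (proj z \<star> y) = 0" unfolding shift_def conv_assoc[symmetric] dl_proj[OF z] by simp
  then have "((\<lambda>w. T w \<ominus>\<^bsub>hd\<^esub> res z \<odot>\<^bsub>hd\<^esub> w) ^^ 1) v = \<zero>\<^bsub>hd\<^esub>"
    unfolding y(2) T_shift(1)[OF Z_R[OF z] proj_L[OF z y(1)]] by (simp add: hd_simps(2))
  then show "v \<in> {v \<in> carrier hd. \<exists>n. ((\<lambda>w. T w \<ominus>\<^bsub>hd\<^esub> res z \<odot>\<^bsub>hd\<^esub> w) ^^ n) v = \<zero>\<^bsub>hd\<^esub>}"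
    using proj_L[OF z y(1)] unfolding y(2) hd_simps(1) by blast
qed

definition S where "S = {z \<in> Z. \<not> Y z \<subseteq> N}"

lemma S_Z: "S \<subseteq> Z" and S_finite: "finite S" using Z_finite by (auto simp: S_def)

text \<open>A representative of an eigenvector lies outside \<open>N\<close>, hence so does one of
  its components, and the root belonging to that component must be congruent to the
  eigenvalue.\<close>

lemma eigenvalues_eq: "eigenvalues k hd T = res ` S"
proof (intro equalityI subsetI)
  fix c assume "c \<in> eigenvalues k hd T"
  then obtain r x where r: "r \<in> R" "c = res r" and x: "x \<in> L" "kl x \<noteq> kl 0" "T (kl x) = res r \<odot>\<^bsub>hd\<^esub> kl x"
    by (auto simp: eigenvalues_def k_simps(1) hd_simps(1,2))
  have gx: "dl g \<star> x \<in> L" "r *\<^sub>c x \<in> L" using x(1) g_G r(1) by (auto intro!: L_conv L_sc)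
  have "kl (dl g \<star> x) = kl (r *\<^sub>c x)" using x(3) quotient_act_kl[OF g_G x(1)] hd_simps(4)[OF r(1) x(1)] by simp
  then have "(shift r ^^ 1) x \<in> N" using kl_eq[OF gx] by (simp add: shift_def)
  note shN = proj_in_N[OF r(1) x(1) this] diff_proj_in_N[OF r(1) x(1) this]
  have xN: "x \<notin> N" using x(2) kl_eq[OF x(1) L_0] by simp
  have "\<exists>w\<in>Z. w - r \<in> J"
  proof (rule ccontr)
    assume "\<not> (\<exists>w\<in>Z. w - r \<in> J)"
    then have "(\<Sum>w\<in>Z. proj w \<star> x) \<in> N" using shN(1) by (intro N_sum) blast
    then show False using xN by (simp only: sum_proj_conv[OF x(1)])
  qed
  then obtain w where w: "w \<in> Z" "w - r \<in> J" by blast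
  have "proj w \<star> x \<notin> N"
  proof
    assume "proj w \<star> x \<in> N"
    then have "(x - proj w \<star> x) + proj w \<star> x \<in> N" by (rule N_add[OF shN(2)[OF w]])
    then show False using xN by simp
  qed
  then have "w \<in> S" using w(1) x(1) unfolding S_def Y_def by blast
  moreover have "c = res w" using res_eq[OF Z_R[OF w(1)] r(1)] w(2) r(2) by simp
  ultimately show "c \<in> res ` S" by blast
next
  fix c assume "c \<in> res ` S"
  then obtain z y where z: "z \<in> Z" "c = res z" and y: "y \<in> Y z" "y \<notin> N" by (auto simp: S_def)
  have yL: "y \<in> L" "proj z \<star> y = y" using y(1) unfolding Y_iff[OF z(1)] by simp_all
  have "dl g \<star> y = (dl g \<star> proj z) \<star> y" using yL(2) by (simp only: conv_assoc)
  also have "\<dots> = z *\<^sub>c y" using yL(2) by (simp only: dl_proj[OF z(1)] conv_sc_left)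
  finally have "T (kl y) = res z \<odot>\<^bsub>hd\<^esub> kl y"
    using quotient_act_kl[OF g_G yL(1)] hd_simps(4)[OF Z_R[OF z(1)] yL(1)] by simp
  moreover have "kl y \<noteq> kl 0" using kl_eq[OF yL(1) L_0] y(2) by simp
  ultimately show "c \<in> eigenvalues k hd T"
    using yL(1) Z_R[OF z(1)] z(2) unfolding eigenvalues_def k_simps(1) hd_simps(1,2) by blast
qed

lemma head_brauer_character_eq:
  "head_brauer_character MM G P \<rho> g = (\<Sum>z\<in>S. of_nat (vectorspace.dim k (sub (Y z))) * z)"
proof -
  have inj: "inj_on res S"
  proof (rule inj_onI)
    fix z w assume "z \<in> S" "w \<in> S" "res z = res w"
    moreover from this have "z \<in> Z" "w \<in> Z" using S_Z by auto
    ultimately show "z = w" using Z_incongruent[of w z] res_eq[OF Z_R Z_R, of z w] by simp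
  qed
  have "head_brauer_character MM G P \<rho> g = (\<Sum>c\<in>res ` S. of_nat (eigen_mult k hd T c) * root_lift MM c)"
    unfolding head_brauer_character_def unique_maximal_submodule_eq brauer_character_def eigenvalues_eq ..
  also have "\<dots> = (\<Sum>z\<in>S. of_nat (eigen_mult k hd T (res z)) * root_lift MM (res z))"
    by (simp add: sum.reindex[OF inj])
  also have "\<dots> = (\<Sum>z\<in>S. of_nat (vectorspace.dim k (sub (Y z))) * z)"
  proof (rule sum.cong[OF refl])
    fix z assume "z \<in> S"
    then have z: "z \<in> Z" using S_Z by auto
    show "of_nat (eigen_mult k hd T (res z)) * root_lift MM (res z) = of_nat (vectorspace.dim k (sub (Y z))) * z"
      unfolding eigen_mult_def generalized_eigenspace[OF z] using root_lift_res[OF g_odd, of z] z by simp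
  qed
  finally show ?thesis .
qed

theorem head_brauer_character_twoR_iff:
  "head_brauer_character MM G P \<rho> g \<in> twoR \<longleftrightarrow> head_brauer_character MM G P \<rho> g \<in> J"
  unfolding head_brauer_character_eq
  by (rule sum_of_odd_roots_twoR_iff[OF g_odd S_finite]) (use S_Z in auto)

text \<open>Lifts of a basis of the eigenspace and of its coordinates; like head functionals, the
  lifted coordinates are linear modulo \<open>J\<close>. The cardinality clause ties the frame to
  the multiplicity in the Brauer character.\<close>

definition eigen_coordinates ::
  "complex \<Rightarrow> ('g \<Rightarrow> complex) set \<Rightarrow> (('g \<Rightarrow> complex) \<Rightarrow> ('g \<Rightarrow> complex) \<Rightarrow> complex) \<Rightarrow> bool" where
  "eigen_coordinates z B co \<longleftrightarrow>
     finite B \<and> B \<subseteq> Y z \<and> vectorspace.dim k (sub (Y z)) = card B \<and>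
     (\<forall>b\<in>B. \<forall>x\<in>Y z. co b x \<in> R) \<and>
     (\<forall>b\<in>B. \<forall>x\<in>Y z. \<forall>y\<in>Y z. cong_J (co b (x + y)) (co b x + co b y)) \<and>
     (\<forall>b\<in>B. \<forall>r\<in>R. \<forall>x\<in>Y z. cong_J (co b (r *\<^sub>c x)) (r * co b x)) \<and>
     (\<forall>b\<in>B. \<forall>x\<in>Y z. x \<in> N \<longrightarrow> co b x \<in> J) \<and>
     (\<forall>x\<in>Y z. x - (\<Sum>b\<in>B. co b x *\<^sub>c b) \<in> N) \<and>
     (\<forall>b\<in>B. cong_J (co b b) 1)"

lemma eigen_coordinatesD:
  assumes "eigen_coordinates z B co"
  shows "finite B" "B \<subseteq> Y z" "vectorspace.dim k (sub (Y z)) = card B"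
    "b \<in> B \<Longrightarrow> x \<in> Y z \<Longrightarrow> co b x \<in> R"
    "b \<in> B \<Longrightarrow> x \<in> Y z \<Longrightarrow> y \<in> Y z \<Longrightarrow> cong_J (co b (x + y)) (co b x + co b y)"
    "b \<in> B \<Longrightarrow> r \<in> R \<Longrightarrow> x \<in> Y z \<Longrightarrow> cong_J (co b (r *\<^sub>c x)) (r * co b x)"
    "b \<in> B \<Longrightarrow> x \<in> Y z \<Longrightarrow> x \<in> N \<Longrightarrow> co b x \<in> J"
    "x \<in> Y z \<Longrightarrow> x - (\<Sum>b\<in>B. co b x *\<^sub>c b) \<in> N"
    "b \<in> B \<Longrightarrow> cong_J (co b b) 1"
proof -
  note A1 = assms[unfolded eigen_coordinates_def]
  note A2 = A1[THEN conjunct2]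
  note A3 = A2[THEN conjunct2]
  note A4 = A3[THEN conjunct2]
  note A5 = A4[THEN conjunct2]
  note A6 = A5[THEN conjunct2]
  note A7 = A6[THEN conjunct2]
  note A8 = A7[THEN conjunct2]
  note D = A1[THEN conjunct1] A2[THEN conjunct1] A3[THEN conjunct1] A4[THEN conjunct1]
    A5[THEN conjunct1] A6[THEN conjunct1] A7[THEN conjunct1] A8[THEN conjunct1] A8[THEN conjunct2]
  show "finite B" "B \<subseteq> Y z" "vectorspace.dim k (sub (Y z)) = card B" by (fact D)+
  show "b \<in> B \<Longrightarrow> x \<in> Y z \<Longrightarrow> co b x \<in> R" by (rule D(4)[THEN bspec, THEN bspec])
  show "b \<in> B \<Longrightarrow> x \<in> Y z \<Longrightarrow> y \<in> Y z \<Longrightarrow> cong_J (co b (x + y)) (co b x + co b y)"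
    by (rule D(5)[THEN bspec, THEN bspec, THEN bspec])
  show "b \<in> B \<Longrightarrow> r \<in> R \<Longrightarrow> x \<in> Y z \<Longrightarrow> cong_J (co b (r *\<^sub>c x)) (r * co b x)"
    by (rule D(6)[THEN bspec, THEN bspec, THEN bspec])
  show "b \<in> B \<Longrightarrow> x \<in> Y z \<Longrightarrow> x \<in> N \<Longrightarrow> co b x \<in> J" by (rule D(7)[THEN bspec, THEN bspec, THEN mp])
  show "x \<in> Y z \<Longrightarrow> x - (\<Sum>b\<in>B. co b x *\<^sub>c b) \<in> N" by (rule D(8)[THEN bspec])
  show "b \<in> B \<Longrightarrow> cong_J (co b b) 1" by (rule D(9)[THEN bspec])
qed

text \<open>Basis vectors and coordinates over the residue field are lifted by choosing
  representatives; identities between cosets become congruences.\<close>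

lemma eigenspace_basis:
  assumes z: "z \<in> Z"
  shows "\<exists>B co. eigen_coordinates z B co"
proof -
  note Yc = Y_closed[OF z]
  note Y' = R_closedD[OF Yc]
  interpret E: vectorspace k "sub (Y z)" by (rule sub_vectorspace[OF Yc])
  have "E.fin_dim"
  proof (rule E.spanning_family_fin_dim)
    show "finite (carrier G)" by (rule fin_G)
    have v: "proj z \<star> (dl h \<star> e) \<in> Y z" if "h \<in> carrier G" for h
      unfolding Y_def using that by (intro imageI L_conv RG_dl L_e)
    then show "(\<lambda>h. kl (proj z \<star> (dl h \<star> e))) \<in> carrier G \<rightarrow> carrier (sub (Y z))" by auto
    fix X assume "X \<in> carrier (sub (Y z))"
    then obtain x where x: "x \<in> L" "X = kl (proj z \<star> x)" by (auto simp: Y_def)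
    have xR: "x h \<in> R" for h using x(1) by (intro RG_R L_RG)
    have "proj z \<star> x = (\<Sum>h\<in>carrier G. x h *\<^sub>c (proj z \<star> (dl h \<star> e)))"
      using arg_cong[OF L_expand[OF x(1)], of "\<lambda>y. proj z \<star> y"] by (simp only: conv_sum_right conv_sc_right)
    then have "X = (\<Oplus>\<^bsub>sub (Y z)\<^esub>h\<in>carrier G. res (x h) \<odot>\<^bsub>hd\<^esub> kl (proj z \<star> (dl h \<star> e)))"
      using sub_finsum(1)[OF Yc fin_G, of x "\<lambda>h. proj z \<star> (dl h \<star> e)"] xR v x(2) by simp
    then show "\<exists>c\<in>carrier G \<rightarrow> carrier k. X = (\<Oplus>\<^bsub>sub (Y z)\<^esub>h\<in>carrier G. c h \<odot>\<^bsub>sub (Y z)\<^esub> kl (proj z \<star> (dl h \<star> e)))"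
      using xR by (intro bexI[of _ "\<lambda>h. res (x h)"]) (auto simp: k_simps(1))
  qed
  then obtain B0 where B0: "finite B0" "E.basis B0" using E.finite_basis_exists by blast
  have BY: "B0 \<subseteq> kl ` Y z" using B0(2) by (simp add: E.basis_def)
  obtain co where co: "\<And>b x. b \<in> B0 \<Longrightarrow> x \<in> carrier (sub (Y z)) \<Longrightarrow> co b x \<in> carrier k"
    "\<And>b x y. b \<in> B0 \<Longrightarrow> x \<in> carrier (sub (Y z)) \<Longrightarrow> y \<in> carrier (sub (Y z)) \<Longrightarrow>
       co b (x \<oplus>\<^bsub>sub (Y z)\<^esub> y) = co b x \<oplus>\<^bsub>k\<^esub> co b y"
    "\<And>b c x. b \<in> B0 \<Longrightarrow> c \<in> carrier k \<Longrightarrow> x \<in> carrier (sub (Y z)) \<Longrightarrow>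
       co b (c \<odot>\<^bsub>sub (Y z)\<^esub> x) = c \<otimes>\<^bsub>k\<^esub> co b x"
    "\<And>x. x \<in> carrier (sub (Y z)) \<Longrightarrow> E.lincomb (\<lambda>b. co b x) B0 = x"
    "\<And>a b. a \<in> B0 \<rightarrow> carrier k \<Longrightarrow> b \<in> B0 \<Longrightarrow> co b (E.lincomb a B0) = a b"
    "\<And>b. b \<in> B0 \<Longrightarrow> co b b = \<one>\<^bsub>k\<^esub>"
    by (rule E.basis_coordinates[OF B0]) (rule that)
  define rep where "rep X = (SOME y. y \<in> Y z \<and> kl y = X)" for X
  have rep: "rep X \<in> Y z" "kl (rep X) = X" if "X \<in> B0" for X
    using someI_ex[of "\<lambda>y. y \<in> Y z \<and> kl y = X"] BY that by (auto simp: rep_def)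
  have inj: "inj_on rep B0" by (rule inj_onI) (metis rep(2))
  define B where "B = rep ` B0"
  have BB: "kl b \<in> B0" "b \<in> Y z" "rep (kl b) = b" if "b \<in> B" for b using that rep by (auto simp: B_def)
  define ci where "ci b x = (SOME r. r \<in> R \<and> res r = co (kl b) (kl x))" for b x
  have cY: "kl x \<in> carrier (sub (Y z))" if "x \<in> Y z" for x using that by simp
  have ci: "ci b x \<in> R" "res (ci b x) = co (kl b) (kl x)" if "b \<in> B" "x \<in> Y z" for b x
    using someI_ex[of "\<lambda>r. r \<in> R \<and> res r = co (kl b) (kl x)"] co(1)[OF BB(1)[OF that(1)] cY[OF that(2)]]
    by (auto simp: ci_def k_simps(1))
  have "eigen_coordinates z B ci"
    unfolding eigen_coordinates_def
  proof (intro conjI ballI impI)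
    show "finite B" using B0(1) by (simp add: B_def)
    show "B \<subseteq> Y z" using BB(2) by blast
    show "E.dim = card B" using E.dim_basis[OF B0] card_image[OF inj] by (simp add: B_def)
    show "ci b x \<in> R" if "b \<in> B" "x \<in> Y z" for b x using ci(1)[OF that] .
    show "cong_J (ci b (x + y)) (ci b x + ci b y)" if b: "b \<in> B" and x: "x \<in> Y z" and y: "y \<in> Y z" for b x y
    proof -
      have "co (kl b) (kl (x + y)) = co (kl b) (kl x) \<oplus>\<^bsub>k\<^esub> co (kl b) (kl y)"
        using co(2)[OF BB(1)[OF b] cY[OF x] cY[OF y]] hd_simps(3)[OF Y'(1)[OF x] Y'(1)[OF y]] by simp
      then have "res (ci b (x + y)) = res (ci b x + ci b y)"
        using ci b x y Y'(3)[OF x y] by (simp add: k_simps(4)[symmetric])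
      then show ?thesis using res_eq ci(1)[OF b] Y'(3)[OF x y] x y by (simp add: cong_J_def add_R)
    qed
    show "cong_J (ci b (r *\<^sub>c x)) (r * ci b x)" if b: "b \<in> B" and r: "r \<in> R" and x: "x \<in> Y z" for b r x
    proof -
      have "co (kl b) (kl (r *\<^sub>c x)) = res r \<otimes>\<^bsub>k\<^esub> co (kl b) (kl x)"
        using co(3)[OF BB(1)[OF b] _ cY[OF x], of "res r"] r hd_simps(4)[OF r Y'(1)[OF x]] by (simp add: k_simps(1))
      then have "res (ci b (r *\<^sub>c x)) = res (r * ci b x)"
        using ci b r x Y'(4)[OF r x] by (simp add: k_simps(5)[symmetric])
      then show ?thesis using res_eq ci(1)[OF b] Y'(4)[OF r x] r x by (simp add: cong_J_def mult_R)
    qed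
    have zero: "co (kl b) (kl 0) = res 0" if b: "b \<in> B" for b
    proof -
      have "co (kl b) (res 0 \<odot>\<^bsub>hd\<^esub> kl 0) = res 0 \<otimes>\<^bsub>k\<^esub> co (kl b) (kl 0)"
        using co(3)[OF BB(1)[OF b] _ cY[OF Y'(2)], of "res 0"] by (simp add: k_simps(1))
      then show ?thesis
        using ci(1)[OF b Y'(2)] hd_simps(4)[OF zero_R L_0] by (simp add: ci(2)[OF b Y'(2), symmetric] k_simps(5))
    qed
    show "ci b x \<in> J" if b: "b \<in> B" and x: "x \<in> Y z" and xN: "x \<in> N" for b x
    proof -
      have "kl x = kl 0" using kl_eq[OF Y'(1)[OF x] L_0] xN by simp
      then have "res (ci b x) = res 0" using ci(2)[OF b x] zero[OF b] by simp
      then show ?thesis using res_eq[OF ci(1)[OF b x] zero_R] by simp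
    qed
    show "x - (\<Sum>b\<in>B. ci b x *\<^sub>c b) \<in> N" if x: "x \<in> Y z" for x
    proof -
      have "kl x = (\<Oplus>\<^bsub>sub (Y z)\<^esub>X\<in>B0. co X (kl x) \<odot>\<^bsub>hd\<^esub> X)"
        using co(4)[OF cY[OF x]] by (simp add: E.lincomb_def)
      also have "\<dots> = (\<Oplus>\<^bsub>sub (Y z)\<^esub>X\<in>B0. res (ci (rep X) x) \<odot>\<^bsub>hd\<^esub> kl (rep X))"
      proof (rule E.M.finsum_cong'[OF refl])
        have r: "rep X \<in> B" if "X \<in> B0" for X using that by (simp add: B_def)
        show "co X (kl x) \<odot>\<^bsub>hd\<^esub> X = res (ci (rep X) x) \<odot>\<^bsub>hd\<^esub> kl (rep X)" if X: "X \<in> B0" for X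
          using ci(2)[OF r[OF X] x] rep(2)[OF X] by simp
        show "(\<lambda>X. res (ci (rep X) x) \<odot>\<^bsub>hd\<^esub> kl (rep X)) \<in> B0 \<rightarrow> carrier (sub (Y z))"
        proof
          fix X assume X: "X \<in> B0"
          have "res (ci (rep X) x) \<odot>\<^bsub>hd\<^esub> kl (rep X) = kl (ci (rep X) x *\<^sub>c rep X)"
            using ci(1)[OF r[OF X] x] Y'(1)[OF rep(1)[OF X]] by (rule hd_simps(4))
          then show "res (ci (rep X) x) \<odot>\<^bsub>hd\<^esub> kl (rep X) \<in> carrier (sub (Y z))"
            using Y'(4)[OF ci(1)[OF r[OF X] x] rep(1)[OF X]] by simp
        qed
      qed
      also have "\<dots> = kl (\<Sum>X\<in>B0. ci (rep X) x *\<^sub>c rep X)"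
        using rep(1) ci(1)[OF _ x] by (intro sub_finsum(1)[OF Yc B0(1)]) (auto simp: B_def)
      also have "(\<Sum>X\<in>B0. ci (rep X) x *\<^sub>c rep X) = (\<Sum>b\<in>B. ci b x *\<^sub>c b)"
        unfolding B_def by (simp add: sum.reindex[OF inj])
      finally have *: "kl x = kl (\<Sum>b\<in>B. ci b x *\<^sub>c b)" .
      have "(\<Sum>b\<in>B. ci b x *\<^sub>c b) \<in> L"
        using ci(1)[OF _ x] Y'(1)[OF BB(2)] by (intro L_sum L_sc)
      then show ?thesis using kl_eq[OF Y'(1)[OF x], of "\<Sum>b\<in>B. ci b x *\<^sub>c b"] * by blast
    qed
    show "cong_J (ci b b) 1" if b: "b \<in> B" for b
      using ci[OF b BB(2)[OF b]] co(6)[OF BB(1)[OF b]] res_eq[of "ci b b" 1]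
      by (simp add: k_simps(3) cong_J_def)
  qed
  then show ?thesis by blast
qed

text \<open>The traces \<open>tr\<close> only see the Brauer character modulo \<open>J\<close>; a frame adapted to the
  eigenspaces of \<open>g\<close> makes this visible.\<close>

lemma exists_eigenframe:
  "\<exists>I d (\<psi> :: complex \<times> ('g \<Rightarrow> complex) \<Rightarrow> ('g \<Rightarrow> complex) \<Rightarrow> complex).
     frame I d \<psi> \<and> cong_J (tr I d \<psi> (dl g)) (head_brauer_character MM G P \<rho> g)"
proof -
  have "\<forall>z\<in>S. \<exists>B co. eigen_coordinates z B co" using eigenspace_basis S_Z by blast
  then obtain B co where C: "\<And>z. z \<in> S \<Longrightarrow> eigen_coordinates z (B z) (co z)" by metis
  have B: "finite (B z)" "B z \<subseteq> Y z" "vectorspace.dim k (sub (Y z)) = card (B z)" if "z \<in> S" for z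
    by (fact eigen_coordinatesD(1-3)[OF C[OF that]])+
  have co: "x \<in> Y z \<Longrightarrow> co z b x \<in> R"
    "x \<in> Y z \<Longrightarrow> y \<in> Y z \<Longrightarrow> cong_J (co z b (x + y)) (co z b x + co z b y)"
    "r \<in> R \<Longrightarrow> x \<in> Y z \<Longrightarrow> cong_J (co z b (r *\<^sub>c x)) (r * co z b x)"
    "x \<in> Y z \<Longrightarrow> x \<in> N \<Longrightarrow> co z b x \<in> J"
    "cong_J (co z b b) 1" if "z \<in> S" "b \<in> B z" for z b x y r
    by (fact eigen_coordinatesD(4-7,9)[OF C[OF that(1)] that(2)])+
  have coN: "x - (\<Sum>b\<in>B z. co z b x *\<^sub>c b) \<in> N" if "z \<in> S" "x \<in> Y z" for z x
    by (fact eigen_coordinatesD(8)[OF C[OF that(1)] that(2)])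
  have Yx: "proj z \<star> x \<in> Y z" if "x \<in> L" for z x using that by (simp add: Y_def)
  \<comment> \<open>One index for each basis vector of each eigenspace; the functional projects to
    the eigenspace and then takes the coordinate.\<close>
  define I where "I = Sigma S B"
  define d where "d = (snd :: complex \<times> ('g \<Rightarrow> complex) \<Rightarrow> _)"
  define \<psi> where "\<psi> i x = co (fst i) (snd i) (proj (fst i) \<star> x)" for i x
  have I: "finite I" unfolding I_def using S_finite B(1) by (rule finite_SigmaI)
  have sum_I: "(\<Sum>i\<in>I. f i) = (\<Sum>z\<in>S. \<Sum>b\<in>B z. f (z, b))" for f :: "complex \<times> ('g \<Rightarrow> complex) \<Rightarrow> 'b :: comm_monoid_add"
    unfolding I_def using S_finite B(1) by (simp add: sum.Sigma)
  have hf: "head_functional (\<psi> i)" if i: "i \<in> I" for i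
  proof -
    obtain z b where zb: "i = (z, b)" "z \<in> S" "b \<in> B z" using i by (auto simp: I_def)
    have z: "z \<in> Z" using zb(2) S_Z by blast
    show ?thesis
      unfolding head_functional_def \<psi>_def zb(1) fst_conv snd_conv
    proof (intro conjI ballI)
      show "co z b (proj z \<star> x) \<in> R" if "x \<in> L" for x using co(1)[OF zb(2,3) Yx[OF that]] .
      show "cong_J (co z b (proj z \<star> (x + y))) (co z b (proj z \<star> x) + co z b (proj z \<star> y))"
        if "x \<in> L" "y \<in> L" for x y
        unfolding conv_add_right by (rule co(2)[OF zb(2,3) Yx[OF that(1)] Yx[OF that(2)]])
      show "cong_J (co z b (proj z \<star> (r *\<^sub>c x))) (r * co z b (proj z \<star> x))" if "r \<in> R" "x \<in> L" for r x
        unfolding conv_sc_right by (rule co(3)[OF zb(2,3) that(1) Yx[OF that(2)]])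
      show "co z b (proj z \<star> x) \<in> J" if "x \<in> N" for x
        by (rule co(4)[OF zb(2,3) Yx[OF N_L[OF that]] N_conv[OF proj_RG[OF z] that]])
    qed
  qed
  have dL: "d i \<in> L" if i: "i \<in> I" for i
  proof -
    obtain z b where zb: "i = (z, b)" "z \<in> S" "b \<in> B z" using i by (auto simp: I_def)
    have z: "z \<in> Z" using zb(2) S_Z by blast
    have "b \<in> Y z" using B(2)[OF zb(2)] zb(3) by blast
    then show ?thesis using R_closedD(1)[OF Y_closed[OF z]] by (simp add: d_def zb(1))
  qed
  have "x - (\<Sum>i\<in>I. \<psi> i x *\<^sub>c d i) \<in> N" if x: "x \<in> L" for x
  proof -
    \<comment> \<open>The roots outside \<open>S\<close> belong to eigenspaces that vanish in the
      head.\<close>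
    have "(\<Sum>z\<in>Z - S. proj z \<star> x) \<in> N"
    proof (rule N_sum)
      fix z assume "z \<in> Z - S"
      then have "Y z \<subseteq> N" by (auto simp: S_def)
      then show "proj z \<star> x \<in> N" using Yx[OF x] by blast
    qed
    moreover have "(\<Sum>z\<in>S. proj z \<star> x - (\<Sum>b\<in>B z. co z b (proj z \<star> x) *\<^sub>c b)) \<in> N"
      using coN[OF _ Yx[OF x]] by (rule N_sum)
    ultimately have "(\<Sum>z\<in>Z - S. proj z \<star> x) + (\<Sum>z\<in>S. proj z \<star> x - (\<Sum>b\<in>B z. co z b (proj z \<star> x) *\<^sub>c b)) \<in> N"
      by (rule N_add)
    moreover have "(\<Sum>z\<in>Z. proj z \<star> x) = (\<Sum>z\<in>Z - S. proj z \<star> x) + (\<Sum>z\<in>S. proj z \<star> x)"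
      by (rule sum.subset_diff[OF S_Z Z_finite])
    ultimately show ?thesis
      by (simp add: sum_I \<psi>_def d_def sum_subtractf sum_proj_conv[OF x] algebra_simps)
  qed
  then have fr: "frame I d \<psi>" unfolding frame_def using I hf dL by blast
  \<comment> \<open>Each basis vector contributes its eigenvalue, lifted to \<open>z\<close>, since
    \<open>proj z\<close> fixes it and its own coordinate is congruent to \<open>1\<close>.\<close>
  have "cong_J (\<psi> (z, b) (dl g \<star> d (z, b))) z" if zb: "z \<in> S" "b \<in> B z" for z b
  proof -
    have z: "z \<in> Z" using zb(1) S_Z by blast
    have b: "b \<in> Y z" using B(2)[OF zb(1)] zb(2) by blast
    then have pb: "proj z \<star> b = b" by (simp only: Y_iff[OF z])
    have "proj z \<star> (dl g \<star> b) = z *\<^sub>c b"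
      unfolding conv_assoc[symmetric] proj_dl[OF z] conv_sc_left pb ..
    then have "cong_J (\<psi> (z, b) (dl g \<star> d (z, b))) (z * co z b b)"
      using co(3)[OF zb Z_R[OF z] b] by (simp add: \<psi>_def d_def)
    moreover have "cong_J (z * co z b b) (z * 1)" by (rule cong_mult_left[OF Z_R[OF z] co(5)[OF zb]])
    ultimately show ?thesis by (metis cong_trans mult_1_right)
  qed
  then have "cong_J (tr I d \<psi> (dl g)) (\<Sum>z\<in>S. \<Sum>b\<in>B z. z)"
    unfolding tr_def sum_I by (rule cong_sum[OF cong_sum])
  also have "(\<Sum>z\<in>S. \<Sum>b\<in>B z. z) = head_brauer_character MM G P \<rho> g"
    unfolding head_brauer_character_eq using B(3) by (intro sum.cong) simp_all
  finally show ?thesis using fr by blast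
qed

end

section \<open>Real classes and the main theorem\<close>

context group_algebra begin

lemma involution_inv: "t \<in> carrier G \<Longrightarrow> t \<otimes> t = \<one> \<Longrightarrow> inv t = t"
  using inv_equality by blast

lemma ord_involution:
  assumes "t \<in> carrier G" "t \<otimes> t = \<one>" "t \<noteq> \<one>" shows "ord t = 2"
proof -
  have "t [^] (2::nat) = \<one>" using assms by (simp add: numeral_2_eq_2)
  then have "ord t dvd 2" using assms(1) pow_eq_id by blast
  moreover have "ord t \<noteq> 1" using ord_eq_1 assms by blast
  ultimately show ?thesis using prime_nat_iff[of 2] two_is_prime_nat by blast
qed

text \<open>Without involutions, inversion has no fixed point among the nonidentity elements, so
  their number is even. The count is made by summing \<open>1\<close> with
  \<open>sum_involution\<close>.\<close>

lemma exists_involution: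
  assumes "even (Coset.order G)"
  shows "\<exists>t\<in>carrier G. t \<otimes> t = \<one> \<and> t \<noteq> \<one>"
proof (rule ccontr)
  assume none: "\<not> ?thesis"
  define A where "A = carrier G - {\<one>}"
  have A: "finite A" "card A = Coset.order G - 1" "Coset.order G > 0"
    using fin_G order_gt_0_iff_finite by (simp_all add: A_def Coset.order_def)
  have "(\<Sum>x\<in>A. 1 :: complex) \<in> J"
  proof (rule sum_involution[of A "\<lambda>x. inv x"])
    show "twoR \<subseteq> J" using twoR_J by blast
    fix x assume x: "x \<in> A"
    then show "inv x \<in> A" "inv (inv x) = x" by (auto simp: A_def inv_eq_1_iff)
    assume "inv x = x"
    then have "x \<otimes> x = \<one>" using x l_inv[of x] by (simp add: A_def)
    then show "1 \<in> J" using none x unfolding A_def by blast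
  qed (use A(1) add_J in simp_all)
  then have "even (card A)" using of_nat_J_iff by simp
  then show False using A assms by auto
qed

text \<open>\<open>u\<close> inverts the product. For \<open>u = \<one>\<close> the product is its
  own inverse, which is the first clause of \<open>strongly_real\<close>.\<close>

lemma product_of_involutions_strongly_real:
  assumes u: "u \<in> carrier G" "u \<otimes> u = \<one>" and v: "v \<in> carrier G" "v \<otimes> v = \<one>"
  shows "strongly_real G (u \<otimes> v)"
proof (cases "u = \<one>")
  case True
  then show ?thesis using v involution_inv[OF v] by (simp add: strongly_real_def)
next
  case False
  have "u \<otimes> (u \<otimes> v) \<otimes> inv u = inv (u \<otimes> v)"
    using u v involution_inv[OF u] involution_inv[OF v]
    by (simp add: inv_mult_group m_assoc[symmetric])
  then show ?thesis using ord_involution[OF u False] u(1) unfolding strongly_real_def by blast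
qed

text \<open>If \<open>t\<close> inverts \<open>g\<close>, then \<open>t \<otimes> g\<close> squares
  to \<open>\<one>\<close>, and it differs from \<open>\<one>\<close> since \<open>g\<close> has odd
  order. For \<open>g = \<one>\<close> both factors are one involution, which the even group order
  supplies. Neither factor may be \<open>\<one>\<close>: translation by the one that defines the
  quadratic form must be free of fixed points.\<close>

lemma strongly_real_product:
  assumes g: "g \<in> carrier G" "odd (ord g)" "strongly_real G g" and even: "even (Coset.order G)"
  obtains t t' where "t \<in> carrier G" "t \<otimes> t = \<one>" "t \<noteq> \<one>" "t' \<in> carrier G" "t' \<otimes> t' = \<one>" "t' \<noteq> \<one>"
    "g = t \<otimes> t'"
proof (cases "g = inv g")
  case True
  have "g \<otimes> g = inv g \<otimes> g" by (rule arg_cong[where f = "\<lambda>x. x \<otimes> g", OF True])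
  then have "g \<otimes> g = \<one>" using g(1) by simp
  then have "g = \<one>" using ord_involution[OF g(1)] g(2) by (metis even_numeral)
  then show ?thesis using exists_involution[OF even] that by metis
next
  case False
  then obtain t where t: "t \<in> carrier G" "ord t = 2" "t \<otimes> g \<otimes> inv t = inv g"
    using g(3) unfolding strongly_real_def by blast
  have tt: "t \<otimes> t = \<one>" using pow_ord_eq_1[OF t(1)] t(1,2) by (simp add: numeral_2_eq_2)
  have t1: "t \<noteq> \<one>" using t(2) ord_eq_1[OF t(1)] by simp
  have it: "inv t = t" using involution_inv[OF t(1) tt] .
  have "t \<otimes> g \<otimes> (t \<otimes> g) = (t \<otimes> g \<otimes> t) \<otimes> g" using t(1) g(1) by (simp add: m_assoc)
  also have "\<dots> = \<one>" using t(3) g(1) by (simp add: it)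
  finally have sq: "t \<otimes> g \<otimes> (t \<otimes> g) = \<one>" .
  have prod: "g = t \<otimes> (t \<otimes> g)" using t(1) g(1) tt by (simp add: m_assoc[symmetric])
  have "t \<otimes> g \<noteq> \<one>"
  proof
    assume "t \<otimes> g = \<one>"
    then have "g = t" using prod t(1) by simp
    then show False using g(2) t(2) by simp
  qed
  then show ?thesis using that[OF t(1) tt t1 _ sq _ prod] t(1) g(1) by blast
qed

lemma real_element_iff: "g \<in> carrier G \<Longrightarrow> real_element G g \<longleftrightarrow> inv g \<in> cls g"
  unfolding real_element_def cls_def image_iff by metis

end

section \<open>The three implications\<close>

context pim_model begin

lemma class_ratio:
  assumes g: "g \<in> carrier G"
  shows "ordinary_character MM P \<rho> g / of_nat (card (centralizer G g)) = csum (cls (inv g)) e"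
  using centralizer_pos[OF g] by (simp add: ordinary_character_eq[OF g])

text \<open>Traces do not depend on the frame modulo \<open>J\<close>, and the frame fitted to the
  eigenspaces of \<open>g\<close> compares them with the Brauer character.\<close>

lemma head_character_trace:
  assumes g: "g \<in> carrier G" "odd (ord g)" and fr: "frame I d \<psi>"
  shows "head_brauer_character MM G P \<rho> g \<in> twoR \<longleftrightarrow> tr I d \<psi> (dl g) \<in> J"
proof -
  interpret O: pim_model_odd_element MM G e P \<rho> F g by unfold_locales (use g in auto)
  obtain I' d' and \<psi>' :: "complex \<times> ('g \<Rightarrow> complex) \<Rightarrow> ('g \<Rightarrow> complex) \<Rightarrow> complex"
    where f': "frame I' d' \<psi>'" "cong_J (tr I' d' \<psi>' (dl g)) (head_brauer_character MM G P \<rho> g)"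
    using O.exists_eigenframe by blast
  have "cong_J (tr I d \<psi> (dl g)) (head_brauer_character MM G P \<rho> g)"
    using tr_independent[OF fr f'(1) RG_dl[OF g(1)]] f'(2) by (rule cong_trans)
  then show ?thesis using O.head_brauer_character_twoR_iff cong_J_iff by blast
qed

lemma exists_frame:
  obtains I d and \<psi> :: "complex \<times> ('g \<Rightarrow> complex) \<Rightarrow> ('g \<Rightarrow> complex) \<Rightarrow> complex" where "frame I d \<psi>"
proof -
  \<comment> \<open>The identity has odd order, so its eigenspace decomposition supplies a
    frame.\<close>
  interpret O: pim_model_odd_element MM G e P \<rho> F \<one> by unfold_locales auto
  show thesis using O.exists_eigenframe that by blast
qed

lemma quadratic_type_imp_weakly_real:
  assumes qt: "quadratic_type (loc_ring MM) G P \<rho>" and g: "g \<in> carrier G" "weakly_real G g"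
  shows "ordinary_character MM P \<rho> g / of_nat (card (centralizer G g)) \<in> twoR"
proof -
  obtain c d where cd: "c \<in> RG" "d \<in> RG" "star c = c" "star d = d" "c \<star> d = e"
    by (rule quadratic_type_units[OF qt])
  have real: "inv g \<in> cls g" using g real_element_iff[OF g(1)] by (simp add: weakly_real_def)
  have K: "cls (inv g) = cls g" by (rule cls_eq[OF g(1) real])
  have "csum (cls (inv g)) (c \<star> d) \<in> twoR"
  proof (rule csum_symmetric_conv)
    show "conj_closed (cls (inv g))" using g(1) by (intro cls_conj_closed) simp
    fix y assume "y \<in> cls (inv g)"
    then obtain h where h: "h \<in> carrier G" "y = h \<otimes> inv g \<otimes> inv h" by (auto simp: cls_def)
    then have "inv y = h \<otimes> g \<otimes> inv h" using g(1) by (simp add: inv_mult_group m_assoc)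
    then show "inv y \<in> cls (inv g)" using h(1) unfolding K by (auto simp: cls_def)
  next
    fix u v assume u: "u \<in> carrier G" "u \<otimes> u = \<one>" and v: "v \<in> carrier G" "v \<otimes> v = \<one>"
    show "u \<otimes> v \<notin> cls (inv g)"
    proof
      assume "u \<otimes> v \<in> cls (inv g)"
      then obtain h where h: "h \<in> carrier G" "u \<otimes> v = h \<otimes> inv g \<otimes> inv h" by (auto simp: cls_def)
      \<comment> \<open>Conjugation carries the factorization of a conjugate of \<open>inv g\<close>
        to one of \<open>inv g\<close> itself; reversing the factors gives \<open>g\<close>.\<close>
      define c where "c x = inv h \<otimes> x \<otimes> h" for x
      have c_mult: "c x \<otimes> c y = c (x \<otimes> y)" if "x \<in> carrier G" "y \<in> carrier G" for x y
        using that h(1) by (simp add: c_def m_assoc inv_cancel)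
      have c_G: "c x \<in> carrier G" if "x \<in> carrier G" for x using that h(1) by (simp add: c_def)
      have c_1: "c \<one> = \<one>" using h(1) by (simp add: c_def)
      have cu: "c u \<in> carrier G" "c u \<otimes> c u = \<one>" and cv: "c v \<in> carrier G" "c v \<otimes> c v = \<one>"
        using u v by (simp_all add: c_G c_mult c_1)
      have "c u \<otimes> c v = inv g"
        unfolding c_mult[OF u(1) v(1)] h(2) using h(1) g(1) by (simp add: c_def m_assoc inv_cancel)
      then have "inv (c u \<otimes> c v) = g" using g(1) by simp
      then have "c v \<otimes> c u = g"
        using inv_mult_group[OF cu(1) cv(1)] involution_inv[OF cu] involution_inv[OF cv] by simp
      then have "strongly_real G g" using product_of_involutions_strongly_real[OF cv cu] by simp
      then show False using g(2) by (simp add: weakly_real_def)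
    qed
  qed (use cd in auto)
  then show ?thesis unfolding class_ratio[OF g(1)] by (simp only: cd(5))
qed

lemma weakly_real_imp_strongly_real:
  assumes sd: "self_dual (loc_ring MM) G P \<rho>"
    and iii: "\<And>g. g \<in> carrier G \<Longrightarrow> odd (ord g) \<Longrightarrow> weakly_real G g \<Longrightarrow>
      ordinary_character MM P \<rho> g / of_nat (card (centralizer G g)) \<in> twoR"
  shows "\<exists>g\<in>carrier G. odd (ord g) \<and> strongly_real G g \<and> head_brauer_character MM G P \<rho> g \<notin> twoR"
proof -
  obtain c d where cd: "c \<in> RG" "d \<in> RG" "e \<star> c = c" "c \<star> star e = c" "star e \<star> d = d" "d \<star> e = d"
    "c \<star> d = e" "d \<star> c = star e"
    by (rule self_dual_units[OF sd])
  obtain I b and \<psi> :: "complex \<times> ('g \<Rightarrow> complex) \<Rightarrow> ('g \<Rightarrow> complex) \<Rightarrow> complex" where fr: "frame I b \<psi>"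
    by (rule exists_frame)
  obtain g where g: "g \<in> carrier G" "inv g \<in> cls g" "odd (ord g)" "csum (cls g) e \<notin> J" "tr I b \<psi> (dl g) \<notin> J"
    using real_class_contribution[OF cd(1,2,7,8) fr tr_star[OF cd fr]] by blast
  have "strongly_real G g"
  proof (rule ccontr)
    assume "\<not> strongly_real G g"
    then have "weakly_real G g" using g(1,2) real_element_iff by (simp add: weakly_real_def)
    then have "csum (cls (inv g)) e \<in> twoR" using iii[OF g(1,3)] class_ratio[OF g(1)] by simp
    then show False using g(4) twoR_J cls_eq[OF g(1,2)] by metis
  qed
  then show ?thesis using g head_character_trace[OF g(1,3) fr] by blast
qed

lemma strongly_real_imp_quadratic_type:
  assumes sd: "self_dual (loc_ring MM) G P \<rho>" and even: "even (Coset.order G)"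
    and g: "g \<in> carrier G" "odd (ord g)" "strongly_real G g" "head_brauer_character MM G P \<rho> g \<notin> twoR"
  shows "quadratic_type (loc_ring MM) G P \<rho>"
proof -
  obtain c d where cd: "c \<in> RG" "d \<in> RG" "e \<star> c = c" "c \<star> star e = c" "star e \<star> d = d" "d \<star> e = d"
    "c \<star> d = e" "d \<star> c = star e"
    by (rule self_dual_units[OF sd])
  obtain I b and \<psi> :: "complex \<times> ('g \<Rightarrow> complex) \<Rightarrow> ('g \<Rightarrow> complex) \<Rightarrow> complex" where fr: "frame I b \<psi>"
    by (rule exists_frame)
  obtain t t' where t: "t \<in> carrier G" "t \<otimes> t = \<one>" "t \<noteq> \<one>" "t' \<in> carrier G" "t' \<otimes> t' = \<one>" "t' \<noteq> \<one>"
    "g = t \<otimes> t'"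
    by (rule strongly_real_product[OF g(1-3) even])
  have "tr I b \<psi> (dl (t \<otimes> t')) \<notin> J" using head_character_trace[OF g(1,2) fr] g(4) t(7) by blast
  from exists_nonalternating_involution[OF cd fr t(1,2,4,5) this]
  obtain s where s: "s \<in> {t, t'}" and "\<exists>z\<in>L. star z \<star> dl s \<star> z \<notin> N" by (rule bexE)
  then obtain z where z: "z \<in> L" "star z \<star> dl s \<star> z \<notin> N" by (elim bexE)
  have s': "s \<in> carrier G" "s \<otimes> s = \<one>" "s \<noteq> \<one>" using s t(1-6) by (elim insertE emptyE; simp)+
  obtain w d' where w: "w \<in> RG" "d' \<in> RG" "e \<star> w = w" "d' \<star> e = d'"
    "w \<star> dl s \<star> star w \<star> d' = e" "d' \<star> (w \<star> dl s \<star> star w) = star e"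
    by (rule symmetric_unit_from_involution[OF cd s'(1) z])
  show ?thesis by (rule quadratic_type_from_units[OF w(1-4) s' w(5,6)])
qed

end

theorem theorem1:
  fixes G :: "('g, 'gs) monoid_scheme"
    and MM :: "complex set"
    and P :: "(complex, 'm, 'ms) module_scheme"
    and \<rho> :: "'g \<Rightarrow> 'm \<Rightarrow> 'm"
  assumes "group G" and "finite (carrier G)" and "even (Coset.order G)"
    and "maximalideal MM alg_ints" and "2 \<in> MM"
    and "principal_indecomposable (loc_ring MM) G P \<rho>"
    and "self_dual (loc_ring MM) G P \<rho>"
  shows "(quadratic_type (loc_ring MM) G P \<rho> \<longleftrightarrow>
          (\<exists>g\<in>carrier G. two_regular G g \<and> strongly_real G g \<and>
             head_brauer_character MM G P \<rho> g \<notin> twice_loc_ring MM))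
       \<and> ((\<exists>g\<in>carrier G. two_regular G g \<and> strongly_real G g \<and>
             head_brauer_character MM G P \<rho> g \<notin> twice_loc_ring MM) \<longleftrightarrow>
          (\<forall>g\<in>carrier G. two_regular G g \<and> weakly_real G g \<longrightarrow>
             ordinary_character MM P \<rho> g / of_nat (card (centralizer G g)) \<in> twice_loc_ring MM))"
proof -
  interpret group G by fact
  interpret M: two_adic_maximal_ideal MM by (rule two_adic_maximal_ideal.intro) fact+
  interpret A: group_algebra G M.R M.J using assms(2) by unfold_locales
  interpret fp: finite_group_pim MM G P \<rho> using assms(6) by unfold_locales
  obtain e F where "pim_model MM G e P \<rho> F" using fp.exists_model by blast
  then interpret pm: pim_model MM G e P \<rho> F .
  note sd = assms(7)
  have i_iii: "ordinary_character MM P \<rho> g / of_nat (card (centralizer G g)) \<in> twice_loc_ring MM"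
    if "quadratic_type (loc_ring MM) G P \<rho>" "g \<in> carrier G" "weakly_real G g" for g
    using pm.quadratic_type_imp_weakly_real[OF that] by (simp only: M.twice_loc_ring_eq)
  have iii_ii: "\<exists>g\<in>carrier G. two_regular G g \<and> strongly_real G g \<and>
             head_brauer_character MM G P \<rho> g \<notin> twice_loc_ring MM"
    if "\<forall>g\<in>carrier G. two_regular G g \<and> weakly_real G g \<longrightarrow>
             ordinary_character MM P \<rho> g / of_nat (card (centralizer G g)) \<in> twice_loc_ring MM"
    using pm.weakly_real_imp_strongly_real[OF sd] that by (simp add: M.twice_loc_ring_eq two_regular_def)
  have ii_i: "quadratic_type (loc_ring MM) G P \<rho>"
    if "g \<in> carrier G" "two_regular G g" "strongly_real G g" "head_brauer_character MM G P \<rho> g \<notin> twice_loc_ring MM" for g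
    using pm.strongly_real_imp_quadratic_type[OF sd assms(3), of g] that
    by (simp add: M.twice_loc_ring_eq two_regular_def)
  show ?thesis using i_iii iii_ii ii_i by blast
qed

end
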